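(* For any $i,j\in I$, we have $$\widetilde C_{ij}(q,t)=\frac{q^{d_j}t^{-1}}{1-(q^{rh^\vee}t^{-h})^2}\left(\dim_{q,t}e_i\bar I_j-q^{rh^\vee}t^{-h}\dim_{q,t}e_i\bar I_{j^*}\right).$$ If the involution $i\mapsto i^*$ is trivial (e.g. when $\mathfrak g$ is of non-simply-laced type), this simplifies to $$\widetilde C_{ij}(q,t)=\frac{q^{d_j}t^{-1}}{1+q^{rh^\vee}t^{-h}}\dim_{q,t}e_i\bar I_j.$$
   Context: Lie data: $\mathfrak g$ is a complex finite-dimensional simple Lie algebra with Cartan matrix $C=(c_{ij})_{i,j\in I}$. Write $i\sim j$ if $i\neq j$ and $c_{ij}<0$. $r\in\{1,2,3\}$ is the lacing number ($1$ for types ADE, $2$ for B, C, F$_4$, $3$ for G$_2$). $(d_i)_{i\in I}$ is the unique tuple of mutually coprime positive integers with $d_ic_{ij}=d_jc_{ji}$ (so $d_i\in\{1,r\}$ and $c_{ij}=-\lceil d_j/d_i\rceil$ if $i\sim j$). $h$ and $h^\vee$ are the Coxeter and dual Coxeter numbers, and $i\mapsto i^*$ is the involution of $I$ with $w_0(\alpha_i)=-\alpha_{i^*}$, where $w_0$ is the longest element of the Weyl group. $(q,t)$-deformed Cartan matrix: $[k]_q=(q^k-q^{-k})/(q-q^{-1})$; $C(q,t)$ has entries $C_{ii}(q,t)=q^{d_i}t^{-1}+q^{-d_i}t$ and $C_{ij}(q,t)=[c_{ij}]_q$ for $i\neq j$. It is invertible in $GL_I(\mathbb Z[\![q,t^{-1}]\!][(qt^{-1})^{-1}])$,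 and $\widetilde C(q,t)$ denotes its inverse. Algebra: $\Bbbk$ is an arbitrary field. $\widetilde Q$ is the quiver with vertex set $I$, arrows $\alpha_{ij}\colon j\to i$ for each $(i,j)$ with $i\sim j$, and loops $\varepsilon_i\colon i\to i$; $e_i$ is the idempotent at $i$, and $\alpha=e_{t(\alpha)}\alpha e_{s(\alpha)}$ for an arrow $\alpha$ with source $s(\alpha)$ and target $t(\alpha)$. Bigrading: $\deg\alpha_{ij}=(-\max(d_i,d_j),1)$, $\deg\varepsilon_i=(2d_i,0)$. Fix signs $\omega_{ij}=-\omega_{ji}\in\{\pm1\}$ for $i\sim j$. $\widetilde\Pi$ is the quotient of $\Bbbk\widetilde Q$ by (R1) $\varepsilon_i^{-c_{ij}}\alpha_{ij}=\alpha_{ij}\varepsilon_j^{-c_{ji}}$ for $i\sim j$, and (R2) $\sum_{j\sim i}\sum_{k=0}^{-c_{ij}-1}\omega_{ij}\varepsilon_i^k\alpha_{ij}\alpha_{ji}\varepsilon_i^{-c_{ij}-1-k}=0$ for each $i$. Modules: left modules. For a bigraded vector space $V$, $\dim_{q,t}V=\sum_{u,v}(\dim_\Bbbk V_{u,v})q^ut^v$, and $\mathbb D(V)_{u,v}=\mathrm{Hom}_\Bbbk(V_{-u,-v},\Bbbk)$. The dual of a left $\widetilde\Pi$-module is a left $\widetilde\Pi$-module via the anti-involution $e_i\mapsto e_i$, $\alpha_{ij}\mapsto\alpha_{ji}$, $\varepsilon_i\mapsto\varepsilon_i$. $\bar I_i=\mathbb D((\widetilde\Pi/\widetilde\Pi\varepsilon_i)e_i)$,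 a finite-dimensional bigraded module. *)

theory Defs
  imports
    "HOL-Analysis.Analysis"
    "HOL-Algebra.QuotRing"
    "HOL-Computational_Algebra.Formal_Laurent_Series"
    "HOL-Library.Poly_Mapping"
    "HOL-Library.Function_Algebras"
begin

text \<open>Only \<open>vec_nth\<close> is written \<open>$\<close> here; otherwise every occurrence is parsed in two ways.\<close>

no_notation fps_nth (infixl \<open>$\<close> 75)

section \<open>Lie data\<close>

text \<open>
  A complex finite-dimensional simple Lie algebra enters only through its Cartan matrix.
  By the Killing--Cartan classification and Serre's theorem, the matrices arising in this way are
  the indecomposable Cartan matrices of finite type. The index set \<open>I\<close> is the finite type \<open>'i\<close>.
\<close>

definition simple_cartan_matrix :: "int ^ 'i ^ 'i \<Rightarrow> bool" where
  "simple_cartan_matrix C \<longleftrightarrow>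
     (\<forall>i. C $ i $ i = 2) \<and>
     (\<forall>i j. i \<noteq> j \<longrightarrow> C $ i $ j \<le> 0) \<and>
     (\<forall>i j. C $ i $ j = 0 \<longrightarrow> C $ j $ i = 0) \<and>
     (\<exists>D :: 'i \<Rightarrow> int. (\<forall>i. D i > 0) \<and>
        (\<forall>i j. D i * C $ i $ j = D j * C $ j $ i) \<and>
        (\<forall>x :: real ^ 'i. x \<noteq> 0 \<longrightarrow>
           (\<Sum>i\<in>UNIV. \<Sum>j\<in>UNIV. x $ i * of_int (D i * C $ i $ j) * x $ j) > 0)) \<and>
     (\<forall>J. J \<noteq> {} \<and> J \<noteq> UNIV \<longrightarrow> (\<exists>i\<in>J. \<exists>j\<in>-J. C $ i $ j \<noteq> 0))"

definition adj :: "int ^ 'i ^ 'i \<Rightarrow> 'i \<Rightarrow> 'i \<Rightarrow> bool" where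
  "adj C i j \<longleftrightarrow> i \<noteq> j \<and> C $ i $ j < 0"

definition sym_d :: "int ^ 'i ^ 'i \<Rightarrow> 'i \<Rightarrow> nat" where
  "sym_d C = (THE d. (\<forall>i. d i > 0) \<and>
     (\<forall>i j. int (d i) * C $ i $ j = int (d j) * C $ j $ i) \<and> Gcd (range d) = 1)"

text \<open>The number \<open>c\<^sub>i\<^sub>j c\<^sub>j\<^sub>i\<close> is the multiplicity of the edge between \<open>i\<close> and \<open>j\<close> in the Dynkin
  diagram; the number 1 is inserted for type \<open>A\<^sub>1\<close>, which has no edge.\<close>

definition lacing_number :: "int ^ 'i ^ 'i \<Rightarrow> int" where
  "lacing_number C = Max (insert 1 {C $ i $ j * C $ j $ i | i j. i \<noteq> j})"

text \<open>The root lattice is \<open>int ^ 'i\<close>, in coordinates with respect to the simple roots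
  \<open>\<alpha>\<^sub>i\<close> = \<open>axis i 1\<close>, and \<open>s\<^sub>i(\<alpha>\<^sub>j) = \<alpha>\<^sub>j - c\<^sub>i\<^sub>j \<alpha>\<^sub>i\<close>.\<close>

definition simple_reflection :: "int ^ 'i ^ 'i \<Rightarrow> 'i \<Rightarrow> int ^ 'i \<Rightarrow> int ^ 'i" where
  "simple_reflection C i x = x - (\<Sum>j\<in>UNIV. C $ i $ j * x $ j) *s axis i 1"

definition word_action :: "int ^ 'i ^ 'i \<Rightarrow> 'i list \<Rightarrow> int ^ 'i \<Rightarrow> int ^ 'i" where
  "word_action C xs = foldr (\<circ>) (map (simple_reflection C) xs) id"

definition weyl_group :: "int ^ 'i ^ 'i \<Rightarrow> (int ^ 'i \<Rightarrow> int ^ 'i) set" where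
  "weyl_group C = range (word_action C)"

definition weyl_length :: "int ^ 'i ^ 'i \<Rightarrow> (int ^ 'i \<Rightarrow> int ^ 'i) \<Rightarrow> nat" where
  "weyl_length C w = (LEAST n. \<exists>xs. length xs = n \<and> word_action C xs = w)"

definition longest_element :: "int ^ 'i ^ 'i \<Rightarrow> int ^ 'i \<Rightarrow> int ^ 'i" where
  "longest_element C =
     (THE w. w \<in> weyl_group C \<and> (\<forall>w'\<in>weyl_group C. weyl_length C w' \<le> weyl_length C w))"

definition star :: "int ^ 'i ^ 'i \<Rightarrow> 'i \<Rightarrow> 'i" where
  "star C i = (THE j. longest_element C (axis i 1) = - axis j 1)"

text \<open>The Coxeter number is the order of a Coxeter element, i.e. of the product of all simple
  reflections in some order. All Coxeter elements are conjugate, so the choice of order is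
  immaterial.\<close>

definition coxeter_element :: "int ^ 'i ^ 'i \<Rightarrow> int ^ 'i \<Rightarrow> int ^ 'i" where
  "coxeter_element C = word_action C (SOME xs. distinct xs \<and> set xs = UNIV)"

definition coxeter_number :: "int ^ 'i ^ 'i \<Rightarrow> nat" where
  "coxeter_number C = (LEAST n. n > 0 \<and> (coxeter_element C ^^ n) = id)"

definition roots :: "int ^ 'i ^ 'i \<Rightarrow> (int ^ 'i) set" where
  "roots C = {w (axis i 1) | w i. w \<in> weyl_group C}"

definition highest_root :: "int ^ 'i ^ 'i \<Rightarrow> int ^ 'i" where
  "highest_root C = (THE \<theta>. \<theta> \<in> roots C \<and> (\<forall>\<beta>\<in>roots C. \<forall>i. \<beta> $ i \<le> \<theta> $ i))"

definition root_form :: "int ^ 'i ^ 'i \<Rightarrow> int ^ 'i \<Rightarrow> int ^ 'i \<Rightarrow> int" where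
  "root_form C x y = (\<Sum>i\<in>UNIV. \<Sum>j\<in>UNIV. x $ i * (int (sym_d C i) * C $ i $ j) * y $ j)"

text \<open>The dual Coxeter number is \<open>1 + \<langle>\<rho>, \<theta>\<^sup>\<or>\<rangle>\<close> where \<open>\<theta>\<close> is the highest root. Since
  \<open>\<theta>\<^sup>\<or> = 2\<theta>/(\<theta>,\<theta>)\<close> and \<open>(\<rho>,\<alpha>\<^sub>i) = (\<alpha>\<^sub>i,\<alpha>\<^sub>i)/2 = d\<^sub>i\<close>, the pairing is
  \<open>2 (\<Sum>\<^sub>i d\<^sub>i \<theta>\<^sub>i) / (\<theta>,\<theta>)\<close>; this division is exact.\<close>

definition dual_coxeter_number :: "int ^ 'i ^ 'i \<Rightarrow> int" where
  "dual_coxeter_number C = (let \<theta> = highest_root C in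
     1 + (2 * (\<Sum>i\<in>UNIV. int (sym_d C i) * \<theta> $ i)) div root_form C \<theta> \<theta>)"


section \<open>The deformed Cartan matrix\<close>

text \<open>
  The field of iterated Laurent series in \<open>q\<close> over Laurent series in \<open>t\<^sup>-\<^sup>1\<close>, with rational
  coefficients, contains \<open>\<int>[[q,t\<^sup>-\<^sup>1]][(qt\<^sup>-\<^sup>1)\<^sup>-\<^sup>1]\<close> as a subring. A matrix that is invertible over
  the subring has the same inverse over the field, and likewise for scalars, so that fractions
  such as \<open>1 / (1 - q\<^sup>a t\<^sup>-\<^sup>b)\<close> with \<open>a, b > 0\<close> have their expansion in the subring.
\<close>

type_synonym qt_series = "rat fls fls"

definition qv :: qt_series where
  "qv = fls_X"

definition tv :: qt_series where
  "tv = fls_const fls_X_inv"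

definition q_int :: "int \<Rightarrow> qt_series" where
  "q_int k = (qv powi k - qv powi (- k)) / (qv - qv powi (-1))"

definition qt_cartan :: "int ^ 'i ^ 'i \<Rightarrow> qt_series ^ 'i ^ 'i" where
  "qt_cartan C = (\<chi> i j.
     if i = j then qv powi (int (sym_d C i)) * tv powi (-1) + qv powi (- int (sym_d C i)) * tv
     else q_int (C $ i $ j))"

definition qt_cartan_inv :: "int ^ 'i ^ 'i \<Rightarrow> qt_series ^ 'i ^ 'i" where
  "qt_cartan_inv C = matrix_inv (qt_cartan C)"


section \<open>The path algebra\<close>

text \<open>\<open>Alpha i j\<close> is the arrow \<open>\<alpha>\<^sub>i\<^sub>j : j \<rightarrow> i\<close>.\<close>

datatype 'i arrow = Alpha 'i 'i | Eps 'i

fun arrow_tgt :: "'i arrow \<Rightarrow> 'i" where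
  "arrow_tgt (Alpha i j) = i"
| "arrow_tgt (Eps i) = i"

fun arrow_src :: "'i arrow \<Rightarrow> 'i" where
  "arrow_src (Alpha i j) = j"
| "arrow_src (Eps i) = i"

definition arrows :: "int ^ 'i ^ 'i \<Rightarrow> 'i arrow set" where
  "arrows C = {Alpha i j | i j. adj C i j} \<union> range Eps"

text \<open>A path is a triple (target, arrows, source). The arrows are listed as they appear in a
  product, so the last one in the list is traversed first.\<close>

type_synonym 'i qpath = "'i \<times> 'i arrow list \<times> 'i"

fun is_walk :: "int ^ 'i ^ 'i \<Rightarrow> 'i \<Rightarrow> 'i arrow list \<Rightarrow> 'i \<Rightarrow> bool" where
  "is_walk C i [] j \<longleftrightarrow> i = j"
| "is_walk C i (a # as) j \<longleftrightarrow> a \<in> arrows C \<and> arrow_tgt a = i \<and> is_walk C (arrow_src a) as j"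

definition paths :: "int ^ 'i ^ 'i \<Rightarrow> 'i qpath set" where
  "paths C = {(i, as, j). is_walk C i as j}"


text \<open>The product of two basis paths is their concatenation if they are composable and 0
  otherwise.\<close>

fun basis_mult :: "'i qpath \<Rightarrow> 'i qpath \<Rightarrow> ('i qpath \<Rightarrow>\<^sub>0 'k::field)" where
  "basis_mult (i, as, j) (k, bs, l) = (if j = k then Poly_Mapping.single (i, as @ bs, l) 1 else 0)"

definition scale :: "'k::field \<Rightarrow> ('i qpath \<Rightarrow>\<^sub>0 'k) \<Rightarrow> ('i qpath \<Rightarrow>\<^sub>0 'k)" where
  "scale c f = Poly_Mapping.map ((*) c) f"

definition path_mult ::
    "('i qpath \<Rightarrow>\<^sub>0 'k::field) \<Rightarrow> ('i qpath \<Rightarrow>\<^sub>0 'k) \<Rightarrow> ('i qpath \<Rightarrow>\<^sub>0 'k)" where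
  "path_mult f g = (\<Sum>a\<in>Poly_Mapping.keys f. \<Sum>b\<in>Poly_Mapping.keys g.
     scale (Poly_Mapping.lookup f a * Poly_Mapping.lookup g b) (basis_mult a b))"

definition idem :: "'i \<Rightarrow> ('i qpath \<Rightarrow>\<^sub>0 'k::field)" where
  "idem i = Poly_Mapping.single (i, [], i) 1"

definition arr :: "'i arrow \<Rightarrow> ('i qpath \<Rightarrow>\<^sub>0 'k::field)" where
  "arr a = Poly_Mapping.single (arrow_tgt a, [a], arrow_src a) 1"

definition path_algebra :: "int ^ 'i ^ 'i \<Rightarrow> ('i qpath \<Rightarrow>\<^sub>0 'k::field) ring" where
  "path_algebra C =
     \<lparr>carrier = {f. Poly_Mapping.keys f \<subseteq> paths C}, mult = path_mult,
      one = (\<Sum>i\<in>UNIV. idem i), zero = 0, add = (+)\<rparr>"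

definition arrow_deg :: "int ^ 'i ^ 'i \<Rightarrow> 'i arrow \<Rightarrow> int \<times> int" where
  "arrow_deg C a = (case a of
     Alpha i j \<Rightarrow> (- int (max (sym_d C i) (sym_d C j)), 1)
   | Eps i \<Rightarrow> (2 * int (sym_d C i), 0))"

fun path_deg :: "int ^ 'i ^ 'i \<Rightarrow> 'i qpath \<Rightarrow> int \<times> int" where
  "path_deg C (i, as, j) = sum_list (map (arrow_deg C) as)"

definition path_comp :: "int ^ 'i ^ 'i \<Rightarrow> int \<times> int \<Rightarrow> ('i qpath \<Rightarrow>\<^sub>0 'k::field) set" where
  "path_comp C n =
     {f \<in> carrier (path_algebra C). \<forall>p\<in>Poly_Mapping.keys f. path_deg C p = n}"

text \<open>The anti-involution fixing \<open>e\<^sub>i\<close> and \<open>\<epsilon>\<^sub>i\<close> and exchanging \<open>\<alpha>\<^sub>i\<^sub>j\<close> with \<open>\<alpha>\<^sub>j\<^sub>i\<close>.\<close>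

fun arrow_flip :: "'i arrow \<Rightarrow> 'i arrow" where
  "arrow_flip (Alpha i j) = Alpha j i"
| "arrow_flip (Eps i) = Eps i"

fun path_rev :: "'i qpath \<Rightarrow> 'i qpath" where
  "path_rev (i, as, j) = (j, map arrow_flip (rev as), i)"

definition path_anti :: "('i qpath \<Rightarrow>\<^sub>0 'k::field) \<Rightarrow> ('i qpath \<Rightarrow>\<^sub>0 'k)" where
  "path_anti f = Poly_Mapping.map_key path_rev f"


section \<open>The generalized preprojective algebra\<close>

text \<open>The signs \<open>\<omega>\<^sub>i\<^sub>j\<close> are taken in the ground field, where they are used.\<close>

definition sign_choice :: "int ^ 'i ^ 'i \<Rightarrow> ('i \<Rightarrow> 'i \<Rightarrow> 'k::field) \<Rightarrow> bool" where
  "sign_choice C \<omega> \<longleftrightarrow> (\<forall>i j. adj C i j \<longrightarrow> \<omega> i j \<in> {1, -1} \<and> \<omega> i j = - \<omega> j i)"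

definition relation1 :: "int ^ 'i ^ 'i \<Rightarrow> 'i \<Rightarrow> 'i \<Rightarrow> ('i qpath \<Rightarrow>\<^sub>0 'k::field)" where
  "relation1 C i j = (let A = path_algebra C in
     (arr (Eps i) [^]\<^bsub>A\<^esub> nat (- C $ i $ j)) \<otimes>\<^bsub>A\<^esub> arr (Alpha i j)
     - arr (Alpha i j) \<otimes>\<^bsub>A\<^esub> (arr (Eps j) [^]\<^bsub>A\<^esub> nat (- C $ j $ i)))"

definition relation2 ::
    "int ^ 'i ^ 'i \<Rightarrow> ('i \<Rightarrow> 'i \<Rightarrow> 'k) \<Rightarrow> 'i \<Rightarrow> ('i qpath \<Rightarrow>\<^sub>0 'k::field)" where
  "relation2 C \<omega> i = (let A = path_algebra C in
     \<Sum>j\<in>{j. adj C j i}. \<Sum>k<nat (- C $ i $ j).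
       scale (\<omega> i j)
         ((arr (Eps i) [^]\<^bsub>A\<^esub> k) \<otimes>\<^bsub>A\<^esub> arr (Alpha i j) \<otimes>\<^bsub>A\<^esub> arr (Alpha j i)
          \<otimes>\<^bsub>A\<^esub> (arr (Eps i) [^]\<^bsub>A\<^esub> (nat (- C $ i $ j) - 1 - k))))"

definition relations ::
    "int ^ 'i ^ 'i \<Rightarrow> ('i \<Rightarrow> 'i \<Rightarrow> 'k) \<Rightarrow> ('i qpath \<Rightarrow>\<^sub>0 'k::field) set" where
  "relations C \<omega> = {relation1 C i j | i j. adj C i j} \<union> range (relation2 C \<omega>)"

definition rel_ideal ::
    "int ^ 'i ^ 'i \<Rightarrow> ('i \<Rightarrow> 'i \<Rightarrow> 'k) \<Rightarrow> ('i qpath \<Rightarrow>\<^sub>0 'k::field) set" where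
  "rel_ideal C \<omega> = Idl\<^bsub>path_algebra C\<^esub> (relations C \<omega>)"

definition gpa ::
    "int ^ 'i ^ 'i \<Rightarrow> ('i \<Rightarrow> 'i \<Rightarrow> 'k) \<Rightarrow> ('i qpath \<Rightarrow>\<^sub>0 'k::field) set ring" where
  "gpa C \<omega> = path_algebra C Quot rel_ideal C \<omega>"

definition gpa_class ::
    "int ^ 'i ^ 'i \<Rightarrow> ('i \<Rightarrow> 'i \<Rightarrow> 'k) \<Rightarrow> ('i qpath \<Rightarrow>\<^sub>0 'k::field) \<Rightarrow> ('i qpath \<Rightarrow>\<^sub>0 'k) set" where
  "gpa_class C \<omega> x = rel_ideal C \<omega> +>\<^bsub>path_algebra C\<^esub> x"


section \<open>The modules\<close>

definition eps_left_ideal ::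
    "int ^ 'i ^ 'i \<Rightarrow> ('i \<Rightarrow> 'i \<Rightarrow> 'k) \<Rightarrow> 'i \<Rightarrow> ('i qpath \<Rightarrow>\<^sub>0 'k::field) set set" where
  "eps_left_ideal C \<omega> i =
     {x \<otimes>\<^bsub>gpa C \<omega>\<^esub> gpa_class C \<omega> (arr (Eps i)) | x. x \<in> carrier (gpa C \<omega>)}"

text \<open>\<open>pbar C \<omega> i\<close> is \<open>(\<Pi>/\<Pi>\<epsilon>\<^sub>i)e\<^sub>i\<close>; its elements are the cosets of \<open>xe\<^sub>i\<close> modulo \<open>\<Pi>\<epsilon>\<^sub>i\<close>, and
  \<open>a\<close> acts by \<open>a \<cdot> (x + \<Pi>\<epsilon>\<^sub>i) = ax + \<Pi>\<epsilon>\<^sub>i\<close>.\<close>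

type_synonym ('i, 'k) pbar_elem = "('i qpath \<Rightarrow>\<^sub>0 'k) set set"

definition pbar_class ::
    "int ^ 'i ^ 'i \<Rightarrow> ('i \<Rightarrow> 'i \<Rightarrow> 'k::field) \<Rightarrow> 'i \<Rightarrow> ('i qpath \<Rightarrow>\<^sub>0 'k) set \<Rightarrow> ('i, 'k) pbar_elem" where
  "pbar_class C \<omega> i x = eps_left_ideal C \<omega> i +>\<^bsub>gpa C \<omega>\<^esub> x"

definition pbar ::
    "int ^ 'i ^ 'i \<Rightarrow> ('i \<Rightarrow> 'i \<Rightarrow> 'k::field) \<Rightarrow> 'i \<Rightarrow> ('i, 'k) pbar_elem set" where
  "pbar C \<omega> i = {pbar_class C \<omega> i (x \<otimes>\<^bsub>gpa C \<omega>\<^esub> gpa_class C \<omega> (idem i)) | x.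
     x \<in> carrier (gpa C \<omega>)}"

definition pbar_comp ::
    "int ^ 'i ^ 'i \<Rightarrow> ('i \<Rightarrow> 'i \<Rightarrow> 'k::field) \<Rightarrow> 'i \<Rightarrow> int \<times> int \<Rightarrow> ('i, 'k) pbar_elem set" where
  "pbar_comp C \<omega> i n =
     {pbar_class C \<omega> i (gpa_class C \<omega> x \<otimes>\<^bsub>gpa C \<omega>\<^esub> gpa_class C \<omega> (idem i)) | x.
       x \<in> path_comp C n}"

definition pbar_act ::
    "int ^ 'i ^ 'i \<Rightarrow> ('i \<Rightarrow> 'i \<Rightarrow> 'k::field) \<Rightarrow> 'i \<Rightarrow> ('i qpath \<Rightarrow>\<^sub>0 'k) set
       \<Rightarrow> ('i, 'k) pbar_elem \<Rightarrow> ('i, 'k) pbar_elem" where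
  "pbar_act C \<omega> i a X = (\<Union>x\<in>X. pbar_class C \<omega> i (a \<otimes>\<^bsub>gpa C \<omega>\<^esub> x))"

definition pbar_scale ::
    "int ^ 'i ^ 'i \<Rightarrow> ('i \<Rightarrow> 'i \<Rightarrow> 'k::field) \<Rightarrow> 'i \<Rightarrow> 'k
       \<Rightarrow> ('i, 'k) pbar_elem \<Rightarrow> ('i, 'k) pbar_elem" where
  "pbar_scale C \<omega> i c = pbar_act C \<omega> i (gpa_class C \<omega> (scale c \<one>\<^bsub>path_algebra C\<^esub>))"

text \<open>\<open>ibar C \<omega> i\<close> is the dual of \<open>pbar C \<omega> i\<close>. A functional is extended by 0 outside of
  \<open>pbar C \<omega> i\<close>, so that it is determined by its values on the module. The component of degree \<open>n\<close>
  is \<open>Hom(V\<^sub>-\<^sub>n, \<bbbk>)\<close>, realised as the functionals on \<open>V\<close> vanishing on all \<open>V\<^sub>m\<close> with \<open>m \<noteq> -n\<close>.\<close>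

definition ibar ::
    "int ^ 'i ^ 'i \<Rightarrow> ('i \<Rightarrow> 'i \<Rightarrow> 'k::field) \<Rightarrow> 'i \<Rightarrow> (('i, 'k) pbar_elem \<Rightarrow> 'k) set" where
  "ibar C \<omega> i = {f.
     (\<forall>X. X \<notin> pbar C \<omega> i \<longrightarrow> f X = 0) \<and>
     (\<forall>X\<in>pbar C \<omega> i. \<forall>Y\<in>pbar C \<omega> i. f (X <+>\<^bsub>gpa C \<omega>\<^esub> Y) = f X + f Y) \<and>
     (\<forall>c. \<forall>X\<in>pbar C \<omega> i. f (pbar_scale C \<omega> i c X) = c * f X)}"

definition ibar_comp ::
    "int ^ 'i ^ 'i \<Rightarrow> ('i \<Rightarrow> 'i \<Rightarrow> 'k::field) \<Rightarrow> 'i \<Rightarrow> int \<times> int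
       \<Rightarrow> (('i, 'k) pbar_elem \<Rightarrow> 'k) set" where
  "ibar_comp C \<omega> i n =
     {f \<in> ibar C \<omega> i. \<forall>m. m \<noteq> - n \<longrightarrow> (\<forall>X\<in>pbar_comp C \<omega> i m. f X = 0)}"

definition ibar_act ::
    "int ^ 'i ^ 'i \<Rightarrow> ('i \<Rightarrow> 'i \<Rightarrow> 'k::field) \<Rightarrow> 'i \<Rightarrow> ('i qpath \<Rightarrow>\<^sub>0 'k) set
       \<Rightarrow> (('i, 'k) pbar_elem \<Rightarrow> 'k) \<Rightarrow> (('i, 'k) pbar_elem \<Rightarrow> 'k)" where
  "ibar_act C \<omega> i a f =
     (\<lambda>X. if X \<in> pbar C \<omega> i then f (pbar_act C \<omega> i (path_anti ` a) X) else 0)"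

text \<open>The component of degree \<open>n\<close> of \<open>e\<^sub>i\<close> times the dual module at \<open>j\<close>.\<close>

definition idem_ibar_comp ::
    "int ^ 'i ^ 'i \<Rightarrow> ('i \<Rightarrow> 'i \<Rightarrow> 'k::field) \<Rightarrow> 'i \<Rightarrow> 'i \<Rightarrow> int \<times> int
       \<Rightarrow> (('i, 'k) pbar_elem \<Rightarrow> 'k) set" where
  "idem_ibar_comp C \<omega> i j n =
     ibar_act C \<omega> j (gpa_class C \<omega> (idem i)) ` ibar C \<omega> j \<inter> ibar_comp C \<omega> j n"

definition fun_dim :: "('x \<Rightarrow> 'k::field) set \<Rightarrow> nat" where
  "fun_dim V = vector_space.dim (\<lambda>(c::'k) f. \<lambda>x. c * f x) V"

definition dim_qt :: "(int \<times> int \<Rightarrow> ('x \<Rightarrow> 'k::field) set) \<Rightarrow> qt_series" where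
  "dim_qt V = (\<Sum>(u, v)\<in>{n. fun_dim (V n) \<noteq> 0}.
     of_nat (fun_dim (V (u, v))) * qv powi u * tv powi v)"

end

(*
  The dual of a component of the module is a space of functions on words of arrows that satisfy the
  transposed relations. Resolving the simple modules over the generalized preprojective algebra by a
  complex of length two gives a recursion for the dimensions N(i,j;u,v) of these spaces, which says
  that the deformed Cartan matrix sends the j-th column of generating functions to a multiple of a
  unit vector plus an error term K, the kernel at the left end. Positivity of the Cartan matrix
  forces K to be nonzero, and the self-duality of the complex makes it a permutation matrix sigma
  placed in a single bidegree (G,B), up to a shift by d.
  It remains to identify sigma, B and G. For q specialised to a positive real x the recursion is a
  deformed mesh relation, that is, the orbit of a deformed Coxeter element, so that this element has
  order B at x = 1 (hence B = h), and comparing determinants at x = 2 gives -nG = h (d_1 + ... + d_n).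
  At x = 1, alternating the reflections in the two colour classes of the Dynkin diagram B times sends
  alpha_i to -alpha_sigma(i), so this product is the longest element and sigma is the involution *;
  the intermediate vectors enumerate every positive root twice, so the norms of the positive roots
  add up to h (d_1 + ... + d_n). The Casimir identity, evaluated at the highest root, shows that this
  sum is also n r h^vee, whence -G = r h^vee.
*)
theory Submission
  imports Defs
begin

section \<open>Finite-dimensional spaces of functions\<close>

text \<open>The obstacle is to control the kernel term while the module is not yet known to be
  finite-dimensional and the field is arbitrary. The relations are the cyclic derivatives of a
  potential of degree (0, 2), which gives a complex of four terms for the homomorphisms from a
  truncated dual module to another one. Three facts about it are proved: the maps compose to zero,
  the last one is onto, and cocycles integrate to homomorphisms up to an explicit obstruction. They
  yield an inequality of dimensions in each bidegree, whose two sides have the same total at x = 1,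
  so that it is an equality. With the recursion inserted, the equality becomes a vanishing sum of
  products of dimensions with positive factors x^(2d) - 1 at x = 2, which must vanish termwise:
  nothing lives above a kernel. Finiteness follows, and then the same identity, read from the other
  side, turns the kernels into a permutation. The Coxeter element appears because the dimensions are
  the fundamental solution of a recursion of order two in the t-degree; at its end only one of the
  two initial values survives, with a sign, so B steps are half a period.\<close>

interpretation fv: vector_space "\<lambda>(c::'k::field) (f::'x => 'k). (\<lambda>x. c * f x)"
 by unfold_locales (auto simp: fun_eq_iff algebra_simps)

lemma sum_fun_eval: "(\<Sum>b\<in>B. F b) c = (\<Sum>b\<in>B. F b c)"
 by(induction B rule: infinite_finite_induct) auto

lemma fun_dim_eq: "fun_dim V = fv.dim V"
 by(simp add: fun_dim_def)

text \<open>\<open>fv.dim\<close> is a cardinality and says nothing useful about an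
  infinite-dimensional subspace. The space of all functions may be infinite-dimensional, so
  finiteness is carried along as a property of the subspace.\<close>

definition fin_space :: "('x => 'k::field) set => bool" where
 "fin_space V \<longleftrightarrow> fv.subspace V \<and> (\<exists>S. finite S \<and> V \<subseteq> fv.span S)"

definition flinear :: "(('x => 'k::field) => ('y => 'k)) => bool" where
 "flinear T \<longleftrightarrow> (\<forall>f g. T (f + g) = T f + T g) \<and> (\<forall>c f. T (\<lambda>x. c * f x) = (\<lambda>y. c * T f y))"

lemma flinear_linear: "flinear T \<longleftrightarrow>
  Vector_Spaces.linear (\<lambda>(c::'k::field) f x. c * f x) (\<lambda>c f x. c * f x) T"
 by(simp add: flinear_def Vector_Spaces.linear_iff fv.vector_space_axioms)

lemma fin_space_subspace: "fin_space V ==> fv.subspace V"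
 by(simp add: fin_space_def)

lemma fin_space_basis:
 assumes "fin_space V"
 obtains B where "finite B" "B \<subseteq> V" "fv.independent B" "V = fv.span B" "card B = fun_dim V"
proof -
 obtain B where B: "B \<subseteq> V" "fv.independent B" "V \<subseteq> fv.span B" "card B = fv.dim V"
  using fv.basis_exists .
 obtain S where S: "finite S" "V \<subseteq> fv.span S" using assms by(auto simp: fin_space_def)
 have "finite B" using fv.independent_span_bound[OF S(1) B(2)] B(1) S(2) by auto
 moreover have "V = fv.span B"
  using B(1,3) fv.span_minimal[OF B(1) fin_space_subspace[OF assms]] by auto
 ultimately show ?thesis using that B by(simp add: fun_dim_eq)
qed

lemma fin_space_subset:
 "fin_space W ==> fv.subspace V ==> V \<subseteq> W ==> fin_space V"
 by(auto simp: fin_space_def)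

lemma fun_dim_0: "fun_dim {0::'x => 'k::field} = 0"
 unfolding fun_dim_eq by(rule fv.dim_unique[of "{}"]) (auto simp: fv.independent_empty)

lemma fun_dim_mono:
 assumes "fin_space W" "V \<subseteq> W"
 shows "fun_dim V \<le> fun_dim W"
proof -
 obtain B where "finite B" "W = fv.span B" "card B = fun_dim W"
  using fin_space_basis[OF assms(1)] by metis
 thus ?thesis using fv.dim_le_card[of V B] assms(2) by(simp add: fun_dim_eq)
qed

lemma flinear_ker_subspace:
 fixes T :: "('x => 'k::field) => ('y => 'k)"
 assumes "flinear T" "fv.subspace V"
 shows "fv.subspace {f \<in> V. T f = 0}"
proof -
 interpret T: Vector_Spaces.linear "\<lambda>(c::'k) f x. c * f x" "\<lambda>c f x. c * f x" T
  using assms(1) by(simp add: flinear_linear)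
 have "T (\<lambda>x. c * f x) = 0" if "T f = 0" for c f
  using T.scale[of c f] that by(simp add: fun_eq_iff)
 thus ?thesis
  using assms(2) by(auto simp: fv.subspace_def T.add T.zero)
qed

lemma rank_nullity:
 fixes T :: "('x => 'k::field) => ('y => 'k)"
 assumes V: "fin_space V" and T: "flinear T"
 shows "fun_dim V = fun_dim (T ` V) + fun_dim {f \<in> V. T f = 0}"
  and "fin_space (T ` V)" and "fin_space {f \<in> V. T f = 0}"
proof -
 interpret T: Vector_Spaces.linear "\<lambda>(c::'k) f x. c * f x" "\<lambda>c f x. c * f x" T
  using T by(simp add: flinear_linear)
 let ?K = "{f \<in> V. T f = 0}"
 have subK: "fv.subspace ?K"
  by(rule flinear_ker_subspace[OF T fin_space_subspace[OF V]])
 show finK: "fin_space ?K" by(rule fin_space_subset[OF V subK]) auto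
 obtain A where A: "finite A" "A \<subseteq> ?K" "fv.independent A" "?K = fv.span A" "card A = fun_dim ?K"
   by(rule fin_space_basis[OF finK])
 obtain B where B: "A \<subseteq> B" "B \<subseteq> V" "fv.independent B" "V \<subseteq> fv.span B"
  using fv.maximal_independent_subset_extend[of A V] A by auto
 obtain S where S: "finite S" "V \<subseteq> fv.span S" using V by(auto simp: fin_space_def)
 have finB: "finite B" using fv.independent_span_bound[OF S(1) B(3)] B(2) S(2) by auto
 have VB: "V = fv.span B"
  using B fv.span_minimal[OF B(2) fin_space_subspace[OF V]] by auto
 have dimV: "fun_dim V = card B"
  using fv.dim_unique[of B V "card B"] B by(simp add: fun_dim_eq)
 \<comment> \<open>The basis vectors outside the kernel: their span meets the kernel only in 0, so
   they are mapped to a basis of the image.\<close>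
 let ?C = "B - A"
 have indC: "fv.independent ?C" using B(3) fv.independent_mono by blast
 have span_im: "T ` V = fv.span (T ` B)" using VB T.span_image by simp
 have imB: "fv.span (T ` B) = fv.span (T ` ?C)"
 proof (rule antisym)
  have "T ` B \<subseteq> fv.span (T ` ?C)"
  proof
   fix y assume "y \<in> T ` B"
   then obtain b where b: "b \<in> B" "y = T b" by auto
   show "y \<in> fv.span (T ` ?C)"
   proof (cases "b \<in> A")
    case True
    hence "y = 0" using A(2) b by auto
    thus ?thesis by(simp add: fv.span_zero)
   next
    case False
    thus ?thesis using b by(auto intro: fv.span_base)
   qed
  qed
  thus "fv.span (T ` B) \<subseteq> fv.span (T ` ?C)"
   by(rule fv.span_minimal) (rule fv.subspace_span)
  show "fv.span (T ` ?C) \<subseteq> fv.span (T ` B)" by(rule fv.span_mono) auto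
 qed
 have inj: "inj_on T (fv.span ?C)"
 proof (rule T.inj_on_iff_eq_0[THEN iffD2], rule fv.subspace_span, safe)
  fix x assume x: "x \<in> fv.span ?C" "T x = 0"
  have "x \<in> V" using x(1) VB fv.span_mono[of ?C B] by auto
  hence "x \<in> fv.span A" using x(2) A(4) by auto
  moreover have "fv.span A \<inter> fv.span ?C = {0}"
  proof -
   have "x = 0" if xA: "x \<in> fv.span A" and xC: "x \<in> fv.span ?C" for x
   proof -
    have rA: "fv.representation B x b = fv.representation A x b" for b
     using fv.representation_extend[OF B(3) xA B(1)] by simp
    have rC: "fv.representation B x b = fv.representation ?C x b" for b
     using fv.representation_extend[OF B(3) xC] by auto
    have "fv.representation B x b = 0" for b
    proof (cases "b \<in> A")
     case True
     thus ?thesis using rC[of b] fv.representation_ne_zero[of ?C x b] by auto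
    next
     case False
     thus ?thesis using rA[of b] fv.representation_ne_zero[of A x b] by auto
    qed
    moreover have "x \<in> fv.span B" using xA fv.span_mono[OF B(1)] by auto
    ultimately show "x = 0"
     using fv.sum_nonzero_representation_eq[OF B(3), of x] by(simp add: zero_fun_def times_fun_def)
   qed
   thus ?thesis by(auto simp: fv.span_zero)
  qed
  ultimately show "x = 0" using x(1) by auto
 qed
 have indTC: "fv.independent (T ` ?C)"
  using T.independent_injective_image[OF indC inj] .
 have "card (T ` ?C) = card ?C"
  using inj by(intro card_image inj_on_subset[OF inj] fv.span_superset)
 moreover have "fun_dim (T ` V) = card (T ` ?C)"
  unfolding span_im imB fun_dim_eq by(rule fv.dim_span_eq_card_independent[OF indTC])
 moreover have "card ?C = card B - card A" using A(1) B(1) by(simp add: card_Diff_subset)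
 moreover have "card A \<le> card B" using finB B(1) by(simp add: card_mono)
 ultimately show "fun_dim V = fun_dim (T ` V) + fun_dim ?K"
  using dimV A(5) by simp
 show "fin_space (T ` V)"
  unfolding fin_space_def
  using T.subspace_image[OF fin_space_subspace[OF V]] finB span_im by(auto intro!: exI[of _ "T ` B"])
qed

lemma fun_dim_inj_le:
 assumes V: "fin_space V" and T: "flinear T" and W: "fin_space W" and im: "T ` V \<subseteq> W"
  and inj: "\<And>f. f \<in> V ==> T f = 0 ==> f = 0"
 shows "fun_dim V \<le> fun_dim W"
proof -
 have "0 \<in> V" "T 0 = 0"
  using fin_space_subspace[OF V] T by(auto simp: fv.subspace_def flinear_def) (metis add_cancel_right_right)
 hence K: "{f \<in> V. T f = 0} = {0}" using inj by auto
 thus ?thesis using rank_nullity(1)[OF V T] fun_dim_mono[OF W im] K by(simp add: fun_dim_0)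
qed

lemma fun_dim_bij_eq:
 assumes V: "fin_space V" and T: "flinear T" and im: "T ` V = W"
  and inj: "\<And>f. f \<in> V ==> T f = 0 ==> f = 0"
 shows "fun_dim V = fun_dim W"
proof -
 have "0 \<in> V" "T 0 = 0"
  using fin_space_subspace[OF V] T by(auto simp: fv.subspace_def flinear_def) (metis add_cancel_right_right)
 hence K: "{f \<in> V. T f = 0} = {0}" using inj by auto
 thus ?thesis using rank_nullity(1)[OF V T] im K by(simp add: fun_dim_0)
qed

text \<open>Evaluation at the points of \<open>B\<close> is a coordinate system on \<open>V\<close>,
  and the functions \<open>\<phi> b\<close> are its coordinate vectors. For functionals written as
  functions on words this gives dual bases at once: the points are words whose classes form a basis,
  and the coordinates of a functional are its values.\<close>

definition dual_points :: "('x => 'k::field) set => 'x set => ('x => 'x => 'k) => bool" where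
 "dual_points V B \<phi> \<longleftrightarrow> finite B \<and> (\<forall>b\<in>B. \<phi> b \<in> V) \<and>
   (\<forall>b\<in>B. \<forall>c\<in>B. \<phi> b c = (if b = c then 1 else 0)) \<and>
   (\<forall>f\<in>V. f = (\<Sum>b\<in>B. (\<lambda>x. f b * \<phi> b x)))"

text \<open>Induction on the dimension: a function that is nonzero at \<open>x\<close> adds the
  point \<open>x\<close> to a system for the functions vanishing at \<open>x\<close>.\<close>

lemma dual_points_exist:
 assumes "fin_space V"
 shows "\<exists>B \<phi>. dual_points V B \<phi>"
 using assms
proof (induction "fun_dim V" arbitrary: V rule: less_induct)
 case less
 show ?case
 proof (cases "V = {0}")
  case True
  thus ?thesis by(intro exI[of _ "{}"] exI[of _ undefined]) (simp add: dual_points_def)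
 next
  case False
  have sub: "fv.subspace V" using less.prems by(rule fin_space_subspace)
  then obtain f where f: "f \<in> V" "f \<noteq> 0" using False fv.subspace_0[of V] by blast
  then obtain x where x: "f x \<noteq> 0" by(auto simp: fun_eq_iff)
  let ?W = "{g \<in> V. g x = 0}"
  have subW: "fv.subspace ?W" using sub by(auto simp: fv.subspace_def)
  have finW: "fin_space ?W" by(rule fin_space_subset[OF less.prems subW]) auto
  obtain A where A: "finite A" "A \<subseteq> ?W" "fv.independent A" "?W = fv.span A" "card A = fun_dim ?W"
   by(rule fin_space_basis[OF finW])
  have fA: "f \<notin> fv.span A" using A(4) x by auto
  hence ind: "fv.independent (insert f A)" using A(3) fv.independent_insertI by blast
  obtain B where B: "finite B" "V = fv.span B" "card B = fun_dim V"
   using fin_space_basis[OF less.prems] by metis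
  have "card (insert f A) \<le> card B"
   using fv.independent_span_bound[OF B(1) ind] A(2) f(1) B(2) by blast
  moreover have "f \<notin> A" using fA fv.span_base by blast
  ultimately have "fun_dim ?W < fun_dim V" using A B by simp
  from less.hyps[OF this finW] obtain B' \<phi>' where B': "dual_points ?W B' \<phi>'" by blast
  have fin: "finite B'" using B' by(simp add: dual_points_def)
  have inW: "\<phi>' b \<in> V" "\<phi>' b x = 0" if "b \<in> B'" for b using B' that by(auto simp: dual_points_def)
  have dl: "\<phi>' b c = (if b = c then 1 else 0)" if "b \<in> B'" "c \<in> B'" for b c
   using B' that by(auto simp: dual_points_def)
  have xB': "x \<notin> B'" using dl inW(2) by force
  have ex: "g = (\<Sum>b\<in>B'. (\<lambda>y. g b * \<phi>' b y))" if "g \<in> V" "g x = 0" for g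
   using B' that by(auto simp: dual_points_def)
  \<comment> \<open>\<open>f\<close> is scaled to the value 1 at \<open>x\<close> and corrected by
    the old coordinate vectors so that it vanishes at the old points. Those vectors vanish at
    \<open>x\<close>, so the correction leaves the value 1 untouched.\<close>
  define \<psi> where "\<psi> = (\<lambda>y. (1 / f x) * f y) - (\<Sum>b\<in>B'. (\<lambda>y. (f b / f x) * \<phi>' b y))"
  have \<psi>V: "\<psi> \<in> V" unfolding \<psi>_def
   by(intro fv.subspace_diff[OF sub] fv.subspace_sum[OF sub] fv.subspace_scale[OF sub] f(1) inW)
  have \<psi>x: "\<psi> x = 1" using x inW(2) by(simp add: \<psi>_def sum_fun_eval)
  have \<psi>B: "\<psi> c = 0" if "c \<in> B'" for c
  proof -
   have "(\<Sum>b\<in>B'. (f b / f x) * \<phi>' b c) = (\<Sum>b\<in>B'. if b = c then f b / f x else 0)"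
    by(rule sum.cong) (use dl that in auto)
   also have "\<dots> = f c / f x" using fin that by simp
   finally show ?thesis using that by(simp add: \<psi>_def sum_fun_eval)
  qed
  define \<phi> where "\<phi> = \<phi>'(x := \<psi>)"
  have eq: "\<phi> b = \<phi>' b" if "b \<in> B'" for b using that xB' by(auto simp: \<phi>_def)
  have expand: "g = (\<Sum>b\<in>insert x B'. (\<lambda>y. g b * \<phi> b y))" if "g \<in> V" for g
  proof -
   let ?g = "g - (\<lambda>y. g x * \<psi> y)"
   have gV: "?g \<in> V" by(intro fv.subspace_diff[OF sub] fv.subspace_scale[OF sub] that \<psi>V)
   have "?g = (\<Sum>b\<in>B'. (\<lambda>y. ?g b * \<phi>' b y))" by(rule ex[OF gV]) (simp add: \<psi>x)
   also have "\<dots> = (\<Sum>b\<in>B'. (\<lambda>y. g b * \<phi> b y))"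
    by(rule sum.cong) (auto simp: \<psi>B eq)
   finally have "g = (\<lambda>y. g x * \<psi> y) + (\<Sum>b\<in>B'. (\<lambda>y. g b * \<phi> b y))"
    by(metis add.commute diff_add_cancel)
   also have "\<dots> = (\<Sum>b\<in>insert x B'. (\<lambda>y. g b * \<phi> b y))"
    using fin xB' by(simp add: \<phi>_def)
   finally show ?thesis .
  qed
  have "dual_points V (insert x B') \<phi>"
   unfolding dual_points_def using fin inW dl expand \<psi>V \<psi>x \<psi>B xB'
   by(auto simp: \<phi>_def)
  thus ?thesis by blast
 qed
qed

lemma dual_points_dim:
 assumes "dual_points V B \<phi>" "fin_space V"
 shows "card B = fun_dim V"
proof -
 have fin: "finite B" and inV: "\<And>b. b \<in> B ==> \<phi> b \<in> V"
  and dl: "\<And>b c. b \<in> B ==> c \<in> B ==> \<phi> b c = (if b = c then 1 else 0)"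
  and ex: "\<And>f. f \<in> V ==> f = (\<Sum>b\<in>B. (\<lambda>x. f b * \<phi> b x))"
  using assms by(auto simp: dual_points_def)
 have inj: "inj_on \<phi> B"
 proof (rule inj_onI)
  fix b c assume "b \<in> B" "c \<in> B" "\<phi> b = \<phi> c"
  thus "b = c" using dl[of b c] dl[of c c] by(auto split: if_splits)
 qed
 have ind: "fv.independent (\<phi> ` B)"
 proof (rule fv.independent_if_scalars_zero[OF finite_imageI[OF fin]])
  fix u f assume s: "(\<Sum>g\<in>\<phi> ` B. (\<lambda>x. u g * g x)) = 0" and f: "f \<in> \<phi> ` B"
  obtain c where c: "c \<in> B" "f = \<phi> c" using f by auto
  have "0 = (\<Sum>g\<in>\<phi> ` B. (\<lambda>x. u g * g x)) c" using s by simp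
  also have "\<dots> = (\<Sum>b\<in>B. u (\<phi> b) * \<phi> b c)" using inj by(simp add: sum.reindex sum_fun_eval)
  also have "\<dots> = (\<Sum>b\<in>B. if b = c then u (\<phi> b) else 0)"
   by(rule sum.cong) (use dl c in auto)
  also have "\<dots> = u f" using fin c by simp
  finally show "u f = 0" by simp
 qed
 have "V \<subseteq> fv.span (\<phi> ` B)"
 proof
  fix f assume "f \<in> V"
  hence "f = (\<Sum>b\<in>B. (\<lambda>x. f b * \<phi> b x))" by(rule ex)
  moreover have "(\<Sum>b\<in>B. (\<lambda>x. f b * \<phi> b x)) \<in> fv.span (\<phi> ` B)"
   by(intro fv.span_sum fv.span_scale fv.span_base) auto
  ultimately show "f \<in> fv.span (\<phi> ` B)" by simp
 qed
 moreover have "\<phi> ` B \<subseteq> V" using inV by auto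
 ultimately show ?thesis
  using fv.dim_unique[of "\<phi> ` B" V "card B"] ind card_image[OF inj] by(simp add: fun_dim_eq)
qed

text \<open>The direct sum of the spaces \<open>F s\<close>, encoded as one space of functions on
  pairs so that the dimension theory for functions applies to it. The values outside
  \<open>S\<close> are fixed to make the encoding unique.\<close>

definition fbundle :: "'s set => ('s => ('x => 'k::field) set) => ('s \<times> 'x => 'k) set" where
 "fbundle S F = {g. (\<forall>s\<in>S. (\<lambda>x. g (s, x)) \<in> F s) \<and> (\<forall>s x. s \<notin> S \<longrightarrow> g (s, x) = 0)}"

lemma fbundle_dim:
 assumes "finite S" "\<And>s. s \<in> S ==> fin_space (F s)"
 shows "fin_space (fbundle S F)" "fun_dim (fbundle S F) = (\<Sum>s\<in>S. fun_dim (F s))"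
proof -
 have "fin_space (fbundle S F) \<and> fun_dim (fbundle S F) = (\<Sum>s\<in>S. fun_dim (F s))"
  using assms
 proof (induction S rule: finite_induct)
  case empty
  have "fbundle {} F = {0}" by(auto simp: fbundle_def)
  thus ?case by(auto simp: fin_space_def fun_dim_0 fv.subspace_0 intro!: exI[of _ "{}"])
 next
  case (insert s S)
  let ?V = "fbundle (insert s S) F"
  define T where "T = (\<lambda>(g::'a \<times> 'b => 'c) x. g (s, x))"
  define E where "E = (\<lambda>(f::'b => 'c) (r, x). if r = s then f x else 0)"
  have fs: "fin_space (F s)" and IH: "fin_space (fbundle S F)"
   "fun_dim (fbundle S F) = (\<Sum>s\<in>S. fun_dim (F s))" using insert by auto
  have T: "flinear T" by(auto simp: flinear_def T_def)
  have flE: "flinear E" by(auto simp: flinear_def E_def fun_eq_iff)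
  have F0: "(\<lambda>x. 0) \<in> F s'" if "s' \<in> insert s S" for s'
   using insert.prems[OF that] by(auto simp: fin_space_def fv.subspace_def zero_fun_def)
  have sub: "fv.subspace ?V"
   unfolding fv.subspace_def
  proof (intro conjI ballI allI)
   show "0 \<in> ?V" using F0 by(auto simp: fbundle_def)
   fix g assume g: "g \<in> ?V"
   { fix h assume h: "h \<in> ?V"
    have "(\<lambda>x. (g + h) (r, x)) \<in> F r" if "r \<in> insert s S" for r
    proof -
     have "(\<lambda>x. g (r, x)) + (\<lambda>x. h (r, x)) \<in> F r"
      using g h that insert.prems[OF that]
      by(intro fv.subspace_add) (auto simp: fbundle_def fin_space_def)
     thus ?thesis by(simp add: plus_fun_def)
    qed
    thus "g + h \<in> ?V" using g h by(simp add: fbundle_def) }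
   fix c
   have "(\<lambda>x. c * g (r, x)) \<in> F r" if "r \<in> insert s S" for r
    using g that insert.prems[OF that]
    by(intro fv.subspace_scale) (auto simp: fbundle_def fin_space_def)
   thus "(\<lambda>x. c * g x) \<in> ?V" using g by(simp add: fbundle_def)
  qed
  have Tim: "T ` ?V = F s"
  proof (intro equalityI subsetI)
   fix f assume "f \<in> T ` ?V" then show "f \<in> F s" by(auto simp: T_def fbundle_def)
  next
   fix f assume "f \<in> F s"
   have "(\<lambda>x. E f (r, x)) = (if r = s then f else (\<lambda>x. 0))" for r by(auto simp: E_def)
   hence "E f \<in> ?V" "T (E f) = f"
    using F0 \<open>f \<in> F s\<close> by(auto simp: fbundle_def T_def E_def)
   thus "f \<in> T ` ?V" by(metis image_eqI)
  qed
  have ker: "{g \<in> ?V. T g = 0} = fbundle S F"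
  proof (intro equalityI subsetI)
   fix g assume "g \<in> {g \<in> ?V. T g = 0}"
   hence g: "g \<in> ?V" "g (s, x) = 0" for x by(auto simp: T_def fun_eq_iff)
   show "g \<in> fbundle S F"
    unfolding fbundle_def using g by(auto simp: fbundle_def) metis
  next
   fix g assume g: "g \<in> fbundle S F"
   have "(\<lambda>x. g (r, x)) \<in> F r" if "r \<in> insert s S" for r
    using g that F0[of r] insert.hyps by(cases "r = s") (auto simp: fbundle_def)
   thus "g \<in> {g \<in> ?V. T g = 0}"
    using g insert.hyps F0[of s] by(simp add: fbundle_def T_def zero_fun_def)
  qed
  obtain B1 where B1: "finite B1" "F s = fv.span B1" using fin_space_basis[OF fs] by metis
  obtain B2 where B2: "finite B2" "fbundle S F = fv.span B2" using fin_space_basis[OF IH(1)] by metis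
  interpret E: Vector_Spaces.linear "\<lambda>(c::'c) f x. c * f x" "\<lambda>c f x. c * f x" E
   using flE by(simp add: flinear_linear)
  have "?V \<subseteq> fv.span (E ` B1 \<union> B2)"
  proof
   fix g assume g: "g \<in> ?V"
   have "T g \<in> fv.span B1" using g Tim B1(2) by auto
   hence 1: "E (T g) \<in> fv.span (E ` B1 \<union> B2)"
    using E.span_image[of B1] fv.span_mono[of "E ` B1" "E ` B1 \<union> B2"] by blast
   have "(\<lambda>x. (g - E (T g)) (r, x)) \<in> F r" if "r \<in> S" for r
   proof -
    have "(\<lambda>x. (g - E (T g)) (r, x)) = (\<lambda>x. g (r, x))"
     using that insert.hyps by(auto simp: E_def fun_eq_iff)
    thus ?thesis using g that by(auto simp: fbundle_def)
   qed
   moreover have "(g - E (T g)) (r, x) = 0" if "r \<notin> S" for r x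
    using that g by(cases "r = s") (auto simp: fbundle_def E_def T_def)
   ultimately have "g - E (T g) \<in> fbundle S F" unfolding fbundle_def by blast
   hence "g - E (T g) \<in> fv.span (E ` B1 \<union> B2)"
    using B2(2) fv.span_mono[of B2 "E ` B1 \<union> B2"] by blast
   from fv.span_add[OF this 1] show "g \<in> fv.span (E ` B1 \<union> B2)" by simp
  qed
  hence V: "fin_space ?V" unfolding fin_space_def using sub B1 B2
   by(intro conjI exI[of _ "E ` B1 \<union> B2"]) auto
  have "fun_dim ?V = fun_dim (F s) + fun_dim (fbundle S F)"
   using rank_nullity(1)[OF V T] Tim ker by simp
  thus ?case using V IH insert.hyps by simp
 qed
 thus "fin_space (fbundle S F)" "fun_dim (fbundle S F) = (\<Sum>s\<in>S. fun_dim (F s))" by auto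
qed

section \<open>Dual spaces of the modules as functions on words\<close>

definition mul :: "int ^ 'i ^ 'i => 'i => 'i => nat" where
 "mul C x y = nat (- C $ x $ y)"

definition wdeg :: "int ^ 'i ^ 'i => 'i arrow list => int \<times> int" where
 "wdeg C w = sum_list (map (arrow_deg C) w)"

abbreviation eps :: "nat => 'i => 'i arrow list" where
 "eps n x \<equiv> replicate n (Eps x)"

lemma wdeg_simps [simp]:
 "wdeg C [] = 0" "wdeg C (a # w) = arrow_deg C a + wdeg C w"
 "wdeg C (v @ w) = wdeg C v + wdeg C w"
 by(simp_all add: wdeg_def)

lemma wdeg_eps [simp]: "wdeg C (eps n x) = (2 * int (sym_d C x) * int n, 0)"
 by(induction n) (auto simp: arrow_deg_def algebra_simps zero_prod_def)

lemma is_walk_append: "is_walk C i (v @ w) j \<longleftrightarrow> (\<exists>k. is_walk C i v k \<and> is_walk C k w j)"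
 by(induction v arbitrary: i) auto

lemma is_walk_eps [simp]: "is_walk C i (eps n x) j \<longleftrightarrow> i = j \<and> (n = 0 \<or> i = x)"
 by(induction n) (auto simp: arrows_def)

lemma Alpha_in_arrows [simp]: "Alpha x y \<in> arrows C \<longleftrightarrow> adj C x y"
 by(auto simp: arrows_def)

lemma Eps_in_arrows [simp]: "Eps x \<in> arrows C"
 by(auto simp: arrows_def)

lemma arrow_deg_simps [simp]:
 "arrow_deg C (Eps x) = (2 * int (sym_d C x), 0)"
 "arrow_deg C (Alpha x y) = (- int (max (sym_d C x) (sym_d C y)), 1)"
 by(simp_all add: arrow_deg_def)

text \<open>The functionals on the degree \<open>n\<close> part of e_i (Pi / Pi eps_j) e_j, given by
  their values on words. The conditions say that they live on paths from \<open>j\<close> to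
  \<open>i\<close> of that degree, kill both families of relations between arbitrary words
  \<open>u\<close> and \<open>w\<close>, and kill the left ideal generated by the loop at
  \<open>j\<close>.\<close>

definition fspace :: "int ^ 'i ^ 'i => ('i => 'i => 'k::field) => 'i => 'i => int \<times> int
  => ('i arrow list => 'k) set" where
 "fspace C \<omega> i j n = {\<phi>.
   (\<forall>w. \<phi> w \<noteq> 0 \<longrightarrow> is_walk C i w j \<and> wdeg C w = n) \<and>
   (\<forall>u x y w. adj C x y \<longrightarrow>
    \<phi> (u @ eps (mul C x y) x @ Alpha x y # w) = \<phi> (u @ Alpha x y # eps (mul C y x) y @ w)) \<and>
   (\<forall>u x w. (\<Sum>y | adj C y x. \<Sum>k<mul C x y.
    \<omega> x y * \<phi> (u @ eps k x @ Alpha x y # Alpha y x # eps (mul C x y - 1 - k) x @ w)) = 0) \<and>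
   (\<forall>u. \<phi> (u @ [Eps j]) = 0)}"

lemma fspace_support:
 "\<phi> \<in> fspace C \<omega> i j n ==> \<phi> w \<noteq> 0 ==> is_walk C i w j \<and> wdeg C w = n"
 by(simp add: fspace_def)

lemma fspace_rel1:
 "\<phi> \<in> fspace C \<omega> i j n ==> adj C x y ==>
  \<phi> (u @ eps (mul C x y) x @ Alpha x y # w) = \<phi> (u @ Alpha x y # eps (mul C y x) y @ w)"
 by(simp add: fspace_def)

lemma fspace_rel2:
 "\<phi> \<in> fspace C \<omega> i j n ==> (\<Sum>y | adj C y x. \<Sum>k<mul C x y.
    \<omega> x y * \<phi> (u @ eps k x @ Alpha x y # Alpha y x # eps (mul C x y - 1 - k) x @ w)) = 0"
 by(simp add: fspace_def)

lemma fspace_eps_end: "\<phi> \<in> fspace C \<omega> i j n ==> \<phi> (u @ [Eps j]) = 0"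
 by(simp add: fspace_def)

lemma subspace_fspace: "fv.subspace (fspace C \<omega> i j n)"
proof (unfold fv.subspace_def, intro conjI ballI allI)
 show "0 \<in> fspace C \<omega> i j n" by(simp add: fspace_def)
 fix \<phi> assume \<phi>: "\<phi> \<in> fspace C \<omega> i j n"
 { fix \<psi> assume \<psi>: "\<psi> \<in> fspace C \<omega> i j n"
  have "is_walk C i w j \<and> wdeg C w = n" if "(\<phi> + \<psi>) w \<noteq> 0" for w
   using that fspace_support[OF \<phi>, of w] fspace_support[OF \<psi>, of w]
   by(cases "\<phi> w = 0") auto
  moreover have "(\<Sum>y | adj C y x. \<Sum>k<mul C x y.
    \<omega> x y * (\<phi> + \<psi>) (u @ eps k x @ Alpha x y # Alpha y x # eps (mul C x y - 1 - k) x @ w)) = 0" for u x w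
   using fspace_rel2[OF \<phi>, of x u w] fspace_rel2[OF \<psi>, of x u w]
   by(simp add: distrib_left sum.distrib)
  ultimately show "\<phi> + \<psi> \<in> fspace C \<omega> i j n"
   using fspace_rel1[OF \<phi>] fspace_rel1[OF \<psi>] fspace_eps_end[OF \<phi>] fspace_eps_end[OF \<psi>]
   unfolding fspace_def by simp }
 fix c
 have "(\<Sum>y | adj C y x. \<Sum>k<mul C x y.
   \<omega> x y * (c * \<phi> (u @ eps k x @ Alpha x y # Alpha y x # eps (mul C x y - 1 - k) x @ w))) = 0" for u x w
  using arg_cong[OF fspace_rel2[OF \<phi>, of x u w], of "\<lambda>z. c * z"]
  by(simp add: sum_distrib_left mult.left_commute)
 thus "(\<lambda>x. c * \<phi> x) \<in> fspace C \<omega> i j n"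
  using fspace_rel1[OF \<phi>] fspace_eps_end[OF \<phi>] fspace_support[OF \<phi>]
  unfolding fspace_def by simp
qed

lemma wdeg_snd_nonneg: "snd (wdeg C w) \<ge> 0"
proof (induction w)
 case (Cons a w)
 thus ?case by(cases a) auto
qed simp

text \<open>The linear form fst + (D + 1) snd is at least 1 on every arrow: on a loop it is 2 d_x,
  on \<open>Alpha x y\<close> it is D + 1 - max (d_x) (d_y). Hence each bidegree contains only
  finitely many words.\<close>

lemma length_le_wdeg:
 fixes C :: "int ^ 'i ^ 'i"
 assumes "\<And>x. sym_d C x > 0"
 defines "D \<equiv> int (Max (range (sym_d C)))"
 shows "int (length w) \<le> fst (wdeg C w) + (D + 1) * snd (wdeg C w)"
proof (induction w)
 case (Cons a w)
 have D: "int (sym_d C x) \<le> D" for x by(simp add: D_def)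
 show ?case
 proof (cases a)
  case (Alpha x y)
  thus ?thesis using Cons D[of x] D[of y] by(simp add: algebra_simps)
 next
  case (Eps x)
  thus ?thesis using Cons assms(1)[of x] by(simp add: algebra_simps)
 qed
qed simp

lemma finite_arrows: "finite (arrows (C :: int ^ 'i ^ 'i))"
proof -
 have "arrows C \<subseteq> range (\<lambda>(x, y). Alpha x y) \<union> range Eps" by(auto simp: arrows_def)
 moreover have "finite (UNIV :: ('i \<times> 'i) set)" by simp
 ultimately show ?thesis by(auto intro: finite_subset)
qed

lemma is_walk_arrows: "is_walk C i w j ==> set w \<subseteq> arrows C"
 by(induction w arbitrary: i) auto

lemma finite_walks:
 fixes C :: "int ^ 'i ^ 'i"
 assumes "\<And>x. sym_d C x > 0"
 shows "finite {w. is_walk C i w j \<and> wdeg C w = n}"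
proof -
 let ?L = "nat (fst n + (int (Max (range (sym_d C))) + 1) * snd n)"
 have "{w. is_walk C i w j \<and> wdeg C w = n} \<subseteq> {w. set w \<subseteq> arrows C \<and> length w \<le> ?L}"
 proof safe
  fix w a assume w: "is_walk C i w j" "n = wdeg C w"
  show "length w \<le> nat (fst (wdeg C w) + (int (Max (range (sym_d C))) + 1) * snd (wdeg C w))"
   using length_le_wdeg[of C, OF assms, of w] by linarith
  show "a \<in> set w ==> a \<in> arrows C" using is_walk_arrows[OF w(1)] by auto
 qed
 thus ?thesis using finite_lists_length_le[OF finite_arrows] finite_subset by blast
qed

lemma fin_space_support:
 fixes V :: "('x => 'k::field) set"
 assumes "fv.subspace V" "finite S" "\<And>f x. f \<in> V ==> f x \<noteq> 0 ==> x \<in> S"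
 shows "fin_space V"
proof -
 let ?e = "\<lambda>s x. if x = s then 1 else (0::'k)"
 have "V \<subseteq> fv.span (?e ` S)"
 proof
  fix f assume f: "f \<in> V"
  have "f = (\<Sum>s\<in>S. (\<lambda>x. f s * ?e s x))"
  proof
   fix x
   have "(\<Sum>s\<in>S. f s * ?e s x) = (\<Sum>s\<in>S. if s = x then f s else 0)" by(rule sum.cong) auto
   also have "\<dots> = f x" using assms(2,3) f by(auto simp: sum.delta)
   finally show "f x = (\<Sum>s\<in>S. (\<lambda>x. f s * ?e s x)) x" by(simp add: sum_fun_eval)
  qed
  moreover have "(\<Sum>s\<in>S. (\<lambda>x. f s * ?e s x)) \<in> fv.span (?e ` S)"
   by(intro fv.span_sum fv.span_scale fv.span_base) auto
  ultimately show "f \<in> fv.span (?e ` S)" by simp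
 qed
 thus ?thesis using assms(1,2) by(auto simp: fin_space_def)
qed

text \<open>The facts about the Cartan matrix on which the complexes rest. \<open>d_mul\<close>
  makes both families of relations homogeneous: passing an arrow exchanges loops of the same total
  degree 2 max (d_x) (d_y).\<close>

locale gpa_data =
 fixes C :: "int ^ 'i ^ 'i" and \<omega> :: "'i => 'i => 'k::field"
 assumes adj_sym: "adj C x y ==> adj C y x"
  and d_pos: "sym_d C x > 0"
  and d_mul: "adj C x y ==> sym_d C x * mul C x y = max (sym_d C x) (sym_d C y)"
  and om: "adj C x y ==> \<omega> x y \<in> {1, -1} \<and> \<omega> x y = - \<omega> y x"
begin

abbreviation d where "d \<equiv> sym_d C"
abbreviation f where "f \<equiv> mul C"
abbreviation F where "F \<equiv> fspace C \<omega>"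

definition N :: "'i => 'i => int \<times> int => nat" where
 "N i j n = fun_dim (F i j n)"

lemma adj_iff: "adj C x y \<longleftrightarrow> adj C y x" using adj_sym by blast

lemma mul_pos: "adj C x y ==> f x y > 0"
 by(simp add: adj_def mul_def)

lemma fin_fspace: "fin_space (F i j n)"
 by(rule fin_space_support[OF subspace_fspace finite_walks[OF d_pos, of i j n]])
   (auto dest: fspace_support)

lemma d_mul': "adj C x y ==> int (d x) * int (f x y) = int (max (d x) (d y))"
 using d_mul[of x y] by(metis of_nat_mult)

lemma d_mul_sym: "adj C x y ==> d x * f x y = d y * f y x"
 using d_mul[of x y] d_mul[of y x] adj_sym by(simp add: max.commute)

text \<open>The transpose of left multiplication by the arrow \<open>a\<close>; it moves a
  functional from the target of \<open>a\<close> to its source.\<close>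

lemma fspace_shift:
 assumes "\<phi> \<in> F i j n" "a \<in> arrows C" "arrow_tgt a = i"
 shows "(\<lambda>w. \<phi> (a # w)) \<in> F (arrow_src a) j (n - arrow_deg C a)"
proof -
 have "is_walk C (arrow_src a) w j \<and> wdeg C w = n - arrow_deg C a" if "\<phi> (a # w) \<noteq> 0" for w
  using fspace_support[OF assms(1) that] assms by auto
 thus ?thesis
  using fspace_rel1[OF assms(1), of _ _ "a # u" for u] fspace_rel2[OF assms(1), of _ "a # u" for u]
   fspace_eps_end[OF assms(1), of "a # u" for u]
  unfolding fspace_def by simp
qed

lemma fspace_rel1_iter:
 assumes "\<phi> \<in> F i j n" "adj C x y"
 shows "\<phi> (u @ eps (f x y * c) x @ Alpha x y # w) = \<phi> (u @ Alpha x y # eps (f y x * c) y @ w)"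
proof (induction c arbitrary: w)
 case (Suc c)
 have "eps (f x y * Suc c) x = eps (f x y * c) x @ eps (f x y) x"
  by(simp flip: replicate_add add: add.commute)
 moreover have "eps (f y x * Suc c) y = eps (f y x * c) y @ eps (f y x) y"
  by(simp flip: replicate_add add: add.commute)
 ultimately show ?case
  using fspace_rel1[OF assms, of "u @ eps (f x y * c) x" w] Suc[of "eps (f y x) y @ w"]
  by simp
qed simp

lemma fspace_neg: "snd n < 0 ==> F i j n = {0}"
proof -
 assume n: "snd n < 0"
 have "\<phi> = 0" if "\<phi> \<in> F i j n" for \<phi>
 proof
  fix w show "\<phi> w = 0 w"
   using fspace_support[OF that, of w] wdeg_snd_nonneg[of C w] n by(cases "\<phi> w = 0") auto
 qed
 thus ?thesis using fv.subspace_0[OF subspace_fspace] by blast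
qed

lemma N_neg: "snd n < 0 ==> N i j n = 0"
 by(simp add: N_def fspace_neg fun_dim_0)

lemma word_cases:
 obtains b where "w = eps b i"
 | b a v where "w = eps b i @ a # v" "a \<noteq> Eps i"
proof (induction w arbitrary: thesis)
 case Nil
 thus ?case by(metis replicate_0)
next
 case (Cons a w)
 show ?case
 proof (cases "a = Eps i")
  case True
  show ?thesis
  proof (rule Cons.IH)
   fix b assume "w = eps b i"
   hence "a # w = eps (Suc b) i" using True by simp
   thus thesis using Cons.prems(1) by blast
  next
   fix b c v assume "w = eps b i @ c # v" "c \<noteq> Eps i"
   hence "a # w = eps (Suc b) i @ c # v" using True by simp
   thus thesis using Cons.prems(2) \<open>c \<noteq> Eps i\<close> by blast
  qed
 next
  case False
  thus ?thesis using Cons.prems(2)[of 0] by simp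
 qed
qed

lemma walk0_eps: "is_walk C i w j ==> snd (wdeg C w) = 0 ==> i = j \<and> (\<exists>b. w = eps b i)"
proof (induction w arbitrary: i)
 case (Cons a w)
 show ?case
 proof (cases a)
  case (Alpha x y)
  thus ?thesis using Cons.prems wdeg_snd_nonneg[of C w] by simp
 next
  case (Eps x)
  with Cons have "i = j" "x = i" "\<exists>b. w = eps b i" by auto
  then obtain b where "w = eps b i" by blast
  hence "a # w = eps (Suc b) i" using Eps \<open>x = i\<close> by simp
  thus ?thesis using \<open>i = j\<close> by blast
 qed
qed (auto intro: exI[of _ 0])

text \<open>Words of t-degree 0 are powers of one loop, and all but the empty one lie in the left
  ideal generated by the loop at \<open>j\<close>.\<close>

lemma N_deg0: "N i j (u, 0) = (if i = j \<and> u = 0 then 1 else 0)"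
proof -
 let ?e = "\<lambda>w. if w = [] then 1 else (0::'k)"
 have sup: "i = j \<and> w = [] \<and> u = 0" if "\<phi> \<in> F i j (u, 0)" "\<phi> w \<noteq> 0" for \<phi> w
 proof -
  from walk0_eps[of i w j] fspace_support[OF that] obtain b where b: "i = j" "w = eps b i"
   by(metis snd_conv)
  have "b = 0"
  proof (rule ccontr)
   assume "b \<noteq> 0"
   then obtain c where "b = Suc c" using not0_implies_Suc by blast
   hence "w = eps c i @ [Eps j]" using b by(simp add: replicate_append_same)
   thus False using fspace_eps_end[OF that(1), of "eps c i"] that(2) by simp
  qed
  thus ?thesis using b fspace_support[OF that] by(simp add: zero_prod_def)
 qed
 show ?thesis
 proof (cases "i = j \<and> u = 0")
  case True
  have mem: "?e \<in> F i j (u, 0)"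
   using True by(simp add: fspace_def zero_prod_def)
  have "\<phi> = (\<lambda>w. \<phi> [] * ?e w)" if "\<phi> \<in> F i j (u, 0)" for \<phi>
  proof
   fix w show "\<phi> w = \<phi> [] * ?e w" using sup[OF that, of w] by(cases "\<phi> w = 0") auto
  qed
  hence "dual_points (F i j (u, 0)) {[]} (\<lambda>_. ?e)"
   using mem by(simp add: dual_points_def)
  from dual_points_dim[OF this fin_fspace] show ?thesis using True by(simp add: N_def)
 next
  case False
  have "\<phi> = 0" if "\<phi> \<in> F i j (u, 0)" for \<phi>
  proof
   fix w show "\<phi> w = 0 w" using sup[OF that, of w] False by auto
  qed
  hence "F i j (u, 0) = {0}"
   using fv.subspace_0[OF subspace_fspace, of C \<omega> i j "(u, 0)"] by blast
  thus ?thesis using False by(simp add: N_def fun_dim_0)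
 qed
qed

text \<open>The pair (y, a) stands for the initial word eps_i^a alpha_iy. By (R1) a power of the
  loop with exponent f_iy can be carried across the arrow, so exponents below f_iy suffice. These
  words index the middle term of the complex at \<open>i\<close>.\<close>

definition nb :: "'i => ('i \<times> nat) set" where
 "nb i = {(y, a). adj C i y \<and> a < f i y}"

lemma finite_nb: "finite (nb i)"
proof -
 have "nb i \<subseteq> UNIV \<times> {..<Max (range (f i))}"
  by(force simp: nb_def intro: less_le_trans)
 thus ?thesis by(rule finite_subset) simp
qed

definition shift_deg :: "'i => 'i \<times> nat => int \<times> int" where
 "shift_deg i = (\<lambda>(y, a). (2 * int (d i) * int a - int (max (d i) (d y)), 1))"

definition mid :: "'i => 'i => int \<times> int => (('i \<times> nat) \<times> 'i arrow list => 'k) set" where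
 "mid i j n = fbundle (nb i) (\<lambda>s. F (fst s) j (n - shift_deg i s))"

text \<open>\<open>Phi\<close> reads a functional on words of positive t-degree through the initial
  words in \<open>nb i\<close>, and \<open>Psi\<close> is the transpose of (R2) at \<open>i\<close>.
  In t-degree at least 1 the resulting sequence is exact at its first two places
  (\<open>Phi_inj\<close>, \<open>ext_mem\<close> with \<open>Phi_ext\<close>); \<open>K\<close>
  measures the failure at the last.\<close>

definition Phi :: "'i => ('i arrow list => 'k) => (('i \<times> nat) \<times> 'i arrow list => 'k)" where
 "Phi i \<phi> = (\<lambda>((y, a), w). if (y, a) \<in> nb i then \<phi> (eps a i @ Alpha i y # w) else 0)"

definition Psi :: "'i => (('i \<times> nat) \<times> 'i arrow list => 'k) => ('i arrow list => 'k)" where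
 "Psi i g = (\<lambda>w. \<Sum>y | adj C y i. \<Sum>a<f i y.
   \<omega> i y * g ((y, a), Alpha y i # eps (f i y - 1 - a) i @ w))"

lemma flinear_Phi: "flinear (Phi i)"
 by(auto simp: flinear_def Phi_def fun_eq_iff)

lemma flinear_Psi: "flinear (Psi i)"
 by(auto simp: flinear_def Psi_def fun_eq_iff distrib_left sum.distrib sum_distrib_left
   mult.left_commute)

lemma fspace_shift_eps:
 assumes "\<phi> \<in> F i j n"
 shows "(\<lambda>w. \<phi> (eps a i @ w)) \<in> F i j (n - (2 * int (d i) * int a, 0))"
proof (induction a)
 case 0
 thus ?case using assms by(simp flip: zero_prod_def)
next
 case (Suc a)
 have "(\<lambda>w. \<phi> (eps a i @ Eps i # w)) \<in> F i j (n - (2 * int (d i) * int a, 0) - (2 * int (d i), 0))"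
  using fspace_shift[OF Suc, of "Eps i"] by simp
 moreover have "n - (2 * int (d i) * int a, 0) - (2 * int (d i), 0) = n - (2 * int (d i) * int (Suc a), 0)"
  by(cases n) (simp add: algebra_simps)
 moreover have "eps a i @ Eps i # w = eps (Suc a) i @ w" for w
  by(simp add: replicate_app_Cons_same)
 ultimately show ?case by simp
qed

lemma Phi_mem:
 assumes "\<phi> \<in> F i j n"
 shows "Phi i \<phi> \<in> mid i j n"
proof -
 have "(\<lambda>w. \<phi> (eps a i @ Alpha i y # w)) \<in> F y j (n - shift_deg i (y, a))" if "(y, a) \<in> nb i" for y a
 proof -
  have "(\<lambda>w. \<phi> (eps a i @ Alpha i y # w))
    \<in> F y j (n - (2 * int (d i) * int a, 0) - arrow_deg C (Alpha i y))"
   using fspace_shift[OF fspace_shift_eps[OF assms, of a], of "Alpha i y"] that by(simp add: nb_def)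
  moreover have "n - (2 * int (d i) * int a, 0) - arrow_deg C (Alpha i y) = n - shift_deg i (y, a)"
   by(cases n) (simp add: shift_deg_def)
  ultimately show ?thesis by(simp only:)
 qed
 thus ?thesis by(auto simp: mid_def fbundle_def Phi_def)
qed

lemma Phi_inj:
 assumes \<phi>: "\<phi> \<in> F i j n" and n: "snd n \<ge> 1" and 0: "Phi i \<phi> = 0"
 shows "\<phi> = 0"
proof
 fix w
 show "\<phi> w = 0 w"
 proof (rule ccontr)
  assume "\<phi> w \<noteq> 0 w"
  hence nz: "\<phi> w \<noteq> 0" by simp
  have walk: "is_walk C i w j" "wdeg C w = n" using fspace_support[OF \<phi> nz] by auto
  show False
  proof (rule word_cases[of w i])
   fix b assume "w = eps b i"
   thus False using walk n by auto
  next
   fix b a v assume w: "w = eps b i @ a # v" and a: "a \<noteq> Eps i"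
   obtain y where y: "a = Alpha i y" "adj C i y"
    using walk(1) a unfolding w is_walk_append by(cases a) auto
   \<comment> \<open>Only the residue of the exponent stays in front. By (R1) the remaining multiple
     of f_iy passes to the right of the arrow, so the value is one of those recorded by
     \<open>Phi\<close>.\<close>
   let ?r = "b mod f i y" and ?c = "b div f i y"
   have "?r < f i y" using mul_pos[OF y(2)] by simp
   hence r: "(y, ?r) \<in> nb i" using y by(simp add: nb_def)
   have "eps b i = eps ?r i @ eps (f i y * ?c) i"
    by(simp flip: replicate_add)
   hence "\<phi> w = \<phi> (eps ?r i @ Alpha i y # eps (f y i * ?c) y @ v)"
    using fspace_rel1_iter[OF \<phi> y(2), of "eps ?r i" ?c v] w y by simp
   also have "\<dots> = Phi i \<phi> ((y, ?r), eps (f y i * ?c) y @ v)"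
    using r by(simp add: Phi_def)
   finally show False using 0 nz by simp
  qed
 qed
qed

lemma Psi_Phi: "\<phi> \<in> F i j n ==> Psi i (Phi i \<phi>) = 0"
proof
 fix w assume \<phi>: "\<phi> \<in> F i j n"
 have "Psi i (Phi i \<phi>) w = (\<Sum>y | adj C y i. \<Sum>k<f i y.
    \<omega> i y * \<phi> ([] @ eps k i @ Alpha i y # Alpha y i # eps (f i y - 1 - k) i @ w))"
  unfolding Psi_def by(intro sum.cong refl) (auto simp: Phi_def nb_def adj_iff)
 thus "Psi i (Phi i \<phi>) w = 0 w" using fspace_rel2[OF \<phi>, of i "[]" w] by simp
qed

text \<open>Every word of (R2) at \<open>i\<close> has q-degree 2 d_i (f_iy - 1) - 2 max (d_i) (d_y)
  = -2 d_i and t-degree 2, which explains the shift.\<close>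

lemma Psi_mem:
 assumes g: "g \<in> mid i j n"
 shows "Psi i g \<in> F i j (n + (2 * int (d i), -2))"
proof -
 have "(\<lambda>w. \<omega> i y * g ((y, a), Alpha y i # eps (f i y - 1 - a) i @ w)) \<in> F i j (n + (2 * int (d i), -2))"
  if "adj C y i" "a < f i y" for y a
 proof -
  have ya: "(y, a) \<in> nb i" using that adj_sym by(simp add: nb_def)
  hence "(\<lambda>w. g ((y, a), w)) \<in> F y j (n - shift_deg i (y, a))"
   using g by(auto simp: mid_def fbundle_def)
  from fspace_shift[OF this, of "Alpha y i"] that
  have "(\<lambda>w. g ((y, a), Alpha y i # w)) \<in> F i j (n - shift_deg i (y, a) - arrow_deg C (Alpha y i))"
   by simp
  from fspace_shift_eps[OF this, of "f i y - 1 - a"]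
  have "(\<lambda>w. g ((y, a), Alpha y i # eps (f i y - 1 - a) i @ w)) \<in>
   F i j (n - shift_deg i (y, a) - arrow_deg C (Alpha y i) - (2 * int (d i) * int (f i y - 1 - a), 0))"
   by simp
  moreover have "int (f i y - 1 - a) = int (f i y) - 1 - int a" using that by simp
  hence "n - shift_deg i (y, a) - arrow_deg C (Alpha y i) - (2 * int (d i) * int (f i y - 1 - a), 0)
    = n + (2 * int (d i), -2)"
   using d_mul'[OF adj_sym[OF that(1)]]
   by(cases n) (simp add: shift_deg_def algebra_simps max.commute)
  ultimately have "(\<lambda>w. g ((y, a), Alpha y i # eps (f i y - 1 - a) i @ w)) \<in>
   F i j (n + (2 * int (d i), -2))" by(simp only:)
  thus ?thesis by(rule fv.subspace_scale[OF subspace_fspace])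
 qed
 moreover have "Psi i g = (\<Sum>y | adj C y i. \<Sum>a<f i y.
   (\<lambda>w. \<omega> i y * g ((y, a), Alpha y i # eps (f i y - 1 - a) i @ w)))"
  by(simp add: Psi_def fun_eq_iff sum_fun_eval)
 ultimately show ?thesis
  by(auto intro!: fv.subspace_sum[OF subspace_fspace])
qed

text \<open>The inverse of \<open>Phi\<close> on the kernel of \<open>Psi\<close>: powers of \<open>\<epsilon>\<^sub>i\<close> beyond the multiplicity are moved
 across the arrow by the first relation.\<close>

definition ext :: "'i => (('i \<times> nat) \<times> 'i arrow list => 'k) => ('i arrow list => 'k)" where
 "ext i g w = (let b = length (takeWhile (\<lambda>a. a = Eps i) w) in
   case drop b w of
    [] => 0
   | a # v => (case a of Eps x => 0
     | Alpha x y => if x = i \<and> adj C i y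
       then g ((y, b mod f i y), eps (f y i * (b div f i y)) y @ v) else 0))"

lemma takeWhile_eps: "a \<noteq> Eps i ==> takeWhile (\<lambda>a. a = Eps i) (eps b i @ a # v) = eps b i"
 by(induction b) auto

lemma ext_simps:
 "ext i g (eps b i) = 0"
 "x \<noteq> i ==> ext i g (eps b i @ Eps x # v) = 0"
 "\<not> (x = i \<and> adj C i y) ==> ext i g (eps b i @ Alpha x y # v) = 0"
 "adj C i y ==> ext i g (eps b i @ Alpha i y # v)
   = g ((y, b mod f i y), eps (f y i * (b div f i y)) y @ v)"
proof -
 have "takeWhile (\<lambda>a. a = Eps i) (eps b i) = eps b i" by(induction b) auto
 thus "ext i g (eps b i) = 0" by(simp add: ext_def)
qed (auto simp: ext_def takeWhile_eps Let_def)

text \<open>If the word in front of a relation contains a letter other than the loop at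
  \<open>i\<close>, the relation lies inside the argument of a component of \<open>g\<close> and
  holds there. For a front \<open>eps b i\<close> and a relation at \<open>i\<close>, (R1) is built
  into the definition of \<open>ext\<close>, and (R2) reduces to \<open>Psi i g = 0\<close>.\<close>

lemma ext_mem:
 assumes g: "g \<in> mid i j n" and ker: "Psi i g = 0"
 shows "ext i g \<in> F i j n"
proof -
 have gF: "(\<lambda>w. g ((y, b mod f i y), w)) \<in> F y j (n - shift_deg i (y, b mod f i y))" if "adj C i y" for y b
  using g that mul_pos[OF that] by(auto simp: mid_def fbundle_def nb_def)
 have deg: "shift_deg i (y, b mod f i y) + wdeg C (eps (f y i * (b div f i y)) y)
   = wdeg C (eps b i) + arrow_deg C (Alpha i y)" if "adj C i y" for y b
 proof -
  have "int (d y) * int (f y i) = int (d i) * int (f i y)"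
   using d_mul_sym[OF that] by(metis of_nat_mult)
  hence "2 * int (d y) * int (f y i * (b div f i y)) = 2 * int (d i) * int (f i y * (b div f i y))"
   by(simp add: mult.assoc[symmetric])
  moreover have "int b = int (f i y * (b div f i y)) + int (b mod f i y)"
   by(metis mult_div_mod_eq of_nat_add)
  ultimately show ?thesis by(simp add: shift_deg_def algebra_simps)
 qed
 have "is_walk C i w j \<and> wdeg C w = n" if nz: "ext i g w \<noteq> 0" for w
 proof (rule word_cases[of w i])
  fix b assume "w = eps b i"
  thus ?thesis using nz by(simp add: ext_simps)
 next
  fix b a v assume w: "w = eps b i @ a # v" and a: "a \<noteq> Eps i"
  obtain y where y: "a = Alpha i y" "adj C i y"
  proof (cases a)
   case (Alpha x y)
   thus ?thesis using that ext_simps(3)[of x i y g b v] nz w by blast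
  next
   case (Eps x)
   thus ?thesis using ext_simps(2)[of x i g b v] nz w a by auto
  qed
  have nz': "g ((y, b mod f i y), eps (f y i * (b div f i y)) y @ v) \<noteq> 0"
   using nz w y by(simp add: ext_simps)
  from fspace_support[OF gF[OF y(2), of b] nz']
  have s: "is_walk C y (eps (f y i * (b div f i y)) y @ v) j"
   "wdeg C (eps (f y i * (b div f i y)) y @ v) = n - shift_deg i (y, b mod f i y)" by auto
  have "is_walk C y v j" using s(1) by(auto simp: is_walk_append)
  moreover have "wdeg C w = n"
   using s(2) deg[OF y(2), of b] unfolding w y by(simp add: algebra_simps)
  ultimately show ?thesis using w y by(auto simp: is_walk_append)
 qed
 moreover have "ext i g (u @ eps (f x y) x @ Alpha x y # w) = ext i g (u @ Alpha x y # eps (f y x) y @ w)"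
  if xy: "adj C x y" for u x y w
 proof (rule word_cases[of u i])
  fix b assume u: "u = eps b i"
  show ?thesis
  proof (cases "x = i")
   case True
   have "ext i g (u @ eps (f x y) x @ Alpha x y # w) = ext i g (eps (b + f i y) i @ Alpha i y # w)"
    using u True by(simp add: replicate_add)
   also have "\<dots> = g ((y, b mod f i y), eps (f y i + f y i * (b div f i y)) y @ w)"
    using True xy mul_pos[OF xy] by(subst ext_simps) (simp_all add: div_add_self2)
   finally have "ext i g (u @ eps (f x y) x @ Alpha x y # w)
    = g ((y, b mod f i y), eps (f y i + f y i * (b div f i y)) y @ w)" .
   moreover have "f y i + f y i * (b div f i y) = f y i * (b div f i y) + f y i" by simp
   hence "eps (f y i + f y i * (b div f i y)) y = eps (f y i * (b div f i y)) y @ eps (f y i) y"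
    by(metis replicate_add)
   ultimately show ?thesis using u True xy by(simp add: ext_simps)
  next
   case False
   obtain c where "f x y = Suc c" using mul_pos[OF xy] gr0_implies_Suc by blast
   thus ?thesis using False u by(simp add: ext_simps)
  qed
 next
  fix b a v assume u: "u = eps b i @ a # v" and a: "a \<noteq> Eps i"
  show ?thesis
  proof (cases a)
   case (Alpha x' z)
   show ?thesis
   proof (cases "x' = i \<and> adj C i z")
    case True
    thus ?thesis
     using fspace_rel1[OF gF[of z b] xy, of "eps (f z i * (b div f i z)) z @ v" w] u Alpha
     by(simp add: ext_simps)
   qed (use u Alpha in \<open>simp add: ext_simps(3)\<close>)
  qed (use u a in \<open>auto simp: ext_simps\<close>)
 qed
 moreover have "(\<Sum>y | adj C y x. \<Sum>k<f x y. \<omega> x y *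
   ext i g (u @ eps k x @ Alpha x y # Alpha y x # eps (f x y - 1 - k) x @ w)) = 0" for u x w
 proof (rule word_cases[of u i])
  fix b assume u: "u = eps b i"
  show ?thesis
  proof (cases "x = i")
   case True
   \<comment> \<open>There are b + k loops in front of the arrow. The multiple of m = f_iy contained
     in this number travels through both arrows and reappears behind them, so the summand
     \<open>k\<close> becomes the summand (b + k) mod m of \<open>Psi\<close> at the word
     \<open>eps b i @ w\<close>. The summands are only permuted cyclically.\<close>
   have "(\<Sum>k<f i y. \<omega> i y * ext i g (u @ eps k i @ Alpha i y # Alpha y i # eps (f i y - 1 - k) i @ w))
     = (\<Sum>a<f i y. \<omega> i y * g ((y, a), Alpha y i # eps (f i y - 1 - a) i @ eps b i @ w))"
    if "adj C y i" for y
   proof -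
    let ?m = "f i y"
    have iy: "adj C i y" using adj_sym that .
    have m0: "?m > 0" using mul_pos[OF iy] .
    have "ext i g (u @ eps k i @ Alpha i y # Alpha y i # eps (?m - 1 - k) i @ w)
      = g ((y, (b + k) mod ?m), Alpha y i # eps (?m - 1 - (b + k) mod ?m) i @ eps b i @ w)"
     if k: "k < ?m" for k
    proof -
     let ?c = "(b + k) div ?m" and ?a = "(b + k) mod ?m"
     have "?a < ?m" using m0 by simp
     have "b + k = ?m * ?c + ?a" by simp
     hence e: "?m * ?c + (?m - 1 - k) = (?m - 1 - ?a) + b"
      using k \<open>?a < ?m\<close> by linarith
     have "u @ eps k i @ Alpha i y # Alpha y i # eps (?m - 1 - k) i @ w =
       eps (b + k) i @ Alpha i y # Alpha y i # eps (?m - 1 - k) i @ w"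
      using u by(simp add: replicate_add)
     hence "ext i g (u @ eps k i @ Alpha i y # Alpha y i # eps (?m - 1 - k) i @ w) =
       ext i g (eps (b + k) i @ Alpha i y # Alpha y i # eps (?m - 1 - k) i @ w)"
      by(simp only:)
     also have "\<dots> = g ((y, ?a), [] @ eps (f y i * ?c) y @ Alpha y i # eps (?m - 1 - k) i @ w)"
      using iy by(simp add: ext_simps)
     also have "\<dots> = g ((y, ?a), [] @ Alpha y i # eps (?m * ?c) i @ eps (?m - 1 - k) i @ w)"
      by(rule fspace_rel1_iter[OF gF[OF iy, of "b + k"] \<open>adj C y i\<close>, where u = "[]"])
     also have "eps (?m * ?c) i @ eps (?m - 1 - k) i @ w = eps (?m - 1 - ?a) i @ eps b i @ w"
      using e by(metis append.assoc replicate_add)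
     finally show ?thesis by simp
    qed
    hence "(\<Sum>k<?m. \<omega> i y * ext i g (u @ eps k i @ Alpha i y # Alpha y i # eps (?m - 1 - k) i @ w))
     = (\<Sum>k<?m. \<omega> i y * g ((y, (b + k) mod ?m), Alpha y i # eps (?m - 1 - (b + k) mod ?m) i @ eps b i @ w))"
     by(intro sum.cong refl) simp
    also have "\<dots> = (\<Sum>a<?m. \<omega> i y * g ((y, a), Alpha y i # eps (?m - 1 - a) i @ eps b i @ w))"
    proof (rule sum.reindex_bij_betw)
     have inj: "inj_on (\<lambda>k. (b + k) mod ?m) {..<?m}"
     proof (rule inj_onI)
      fix k l assume kl: "k \<in> {..<?m}" "l \<in> {..<?m}" "(b + k) mod ?m = (b + l) mod ?m"
      hence "int ?m dvd int (b + k) - int (b + l)" by(metis mod_eq_dvd_iff of_nat_mod)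
      hence dv: "int ?m dvd int k - int l" by simp
      show "k = l"
      proof (rule ccontr)
       assume "k \<noteq> l"
       hence "\<bar>int k - int l\<bar> \<ge> int ?m" using dvd_imp_le_int[OF _ dv] by simp
       thus False using kl by auto
      qed
     qed
     moreover have "(\<lambda>k. (b + k) mod ?m) ` {..<?m} \<subseteq> {..<?m}" using m0 by auto
     hence "(\<lambda>k. (b + k) mod ?m) ` {..<?m} = {..<?m}"
      using card_image[OF inj] by(intro card_subset_eq) auto
     ultimately show "bij_betw (\<lambda>k. (b + k) mod ?m) {..<?m} {..<?m}" by(simp add: bij_betw_def)
    qed
    finally show ?thesis .
   qed
   thus ?thesis using True fun_cong[OF ker, of "eps b i @ w"] by(simp add: Psi_def)
  next
   case False
   have "ext i g (u @ eps k x @ Alpha x y # v) = 0" for k y v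
    using False u by(cases k) (auto simp: ext_simps)
   thus ?thesis by simp
  qed
 next
  fix b a v assume u: "u = eps b i @ a # v" and a: "a \<noteq> Eps i"
  show ?thesis
  proof (cases a)
   case (Alpha x' z)
   show ?thesis
   proof (cases "x' = i \<and> adj C i z")
    case True
    thus ?thesis
     using fspace_rel2[OF gF[of z b], of x "eps (f z i * (b div f i z)) z @ v" w] u Alpha
     by(simp add: ext_simps)
   qed (use u Alpha in \<open>simp add: ext_simps(3)\<close>)
  qed (use u a in \<open>auto simp: ext_simps\<close>)
 qed
 moreover have "ext i g (u @ [Eps j]) = 0" for u
 proof (rule word_cases[of u i])
  fix b assume u: "u = eps b i"
  show ?thesis
  proof (cases "i = j")
   case True
   hence "u @ [Eps j] = eps (Suc b) i" using u by(simp add: replicate_append_same)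
   thus ?thesis by(metis ext_simps(1))
  qed (use u in \<open>simp add: ext_simps\<close>)
 next
  fix b a v assume u: "u = eps b i @ a # v" and a: "a \<noteq> Eps i"
  show ?thesis
  proof (cases a)
   case (Alpha x' z)
   show ?thesis
   proof (cases "x' = i \<and> adj C i z")
    case True
    thus ?thesis
     using fspace_eps_end[OF gF[of z b], of "eps (f z i * (b div f i z)) z @ v"] u Alpha
     by(simp add: ext_simps)
   qed (use u Alpha in \<open>simp add: ext_simps(3)\<close>)
  qed (use u a in \<open>auto simp: ext_simps\<close>)
 qed
 ultimately show ?thesis unfolding fspace_def by blast
qed

lemma Phi_ext: "g \<in> mid i j n ==> Phi i (ext i g) = g"
 by(auto simp: fun_eq_iff Phi_def nb_def ext_simps mid_def fbundle_def)

text \<open>The dimension of the cokernel of \<open>Psi\<close>, indexed by the degree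
  \<open>m\<close> of its target; the source then sits in degree m - (2 d_i, -2). As the image lies
  in the target, the truncated subtraction is exact.\<close>

definition K :: "'i => 'i => int \<times> int => nat" where
 "K i j m = N i j m - fun_dim (Psi i ` mid i j (m + (- 2 * int (d i), 2)))"

lemma K_le_N: "K i j m \<le> N i j m" by(simp add: K_def)

theorem N_rec:
 assumes "snd n \<ge> 1"
 shows "N i j n + N i j (n + (2 * int (d i), -2)) =
  (\<Sum>s\<in>nb i. N (fst s) j (n - shift_deg i s)) + K i j (n + (2 * int (d i), -2))"
proof -
 let ?m = "n + (2 * int (d i), -2)" and ?V = "mid i j n"
 have V: "fin_space ?V" "fun_dim ?V = (\<Sum>s\<in>nb i. N (fst s) j (n - shift_deg i s))"
  unfolding mid_def N_def using fbundle_dim[OF finite_nb fin_fspace] by auto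
 have "{g \<in> ?V. Psi i g = 0} = Phi i ` F i j n"
 proof (intro equalityI subsetI)
  fix g assume "g \<in> {g \<in> ?V. Psi i g = 0}"
  hence "ext i g \<in> F i j n" "g = Phi i (ext i g)" using ext_mem Phi_ext[of g i j n] by auto
  thus "g \<in> Phi i ` F i j n" by blast
 qed (auto simp: Phi_mem Psi_Phi)
 moreover have "fun_dim (F i j n) = fun_dim (Phi i ` F i j n)"
  by(rule fun_dim_bij_eq[OF fin_fspace flinear_Phi refl]) (use Phi_inj assms in blast)
 ultimately have "fun_dim ?V = fun_dim (Psi i ` ?V) + N i j n"
  using rank_nullity(1)[OF V(1) flinear_Psi[of i]] by(simp add: N_def)
 moreover have "fun_dim (Psi i ` ?V) \<le> N i j ?m"
  unfolding N_def by(rule fun_dim_mono[OF fin_fspace]) (auto simp: Psi_mem)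
 moreover have "?m + (- 2 * int (d i), 2) = n" by(cases n) simp
 hence "K i j ?m = N i j ?m - fun_dim (Psi i ` ?V)" unfolding K_def by(simp only:)
 ultimately show ?thesis using V(2) by simp
qed

end

section \<open>The complex of homomorphisms\<close>

context gpa_data
begin

text \<open>For every arrow \<open>a\<close>, the cyclic derivative at \<open>a\<close> of the potential
 \<open>\<Sum> \<omega>\<^sub>x\<^sub>y \<epsilon>\<^sub>x\<^sup>f \<alpha>\<^sub>x\<^sub>y \<alpha>\<^sub>y\<^sub>x\<close> is, up to sign, a defining relation.
 Its terms are indexed by \<open>ri a\<close>, with coefficients \<open>rc a\<close> and words \<open>rw a\<close>.\<close>

definition ri :: "'i arrow => ('i \<times> nat) set" where
 "ri a = (case a of Eps x => nb x | Alpha x y => {(y, 0), (y, 1)})"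

definition rc :: "'i arrow => 'i \<times> nat => 'k" where
 "rc a s = (case a of Eps x => \<omega> x (fst s)
   | Alpha x y => if snd s = 0 then \<omega> x y else - \<omega> x y)"

definition rw :: "'i arrow => 'i \<times> nat => 'i arrow list" where
 "rw a s = (case a of
   Eps x => eps (snd s) x @ Alpha x (fst s) # Alpha (fst s) x # eps (f x (fst s) - 1 - snd s) x
  | Alpha x y => if snd s = 0 then Alpha y x # eps (f x y) x else eps (f y x) y @ [Alpha y x])"

lemma sum_ri_Alpha:
 "(\<Sum>s\<in>ri (Alpha x y). g s) = g (y, 0) + g (y, 1)"
 by(simp add: ri_def)

lemma sum_nb: "(\<Sum>s\<in>nb x. g s) = (\<Sum>y | adj C x y. \<Sum>k<f x y. g (y, k))"
proof -
 have "nb x = Sigma {y. adj C x y} (\<lambda>y. {..<f x y})" by(auto simp: nb_def)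
 thus ?thesis by(simp add: sum.Sigma)
qed

lemma sum_ri_Eps: "(\<Sum>s\<in>ri (Eps x). g s) = (\<Sum>y | adj C x y. \<Sum>k<f x y. g (y, k))"
 by(simp add: ri_def sum_nb)

lemma adj_set_sym: "{y. adj C y x} = {y. adj C x y}"
 using adj_iff by blast

lemma fspace_rel:
 assumes "\<phi> \<in> F i j n" "a \<in> arrows C"
 shows "(\<Sum>s\<in>ri a. rc a s * \<phi> (u @ rw a s @ w)) = 0"
proof (cases a)
 case (Alpha x y)
 hence "adj C y x" using assms(2) adj_sym by simp
 from fspace_rel1[OF assms(1) this, of u w] show ?thesis
  using Alpha by(simp add: sum_ri_Alpha rc_def rw_def)
next
 case (Eps x)
 thus ?thesis using fspace_rel2[OF assms(1), of x u w]
  by(simp add: sum_ri_Eps rc_def rw_def adj_set_sym)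
qed

lemma fspaceI:
 assumes "\<And>w. \<phi> w \<noteq> 0 ==> is_walk C i w j \<and> wdeg C w = n"
  and rel: "\<And>a u w. a \<in> arrows C ==> (\<Sum>s\<in>ri a. rc a s * \<phi> (u @ rw a s @ w)) = 0"
  and "\<And>u. \<phi> (u @ [Eps j]) = 0"
 shows "\<phi> \<in> F i j n"
proof -
 have "\<phi> (u @ eps (f x y) x @ Alpha x y # w) = \<phi> (u @ Alpha x y # eps (f y x) y @ w)"
  if "adj C x y" for u x y w
 proof -
  have "adj C y x" using adj_sym that .
  hence "\<omega> y x \<noteq> 0" using om[of y x] by auto
  moreover have "\<omega> y x * \<phi> (u @ Alpha x y # eps (f y x) y @ w)
    - \<omega> y x * \<phi> (u @ eps (f x y) x @ Alpha x y # w) = 0"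
   using rel[of "Alpha y x" u w] \<open>adj C y x\<close> by(simp add: sum_ri_Alpha rc_def rw_def)
  ultimately show ?thesis by simp
 qed
 moreover have "(\<Sum>y | adj C y x. \<Sum>k<f x y. \<omega> x y *
   \<phi> (u @ eps k x @ Alpha x y # Alpha y x # eps (f x y - 1 - k) x @ w)) = 0" for u x w
  using rel[of "Eps x" u w] by(simp add: sum_ri_Eps rc_def rw_def adj_set_sym)
 ultimately show ?thesis using assms(1,3) unfolding fspace_def by blast
qed

text \<open>The potential has degree (0, 2): its loops contribute 2 d_x f_xy and its two arrows -2
  max (d_x) (d_y). The derivative at an arrow loses the degree of the arrow and runs in the opposite
  direction.\<close>

lemma rw_walk:
 assumes "a \<in> arrows C" "s \<in> ri a"
 shows "is_walk C (arrow_src a) (rw a s) (arrow_tgt a)" "wdeg C (rw a s) = (0, 2) - arrow_deg C a"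
proof -
 have "is_walk C (arrow_src a) (rw a s) (arrow_tgt a) \<and> wdeg C (rw a s) = (0, 2) - arrow_deg C a"
 proof (cases a)
  case (Alpha x y)
  hence xy: "adj C x y" "adj C y x" using assms(1) adj_sym by auto
  have "s = (y, 0) \<or> s = (y, 1)" using assms(2) Alpha by(auto simp: ri_def)
  thus ?thesis
   using Alpha xy d_mul'[OF xy(1)] d_mul'[OF xy(2)]
   by(auto simp: rw_def is_walk_append max.commute)
 next
  case (Eps x)
  obtain y k where s: "s = (y, k)" "adj C x y" "k < f x y"
   using assms(2) Eps by(auto simp: ri_def nb_def)
  have "int (f x y - 1 - k) = int (f x y) - 1 - int k" using s by simp
  thus ?thesis
   using Eps s adj_sym[OF s(2)] d_mul'[OF s(2)]
   by(auto simp: rw_def is_walk_append max.commute algebra_simps)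
 qed
 thus "is_walk C (arrow_src a) (rw a s) (arrow_tgt a)" "wdeg C (rw a s) = (0, 2) - arrow_deg C a"
  by auto
qed

lemma arrows_tgt: "{a \<in> arrows C. arrow_tgt a = x} = insert (Eps x) (Alpha x ` {y. adj C x y})"
 by(auto simp: arrows_def)

lemma arrows_src: "{a \<in> arrows C. arrow_src a = x} = insert (Eps x) ((\<lambda>y. Alpha y x) ` {y. adj C x y})"
 by(auto simp: arrows_def adj_iff)

text \<open>The usual identity for a potential: both sides list the rotations of its cyclic words
  that are based at \<open>x\<close>, once by their first arrow and once by their last arrow. It
  makes consecutive maps of the complex compose to zero.\<close>

lemma cyclic_identity:
 fixes Q :: "'i arrow list => 'k"
 shows "(\<Sum>a\<in>{a \<in> arrows C. arrow_tgt a = x}. \<Sum>s\<in>ri a. rc a s * Q (a # rw a s)) =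
  (\<Sum>a\<in>{a \<in> arrows C. arrow_src a = x}. \<Sum>s\<in>ri a. rc a s * Q (rw a s @ [a]))"
proof -
 let ?A = "{y. adj C x y}"
 define q where "q y k l = Q (eps k x @ Alpha x y # Alpha y x # eps l x)" for y k l
 define p where "p y = Q (Alpha x y # eps (f y x) y @ [Alpha y x])" for y
 have L: "(\<Sum>a\<in>{a \<in> arrows C. arrow_tgt a = x}. \<Sum>s\<in>ri a. rc a s * Q (a # rw a s)) =
   (\<Sum>y\<in>?A. \<Sum>k<f x y. \<omega> x y * q y (Suc k) (f x y - Suc k)) + (\<Sum>y\<in>?A. \<omega> x y * (q y 0 (f x y) - p y))"
 proof -
  have "(\<Sum>a\<in>{a \<in> arrows C. arrow_tgt a = x}. \<Sum>s\<in>ri a. rc a s * Q (a # rw a s)) =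
   (\<Sum>s\<in>ri (Eps x). rc (Eps x) s * Q (Eps x # rw (Eps x) s)) +
   (\<Sum>a\<in>Alpha x ` ?A. \<Sum>s\<in>ri a. rc a s * Q (a # rw a s))"
   unfolding arrows_tgt by(subst sum.insert) auto
  also have "(\<Sum>a\<in>Alpha x ` ?A. \<Sum>s\<in>ri a. rc a s * Q (a # rw a s)) =
    (\<Sum>y\<in>?A. \<omega> x y * (q y 0 (f x y) - p y))"
   by(subst sum.reindex) (auto simp: inj_on_def sum_ri_Alpha rc_def rw_def q_def p_def algebra_simps
     intro!: sum.cong)
  also have "(\<Sum>s\<in>ri (Eps x). rc (Eps x) s * Q (Eps x # rw (Eps x) s)) =
    (\<Sum>y\<in>?A. \<Sum>k<f x y. \<omega> x y * q y (Suc k) (f x y - Suc k))"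
   by(simp add: sum_ri_Eps rc_def rw_def q_def)
  finally show ?thesis .
 qed
 have R: "(\<Sum>a\<in>{a \<in> arrows C. arrow_src a = x}. \<Sum>s\<in>ri a. rc a s * Q (rw a s @ [a])) =
   (\<Sum>y\<in>?A. \<Sum>k<f x y. \<omega> x y * q y k (f x y - k)) + (\<Sum>y\<in>?A. \<omega> x y * (q y (f x y) 0 - p y))"
 proof -
  have "(\<Sum>a\<in>{a \<in> arrows C. arrow_src a = x}. \<Sum>s\<in>ri a. rc a s * Q (rw a s @ [a])) =
   (\<Sum>s\<in>ri (Eps x). rc (Eps x) s * Q (rw (Eps x) s @ [Eps x])) +
   (\<Sum>a\<in>(\<lambda>y. Alpha y x) ` ?A. \<Sum>s\<in>ri a. rc a s * Q (rw a s @ [a]))"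
   unfolding arrows_src by(subst sum.insert) auto
  also have "(\<Sum>a\<in>(\<lambda>y. Alpha y x) ` ?A. \<Sum>s\<in>ri a. rc a s * Q (rw a s @ [a])) =
    (\<Sum>y\<in>?A. \<omega> x y * (q y (f x y) 0 - p y))"
  proof (subst sum.reindex)
   show "sum ((\<lambda>a. \<Sum>s\<in>ri a. rc a s * Q (rw a s @ [a])) \<circ> (\<lambda>y. Alpha y x)) ?A =
     (\<Sum>y\<in>?A. \<omega> x y * (q y (f x y) 0 - p y))"
   proof (rule sum.cong[OF refl])
    fix y assume "y \<in> ?A"
    hence "\<omega> x y = - \<omega> y x" using om by auto
    thus "((\<lambda>a. \<Sum>s\<in>ri a. rc a s * Q (rw a s @ [a])) \<circ> (\<lambda>y. Alpha y x)) y =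
      \<omega> x y * (q y (f x y) 0 - p y)"
     by(simp add: sum_ri_Alpha rc_def rw_def q_def p_def algebra_simps)
   qed
  qed (auto simp: inj_on_def)
  also have "(\<Sum>s\<in>ri (Eps x). rc (Eps x) s * Q (rw (Eps x) s @ [Eps x])) =
    (\<Sum>y\<in>?A. \<Sum>k<f x y. \<omega> x y * q y k (f x y - k))"
  proof -
   have "eps (f x y - Suc k) x @ [Eps x] = eps (f x y - k) x" if "k < f x y" for y k
    using that by(metis Suc_diff_Suc replicate_Suc replicate_append_same)
   thus ?thesis by(simp add: sum_ri_Eps rc_def rw_def q_def)
  qed
  finally show ?thesis .
 qed
 have "(\<Sum>k<f x y. \<omega> x y * q y (Suc k) (f x y - Suc k)) + \<omega> x y * (q y 0 (f x y) - p y) =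
   (\<Sum>k<f x y. \<omega> x y * q y k (f x y - k)) + \<omega> x y * (q y (f x y) 0 - p y)" for y
 proof -
  \<comment> \<open>The two lists differ only in the position of the loops. Moving one loop from the
    back to the front telescopes, and the boundary terms are the words with all loops on one
    side.\<close>
  have "(\<Sum>k<f x y. \<omega> x y * q y (Suc k) (f x y - Suc k)) - (\<Sum>k<f x y. \<omega> x y * q y k (f x y - k)) =
    \<omega> x y * (q y (f x y) 0 - q y 0 (f x y))"
   using sum_lessThan_telescope[of "\<lambda>k. \<omega> x y * q y k (f x y - k)" "f x y"]
   by(simp add: sum_subtractf algebra_simps)
  thus ?thesis by(simp add: algebra_simps)
 qed
 thus ?thesis unfolding L R sum.distrib[symmetric] by simp
qed

lemma is_walk_src_unique: "is_walk C i w l ==> is_walk C i' w l ==> i = i'"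
 by(cases w) auto

lemma fspace_shift_walk:
 assumes "\<phi> \<in> F i j n" "is_walk C i p t"
 shows "(\<lambda>w. \<phi> (p @ w)) \<in> F t j (n - wdeg C p)"
 using assms
proof (induction p arbitrary: \<phi> i n)
 case (Cons a p)
 hence "(\<lambda>w. \<phi> (a # w)) \<in> F (arrow_src a) j (n - arrow_deg C a)"
  by(intro fspace_shift) auto
 from Cons.IH[OF this] Cons.prems(2) show ?case by(simp add: diff_diff_eq)
qed auto

lemma N_le: "snd n \<ge> 1 ==> N i j n \<le> (\<Sum>s\<in>nb i. N (fst s) j (n - shift_deg i s))"
 using N_rec[of n i j] K_le_N[of i j "n + (2 * int (d i), -2)"] by linarith

lemma finite_N_support: "finite {u. N i j (u, int v) \<noteq> 0}"
proof (induction v arbitrary: i)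
 case 0
 have "{u. N i j (u, int 0) \<noteq> 0} \<subseteq> {0}" by(auto simp: N_deg0)
 thus ?case by(rule finite_subset) simp
next
 case (Suc v)
 have "{u. N i j (u, int (Suc v)) \<noteq> 0} \<subseteq>
   (\<Union>s\<in>nb i. (\<lambda>u. u + fst (shift_deg i s)) ` {u. N (fst s) j (u, int v) \<noteq> 0})"
 proof
  fix u assume "u \<in> {u. N i j (u, int (Suc v)) \<noteq> 0}"
  hence "(\<Sum>s\<in>nb i. N (fst s) j ((u, int (Suc v)) - shift_deg i s)) \<noteq> 0"
   using N_le[of "(u, int (Suc v))" i j] by auto
  then obtain s where s: "s \<in> nb i" "N (fst s) j ((u, int (Suc v)) - shift_deg i s) \<noteq> 0"
   by(meson sum.neutral)
  have "(u, int (Suc v)) - shift_deg i s = (u - fst (shift_deg i s), int v)"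
   by(cases s) (simp add: shift_deg_def)
  hence "u - fst (shift_deg i s) \<in> {u. N (fst s) j (u, int v) \<noteq> 0}" using s(2) by simp
  hence "u \<in> (\<lambda>u. u + fst (shift_deg i s)) ` {u. N (fst s) j (u, int v) \<noteq> 0}"
   by(rule rev_image_eqI) simp
  thus "u \<in> (\<Union>s\<in>nb i. (\<lambda>u. u + fst (shift_deg i s)) ` {u. N (fst s) j (u, int v) \<noteq> 0})"
   using s(1) by blast
 qed
 thus ?case by(rule finite_subset) (use Suc finite_nb in auto)
qed

text \<open>A fixed system of dual points for every component: words whose classes form a basis of
  the module in that degree, with \<open>dfun\<close> as the dual functionals.\<close>

definition dpts :: "'i => 'i => int \<times> int => 'i arrow list set" where
 "dpts i l p = (SOME B. \<exists>\<phi>. dual_points (F i l p) B \<phi>)"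

definition dfun :: "'i => 'i => int \<times> int => 'i arrow list => 'i arrow list => 'k" where
 "dfun i l p = (SOME \<phi>. dual_points (F i l p) (dpts i l p) \<phi>)"

lemma dpts: "dual_points (F i l p) (dpts i l p) (dfun i l p)"
proof -
 have "\<exists>\<phi>. dual_points (F i l p) (dpts i l p) \<phi>"
  unfolding dpts_def by(rule someI_ex[OF dual_points_exist[OF fin_fspace]])
 thus ?thesis unfolding dfun_def by(rule someI_ex)
qed

lemma dpts_card: "card (dpts i l p) = N i l p"
 unfolding N_def by(rule dual_points_dim[OF dpts fin_fspace])

end

text \<open>The kernel of \<open>P + Q\<close> on the direct sum of \<open>V\<close> and
  \<open>W\<close> has codimension at most dim U, and \<open>H1 + H2\<close> embeds it into
  \<open>T\<close>; \<open>U\<close> plays the role of a space of obstructions. The direct sum is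
  realised by functions on a disjoint union because the domains differ.\<close>

lemma pair_bound:
 fixes P :: "('x => 'k::field) => 'z => 'k" and Q :: "('y => 'k) => 'z => 'k"
  and H1 :: "('x => 'k) => 't => 'k" and H2 :: "('y => 'k) => 't => 'k"
 assumes V: "fin_space V" and W: "fin_space W" and U: "fin_space U" and T: "fin_space T"
  and lin: "flinear P" "flinear Q" "flinear H1" "flinear H2"
  and PQ: "\<And>f g. f \<in> V ==> g \<in> W ==> P f + Q g \<in> U"
  and H: "\<And>f g. f \<in> V ==> g \<in> W ==> P f + Q g = 0 ==> H1 f + H2 g \<in> T"
  and inj: "\<And>f g. f \<in> V ==> g \<in> W ==> P f + Q g = 0 ==> H1 f + H2 g = 0 ==> f = 0 \<and> g = 0"
 shows "fun_dim V + fun_dim W \<le> fun_dim T + fun_dim U"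
proof -
 define L where "L h = (\<lambda>x. h (Inl x))" for h :: "'x + 'y => 'k"
 define R where "R h = (\<lambda>x. h (Inr x))" for h :: "'x + 'y => 'k"
 define J where "J = {h :: 'x + 'y => 'k. L h \<in> V \<and> R h \<in> W}"
 have linL: "flinear L" and linR: "flinear R" by(auto simp: flinear_def L_def R_def)
 have Ladd: "L (h + h') = L h + L h'" "R (h + h') = R h + R h'"
  "L (\<lambda>x. c * h x) = (\<lambda>x. c * L h x)" "R (\<lambda>x. c * h x) = (\<lambda>x. c * R h x)" for h h' c
  by(auto simp: L_def R_def)
 have subJ: "fv.subspace J"
  using fin_space_subspace[OF V] fin_space_subspace[OF W]
  unfolding fv.subspace_def J_def by(auto simp: Ladd) (auto simp: L_def R_def zero_fun_def)
 obtain BV where BV: "finite BV" "V = fv.span BV" by(rule fin_space_basis[OF V])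
 obtain BW where BW: "finite BW" "W = fv.span BW" by(rule fin_space_basis[OF W])
 define EL where "EL g = case_sum g (\<lambda>_::'y. 0)" for g :: "'x => 'k"
 define ER where "ER g = case_sum (\<lambda>_::'x. 0) g" for g :: "'y => 'k"
 have ELin: "flinear EL" "flinear ER"
  by(auto simp: flinear_def EL_def ER_def fun_eq_iff split: sum.split)
 interpret EL: Vector_Spaces.linear "\<lambda>(c::'k) f x. c * f x" "\<lambda>c f x. c * f x" EL
  using ELin by(simp add: flinear_linear)
 interpret ER: Vector_Spaces.linear "\<lambda>(c::'k) f x. c * f x" "\<lambda>c f x. c * f x" ER
  using ELin by(simp add: flinear_linear)
 have "J \<subseteq> fv.span (EL ` BV \<union> ER ` BW)"
 proof
  fix h assume "h \<in> J"
  hence "L h \<in> fv.span BV" "R h \<in> fv.span BW" using BV BW by(auto simp: J_def)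
  hence "EL (L h) \<in> fv.span (EL ` BV)" "ER (R h) \<in> fv.span (ER ` BW)"
   using EL.span_image[of BV] ER.span_image[of BW] by auto
  hence "EL (L h) + ER (R h) \<in> fv.span (EL ` BV \<union> ER ` BW)"
   using fv.span_mono[of "EL ` BV" "EL ` BV \<union> ER ` BW"] fv.span_mono[of "ER ` BW" "EL ` BV \<union> ER ` BW"]
   by(intro fv.span_add) auto
  moreover have "EL (L h) + ER (R h) = h"
   by(auto simp: fun_eq_iff EL_def ER_def L_def R_def split: sum.split)
  ultimately show "h \<in> fv.span (EL ` BV \<union> ER ` BW)" by simp
 qed
 hence J: "fin_space J" unfolding fin_space_def using subJ BV BW by(auto intro!: exI[of _ "EL ` BV \<union> ER ` BW"])
 have LR: "L (case_sum a b) = a" "R (case_sum a b) = b" for a b by(auto simp: L_def R_def)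
 have "R ` J = W"
 proof (intro equalityI subsetI)
  fix g assume "g \<in> W"
  hence "case_sum 0 g \<in> J" using fin_space_subspace[OF V] by(simp add: J_def LR fv.subspace_def)
  thus "g \<in> R ` J" by(metis LR(2) image_eqI)
 qed (auto simp: J_def)
 moreover have "fun_dim {h \<in> J. R h = 0} = fun_dim V"
 proof (rule fun_dim_bij_eq[OF _ linL])
  show "fin_space {h \<in> J. R h = 0}" by(rule rank_nullity(3)[OF J linR])
  show "L ` {h \<in> J. R h = 0} = V"
  proof (intro equalityI subsetI)
   fix g assume "g \<in> V"
   hence "case_sum g 0 \<in> {h \<in> J. R h = 0}"
    using fin_space_subspace[OF W] by(simp add: J_def LR fv.subspace_def)
   thus "g \<in> L ` {h \<in> J. R h = 0}" by(metis LR(1) image_eqI)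
  qed (auto simp: J_def)
  show "h = 0" if "h \<in> {h \<in> J. R h = 0}" "L h = 0" for h
  proof
   have 1: "h (Inl a) = 0" for a using fun_cong[OF that(2), of a] by(simp add: L_def)
   have "R h = 0" using that(1) by simp
   have 2: "h (Inr b) = 0" for b using \<open>R h = 0\<close> by(metis R_def zero_fun_apply)
   fix x show "h x = 0 x" using 1 2 by(cases x) auto
  qed
 qed
 ultimately have dimJ: "fun_dim J = fun_dim V + fun_dim W"
  using rank_nullity(1)[OF J linR] by simp
 define M where "M h = P (L h) + Q (R h)" for h
 define G where "G h = H1 (L h) + H2 (R h)" for h
 have linM: "flinear M" "flinear G"
  using lin unfolding flinear_def M_def G_def
  by(auto simp: Ladd algebra_simps fun_eq_iff)
 let ?Z = "{h \<in> J. M h = 0}"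
 have Z: "fin_space ?Z" by(rule rank_nullity(3)[OF J linM(1)])
 have "fun_dim J = fun_dim (M ` J) + fun_dim ?Z" by(rule rank_nullity(1)[OF J linM(1)])
 moreover have "fun_dim (M ` J) \<le> fun_dim U"
  by(rule fun_dim_mono[OF U]) (auto simp: M_def J_def PQ)
 moreover have "fun_dim ?Z \<le> fun_dim T"
 proof (rule fun_dim_inj_le[OF Z linM(2) T])
  show "G ` ?Z \<subseteq> T" by(auto simp: G_def M_def J_def H)
  show "h = 0" if "h \<in> ?Z" "G h = 0" for h
  proof -
   have "L h = 0 \<and> R h = 0" using that by(intro inj) (auto simp: G_def M_def J_def)
   hence *: "L h = 0" "R h = 0" by auto
   have 1: "h (Inl a) = 0" for a using fun_cong[OF *(1), of a] by(simp add: L_def)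
   have 2: "h (Inr b) = 0" for b using fun_cong[OF *(2), of b] by(simp add: R_def)
   show ?thesis
   proof
    fix x show "h x = 0 x" using 1 2 by(cases x) auto
   qed
  qed
 qed
 ultimately show ?thesis using dimJ by simp
qed

locale hom_complex = gpa_data C \<omega>
 for C :: "int ^ 'i ^ 'i" and \<omega> :: "'i => 'i => 'k::field" +
 fixes l j :: 'i and m :: nat and n :: "int \<times> int"
 assumes n_ge: "snd n \<ge> -1"
begin

text \<open>Labels of a basis of the truncated module. The word serves both as the name of the basis
  functional \<open>ph\<close> and as the point of evaluation that reads off the corresponding
  coordinate.\<close>

definition B :: "('i \<times> 'i arrow list) set" where
 "B = {(i, w). w \<in> dpts i l (wdeg C w) \<and> snd (wdeg C w) \<le> int m}"

definition dg :: "'i \<times> 'i arrow list => int \<times> int" where "dg b = wdeg C (snd b)"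

definition ph :: "'i \<times> 'i arrow list => 'i arrow list => 'k" where
 "ph b = dfun (fst b) l (dg b) (snd b)"

lemma dpts_walk: "w \<in> dpts i l p ==> is_walk C i w l \<and> wdeg C w = p"
proof -
 assume w: "w \<in> dpts i l p"
 hence "dfun i l p w \<in> F i l p" "dfun i l p w w = 1"
  using dpts[of i l p] by(auto simp: dual_points_def)
 thus ?thesis using fspace_support[of "dfun i l p w"] by(metis zero_neq_one)
qed

lemma B_walk: "b \<in> B ==> is_walk C (fst b) (snd b) l"
 by(auto simp: B_def dest: dpts_walk)

lemma B_deg: "b \<in> B ==> snd (dg b) \<le> int m" "snd (dg b) \<ge> 0"
 by(auto simp: B_def dg_def wdeg_snd_nonneg)

lemma ph_mem: "b \<in> B ==> ph b \<in> F (fst b) l (dg b)"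
proof -
 assume "b \<in> B"
 hence "snd b \<in> dpts (fst b) l (dg b)" by(auto simp: B_def dg_def)
 thus ?thesis using dpts[of "fst b" l "dg b"] by(simp add: ph_def dual_points_def)
qed

lemma B_card:
 "card {b \<in> B. fst b = i \<and> dg b = p} = (if snd p \<le> int m then N i l p else 0)"
proof -
 have "{b \<in> B. fst b = i \<and> dg b = p} = (if snd p \<le> int m then (\<lambda>w. (i, w)) ` dpts i l p else {})"
  by(auto simp: B_def dg_def dest: dpts_walk)
 thus ?thesis by(simp add: card_image inj_on_def dpts_card)
qed

lemma finite_B: "finite B"
proof -
 let ?S = "\<lambda>i v. {u. N i l (u, int v) \<noteq> 0}"
 have "B \<subseteq> (\<Union>i. \<Union>v\<in>{..m}. \<Union>u\<in>?S i v. (\<lambda>w. (i, w)) ` dpts i l (u, int v))"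
 proof
  fix b assume b: "b \<in> B"
  obtain i w where iw: "b = (i, w)" by(cases b)
  have w: "w \<in> dpts i l (wdeg C w)" using b iw by(simp add: B_def)
  obtain u v where uv: "wdeg C w = (u, int v)" "v \<le> m"
  proof -
   obtain v where "snd (dg b) = int v" using nonneg_int_cases[OF B_deg(2)[of b]] by metis
   thus ?thesis using B_deg(1)[OF b] that by(cases "wdeg C w") (auto simp: dg_def iw)
  qed
  have "finite (dpts i l (wdeg C w))" using dpts by(simp add: dual_points_def)
  hence "N i l (wdeg C w) \<noteq> 0" using w by(metis card_0_eq dpts_card empty_iff)
  thus "b \<in> (\<Union>i. \<Union>v\<in>{..m}. \<Union>u\<in>?S i v. (\<lambda>w. (i, w)) ` dpts i l (u, int v))"
   using uv w iw by auto
 qed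
 moreover have "finite (dpts i l p)" for i p using dpts by(simp add: dual_points_def)
 ultimately show ?thesis using finite_N_support by(elim finite_subset) auto
qed

definition X :: "'i => ('i arrow list => 'k) => bool" where
 "X s \<psi> \<longleftrightarrow> (\<exists>e. snd e \<le> int m \<and> \<psi> \<in> F s l e)"

lemma X_ph: "b \<in> B ==> X (fst b) (ph b)"
 unfolding X_def using ph_mem B_deg(1) by blast

lemma X_shift: "X s \<psi> ==> is_walk C s p t ==> X t (\<lambda>w. \<psi> (p @ w))"
proof -
 assume "X s \<psi>" and p: "is_walk C s p t"
 then obtain e where e: "snd e \<le> int m" "\<psi> \<in> F s l e" by(auto simp: X_def)
 have "snd (e - wdeg C p) \<le> int m" using e(1) wdeg_snd_nonneg[of C p] by simp
 thus ?thesis unfolding X_def using fspace_shift_walk[OF e(2) p] by blast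
qed

lemma X_Cons: "X (arrow_tgt a) \<psi> ==> a \<in> arrows C ==> X (arrow_src a) (\<lambda>w. \<psi> (a # w))"
 using X_shift[of "arrow_tgt a" \<psi> "[a]" "arrow_src a"] by simp

lemma X_at_B: "\<psi> \<in> F s l e ==> b \<in> B ==> \<psi> (snd b) \<noteq> 0 ==> fst b = s \<and> dg b = e"
 using fspace_support[of \<psi> C \<omega> s l e "snd b"] B_walk[of b] is_walk_src_unique
 by(metis dg_def)

lemma expand: "X s \<psi> ==> \<psi> w = (\<Sum>b\<in>B. \<psi> (snd b) * ph b w)"
proof -
 assume "X s \<psi>"
 then obtain e where e: "snd e \<le> int m" "\<psi> \<in> F s l e" by(auto simp: X_def)
 have "\<psi> = (\<Sum>v\<in>dpts s l e. (\<lambda>x. \<psi> v * dfun s l e v x))"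
  using dpts e(2) by(auto simp: dual_points_def)
 hence "\<psi> w = (\<Sum>v\<in>dpts s l e. (\<lambda>x. \<psi> v * dfun s l e v x)) w" by simp
 also have "\<dots> = (\<Sum>v\<in>dpts s l e. \<psi> v * dfun s l e v w)" by(simp add: sum_fun_eval)
 also have "\<dots> = (\<Sum>b\<in>(\<lambda>v. (s, v)) ` dpts s l e. \<psi> (snd b) * ph b w)"
  by(subst sum.reindex) (auto simp: inj_on_def ph_def dg_def dest: dpts_walk intro!: sum.cong)
 also have "\<dots> = (\<Sum>b\<in>B. \<psi> (snd b) * ph b w)"
 proof (rule sum.mono_neutral_left[OF finite_B])
  show "(\<lambda>v. (s, v)) ` dpts s l e \<subseteq> B" using e(1) by(auto simp: B_def dest: dpts_walk)
  show "\<forall>b\<in>B - (\<lambda>v. (s, v)) ` dpts s l e. \<psi> (snd b) * ph b w = 0"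
  proof
   fix b assume b: "b \<in> B - (\<lambda>v. (s, v)) ` dpts s l e"
   have "\<psi> (snd b) = 0"
   proof (rule ccontr)
    assume "\<psi> (snd b) \<noteq> 0"
    hence "fst b = s" "dg b = e" using X_at_B[OF e(2)] b by auto
    hence "snd b \<in> dpts s l e" "b = (s, snd b)" using b by(auto simp: B_def dg_def)
    thus False using b by(metis DiffD2 image_eqI)
   qed
   thus "\<psi> (snd b) * ph b w = 0" by simp
  qed
 qed
 finally show ?thesis .
qed

lemma ph_delta:
 assumes "b \<in> B" "b' \<in> B"
 shows "ph b (snd b') = (if b = b' then 1 else 0)"
proof (cases "fst b' = fst b \<and> dg b' = dg b")
 case True
 have "snd b \<in> dpts (fst b) l (dg b)" "snd b' \<in> dpts (fst b) l (dg b)"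
  using assms True by(auto simp: B_def dg_def)
 hence "ph b (snd b') = (if snd b = snd b' then 1 else 0)"
  using dpts by(simp add: ph_def dual_points_def)
 thus ?thesis using True by(simp add: prod_eq_iff)
next
 case False
 thus ?thesis using X_at_B[OF ph_mem[OF assms(1)] assms(2)] by auto
qed

section \<open>The four-term complex of homomorphisms\<close>

definition S1 where "S1 = {(a, b). a \<in> arrows C \<and> b \<in> B \<and> fst b = arrow_tgt a}"
definition S2 where "S2 = {(a, b). a \<in> arrows C \<and> b \<in> B \<and> fst b = arrow_src a}"

text \<open>Write X for the truncated module at \<open>l\<close> and Y for the dual module at
  \<open>j\<close>. An arrow acts on functionals from its target to its source. So \<open>V0\<close>
  consists of maps X_i to Y_i, \<open>V1\<close> of maps X_tgt to Y_src for every arrow,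
  \<open>V2\<close> of maps X_src to Y_tgt, one for the derivative of the potential at every arrow,
  and \<open>V3\<close> of maps X_i to Y_i, shifted by the degree (0, 2) of the potential.\<close>

definition V0 where "V0 = fbundle B (\<lambda>b. F (fst b) j (dg b - n))"
definition V1 where "V1 = fbundle S1 (\<lambda>(a, b). F (arrow_src a) j (dg b - n - arrow_deg C a))"
definition V2 where "V2 = fbundle S2 (\<lambda>(a, b). F (arrow_tgt a) j (dg b - n - (0, 2) + arrow_deg C a))"
definition V3 where "V3 = fbundle B (\<lambda>b. F (fst b) j (dg b - n - (0, 2)))"

lemma finite_S: "finite S1" "finite S2"
proof -
 have "S1 \<subseteq> arrows C \<times> B" "S2 \<subseteq> arrows C \<times> B" by(auto simp: S1_def S2_def)
 thus "finite S1" "finite S2"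
  using finite_subset[OF _ finite_cartesian_product[OF finite_arrows finite_B]] by auto
qed

lemma V0: "fin_space V0" "fun_dim V0 = (\<Sum>b\<in>B. N (fst b) j (dg b - n))"
 unfolding V0_def N_def using fbundle_dim[OF finite_B fin_fspace] by auto

lemma V3: "fin_space V3" "fun_dim V3 = (\<Sum>b\<in>B. N (fst b) j (dg b - n - (0, 2)))"
 unfolding V3_def N_def using fbundle_dim[OF finite_B fin_fspace] by auto

lemma V1: "fin_space V1"
 "fun_dim V1 = (\<Sum>(a, b)\<in>S1. N (arrow_src a) j (dg b - n - arrow_deg C a))"
 unfolding V1_def N_def
 using fbundle_dim[OF finite_S(1), of "\<lambda>(a, b). F (arrow_src a) j (dg b - n - arrow_deg C a)"] fin_fspace
 by(auto simp: split_beta)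

lemma V2: "fin_space V2"
 "fun_dim V2 = (\<Sum>(a, b)\<in>S2. N (arrow_tgt a) j (dg b - n - (0, 2) + arrow_deg C a))"
 unfolding V2_def N_def
 using fbundle_dim[OF finite_S(2), of "\<lambda>(a, b). F (arrow_tgt a) j (dg b - n - (0, 2) + arrow_deg C a)"] fin_fspace
 by(auto simp: split_beta)

text \<open>The linear extension of the component of \<open>g\<close> at the arrow \<open>a\<close>
  from the basis labelled by \<open>B\<close> to all of X; the coordinates of \<open>\<psi>\<close>
  are its values at the words of \<open>B\<close>.\<close>

definition gh :: "(('i arrow \<times> 'i \<times> 'i arrow list) \<times> 'i arrow list => 'k) => 'i arrow
  => ('i arrow list => 'k) => 'i arrow list => 'k" where
 "gh g a \<psi> w = (\<Sum>b\<in>B. \<psi> (snd b) * g ((a, b), w))"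

text \<open>The Leibniz rule: if every arrow acts on the direct sum of Y and X by its own action on
  the diagonal and by \<open>gh g a\<close> from X to Y, then \<open>D g p\<close> is the entry from
  X to Y of the path \<open>p\<close>.\<close>

fun D :: "(('i arrow \<times> 'i \<times> 'i arrow list) \<times> 'i arrow list => 'k) => 'i arrow list
  => ('i arrow list => 'k) => 'i arrow list => 'k" where
 "D g [] \<psi> w = 0"
| "D g (a # p) \<psi> w = gh g a \<psi> (p @ w) + D g p (\<lambda>v. \<psi> (a # v)) w"

lemma gh_sum: "gh g a (\<lambda>v. \<Sum>s\<in>S. c s * \<psi> s v) w = (\<Sum>s\<in>S. c s * gh g a (\<psi> s) w)"
 unfolding gh_def sum_distrib_right sum_distrib_left
 by(subst sum.swap) (simp add: mult.assoc)

lemma D_sum: "D g p (\<lambda>v. \<Sum>s\<in>S. c s * \<psi> s v) w = (\<Sum>s\<in>S. c s * D g p (\<psi> s) w)"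
 by(induction p arbitrary: \<psi>) (simp_all add: gh_sum sum.distrib distrib_left)

lemma D_zero: "D g p (\<lambda>v. 0) w = 0"
 by(induction p) (simp_all add: gh_def)

lemma D_append: "D g (p @ q) \<psi> w = D g p \<psi> (q @ w) + D g q (\<lambda>v. \<psi> (p @ v)) w"
 by(induction p arbitrary: \<psi>) simp_all

lemma gh_lin: "gh (g + g') a \<psi> w = gh g a \<psi> w + gh g' a \<psi> w"
 "gh (\<lambda>x. c * g x) a \<psi> w = c * gh g a \<psi> w"
 by(simp_all add: gh_def distrib_left sum.distrib sum_distrib_left mult.left_commute)

lemma D_lin: "D (g + g') p \<psi> w = D g p \<psi> w + D g' p \<psi> w"
 "D (\<lambda>x. c * g x) p \<psi> w = c * D g p \<psi> w"
 by(induction p arbitrary: \<psi>) (simp_all add: gh_lin algebra_simps)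

lemma gh_mem:
 assumes g: "g \<in> V1" and \<psi>: "\<psi> \<in> F s l e"
 shows "a \<in> arrows C ==> arrow_tgt a = s ==> gh g a \<psi> \<in> F (arrow_src a) j (e - n - arrow_deg C a)"
  and "\<not> (a \<in> arrows C \<and> arrow_tgt a = s) ==> gh g a \<psi> w = 0"
proof -
 assume a: "a \<in> arrows C" "arrow_tgt a = s"
 have "(\<lambda>w. \<psi> (snd b) * g ((a, b), w)) \<in> F (arrow_src a) j (e - n - arrow_deg C a)" if b: "b \<in> B" for b
 proof (cases "\<psi> (snd b) = 0")
  case True
  thus ?thesis using fv.subspace_0[OF subspace_fspace] by(simp add: zero_fun_def)
 next
  case False
  hence "fst b = s" "dg b = e" using X_at_B[OF \<psi> b] by auto
  hence "(a, b) \<in> S1" "dg b = e" using a b by(auto simp: S1_def)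
  hence "(\<lambda>w. g ((a, b), w)) \<in> F (arrow_src a) j (e - n - arrow_deg C a)"
   using g by(fastforce simp: V1_def fbundle_def)
  thus ?thesis by(rule fv.subspace_scale[OF subspace_fspace])
 qed
 moreover have "gh g a \<psi> = (\<Sum>b\<in>B. (\<lambda>w. \<psi> (snd b) * g ((a, b), w)))"
  by(simp add: fun_eq_iff gh_def sum_fun_eval)
 ultimately show "gh g a \<psi> \<in> F (arrow_src a) j (e - n - arrow_deg C a)"
  by(auto intro: fv.subspace_sum[OF subspace_fspace])
next
 assume a: "\<not> (a \<in> arrows C \<and> arrow_tgt a = s)"
 have "\<psi> (snd b) * g ((a, b), w) = 0" if b: "b \<in> B" for b
 proof (cases "\<psi> (snd b) = 0")
  case False
  hence "(a, b) \<notin> S1" using X_at_B[OF \<psi> b] a by(auto simp: S1_def)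
  hence "g ((a, b), w) = 0" using g unfolding V1_def fbundle_def by blast
  thus ?thesis by simp
 qed simp
 thus "gh g a \<psi> w = 0" unfolding gh_def by(intro sum.neutral) blast
qed

lemma shift_not_walk:
 assumes "\<psi> \<in> F s l e" "\<not> (\<exists>t. is_walk C s p t)"
 shows "\<psi> (p @ w) = 0"
 using fspace_support[OF assms(1), of "p @ w"] assms(2) by(auto simp: is_walk_append)

lemma D_mem:
 assumes g: "g \<in> V1" and \<psi>: "\<psi> \<in> F s l e"
 shows "is_walk C s p t ==> D g p \<psi> \<in> F t j (e - n - wdeg C p)"
  and "\<not> (\<exists>t. is_walk C s p t) ==> D g p \<psi> w = 0"
proof -
 have "(is_walk C s p t \<longrightarrow> D g p \<psi> \<in> F t j (e - n - wdeg C p)) \<and>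
   (\<not> (\<exists>t. is_walk C s p t) \<longrightarrow> D g p \<psi> w = 0)" for t w
  using \<psi>
 proof (induction p arbitrary: \<psi> s e)
  case Nil
  have "(\<lambda>w. 0) \<in> F t j (e - n)"
   using fv.subspace_0[OF subspace_fspace] by(simp add: zero_fun_def)
  thus ?case by(simp add: fun_eq_iff D.simps[abs_def])
 next
  case (Cons a p)
  let ?v = "arrow_src a" and ?\<psi> = "\<lambda>v. \<psi> (a # v)"
  show ?case
  proof (cases "a \<in> arrows C \<and> arrow_tgt a = s")
   case True
   have \<psi>': "?\<psi> \<in> F ?v l (e - arrow_deg C a)" by(rule fspace_shift) (use True Cons.prems in auto)
   have gm: "gh g a \<psi> \<in> F ?v j (e - n - arrow_deg C a)"
    using gh_mem(1)[OF g Cons.prems] True by auto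
   have "D g (a # p) \<psi> \<in> F t j (e - n - wdeg C (a # p))" if p: "is_walk C ?v p t"
   proof -
    have "(\<lambda>w. gh g a \<psi> (p @ w)) \<in> F t j (e - n - arrow_deg C a - wdeg C p)"
     by(rule fspace_shift_walk[OF gm p])
    moreover have "D g p ?\<psi> \<in> F t j (e - arrow_deg C a - n - wdeg C p)"
     using Cons.IH[OF \<psi>'] p by auto
    moreover have "e - arrow_deg C a - n - wdeg C p = e - n - wdeg C (a # p)"
     "e - n - arrow_deg C a - wdeg C p = e - n - wdeg C (a # p)"
     by(simp_all add: algebra_simps)
    ultimately have "(\<lambda>w. gh g a \<psi> (p @ w)) + D g p ?\<psi> \<in> F t j (e - n - wdeg C (a # p))"
     by(intro fv.subspace_add[OF subspace_fspace]) (simp_all only:)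
    moreover have "D g (a # p) \<psi> = (\<lambda>w. gh g a \<psi> (p @ w)) + D g p ?\<psi>" by(simp add: fun_eq_iff)
    ultimately show ?thesis by(simp only:)
   qed
   moreover have "D g (a # p) \<psi> w = 0" if p: "\<not> (\<exists>t. is_walk C ?v p t)"
   proof -
    have "gh g a \<psi> (p @ w) = 0"
     using fspace_support[OF gm, of "p @ w"] p by(auto simp: is_walk_append)
    thus ?thesis using Cons.IH[OF \<psi>'] p by simp
   qed
   ultimately show ?thesis using True by(auto simp del: D.simps)
  next
   case False
   have "?\<psi> = (\<lambda>v. 0)"
    using fspace_support[OF Cons.prems, of "a # v" for v] False by(auto simp: fun_eq_iff)
   hence "D g (a # p) \<psi> w = 0" using gh_mem(2)[OF g Cons.prems False] by(simp add: D_zero)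
   thus ?thesis using False by auto
  qed
 qed
 thus "is_walk C s p t ==> D g p \<psi> \<in> F t j (e - n - wdeg C p)"
  and "\<not> (\<exists>t. is_walk C s p t) ==> D g p \<psi> w = 0" by auto
qed

definition Gam where "Gam g a \<psi> w = (\<Sum>s\<in>ri a. rc a s * D g (rw a s) \<psi> w)"

text \<open>\<open>d1 g\<close> measures how far the arrows deformed by \<open>g\<close> violate the
  relations, so its kernel describes extensions of X by Y. The map \<open>d2\<close> is a commutator
  with the arrows.\<close>

definition d1 where
 "d1 g = (\<lambda>((a, b), w). if (a, b) \<in> S2 then Gam g a (ph b) w else 0)"

definition d2 where
 "d2 g = (\<lambda>(b, w). if b \<in> B then
    (\<Sum>a\<in>{a \<in> arrows C. arrow_tgt a = fst b}. gh g a (\<lambda>v. ph b (a # v)) w) -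
    (\<Sum>a\<in>{a \<in> arrows C. arrow_src a = fst b}. g ((a, b), a # w)) else 0)"

lemma Gam_lin: "Gam (g + g') a \<psi> w = Gam g a \<psi> w + Gam g' a \<psi> w"
 "Gam (\<lambda>x. c * g x) a \<psi> w = c * Gam g a \<psi> w"
 by(simp_all add: Gam_def D_lin distrib_left sum.distrib sum_distrib_left mult.left_commute)

lemma flinear_d1: "flinear d1"
 by(auto simp: flinear_def d1_def fun_eq_iff Gam_lin)

lemma flinear_d2: "flinear d2"
 by(auto simp: flinear_def d2_def fun_eq_iff gh_lin sum.distrib right_diff_distrib sum_distrib_left)

lemma Gam_mem:
 assumes "g \<in> V1" "\<psi> \<in> F (arrow_src a) l e" "a \<in> arrows C"
 shows "Gam g a \<psi> \<in> F (arrow_tgt a) j (e - n - (0, 2) + arrow_deg C a)"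
proof -
 have "(\<lambda>w. rc a s * D g (rw a s) \<psi> w) \<in> F (arrow_tgt a) j (e - n - (0, 2) + arrow_deg C a)"
  if "s \<in> ri a" for s
 proof -
  have "D g (rw a s) \<psi> \<in> F (arrow_tgt a) j (e - n - wdeg C (rw a s))"
   by(rule D_mem(1)[OF assms(1,2) rw_walk(1)[OF assms(3) that]])
  moreover have "e - n - wdeg C (rw a s) = e - n - (0, 2) + arrow_deg C a"
   using rw_walk(2)[OF assms(3) that] by simp
  ultimately show ?thesis by(intro fv.subspace_scale[OF subspace_fspace]) simp
 qed
 moreover have "Gam g a \<psi> = (\<Sum>s\<in>ri a. (\<lambda>w. rc a s * D g (rw a s) \<psi> w))"
  by(simp add: fun_eq_iff Gam_def sum_fun_eval)
 ultimately show ?thesis by(auto intro: fv.subspace_sum[OF subspace_fspace])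
qed

lemma d1_mem: "g \<in> V1 ==> d1 g \<in> V2"
proof -
 assume g: "g \<in> V1"
 have "(\<lambda>w. d1 g ((a, b), w)) \<in> F (arrow_tgt a) j (dg b - n - (0, 2) + arrow_deg C a)"
  if "(a, b) \<in> S2" for a b
  using Gam_mem[OF g, of "ph b" a "dg b"] ph_mem[of b] that by(auto simp: d1_def S2_def)
 thus ?thesis by(auto simp: V2_def fbundle_def d1_def)
qed

lemma gh_expand:
 assumes "X s \<psi>"
 shows "gh (d1 g) a \<psi> w = (if a \<in> arrows C \<and> arrow_src a = s then Gam g a \<psi> w else 0)"
proof -
 obtain e where e: "snd e \<le> int m" "\<psi> \<in> F s l e" using assms by(auto simp: X_def)
 have "gh (d1 g) a \<psi> w = (\<Sum>b\<in>B. if a \<in> arrows C \<and> arrow_src a = s then \<psi> (snd b) * Gam g a (ph b) w else 0)"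
  unfolding gh_def
 proof (rule sum.cong[OF refl])
  fix b assume b: "b \<in> B"
  show "\<psi> (snd b) * d1 g ((a, b), w) =
    (if a \<in> arrows C \<and> arrow_src a = s then \<psi> (snd b) * Gam g a (ph b) w else 0)"
   using X_at_B[OF e(2) b] b by(cases "\<psi> (snd b) = 0") (auto simp: d1_def S2_def)
 qed
 moreover have "(\<Sum>b\<in>B. \<psi> (snd b) * Gam g a (ph b) w) = Gam g a \<psi> w"
 proof -
  have "(\<Sum>b\<in>B. \<psi> (snd b) * Gam g a (ph b) w) =
    (\<Sum>s\<in>ri a. rc a s * (\<Sum>b\<in>B. \<psi> (snd b) * D g (rw a s) (ph b) w))"
   unfolding Gam_def sum_distrib_left by(subst sum.swap) (simp add: mult.left_commute)
  also have "\<dots> = (\<Sum>s\<in>ri a. rc a s * D g (rw a s) \<psi> w)"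
  proof (intro sum.cong refl arg_cong2[where f="(*)"])
   fix p
   have "\<psi> = (\<lambda>v. \<Sum>b\<in>B. \<psi> (snd b) * ph b v)" using expand[OF assms] by blast
   thus "(\<Sum>b\<in>B. \<psi> (snd b) * D g (rw a p) (ph b) w) = D g (rw a p) \<psi> w"
    using D_sum[of g "rw a p" "\<lambda>b. \<psi> (snd b)" ph B w] by simp
  qed
  finally show ?thesis by(simp add: Gam_def)
 qed
 ultimately show ?thesis by(auto intro: sum.neutral)
qed

text \<open>Each half of \<open>d2\<close> multiplies the relations by one more arrow. The
  additional Leibniz terms vanish because Y and X satisfy the relations, and what is left is
  \<open>cyclic_identity\<close> for the function sending \<open>p\<close> to
  \<open>D g p (ph b) w\<close>.\<close>

lemma d2_d1:
 assumes g: "g \<in> V1"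
 shows "d2 (d1 g) = 0"
proof -
 have "d2 (d1 g) (b, w) = 0" if b: "b \<in> B" for b w
 proof -
  let ?x = "fst b"
  have "(\<Sum>a\<in>{a \<in> arrows C. arrow_tgt a = ?x}. gh (d1 g) a (\<lambda>v. ph b (a # v)) w) =
    (\<Sum>a\<in>{a \<in> arrows C. arrow_tgt a = ?x}. \<Sum>s\<in>ri a. rc a s * D g (a # rw a s) (ph b) w)"
  proof (rule sum.cong[OF refl])
   fix a assume "a \<in> {a \<in> arrows C. arrow_tgt a = ?x}"
   hence a: "a \<in> arrows C" "arrow_tgt a = ?x" by auto
   have "X (arrow_src a) (\<lambda>v. ph b (a # v))" using X_Cons[of a "ph b"] X_ph[OF b] a by simp
   from gh_expand[OF this, of g a w] a
   have "gh (d1 g) a (\<lambda>v. ph b (a # v)) w = Gam g a (\<lambda>v. ph b (a # v)) w" by simp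
   moreover have "(\<Sum>s\<in>ri a. rc a s * gh g a (ph b) (rw a s @ w)) = 0"
    using fspace_rel[OF gh_mem(1)[OF g ph_mem[OF b] a], where u = "[]"] a by simp
   ultimately show "gh (d1 g) a (\<lambda>v. ph b (a # v)) w = (\<Sum>s\<in>ri a. rc a s * D g (a # rw a s) (ph b) w)"
    by(simp add: Gam_def distrib_left sum.distrib)
  qed
  moreover have "(\<Sum>a\<in>{a \<in> arrows C. arrow_src a = ?x}. d1 g ((a, b), a # w)) =
    (\<Sum>a\<in>{a \<in> arrows C. arrow_src a = ?x}. \<Sum>s\<in>ri a. rc a s * D g (rw a s @ [a]) (ph b) w)"
  proof (rule sum.cong[OF refl])
   fix a assume "a \<in> {a \<in> arrows C. arrow_src a = ?x}"
   hence a: "a \<in> arrows C" "arrow_src a = ?x" by auto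
   have "(\<Sum>s\<in>ri a. rc a s * gh g a (\<lambda>v. ph b (rw a s @ v)) w) = 0"
   proof -
    have "(\<lambda>v. \<Sum>s\<in>ri a. rc a s * ph b (rw a s @ v)) = (\<lambda>v. 0)"
     using fspace_rel[OF ph_mem[OF b] a(1), where u = "[]"] by simp
    thus ?thesis
     using gh_sum[of g a "rc a" "\<lambda>s v. ph b (rw a s @ v)" "ri a" w] by(simp add: gh_def)
   qed
   thus "d1 g ((a, b), a # w) = (\<Sum>s\<in>ri a. rc a s * D g (rw a s @ [a]) (ph b) w)"
    using a b by(simp add: d1_def S2_def Gam_def D_append distrib_left sum.distrib)
  qed
  ultimately show ?thesis
   using b cyclic_identity[of "\<lambda>p. D g p (ph b) w" ?x] by(simp add: d2_def)
 qed
 moreover have "d2 (d1 g) (b, w) = 0" if "b \<notin> B" for b w using that by(simp add: d2_def)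
 ultimately have "d2 (d1 g) (b, w) = 0" for b w by blast
 thus ?thesis by(simp add: fun_eq_iff)
qed

lemma gh_V2_mem:
 assumes g: "g \<in> V2" and \<psi>: "\<psi> \<in> F (arrow_src a) l e" and a: "a \<in> arrows C"
 shows "gh g a \<psi> \<in> F (arrow_tgt a) j (e - n - (0, 2) + arrow_deg C a)"
proof -
 have "(\<lambda>w. \<psi> (snd b) * g ((a, b), w)) \<in> F (arrow_tgt a) j (e - n - (0, 2) + arrow_deg C a)"
  if b: "b \<in> B" for b
 proof (cases "\<psi> (snd b) = 0")
  case True
  thus ?thesis using fv.subspace_0[OF subspace_fspace] by(simp add: zero_fun_def)
 next
  case False
  hence "fst b = arrow_src a" "dg b = e" using X_at_B[OF \<psi> b] by auto
  hence "(a, b) \<in> S2" "dg b = e" using a b by(auto simp: S2_def)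
  hence "(\<lambda>w. g ((a, b), w)) \<in> F (arrow_tgt a) j (e - n - (0, 2) + arrow_deg C a)"
   using g by(fastforce simp: V2_def fbundle_def)
  thus ?thesis by(rule fv.subspace_scale[OF subspace_fspace])
 qed
 moreover have "gh g a \<psi> = (\<Sum>b\<in>B. (\<lambda>w. \<psi> (snd b) * g ((a, b), w)))"
  by(simp add: fun_eq_iff gh_def sum_fun_eval)
 ultimately show ?thesis by(auto intro: fv.subspace_sum[OF subspace_fspace])
qed

lemma d2_mem: "g \<in> V2 ==> d2 g \<in> V3"
proof -
 assume g: "g \<in> V2"
 have "(\<lambda>w. d2 g (b, w)) \<in> F (fst b) j (dg b - n - (0, 2))" if b: "b \<in> B" for b
 proof -
  have "gh g a (\<lambda>v. ph b (a # v)) \<in> F (fst b) j (dg b - n - (0, 2))"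
   if a: "a \<in> arrows C" "arrow_tgt a = fst b" for a
  proof -
   have "(\<lambda>v. ph b (a # v)) \<in> F (arrow_src a) l (dg b - arrow_deg C a)"
    by(rule fspace_shift[OF ph_mem[OF b] a])
   from gh_V2_mem[OF g this a(1)] show ?thesis using a by(simp add: algebra_simps)
  qed
  moreover have "(\<lambda>w. g ((a, b), a # w)) \<in> F (fst b) j (dg b - n - (0, 2))"
   if a: "a \<in> arrows C" "arrow_src a = fst b" for a
  proof -
   have "(a, b) \<in> S2" using a b by(simp add: S2_def)
   hence "(\<lambda>w. g ((a, b), w)) \<in> F (arrow_tgt a) j (dg b - n - (0, 2) + arrow_deg C a)"
    using g by(fastforce simp: V2_def fbundle_def)
   from fspace_shift[OF this a(1) refl] show ?thesis using a by simp
  qed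
  moreover have "(\<lambda>w. d2 g (b, w)) = (\<Sum>a\<in>{a \<in> arrows C. arrow_tgt a = fst b}. gh g a (\<lambda>v. ph b (a # v)))
    - (\<Sum>a\<in>{a \<in> arrows C. arrow_src a = fst b}. (\<lambda>w. g ((a, b), a # w)))"
   using b by(simp add: fun_eq_iff d2_def sum_fun_eval)
  ultimately show ?thesis
   by(auto intro!: fv.subspace_diff[OF subspace_fspace] fv.subspace_sum[OF subspace_fspace])
 qed
 thus ?thesis by(auto simp: V3_def fbundle_def d2_def)
qed

text \<open>The element \<open>p \<otimes> y\<close> of the last term of the complex.\<close>

definition tens :: "'i => 'i arrow list => ('i arrow list => 'k) => ('i \<times> 'i arrow list) \<times> 'i arrow list => 'k" where
 "tens i p y = (\<lambda>(b, w). if b \<in> B \<and> fst b = i then ph b p * y w else 0)"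

lemma image_subspace:
 fixes T :: "('x => 'k) => ('y => 'k)"
 assumes "flinear T" "fv.subspace V"
 shows "fv.subspace (T ` V)"
proof -
 interpret T: Vector_Spaces.linear "\<lambda>(c::'k) f x. c * f x" "\<lambda>c f x. c * f x" T
  using assms(1) by(simp add: flinear_linear)
 show ?thesis by(rule T.subspace_image[OF assms(2)])
qed

text \<open>Modulo the image of \<open>d2\<close> a letter can be moved across the tensor sign, from
  the word to \<open>y\<close>. When the word is used up, \<open>y\<close> has t-degree -snd n - 2,
  which is negative, and so it is 0.\<close>

lemma tens_image:
 "is_walk C i p l ==> y \<in> F i j (wdeg C p - n - (0, 2)) ==> tens i p y \<in> d2 ` V2"
proof (induction p arbitrary: i y)
 case Nil
 have "snd (wdeg C [] - n - (0, 2)) < 0" using n_ge by simp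
 hence "y = 0" using fspace_neg Nil.prems(2) by blast
 hence "tens i [] y = 0" by(auto simp: tens_def fun_eq_iff)
 thus ?case
  using fv.subspace_0[OF image_subspace[OF flinear_d2 fin_space_subspace[OF V2(1)]]] by(simp only:)
next
 case (Cons a p)
 hence a: "a \<in> arrows C" "arrow_tgt a = i" and p: "is_walk C (arrow_src a) p l" by auto
 \<comment> \<open>The element of \<open>V2\<close> concentrated at the arrow \<open>a\<close> with
   the rank one value given by \<open>p\<close> and \<open>y\<close>; the two halves of its image
   under \<open>d2\<close> are the two tensors to be compared.\<close>
 define g where "g = (\<lambda>((a', b), w). if a' = a \<and> b \<in> B \<and> fst b = arrow_src a then ph b p * y w else 0)"
 have ph1: "(\<lambda>w. ph b p * y w) \<in> F (arrow_tgt a) j (dg b - n - (0, 2) + arrow_deg C a)"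
  if b: "b \<in> B" "fst b = arrow_src a" for b
 proof (cases "ph b p = 0")
  case True
  thus ?thesis using fv.subspace_0[OF subspace_fspace] by(simp add: zero_fun_def)
 next
  case False
  hence "dg b = wdeg C p" using fspace_support[OF ph_mem[OF b(1)]] by auto
  hence "y \<in> F (arrow_tgt a) j (dg b - n - (0, 2) + arrow_deg C a)"
   using Cons.prems(2) a by(simp add: algebra_simps)
  thus ?thesis by(rule fv.subspace_scale[OF subspace_fspace])
 qed
 have F0: "(\<lambda>w. 0) \<in> F s j e" for s e
  using fv.subspace_0[OF subspace_fspace] by(simp add: zero_fun_def)
 have "(\<lambda>w. g ((a', b), w)) \<in> F (arrow_tgt a') j (dg b - n - (0, 2) + arrow_deg C a')"
  if "(a', b) \<in> S2" for a' b
 proof (cases "a' = a \<and> b \<in> B \<and> fst b = arrow_src a")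
  case True
  thus ?thesis using ph1 by(simp add: g_def)
 next
  case False
  hence "(\<lambda>w. g ((a', b), w)) = (\<lambda>w. 0)" by(auto simp: g_def)
  thus ?thesis by(simp only: F0)
 qed
 hence gV: "g \<in> V2" using a(1)
  by(auto simp: V2_def fbundle_def) (auto simp: g_def S2_def)
 have gh: "gh g a' \<psi> w = (if a' = a then \<psi> p * y w else 0)" if X: "X (arrow_src a) \<psi>" for a' \<psi> w
 proof (cases "a' = a")
  case True
  obtain e where e: "\<psi> \<in> F (arrow_src a) l e" using X by(auto simp: X_def)
  have "gh g a' \<psi> w = (\<Sum>b\<in>B. \<psi> (snd b) * ph b p * y w)"
   unfolding gh_def using X_at_B[OF e] True by(intro sum.cong refl) (auto simp: g_def)
  thus ?thesis using expand[OF X, of p] True by(simp add: sum_distrib_right)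
 qed (simp add: gh_def g_def)
 have eq: "tens i (a # p) y = d2 g + tens (arrow_src a) p (\<lambda>w. y (a # w))"
 proof
  fix z :: "('i \<times> 'i arrow list) \<times> 'i arrow list"
  obtain b w where z: "z = (b, w)" by(cases z)
  show "tens i (a # p) y z = (d2 g + tens (arrow_src a) p (\<lambda>w. y (a # w))) z"
  proof (cases "b \<in> B")
   case True
   have fin: "finite {a \<in> arrows C. P a}" for P using finite_arrows[of C] by simp
   have "(\<Sum>a'\<in>{a \<in> arrows C. arrow_tgt a = fst b}. gh g a' (\<lambda>v. ph b (a' # v)) w) =
     (\<Sum>a'\<in>{a \<in> arrows C. arrow_tgt a = fst b}. if a' = a then ph b (a # p) * y w else 0)"
   proof (rule sum.cong[OF refl])
    fix a' assume a': "a' \<in> {a \<in> arrows C. arrow_tgt a = fst b}"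
    show "gh g a' (\<lambda>v. ph b (a' # v)) w = (if a' = a then ph b (a # p) * y w else 0)"
    proof (cases "a' = a")
     case True
     have "X (arrow_src a) (\<lambda>v. ph b (a # v))"
      using X_Cons[of a "ph b"] X_ph[OF \<open>b \<in> B\<close>] a' True by simp
     from gh[OF this, of a w] True show ?thesis by simp
    qed (simp add: gh_def g_def)
   qed
   also have "\<dots> = (if fst b = i then ph b (a # p) * y w else 0)"
    using fin a by(auto simp: sum.delta)
   finally have 1: "(\<Sum>a'\<in>{a \<in> arrows C. arrow_tgt a = fst b}. gh g a' (\<lambda>v. ph b (a' # v)) w) =
    (if fst b = i then ph b (a # p) * y w else 0)" .
   have "(\<Sum>a'\<in>{a \<in> arrows C. arrow_src a = fst b}. g ((a', b), a' # w)) =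
     (\<Sum>a'\<in>{a \<in> arrows C. arrow_src a = fst b}. if a' = a then ph b p * y (a # w) else 0)"
    using True by(intro sum.cong refl) (auto simp: g_def)
   also have "\<dots> = (if fst b = arrow_src a then ph b p * y (a # w) else 0)"
    using fin a by(auto simp: sum.delta)
   finally show ?thesis using 1 True z by(simp add: d2_def tens_def)
  qed (simp add: z d2_def tens_def)
 qed
 have "tens (arrow_src a) p (\<lambda>w. y (a # w)) \<in> d2 ` V2"
 proof (rule Cons.IH[OF p])
  show "(\<lambda>w. y (a # w)) \<in> F (arrow_src a) j (wdeg C p - n - (0, 2))"
   using fspace_shift[OF Cons.prems(2) a] by(simp add: algebra_simps)
 qed
 from fv.subspace_add[OF image_subspace[OF flinear_d2 fin_space_subspace[OF V2(1)]] imageI[OF gV] this]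
 show ?case unfolding eq .
qed

lemma d2_surj: "d2 ` V2 = V3"
proof (intro equalityI subsetI)
 fix h assume h: "h \<in> V3"
 have "h = (\<Sum>b\<in>B. tens (fst b) (snd b) (\<lambda>w. h (b, w)))"
 proof
  fix z :: "('i \<times> 'i arrow list) \<times> 'i arrow list"
  obtain b w where z: "z = (b, w)" by(cases z)
  have "(\<Sum>b'\<in>B. tens (fst b') (snd b') (\<lambda>w. h (b', w)) (b, w)) = h (b, w)"
  proof (cases "b \<in> B")
   case True
   have "(\<Sum>b'\<in>B. tens (fst b') (snd b') (\<lambda>w. h (b', w)) (b, w)) =
     (\<Sum>b'\<in>B. if b' = b then h (b, w) else 0)"
    using True by(intro sum.cong refl) (auto simp: tens_def ph_delta)
   thus ?thesis using True finite_B by(simp add: sum.delta)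
  next
   case False
   hence "h (b, w) = 0" using h unfolding V3_def fbundle_def by blast
   thus ?thesis using False by(simp add: tens_def)
  qed
  thus "h z = (\<Sum>b\<in>B. tens (fst b) (snd b) (\<lambda>w. h (b, w))) z" by(simp add: z sum_fun_eval)
 qed
 also have "\<dots> \<in> d2 ` V2"
 proof (rule fv.subspace_sum[OF image_subspace[OF flinear_d2 fin_space_subspace[OF V2(1)]]])
  fix b assume b: "b \<in> B"
  show "tens (fst b) (snd b) (\<lambda>w. h (b, w)) \<in> d2 ` V2"
   by(rule tens_image[OF B_walk[OF b]]) (use h b in \<open>auto simp: V3_def fbundle_def dg_def\<close>)
 qed
 finally show "h \<in> d2 ` V2" .
qed (auto simp: d2_mem)

definition Z1 where "Z1 = {g \<in> V1. d1 g = 0}"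

text \<open>The count along \<open>V1\<close>, \<open>V2\<close>, \<open>V3\<close>: the image of
  \<open>d1\<close> lies in the kernel of \<open>d2\<close>, and \<open>d2\<close> is onto. Using
  this inclusion in place of exactness at \<open>V2\<close> gives an inequality.\<close>

lemma Z1: "fin_space Z1" "fun_dim V1 + fun_dim V3 \<le> fun_dim Z1 + fun_dim V2"
proof -
 show "fin_space Z1" unfolding Z1_def by(rule rank_nullity(3)[OF V1(1) flinear_d1])
 have "fun_dim V1 = fun_dim (d1 ` V1) + fun_dim Z1"
  unfolding Z1_def by(rule rank_nullity(1)[OF V1(1) flinear_d1])
 moreover have "fun_dim V2 = fun_dim V3 + fun_dim {g \<in> V2. d2 g = 0}"
  using rank_nullity(1)[OF V2(1) flinear_d2] d2_surj by simp
 moreover have "fun_dim (d1 ` V1) \<le> fun_dim {g \<in> V2. d2 g = 0}"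
  by(rule fun_dim_mono[OF rank_nullity(3)[OF V2(1) flinear_d2]]) (auto simp: d1_mem d2_d1)
 ultimately show "fun_dim V1 + fun_dim V3 \<le> fun_dim Z1 + fun_dim V2" by linarith
qed

end

definition supp_space :: "'x set => ('x => 'k::field) set" where
 "supp_space S = {f. \<forall>x. x \<notin> S \<longrightarrow> f x = 0}"

lemma supp_space:
 assumes "finite S"
 shows "fin_space (supp_space S :: ('x => 'k::field) set)"
  "fun_dim (supp_space S :: ('x => 'k::field) set) = card S"
proof -
 let ?V = "supp_space S :: ('x => 'k) set"
 have sub: "fv.subspace ?V" by(auto simp: fv.subspace_def supp_space_def)
 show fin: "fin_space ?V" by(rule fin_space_support[OF sub assms]) (auto simp: supp_space_def)
 have "f = (\<Sum>b\<in>S. (\<lambda>x. f b * (if x = b then 1 else 0)))" if "f \<in> ?V" for f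
 proof
  fix x
  have "(\<Sum>b\<in>S. f b * (if x = b then 1 else 0)) = (\<Sum>b\<in>S. if b = x then f b else 0)"
   by(rule sum.cong) auto
  thus "f x = (\<Sum>b\<in>S. (\<lambda>x. f b * (if x = b then 1 else 0))) x"
   using that assms by(auto simp: supp_space_def sum_fun_eval)
 qed
 hence "dual_points ?V S (\<lambda>b x. if x = b then 1 else 0)"
  using assms by(auto simp: dual_points_def) (auto simp: supp_space_def)
 from dual_points_dim[OF this fin] show "fun_dim ?V = card S" by simp
qed

section \<open>Integration of cocycles to homomorphisms\<close>

context hom_complex
begin

text \<open>Y consists of those functionals on Pi e_j that vanish on words ending in the loop at
  \<open>j\<close>, and homomorphisms from X to all functionals on Pi e_j are the linear functionals
  on X_j. \<open>Bn\<close> labels such functionals in degree \<open>n\<close>; \<open>Bo\<close>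
  labels the obstructions to landing in Y, which sit 2 d_j higher because of the extra loop.\<close>

definition Bn where "Bn = {b \<in> B. fst b = j \<and> dg b = n}"
definition Bo where "Bo = {b \<in> B. fst b = j \<and> dg b = n + (2 * int (d j), 0)}"

definition lamh :: "('i \<times> 'i arrow list => 'k) => ('i arrow list => 'k) => 'k" where
 "lamh \<mu> \<psi> = (\<Sum>b\<in>B. \<psi> (snd b) * \<mu> b)"

text \<open>A cocycle \<open>g\<close> and a functional \<open>\<mu>\<close> on X_j integrate to a
  map from X to functions on words: \<open>hom1\<close> evaluates the Leibniz extension of
  \<open>g\<close> at the empty word, \<open>hom2\<close> evaluates \<open>\<mu>\<close> after the
  action of the word. The result satisfies all conditions of Y except the one at words ending in the
  loop at \<open>j\<close>, and \<open>obs1 g + obs2 \<mu>\<close> is the defect.\<close>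

definition obs1 where "obs1 g = (\<lambda>b. if b \<in> B then g ((Eps j, b), []) else (0::'k))"
definition obs2 where "obs2 \<mu> = (\<lambda>b. if b \<in> B then lamh \<mu> (\<lambda>v. ph b (Eps j # v)) else 0)"
definition hom1 where "hom1 g = (\<lambda>(b, w). if b \<in> B then D g w (ph b) [] else 0)"
definition hom2 where "hom2 \<mu> = (\<lambda>(b, w). if b \<in> B then lamh \<mu> (\<lambda>v. ph b (w @ v)) else 0)"

lemma lamh_sum: "(\<Sum>s\<in>S. c s * lamh \<mu> (\<psi> s)) = lamh \<mu> (\<lambda>v. \<Sum>s\<in>S. c s * \<psi> s v)"
 unfolding lamh_def sum_distrib_right sum_distrib_left
 by(subst sum.swap) (simp add: mult.assoc)

lemma flinear_obs: "flinear obs1" "flinear obs2" "flinear hom1" "flinear hom2"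
 by(auto simp: flinear_def fun_eq_iff obs1_def obs2_def hom1_def hom2_def D_lin lamh_def
   distrib_left sum.distrib sum_distrib_left mult.left_commute)

lemma shift_expand:
 assumes "b \<in> B"
 shows "ph b (u @ w) = (\<Sum>b'\<in>B. ph b (u @ snd b') * ph b' w)"
proof (cases "\<exists>t. is_walk C (fst b) u t")
 case True
 thus ?thesis using expand[OF X_shift[OF X_ph[OF assms]]] by blast
next
 case False
 thus ?thesis using shift_not_walk[OF ph_mem[OF assms]] by simp
qed

lemma obs_mem:
 assumes "g \<in> V1" "\<mu> \<in> supp_space Bn"
 shows "obs1 g + obs2 \<mu> \<in> supp_space Bo"
proof -
 have "(obs1 g + obs2 \<mu>) b = 0" if b: "b \<notin> Bo" for b
 proof (cases "b \<in> B")
  case True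
  have "g ((Eps j, b), []) = 0"
  proof (rule ccontr)
   assume nz: "g ((Eps j, b), []) \<noteq> 0"
   hence S: "(Eps j, b) \<in> S1" using assms(1) unfolding V1_def fbundle_def by blast
   hence "(\<lambda>w. g ((Eps j, b), w)) \<in> F j j (dg b - n - (2 * int (d j), 0))"
    using assms(1) by(force simp: V1_def fbundle_def)
   from fspace_support[OF this nz] have "dg b - (n + (2 * int (d j), 0)) = 0"
    by(simp add: diff_diff_eq)
   hence "dg b = n + (2 * int (d j), 0)" by(simp only: right_minus_eq)
   thus False using S b True by(simp add: Bo_def S1_def)
  qed
  moreover
  have "ph b (Eps j # snd b') * \<mu> b' = 0" if b': "b' \<in> B" for b'
  proof (rule ccontr)
   assume "ph b (Eps j # snd b') * \<mu> b' \<noteq> 0"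
   hence nz: "ph b (Eps j # snd b') \<noteq> 0" "b' \<in> Bn"
    using assms(2) unfolding supp_space_def by auto (metis surj_pair)
   from fspace_support[OF ph_mem[OF True] nz(1)] nz(2)
   have "fst b = j" "dg b = n + (2 * int (d j), 0)"
    unfolding Bn_def dg_def by(auto simp: add.commute)
   thus False using b True by(simp add: Bo_def)
  qed
  then
  have "lamh \<mu> (\<lambda>v. ph b (Eps j # v)) = 0" unfolding lamh_def by(intro sum.neutral) blast
  ultimately show ?thesis using True by(simp add: obs1_def obs2_def)
 qed (simp add: obs1_def obs2_def)
 thus ?thesis by(simp add: supp_space_def)
qed

lemma rw_not_Nil: "rw a s \<noteq> []"
 by(auto simp: rw_def split: arrow.split)

lemma Gam_0:
 assumes g: "g \<in> V1" "d1 g = 0" and a: "a \<in> arrows C" and \<psi>: "X t \<psi>"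
 shows "Gam g a \<psi> w = 0"
proof (cases "arrow_src a = t")
 case True
 hence "Gam g a \<psi> w = gh (d1 g) a \<psi> w" using gh_expand[OF \<psi>] a by simp
 thus ?thesis using g(2) by(simp add: gh_def)
next
 case False
 obtain e where e: "\<psi> \<in> F t l e" using \<psi> by(auto simp: X_def)
 have "D g (rw a s) \<psi> w = 0" if s: "s \<in> ri a" for s
 proof (rule D_mem(2)[OF g(1) e])
  show "\<not> (\<exists>t'. is_walk C t (rw a s) t')"
   using rw_walk(1)[OF a s] rw_not_Nil[of a s] False by(cases "rw a s") auto
 qed
 thus ?thesis by(simp add: Gam_def)
qed

lemma hom_mem:
 assumes g: "g \<in> Z1" and mu: "\<mu> \<in> supp_space Bn" and obs: "obs1 g + obs2 \<mu> = 0"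
 shows "hom1 g + hom2 \<mu> \<in> V0"
proof -
 have g1: "g \<in> V1" "d1 g = 0" using g by(auto simp: Z1_def)
 have "(\<lambda>w. D g w (ph b) [] + lamh \<mu> (\<lambda>v. ph b (w @ v))) \<in> F (fst b) j (dg b - n)" if b: "b \<in> B" for b
 proof (rule fspaceI)
  fix w assume nz: "D g w (ph b) [] + lamh \<mu> (\<lambda>v. ph b (w @ v)) \<noteq> 0"
  show "is_walk C (fst b) w j \<and> wdeg C w = dg b - n"
  proof (cases "D g w (ph b) [] = 0")
   case False
   then obtain t where t: "is_walk C (fst b) w t" using D_mem(2)[OF g1(1) ph_mem[OF b]] by blast
   from fspace_support[OF D_mem(1)[OF g1(1) ph_mem[OF b] t] False]
   have "t = j" "dg b - n - wdeg C w = 0" by auto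
   thus ?thesis using t by simp
  next
   case True
   hence "lamh \<mu> (\<lambda>v. ph b (w @ v)) \<noteq> 0" using nz by simp
   then obtain b' where b': "b' \<in> B" "ph b (w @ snd b') * \<mu> b' \<noteq> 0"
    unfolding lamh_def by(metis (mono_tags, lifting) sum.neutral)
   hence nz': "ph b (w @ snd b') \<noteq> 0" "\<mu> b' \<noteq> 0" by auto
   hence B: "b' \<in> Bn" "ph b (w @ snd b') \<noteq> 0" using mu unfolding supp_space_def by blast+
   from fspace_support[OF ph_mem[OF b] B(2)] obtain t where
    t: "is_walk C (fst b) w t" "is_walk C t (snd b') l" "wdeg C w + wdeg C (snd b') = dg b"
    by(auto simp: is_walk_append)
   have "t = j" using is_walk_src_unique[OF t(2) B_walk[OF b'(1)]] B(1) by(simp add: Bn_def)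
   moreover have "wdeg C (snd b') = n" using B(1) by(simp add: Bn_def dg_def)
   ultimately show ?thesis using t by(simp add: algebra_simps)
  qed
 next
  fix a u w assume a: "a \<in> arrows C"
  let ?\<psi> = "\<lambda>v. ph b (u @ v)"
  have 1: "(\<Sum>s\<in>ri a. rc a s * D g u (ph b) (rw a s @ w)) = 0"
  proof (cases "\<exists>t. is_walk C (fst b) u t")
   case True
   then obtain t where "is_walk C (fst b) u t" by blast
   from fspace_rel[OF D_mem(1)[OF g1(1) ph_mem[OF b] this] a, of "[]" w] show ?thesis by simp
  next
   case False
   thus ?thesis using D_mem(2)[OF g1(1) ph_mem[OF b] False] by simp
  qed
  have 2: "(\<Sum>s\<in>ri a. rc a s * D g (rw a s) ?\<psi> w) = 0"
  proof (cases "\<exists>t. is_walk C (fst b) u t")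
   case True
   then obtain t where "is_walk C (fst b) u t" by blast
   from Gam_0[OF g1 a X_shift[OF X_ph[OF b] this]] show ?thesis by(simp add: Gam_def)
  next
   case False
   hence "?\<psi> = (\<lambda>v. 0)" using shift_not_walk[OF ph_mem[OF b]] by blast
   thus ?thesis by(simp add: D_zero)
  qed
  have 3: "(\<Sum>s\<in>ri a. rc a s * D g w (\<lambda>v. ph b (u @ rw a s @ v)) []) = 0"
   using D_sum[of g w "rc a" "\<lambda>s v. ph b (u @ rw a s @ v)" "ri a" "[]"]
   by(simp add: fspace_rel[OF ph_mem[OF b] a] D_zero)
  have 4: "(\<Sum>s\<in>ri a. rc a s * lamh \<mu> (\<lambda>v. ph b (u @ rw a s @ w @ v))) = 0"
   unfolding lamh_sum by(simp add: fspace_rel[OF ph_mem[OF b] a]) (simp add: lamh_def)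
  \<comment> \<open>Leibniz over three factors: the first term vanishes since values of
    \<open>D\<close> satisfy the relations of Y, the second because \<open>g\<close> is a cocycle,
    the third since X satisfies the relations.\<close>
  have "D g (u @ rw a s @ w) (ph b) [] = D g u (ph b) (rw a s @ w) + D g (rw a s) ?\<psi> w
    + D g w (\<lambda>v. ph b (u @ rw a s @ v)) []" for s
   by(simp add: D_append)
  thus "(\<Sum>s\<in>ri a. rc a s * (D g (u @ rw a s @ w) (ph b) [] +
    lamh \<mu> (\<lambda>v. ph b ((u @ rw a s @ w) @ v)))) = 0"
   using 1 2 3 4 by(simp add: distrib_left sum.distrib)
 next
  fix u
  have 1: "D g u (ph b) [Eps j] = 0"
  proof (cases "\<exists>t. is_walk C (fst b) u t")
   case True
   then obtain t where "is_walk C (fst b) u t" by blast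
   from fspace_eps_end[OF D_mem(1)[OF g1(1) ph_mem[OF b] this], of "[]"] show ?thesis by simp
  next
   case False
   thus ?thesis using D_mem(2)[OF g1(1) ph_mem[OF b] False] by simp
  qed
  \<comment> \<open>Expanding the functional shifted by \<open>u\<close> in the basis shows that the
    value at a word ending in the loop depends on the obstruction only.\<close>
  have "gh g (Eps j) (\<lambda>v. ph b (u @ v)) [] + lamh \<mu> (\<lambda>v. ph b (u @ Eps j # v)) =
    (\<Sum>b'\<in>B. ph b (u @ snd b') * (obs1 g + obs2 \<mu>) b')"
  proof -
   have "lamh \<mu> (\<lambda>v. ph b (u @ Eps j # v)) =
     (\<Sum>b''\<in>B. (\<Sum>b'\<in>B. ph b (u @ snd b') * ph b' (Eps j # snd b'')) * \<mu> b'')"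
    unfolding lamh_def by(intro sum.cong refl arg_cong2[where f = "(*)"]) (rule shift_expand[OF b])
   also have "\<dots> = (\<Sum>b'\<in>B. ph b (u @ snd b') * obs2 \<mu> b')"
    unfolding sum_distrib_right
    by(subst sum.swap) (simp add: obs2_def lamh_def sum_distrib_left mult.assoc)
   finally show ?thesis
    by(simp add: gh_def obs1_def distrib_left sum.distrib)
  qed
  thus "D g (u @ [Eps j]) (ph b) [] + lamh \<mu> (\<lambda>v. ph b ((u @ [Eps j]) @ v)) = 0"
   using 1 obs by(simp add: D_append)
 qed
 thus ?thesis unfolding V0_def fbundle_def by(auto simp: hom1_def hom2_def)
qed

text \<open>At the empty word \<open>hom1\<close> vanishes and \<open>hom2\<close> returns
  \<open>\<mu>\<close>. After that the values at words \<open>a # w\<close> return the component of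
  \<open>g\<close> at \<open>a\<close>.\<close>

lemma hom_inj:
 assumes g: "g \<in> Z1" and mu: "\<mu> \<in> supp_space Bn" and h0: "hom1 g + hom2 \<mu> = 0"
 shows "g = 0 \<and> \<mu> = 0"
proof -
 have g1: "g \<in> V1" using g by(auto simp: Z1_def)
 have h: "D g w (ph b) [] + lamh \<mu> (\<lambda>v. ph b (w @ v)) = 0" if "b \<in> B" for b w
  using fun_cong[OF h0, of "(b, w)"] that by(simp add: hom1_def hom2_def)
 have "\<mu> b = 0" for b
 proof (cases "b \<in> B")
  case True
  have "lamh \<mu> (ph b) = (\<Sum>b'\<in>B. if b' = b then \<mu> b else 0)"
   unfolding lamh_def using True by(intro sum.cong refl) (auto simp: ph_delta)
  thus ?thesis using h[OF True, of "[]"] finite_B True by simp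
 next
  case False
  hence "b \<notin> Bn" by(simp add: Bn_def)
  thus ?thesis using mu unfolding supp_space_def by blast
 qed
 hence mu0: "\<mu> = 0" by(simp add: fun_eq_iff)
 have D0: "D g w (ph b) [] = 0" if "b \<in> B" for b w
  using h[OF that, of w] mu0 by(simp add: lamh_def)
 have "g ((a, b), w) = 0" for a b w
 proof (cases "(a, b) \<in> S1")
  case True
  hence b: "b \<in> B" by(simp add: S1_def)
  have "D g w (\<lambda>v. ph b (a # v)) [] = (\<Sum>b'\<in>B. ph b (a # snd b') * D g w (ph b') [])"
  proof -
   have "ph b (a # v) = (\<Sum>b'\<in>B. ph b (a # snd b') * ph b' v)" for v
    by(rule shift_expand[OF b, of "[a]", unfolded append_Cons append_Nil])
   hence "(\<lambda>v. ph b (a # v)) = (\<lambda>v. \<Sum>b'\<in>B. ph b (a # snd b') * ph b' v)"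
    by(rule ext)
   hence "D g w (\<lambda>v. ph b (a # v)) [] = D g w (\<lambda>v. \<Sum>b'\<in>B. ph b (a # snd b') * ph b' v) []"
    by(rule arg_cong)
   also have "\<dots> = (\<Sum>b'\<in>B. ph b (a # snd b') * D g w (ph b') [])" by(rule D_sum)
   finally show ?thesis .
  qed
  hence "D g w (\<lambda>v. ph b (a # v)) [] = 0" by(simp add: D0)
  hence "gh g a (ph b) w = 0" using D0[OF b, of "a # w"] by simp
  moreover have "gh g a (ph b) w = (\<Sum>b'\<in>B. if b' = b then g ((a, b), w) else 0)"
   unfolding gh_def using b by(intro sum.cong refl) (auto simp: ph_delta)
  ultimately show ?thesis using finite_B b by simp
 next
  case False
  thus ?thesis using g1 unfolding V1_def fbundle_def by blast
 qed
 thus ?thesis using mu0 by(auto simp: fun_eq_iff)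
qed

lemma Z1_bound: "fun_dim Z1 + card Bn \<le> fun_dim V0 + card Bo"
proof -
 have fin: "finite Bn" "finite Bo" using finite_B by(auto simp: Bn_def Bo_def)
 have "fun_dim Z1 + fun_dim (supp_space Bn :: ('i \<times> 'i arrow list => 'k) set)
   \<le> fun_dim V0 + fun_dim (supp_space Bo :: ('i \<times> 'i arrow list => 'k) set)"
 proof (rule pair_bound[OF Z1(1) supp_space(1)[OF fin(1)] supp_space(1)[OF fin(2)] V0(1) flinear_obs])
  show "obs1 g + obs2 \<mu> \<in> supp_space Bo" if "g \<in> Z1" "\<mu> \<in> supp_space Bn" for g \<mu>
   using obs_mem that by(simp add: Z1_def)
 qed (use hom_mem hom_inj in blast)+
 thus ?thesis using supp_space(2) fin by metis
qed

text \<open>No exactness in the middle enters, so this is only an inequality; equality is recovered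
  in \<open>euler_char\<close> by summing over the q-degree.\<close>

theorem euler_inequality:
 "(\<Sum>(a, b)\<in>S1. N (arrow_src a) j (dg b - n - arrow_deg C a))
   + (\<Sum>b\<in>B. N (fst b) j (dg b - n - (0, 2))) + card Bn \<le>
  (\<Sum>b\<in>B. N (fst b) j (dg b - n))
   + (\<Sum>(a, b)\<in>S2. N (arrow_tgt a) j (dg b - n - (0, 2) + arrow_deg C a)) + card Bo"
 using Z1(2) Z1_bound unfolding V0(2) V1(2) V2(2) V3(2) by linarith

end

section \<open>Evaluation of graded dimensions\<close>

lemma powi_double:
 "x > 0 ==> x powi (2 * k) = x powi k * x powi k"
 "x > 0 ==> x powi (- 2 * k) = x powi (- k) * x powi (- k)"
 "x > 0 ==> x powi k * x powi (- k) = 1" for x :: real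
 by(simp_all flip: power_int_add)

text \<open>A Laurent polynomial with coefficients in the natural numbers is specialised at a real
  number; for positive \<open>x\<close> the positivity of coefficients becomes positivity of
  values.\<close>

definition ev :: "real => (int => nat) => real" where
 "ev x g = (\<Sum>u\<in>{u. g u \<noteq> 0}. real (g u) * x powi u)"

lemma ev_superset:
 assumes "finite S" "{u. g u \<noteq> 0} \<subseteq> S"
 shows "ev x g = (\<Sum>u\<in>S. real (g u) * x powi u)"
 unfolding ev_def using assms by(intro sum.mono_neutral_left) auto

lemma ev_add:
 assumes "finite {u. g u \<noteq> 0}" "finite {u. h u \<noteq> 0}"
 shows "ev x (\<lambda>u. g u + h u) = ev x g + ev x h"
proof -
 let ?S = "{u. g u \<noteq> 0} \<union> {u. h u \<noteq> 0}"
 have S: "finite ?S" using assms by simp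
 have "ev x (\<lambda>u. g u + h u) = (\<Sum>u\<in>?S. real (g u + h u) * x powi u)"
  by(rule ev_superset[OF S]) auto
 moreover have "ev x g = (\<Sum>u\<in>?S. real (g u) * x powi u)" by(rule ev_superset[OF S]) auto
 moreover have "ev x h = (\<Sum>u\<in>?S. real (h u) * x powi u)" by(rule ev_superset[OF S]) auto
 ultimately show ?thesis by(simp add: sum.distrib algebra_simps)
qed

lemma fin_supp_add: "finite {u. g u \<noteq> 0} ==> finite {u. h u \<noteq> 0} ==> finite {u::int. g u + h u \<noteq> (0::nat)}"
 by(rule finite_subset[of _ "{u. g u \<noteq> 0} \<union> {u. h u \<noteq> 0}"]) auto

lemma fin_supp_sum:
 "finite I ==> (\<And>i. i \<in> I ==> finite {u. g i u \<noteq> 0}) ==> finite {u::int. (\<Sum>i\<in>I. g i u) \<noteq> (0::nat)}"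
proof (induction I rule: finite_induct)
 case (insert i I)
 thus ?case using fin_supp_add[of "g i" "\<lambda>u. \<Sum>i\<in>I. g i u"] by simp
qed simp

lemma ev_zero [simp]: "ev x (\<lambda>u. 0) = 0"
 by(simp add: ev_def)

lemma ev_sum:
 "finite I ==> (\<And>i. i \<in> I ==> finite {u. g i u \<noteq> 0}) ==>
  ev x (\<lambda>u. \<Sum>i\<in>I. g i u) = (\<Sum>i\<in>I. ev x (g i))"
proof (induction I rule: finite_induct)
 case (insert i I)
 thus ?case using ev_add[of "g i" "\<lambda>u. \<Sum>i\<in>I. g i u"] fin_supp_sum[of I g] by simp
qed simp

lemma fin_supp_reflect: "finite {u. g u \<noteq> 0} ==> finite {u::int. g (c - u) \<noteq> (0::nat)}"
proof -
 assume "finite {u. g u \<noteq> 0}"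
 moreover have "{u. g (c - u) \<noteq> 0} = (\<lambda>u. c - u) ` {u. g u \<noteq> 0}"
  by(auto simp: image_iff intro!: exI[of _ "c - _"])
 ultimately show ?thesis by simp
qed

lemma fin_supp_shift: "finite {u. g u \<noteq> 0} ==> finite {u::int. g (u + c) \<noteq> (0::nat)}"
proof -
 assume "finite {u. g u \<noteq> 0}"
 moreover have "{u. g (u + c) \<noteq> 0} = (\<lambda>u. u - c) ` {u. g u \<noteq> 0}"
  by(auto simp: image_iff intro!: exI[of _ "_ + c"])
 ultimately show ?thesis by simp
qed

lemma ev_reflect:
 assumes "x > 0"
 shows "ev x (\<lambda>u. g (c - u)) = x powi c * ev (1 / x) g"
proof -
 have im: "{u. g (c - u) \<noteq> 0} = (\<lambda>u. c - u) ` {u. g u \<noteq> 0}"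
  by(auto simp: image_iff intro!: exI[of _ "c - _"])
 have "ev x (\<lambda>u. g (c - u)) = (\<Sum>u\<in>{u. g u \<noteq> 0}. real (g u) * x powi (c - u))"
  unfolding ev_def im by(subst sum.reindex) (auto simp: inj_on_def)
 moreover have "x powi (c - u) = x powi c * (1 / x) powi u" for u
  using assms by(simp add: power_int_diff power_int_divide_distrib)
 ultimately show ?thesis by(simp add: ev_def sum_distrib_left mult.left_commute)
qed

lemma ev_shift:
 assumes "x > 0"
 shows "ev x (\<lambda>u. g (u + c)) = x powi (- c) * ev x g"
proof -
 have im: "{u. g (u + c) \<noteq> 0} = (\<lambda>u. u - c) ` {u. g u \<noteq> 0}"
  by(auto simp: image_iff intro!: exI[of _ "_ + c"])
 have "ev x (\<lambda>u. g (u + c)) = (\<Sum>u\<in>{u. g u \<noteq> 0}. real (g u) * x powi (u - c))"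
  unfolding ev_def im by(subst sum.reindex) (auto simp: inj_on_def)
 moreover have "x powi (u - c) = x powi (- c) * x powi u" for u
  using assms by(simp add: power_int_diff power_int_minus field_simps)
 ultimately show ?thesis by(simp add: ev_def sum_distrib_left mult.left_commute)
qed

lemma ev_nonneg: "x > 0 ==> ev x g \<ge> 0"
 by(auto simp: ev_def intro!: sum_nonneg)

lemma ev_eq_0_iff:
 assumes "x > 0" "finite {u. g u \<noteq> 0}"
 shows "ev x g = 0 \<longleftrightarrow> (\<forall>u. g u = 0)"
 unfolding ev_def using assms by(subst sum_nonneg_eq_0_iff) (auto simp: zero_less_power_int)

lemma ev_mono:
 assumes "x > 0" "finite {u. h u \<noteq> 0}" "\<And>u. g u \<le> h u"
 shows "ev x g \<le> ev x h"
proof -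
 have "{u. g u \<noteq> 0} \<subseteq> {u. h u \<noteq> 0}" using assms(3) by(metis (mono_tags, lifting) Collect_mono le_zero_eq)
 hence "ev x g = (\<Sum>u\<in>{u. h u \<noteq> 0}. real (g u) * x powi u)" by(rule ev_superset[OF assms(2)])
 also have "\<dots> \<le> ev x h" unfolding ev_def
  using assms by(intro sum_mono mult_right_mono) (auto simp: zero_le_power_int)
 finally show ?thesis .
qed

text \<open>Equal sums of coefficients leave no room for a strict inequality between single
  coefficients. Thus one evaluation at 1 upgrades an inequality in all degrees.\<close>

lemma ev_le_imp_eq:
 assumes "finite {u. g u \<noteq> 0}" "finite {u. h u \<noteq> 0}" "\<And>u. g u \<le> h u" "ev 1 g = ev 1 h"
 shows "g = h"
proof -
 define S where "S = {u. g u \<noteq> 0} \<union> {u. h u \<noteq> 0}"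
 have S: "finite S" "{u. g u \<noteq> 0} \<subseteq> S" "{u. h u \<noteq> 0} \<subseteq> S"
  using assms(1,2) by(auto simp: S_def)
 have "ev 1 g = (\<Sum>u\<in>S. real (g u))" using ev_superset[OF S(1,2), of 1] by simp
 moreover have "ev 1 h = (\<Sum>u\<in>S. real (h u))" using ev_superset[OF S(1,3), of 1] by simp
 ultimately have "(\<Sum>u\<in>S. real (h u) - real (g u)) = 0" unfolding sum_subtractf using assms(4) by simp
 moreover have "real (h u) - real (g u) \<ge> 0" for u using assms(3)[of u] by simp
 ultimately have eq: "\<forall>u\<in>S. real (h u) - real (g u) = 0"
  using sum_nonneg_eq_0_iff[OF S(1), of "\<lambda>u. real (h u) - real (g u)"] by blast
 show ?thesis
 proof
  fix u
  have "g u = 0" "h u = 0" if "u \<notin> S" using that by(auto simp: S_def)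
  thus "g u = h u" using eq by(cases "u \<in> S") auto
 qed
qed

section \<open>Dimensions specialised at a positive real number\<close>

context gpa_data
begin

definition Nx :: "real => 'i => 'i => int => real" where
 "Nx x i j v = ev x (\<lambda>u. N i j (u, v))"

definition Kx :: "real => 'i => 'i => int => real" where
 "Kx x i j v = ev x (\<lambda>u. K i j (u, v))"

lemma fin_N: "finite {u. N i j (u, v) \<noteq> 0}"
proof (cases "v < 0")
 case True
 thus ?thesis by(simp add: N_neg)
next
 case False
 thus ?thesis using finite_N_support[of i j "nat v"] by simp
qed

lemma fin_K: "finite {u. K i j (u, v) \<noteq> 0}"
proof (rule finite_subset[OF _ fin_N[of i j v]])
 have "N i j (u, v) \<noteq> 0" if "K i j (u, v) \<noteq> 0" for u
  using K_le_N[of i j "(u, v)"] that by linarith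
 thus "{u. K i j (u, v) \<noteq> 0} \<subseteq> {u. N i j (u, v) \<noteq> 0}" by blast
qed

lemma Nx_neg: "v < 0 ==> Nx x i j v = 0"
 by(simp add: Nx_def N_neg)

lemma Nx_nonneg: "x > 0 ==> Nx x i j v \<ge> 0"
 by(simp add: Nx_def ev_nonneg)

lemma Kx_nonneg: "x > 0 ==> Kx x i j v \<ge> 0"
 by(simp add: Kx_def ev_nonneg)

lemma Kx_le_Nx: "x > 0 ==> Kx x i j v \<le> Nx x i j v"
 unfolding Kx_def Nx_def by(rule ev_mono[OF _ fin_N K_le_N])

lemma Kx_neg: "v < 0 ==> Kx x i j v = 0"
 using K_le_N[of i j "(u, v)" for u] by(simp add: Kx_def N_neg)

lemma Nx_0: "Nx x i j 0 = (if i = j then 1 else 0)"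
proof (cases "i = j")
 case True
 have "Nx x i j 0 = (\<Sum>u\<in>{0}. real (N i j (u, 0)) * x powi u)"
  unfolding Nx_def by(rule ev_superset) (auto simp: N_deg0)
 thus ?thesis using True by(simp add: N_deg0)
qed (simp add: Nx_def N_deg0)

lemma Nx_eq_0_iff: "x > 0 ==> Nx x i j v = 0 \<longleftrightarrow> (\<forall>u. N i j (u, v) = 0)"
 unfolding Nx_def by(rule ev_eq_0_iff[OF _ fin_N])

lemma Kx_eq_0_iff: "x > 0 ==> Kx x i j v = 0 \<longleftrightarrow> (\<forall>u. K i j (u, v) = 0)"
 unfolding Kx_def by(rule ev_eq_0_iff[OF _ fin_K])

text \<open>The ratio of the quantum integers of max (d_i) (d_y) and d_i, see
  \<open>br_geometric\<close>; at x = 1 it is f_iy. The summand d_i in the exponent centres the sum,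
  which makes it invariant under inversion of x (\<open>br_inv\<close>).\<close>

definition br :: "real => 'i => 'i => real" where
 "br x i y = (\<Sum>a<f i y. x powi (2 * int (d i) * int a - int (max (d i) (d y)) + int (d i)))"

text \<open>\<open>N_rec\<close> summed over the q-degree. The factor x^(d_i) makes the coefficients
  of the two outer terms inverse to each other and centres those of the neighbours.\<close>

theorem Nx_rec:
 assumes x: "x > 0" and v: "v \<ge> 1"
 shows "x powi int (d i) * Nx x i j v + x powi (- int (d i)) * Nx x i j (v - 2) =
  (\<Sum>y | adj C i y. br x i y * Nx x y j (v - 1)) + x powi (- int (d i)) * Kx x i j (v - 2)"
proof -
 have pw: "x powi p * x powi q = x powi (p + q)" for p q using x by(simp add: power_int_add)
 have "N i j (u, v) + N i j (u + 2 * int (d i), v - 2) =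
   (\<Sum>s\<in>nb i. N (fst s) j (u - fst (shift_deg i s), v - 1)) + K i j (u + 2 * int (d i), v - 2)" for u
 proof -
  have "(u, v) - shift_deg i s = (u - fst (shift_deg i s), v - 1)" for s
   by(cases s) (simp add: shift_deg_def)
  thus ?thesis using N_rec[of "(u, v)" i j] v by simp
 qed
 hence eq: "(\<lambda>u. N i j (u, v) + N i j (u + 2 * int (d i), v - 2)) =
   (\<lambda>u. (\<Sum>s\<in>nb i. N (fst s) j (u + (- fst (shift_deg i s)), v - 1)) + K i j (u + 2 * int (d i), v - 2))"
  by simp
 have fN: "finite {u. N i j (u + c, v) \<noteq> 0}" for i v c
  by(rule fin_supp_shift[OF fin_N])
 have fK: "finite {u. K i j (u + c, v) \<noteq> 0}" for i v c
  by(rule fin_supp_shift[OF fin_K])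
 have "ev x (\<lambda>u. N i j (u, v) + N i j (u + 2 * int (d i), v - 2)) =
   Nx x i j v + x powi (- (2 * int (d i))) * Nx x i j (v - 2)"
  by(subst ev_add) (auto simp: fin_N fN Nx_def ev_shift[OF x, of "\<lambda>u. N i j (u, v - 2)"] simp del: neq0_conv)
 moreover have "ev x (\<lambda>u. (\<Sum>s\<in>nb i. N (fst s) j (u + (- fst (shift_deg i s)), v - 1)) + K i j (u + 2 * int (d i), v - 2)) =
   (\<Sum>s\<in>nb i. x powi (fst (shift_deg i s)) * Nx x (fst s) j (v - 1)) + x powi (- (2 * int (d i))) * Kx x i j (v - 2)"
 proof -
  have "ev x (\<lambda>u. (\<Sum>s\<in>nb i. N (fst s) j (u + (- fst (shift_deg i s)), v - 1)) + K i j (u + 2 * int (d i), v - 2)) =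
   ev x (\<lambda>u. \<Sum>s\<in>nb i. N (fst s) j (u + (- fst (shift_deg i s)), v - 1)) + ev x (\<lambda>u. K i j (u + 2 * int (d i), v - 2))"
   by(rule ev_add[OF fin_supp_sum[OF finite_nb fN] fK])
  also have "ev x (\<lambda>u. \<Sum>s\<in>nb i. N (fst s) j (u + (- fst (shift_deg i s)), v - 1)) =
    (\<Sum>s\<in>nb i. ev x (\<lambda>u. N (fst s) j (u + (- fst (shift_deg i s)), v - 1)))"
   by(rule ev_sum[OF finite_nb fN])
  also have "\<dots> = (\<Sum>s\<in>nb i. x powi (fst (shift_deg i s)) * Nx x (fst s) j (v - 1))"
   by(intro sum.cong refl, subst ev_shift[OF x, of "\<lambda>u. N (fst _) j (u, v - 1)"]) (simp add: Nx_def)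
  also have "ev x (\<lambda>u. K i j (u + 2 * int (d i), v - 2)) = x powi (- (2 * int (d i))) * Kx x i j (v - 2)"
   by(simp add: Kx_def ev_shift[OF x, of "\<lambda>u. K i j (u, v - 2)"])
  finally show ?thesis .
 qed
 ultimately have "Nx x i j v + x powi (- (2 * int (d i))) * Nx x i j (v - 2) =
  (\<Sum>s\<in>nb i. x powi (fst (shift_deg i s)) * Nx x (fst s) j (v - 1)) + x powi (- (2 * int (d i))) * Kx x i j (v - 2)"
  using eq by simp
 hence "x powi int (d i) * (Nx x i j v + x powi (- (2 * int (d i))) * Nx x i j (v - 2)) =
  x powi int (d i) * ((\<Sum>s\<in>nb i. x powi (fst (shift_deg i s)) * Nx x (fst s) j (v - 1)) + x powi (- (2 * int (d i))) * Kx x i j (v - 2))"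
  by simp
 moreover have "x powi int (d i) * (\<Sum>s\<in>nb i. x powi (fst (shift_deg i s)) * Nx x (fst s) j (v - 1)) =
   (\<Sum>y | adj C i y. br x i y * Nx x y j (v - 1))"
 proof -
  have "x powi int (d i) * (\<Sum>s\<in>nb i. x powi (fst (shift_deg i s)) * Nx x (fst s) j (v - 1)) =
   (\<Sum>s\<in>nb i. x powi (fst (shift_deg i s) + int (d i)) * Nx x (fst s) j (v - 1))"
   unfolding sum_distrib_left
   by(intro sum.cong refl) (simp only: mult.assoc[symmetric] pw add.commute[of "int (d i)"])
  also have "\<dots> = (\<Sum>y | adj C i y. br x i y * Nx x y j (v - 1))"
   by(simp add: sum_nb br_def sum_distrib_right shift_deg_def)
  finally show ?thesis .
 qed
 moreover have "x powi int (d i) * (x powi (- (2 * int (d i))) * z) = x powi (- int (d i)) * z" for z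
  using pw[of "int (d i)" "- (2 * int (d i))"] by(simp only: mult.assoc[symmetric]) simp
 ultimately show ?thesis by(simp only: distrib_left)
qed

lemma br_geometric:
 assumes "x > 0" "adj C i y"
 shows "(x powi int (d i) - x powi (- int (d i))) * br x i y =
   x powi int (max (d i) (d y)) - x powi (- int (max (d i) (d y)))"
proof -
 let ?M = "int (max (d i) (d y))" and ?d = "int (d i)"
 have pw: "x powi p * x powi q = x powi (p + q)" for p q using assms by(simp add: power_int_add)
 have "(x powi ?d - x powi (- ?d)) * br x i y =
   (\<Sum>a<f i y. x powi (2 * ?d * int (Suc a) - ?M) - x powi (2 * ?d * int a - ?M))"
  unfolding br_def sum_distrib_left
 proof (intro sum.cong refl)
  fix a
  have "?d + (2 * ?d * int a - ?M + ?d) = 2 * ?d * int (Suc a) - ?M"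
   "- ?d + (2 * ?d * int a - ?M + ?d) = 2 * ?d * int a - ?M" by(simp_all add: algebra_simps)
  thus "(x powi ?d - x powi (- ?d)) * x powi (2 * ?d * int a - ?M + ?d) =
   x powi (2 * ?d * int (Suc a) - ?M) - x powi (2 * ?d * int a - ?M)"
   by(simp only: left_diff_distrib pw)
 qed
 also have "\<dots> = x powi (2 * ?d * int (f i y) - ?M) - x powi (- ?M)"
  by(subst sum_lessThan_telescope) simp
 also have "2 * ?d * int (f i y) - ?M = ?M" using d_mul'[OF assms(2)] by linarith
 finally show ?thesis .
qed

lemma br_pos: "x > 0 ==> adj C i y ==> br x i y > 0"
 unfolding br_def using mul_pos by(intro sum_pos) (auto simp: zero_less_power_int)

lemma br_inv:
 assumes "x > 0" "adj C i y"
 shows "br (1 / x) i y = br x i y"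
proof (cases "x = 1")
 case False
 have "x powi (- int n) = (1 / x) ^ n" "x powi int n = x ^ n" "(1 / x) powi (- int n) = x ^ n"
  "(1 / x) powi int n = (1 / x) ^ n" for n
  using assms by(simp_all add: power_int_minus power_int_def field_simps)
 hence g: "(x ^ d i - (1 / x) ^ d i) * br x i y = x ^ max (d i) (d y) - (1 / x) ^ max (d i) (d y)"
  and h: "((1 / x) ^ d i - x ^ d i) * br (1 / x) i y = (1 / x) ^ max (d i) (d y) - x ^ max (d i) (d y)"
  using br_geometric[OF assms] br_geometric[of "1 / x", OF _ assms(2)] assms(1) by(simp_all only:) (simp_all)
 have "x ^ d i \<noteq> (1 / x) ^ d i"
 proof
  assume "x ^ d i = (1 / x) ^ d i"
  hence "x ^ d i * x ^ d i = 1" using assms(1) by(simp add: power_one_over field_simps)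
  hence "x ^ (d i + d i) = 1" by(simp add: power_add)
  thus False using power_eq_1_iff[of x "d i + d i"] assms(1) False d_pos[of i] by simp
 qed
 moreover have "(x ^ d i - (1 / x) ^ d i) * br x i y = (x ^ d i - (1 / x) ^ d i) * br (1 / x) i y"
  using g h by(simp add: algebra_simps)
 ultimately show ?thesis by simp
qed simp

end

context hom_complex
begin

lemma sum_S1: "(\<Sum>p\<in>S1. G (fst p) (snd p)) =
  (\<Sum>b\<in>B. G (Eps (fst b)) b + (\<Sum>y | adj C (fst b) y. G (Alpha (fst b) y) b))"
proof -
 have "S1 = prod.swap ` (Sigma B (\<lambda>b. {a \<in> arrows C. arrow_tgt a = fst b}))"
  by(auto simp: S1_def)
 hence "(\<Sum>p\<in>S1. G (fst p) (snd p)) =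
   (\<Sum>q\<in>Sigma B (\<lambda>b. {a \<in> arrows C. arrow_tgt a = fst b}). G (snd q) (fst q))"
  by(simp add: sum.reindex)
 also have "\<dots> = (\<Sum>b\<in>B. \<Sum>a\<in>{a \<in> arrows C. arrow_tgt a = fst b}. G a b)"
  using finite_B finite_arrows[of C] by(subst sum.Sigma) (auto simp: split_beta)
 also have "\<dots> = (\<Sum>b\<in>B. G (Eps (fst b)) b + (\<Sum>y | adj C (fst b) y. G (Alpha (fst b) y) b))"
 proof (rule sum.cong[OF refl])
  fix b
  show "(\<Sum>a\<in>{a \<in> arrows C. arrow_tgt a = fst b}. G a b) =
   G (Eps (fst b)) b + (\<Sum>y | adj C (fst b) y. G (Alpha (fst b) y) b)"
   unfolding arrows_tgt by(subst sum.insert) (auto simp: sum.reindex inj_on_def)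
 qed
 finally show ?thesis .
qed

lemma sum_S2: "(\<Sum>p\<in>S2. G (fst p) (snd p)) =
  (\<Sum>b\<in>B. G (Eps (fst b)) b + (\<Sum>y | adj C (fst b) y. G (Alpha y (fst b)) b))"
proof -
 have "S2 = prod.swap ` (Sigma B (\<lambda>b. {a \<in> arrows C. arrow_src a = fst b}))"
  by(auto simp: S2_def)
 hence "(\<Sum>p\<in>S2. G (fst p) (snd p)) =
   (\<Sum>q\<in>Sigma B (\<lambda>b. {a \<in> arrows C. arrow_src a = fst b}). G (snd q) (fst q))"
  by(simp add: sum.reindex)
 also have "\<dots> = (\<Sum>b\<in>B. \<Sum>a\<in>{a \<in> arrows C. arrow_src a = fst b}. G a b)"
  using finite_B finite_arrows[of C] by(subst sum.Sigma) (auto simp: split_beta)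
 also have "\<dots> = (\<Sum>b\<in>B. G (Eps (fst b)) b + (\<Sum>y | adj C (fst b) y. G (Alpha y (fst b)) b))"
 proof (rule sum.cong[OF refl])
  fix b
  show "(\<Sum>a\<in>{a \<in> arrows C. arrow_src a = fst b}. G a b) =
   G (Eps (fst b)) b + (\<Sum>y | adj C (fst b) y. G (Alpha y (fst b)) b)"
   unfolding arrows_src by(subst sum.insert) (auto simp: sum.reindex inj_on_def)
 qed
 finally show ?thesis .
qed

lemma sum_B: "(\<Sum>b\<in>B. x powi fst (dg b) * H (fst b) (snd (dg b))) =
  (\<Sum>i\<in>UNIV. \<Sum>v\<le>m. Nx x i l (int v) * H i (int v))"
proof -
 let ?g = "\<lambda>b. (fst b, nat (snd (dg b)))"
 have "(\<Sum>b\<in>B. x powi fst (dg b) * H (fst b) (snd (dg b))) =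
   (\<Sum>q\<in>UNIV \<times> {..m}. \<Sum>b\<in>{b \<in> B. ?g b = q}. x powi fst (dg b) * H (fst b) (snd (dg b)))"
  by(rule sum.group[symmetric]) (use finite_B B_deg in \<open>auto simp: nat_le_iff\<close>)
 also have "\<dots> = (\<Sum>q\<in>UNIV \<times> {..m}. Nx x (fst q) l (int (snd q)) * H (fst q) (int (snd q)))"
 proof (rule sum.cong[OF refl])
  fix q :: "'i \<times> nat" assume q: "q \<in> UNIV \<times> {..m}"
  obtain i v where iv: "q = (i, v)" by(cases q)
  let ?Bq = "{b \<in> B. ?g b = q}" and ?S = "{u. N i l (u, int v) \<noteq> 0}"
  have Bq: "fst b = i" "snd (dg b) = int v" if "b \<in> ?Bq" for b
   using that B_deg(2)[of b] iv by auto
  have cd: "card {b \<in> ?Bq. fst (dg b) = u} = N i l (u, int v)" for u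
  proof -
   have "{b \<in> ?Bq. fst (dg b) = u} = {b \<in> B. fst b = i \<and> dg b = (u, int v)}"
   proof -
    have "nat (snd (dg b)) = v \<longleftrightarrow> snd (dg b) = int v" for b using B_deg(2)[of b] by auto
    thus ?thesis using iv by(auto simp: prod_eq_iff)
   qed
   thus ?thesis using B_card[of i "(u, int v)"] q iv by simp
  qed
  have img: "(\<lambda>b. fst (dg b)) ` ?Bq \<subseteq> ?S"
  proof
   fix u assume "u \<in> (\<lambda>b. fst (dg b)) ` ?Bq"
   then obtain b where "b \<in> {b \<in> ?Bq. fst (dg b) = u}" by auto
   moreover have "finite {b \<in> ?Bq. fst (dg b) = u}" using finite_B by simp
   ultimately have "card {b \<in> ?Bq. fst (dg b) = u} > 0" using card_gt_0_iff by blast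
   thus "u \<in> ?S" using cd[of u] by simp
  qed
  have "(\<Sum>b\<in>?Bq. x powi fst (dg b) * H (fst b) (snd (dg b))) =
    (\<Sum>b\<in>?Bq. x powi fst (dg b) * H i (int v))"
  proof (rule sum.cong[OF refl])
   fix b assume "b \<in> ?Bq"
   from Bq[OF this] show "x powi fst (dg b) * H (fst b) (snd (dg b)) = x powi fst (dg b) * H i (int v)"
    by simp
  qed
  also have "\<dots> = (\<Sum>u\<in>?S. \<Sum>b\<in>{b \<in> ?Bq. fst (dg b) = u}. x powi fst (dg b) * H i (int v))"
   using finite_B by(intro sum.group[symmetric] fin_N img) auto
  also have "\<dots> = (\<Sum>u\<in>?S. real (N i l (u, int v)) * (x powi u * H i (int v)))"
  proof (rule sum.cong[OF refl])
   fix u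
   have "(\<Sum>b\<in>{b \<in> ?Bq. fst (dg b) = u}. x powi fst (dg b) * H i (int v)) =
     (\<Sum>b\<in>{b \<in> ?Bq. fst (dg b) = u}. x powi u * H i (int v))"
    by(rule sum.cong) auto
   thus "(\<Sum>b\<in>{b \<in> ?Bq. fst (dg b) = u}. x powi fst (dg b) * H i (int v)) =
     real (N i l (u, int v)) * (x powi u * H i (int v))"
    using cd[of u] by simp
  qed
  also have "\<dots> = Nx x i l (int v) * H i (int v)"
   by(simp add: Nx_def ev_def sum_distrib_right mult.assoc)
  finally show "(\<Sum>b\<in>?Bq. x powi fst (dg b) * H (fst b) (snd (dg b))) =
    Nx x (fst q) l (int (snd q)) * H (fst q) (int (snd q))" using iv by simp
 qed
 also have "\<dots> = (\<Sum>i\<in>UNIV. \<Sum>v\<le>m. Nx x i l (int v) * H i (int v))"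
  by(simp add: sum.cartesian_product split_beta)
 finally show ?thesis .
qed

end

context gpa_data
begin

text \<open>\<open>euler_inequality\<close> compares two Laurent polynomials in the q-degree
  \<open>u\<close> of the homomorphisms. At x = 1 they agree: the loops in \<open>V1\<close> match
  \<open>V0\<close>, the loops in \<open>V2\<close> match \<open>V3\<close>, the other arrows match
  each other, and \<open>Bn\<close> matches \<open>Bo\<close>. By \<open>ev_le_imp_eq\<close> they
  agree altogether.\<close>

lemma euler_char:
 assumes x: "x > 0" and s: "s \<ge> -1" "s \<le> int m"
 shows "(\<Sum>i\<in>UNIV. \<Sum>v\<le>m. Nx x i l (int v) *
    (x powi (- 2 * int (d i)) * Nx (1/x) i j (int v - s) + Nx (1/x) i j (int v - s - 2)
     + (\<Sum>y | adj C i y. x powi int (max (d i) (d y)) * Nx (1/x) y j (int v - s - 1)))) + Nx x j l s =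
  (\<Sum>i\<in>UNIV. \<Sum>v\<le>m. Nx x i l (int v) *
    (Nx (1/x) i j (int v - s) + x powi (2 * int (d i)) * Nx (1/x) i j (int v - s - 2)
     + (\<Sum>y | adj C i y. x powi (- int (max (d i) (d y))) * Nx (1/x) y j (int v - s - 1))))
   + x powi (- 2 * int (d j)) * Nx x j l s"
proof -
 interpret H: hom_complex C \<omega> l j m "(u, s)" for u
  by unfold_locales (use s in auto)
 let ?a = "arrow_deg C"
 define T1 where "T1 p u = N (arrow_src (fst p)) j
  (fst (H.dg (snd p)) - fst (?a (fst p)) - u, snd (H.dg (snd p)) - s - snd (?a (fst p)))" for p u
 define T2 where "T2 p u = N (arrow_tgt (fst p)) j
  (fst (H.dg (snd p)) + fst (?a (fst p)) - u, snd (H.dg (snd p)) - s - 2 + snd (?a (fst p)))" for p u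
 define T0 where "T0 b u = N (fst b) j (fst (H.dg b) - u, snd (H.dg b) - s)" for b u
 define T3 where "T3 b u = N (fst b) j (fst (H.dg b) - u, snd (H.dg b) - s - 2)" for b u
 define gL where "gL u = (\<Sum>p\<in>H.S1. T1 p u) + (\<Sum>b\<in>H.B. T3 b u) + N j l (u, s)" for u
 define gR where "gR u = (\<Sum>b\<in>H.B. T0 b u) + (\<Sum>p\<in>H.S2. T2 p u) + N j l (u + 2 * int (d j), s)" for u
 have le: "gL u \<le> gR u" for u
 proof -
  have "card (H.Bn u) = N j l (u, s)" "card (H.Bo u) = N j l (u + 2 * int (d j), s)"
   using H.B_card[of j "(u, s)"] H.B_card[of j "(u + 2 * int (d j), s)"] s
   by(simp_all add: H.Bn_def H.Bo_def)
  moreover have "(\<Sum>(a, b)\<in>H.S1. N (arrow_src a) j (H.dg b - (u, s) - ?a a)) = (\<Sum>p\<in>H.S1. T1 p u)"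
   unfolding T1_def split_beta
   by(intro sum.cong refl arg_cong[of _ _ "N _ j"]) (simp add: prod_eq_iff)
  moreover have "(\<Sum>(a, b)\<in>H.S2. N (arrow_tgt a) j (H.dg b - (u, s) - (0, 2) + ?a a)) = (\<Sum>p\<in>H.S2. T2 p u)"
   unfolding T2_def split_beta
   by(intro sum.cong refl arg_cong[of _ _ "N _ j"]) (simp add: prod_eq_iff)
  moreover have "(\<Sum>b\<in>H.B. N (fst b) j (H.dg b - (u, s))) = (\<Sum>b\<in>H.B. T0 b u)"
   unfolding T0_def by(intro sum.cong refl arg_cong[of _ _ "N _ j"]) (simp add: prod_eq_iff)
  moreover have "(\<Sum>b\<in>H.B. N (fst b) j (H.dg b - (u, s) - (0, 2))) = (\<Sum>b\<in>H.B. T3 b u)"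
   unfolding T3_def by(intro sum.cong refl arg_cong[of _ _ "N _ j"]) (simp add: prod_eq_iff)
  ultimately show ?thesis using H.euler_inequality[of u] by(simp add: gL_def gR_def)
 qed
 have fT: "finite {u. T0 b u \<noteq> 0}" "finite {u. T1 p u \<noteq> 0}" "finite {u. T2 p u \<noteq> 0}" "finite {u. T3 b u \<noteq> 0}"
  for b p unfolding T0_def T1_def T2_def T3_def by(rule fin_supp_reflect[OF fin_N])+
 have fN: "finite {u. N j l (u + c, s) \<noteq> 0}" for c by(rule fin_supp_shift[OF fin_N])
 have fS: "finite {u. (\<Sum>p\<in>H.S1. T1 p u) \<noteq> 0}" "finite {u. (\<Sum>b\<in>H.B. T3 b u) \<noteq> 0}"
  "finite {u. (\<Sum>b\<in>H.B. T0 b u) \<noteq> 0}" "finite {u. (\<Sum>p\<in>H.S2. T2 p u) \<noteq> 0}"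
  by(rule fin_supp_sum; rule H.finite_S H.finite_B fT)+
 have evL: "ev y gL = (\<Sum>p\<in>H.S1. ev y (T1 p)) + (\<Sum>b\<in>H.B. ev y (T3 b)) + Nx y j l s" for y
  unfolding gL_def[abs_def]
  by(simp only: ev_add[OF fin_supp_add[OF fS(1,2)] fin_N] ev_add[OF fS(1,2)]
    ev_sum[OF H.finite_S(1) fT(2)] ev_sum[OF H.finite_B fT(4)] Nx_def)
 have evR: "ev y gR = (\<Sum>b\<in>H.B. ev y (T0 b)) + (\<Sum>p\<in>H.S2. ev y (T2 p)) + y powi (- 2 * int (d j)) * Nx y j l s"
  if "y > 0" for y
  unfolding gR_def[abs_def]
  using ev_shift[OF that, of "\<lambda>u. N j l (u, s)" "2 * int (d j)"]
  by(simp only: ev_add[OF fin_supp_add[OF fS(3,4)] fN] ev_add[OF fS(3,4)]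
    ev_sum[OF H.finite_S(2) fT(3)] ev_sum[OF H.finite_B fT(1)] Nx_def) simp
 have e0: "ev y (T0 b) = y powi fst (H.dg b) * Nx (1/y) (fst b) j (snd (H.dg b) - s)"
  and e3: "ev y (T3 b) = y powi fst (H.dg b) * Nx (1/y) (fst b) j (snd (H.dg b) - s - 2)"
  and e1: "ev y (T1 p) = y powi (fst (H.dg (snd p)) - fst (?a (fst p))) *
    Nx (1/y) (arrow_src (fst p)) j (snd (H.dg (snd p)) - s - snd (?a (fst p)))"
  and e2: "ev y (T2 p) = y powi (fst (H.dg (snd p)) + fst (?a (fst p))) *
    Nx (1/y) (arrow_tgt (fst p)) j (snd (H.dg (snd p)) - s - 2 + snd (?a (fst p)))"
  if "y > 0" for y b p
  unfolding T0_def[abs_def] T1_def[abs_def] T2_def[abs_def] T3_def[abs_def] Nx_def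
  by(rule ev_reflect[OF that, of "\<lambda>u. N _ j (u, _)"])+
 let ?L = "\<lambda>y. (\<Sum>i\<in>UNIV. \<Sum>v\<le>m. Nx y i l (int v) *
    (y powi (- 2 * int (d i)) * Nx (1/y) i j (int v - s) + Nx (1/y) i j (int v - s - 2)
     + (\<Sum>z | adj C i z. y powi int (max (d i) (d z)) * Nx (1/y) z j (int v - s - 1)))) + Nx y j l s"
 let ?R = "\<lambda>y. (\<Sum>i\<in>UNIV. \<Sum>v\<le>m. Nx y i l (int v) *
    (Nx (1/y) i j (int v - s) + y powi (2 * int (d i)) * Nx (1/y) i j (int v - s - 2)
     + (\<Sum>z | adj C i z. y powi (- int (max (d i) (d z))) * Nx (1/y) z j (int v - s - 1))))
   + y powi (- 2 * int (d j)) * Nx y j l s"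
 have L: "ev y gL = ?L y" if y: "y > 0" for y
 proof -
  have pw: "y powi (p - q) = y powi p * y powi (- q)" "y powi (p + q) = y powi p * y powi q" for p q
   using y by(simp_all add: power_int_diff power_int_minus power_int_add field_simps)
  have "(\<Sum>p\<in>H.S1. ev y (T1 p)) + (\<Sum>b\<in>H.B. ev y (T3 b)) =
   (\<Sum>b\<in>H.B. y powi fst (H.dg b) *
    (y powi (- 2 * int (d (fst b))) * Nx (1/y) (fst b) j (snd (H.dg b) - s) + Nx (1/y) (fst b) j (snd (H.dg b) - s - 2)
     + (\<Sum>z | adj C (fst b) z. y powi int (max (d (fst b)) (d z)) * Nx (1/y) z j (snd (H.dg b) - s - 1))))"
   unfolding e1[OF y] e3[OF y]
   by(subst H.sum_S1[of "\<lambda>a b. y powi (fst (H.dg b) - fst (?a a)) *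
    Nx (1/y) (arrow_src a) j (snd (H.dg b) - s - snd (?a a))"])
    (simp add: pw distrib_left sum_distrib_left sum.distrib mult.assoc)
  thus ?thesis unfolding evL
   by(subst (asm) H.sum_B[of y "\<lambda>i v. y powi (- 2 * int (d i)) * Nx (1/y) i j (v - s) + Nx (1/y) i j (v - s - 2)
     + (\<Sum>z | adj C i z. y powi int (max (d i) (d z)) * Nx (1/y) z j (v - s - 1))"]) simp
 qed
 have R: "ev y gR = ?R y" if y: "y > 0" for y
 proof -
  have pw: "y powi (p + q) = y powi p * y powi q" for p q
   using y by(simp add: power_int_add)
  have pw': "y powi (p - q) = y powi p * y powi (- q)" for p q
   using y by(simp add: power_int_diff power_int_minus field_simps)
  have "(\<Sum>b\<in>H.B. ev y (T0 b)) + (\<Sum>p\<in>H.S2. ev y (T2 p)) =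
   (\<Sum>b\<in>H.B. y powi fst (H.dg b) *
    (Nx (1/y) (fst b) j (snd (H.dg b) - s) + y powi (2 * int (d (fst b))) * Nx (1/y) (fst b) j (snd (H.dg b) - s - 2)
     + (\<Sum>z | adj C (fst b) z. y powi (- int (max (d (fst b)) (d z))) * Nx (1/y) z j (snd (H.dg b) - s - 1))))"
   unfolding e0[OF y] e2[OF y]
   by(subst H.sum_S2[of "\<lambda>a b. y powi (fst (H.dg b) + fst (?a a)) *
    Nx (1/y) (arrow_tgt a) j (snd (H.dg b) - s - 2 + snd (?a a))"])
    (simp add: pw pw' distrib_left sum_distrib_left sum.distrib mult.assoc max.commute)
  thus ?thesis unfolding evR[OF y]
   by(subst (asm) H.sum_B[of y "\<lambda>i v. Nx (1/y) i j (v - s) + y powi (2 * int (d i)) * Nx (1/y) i j (v - s - 2)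
     + (\<Sum>z | adj C i z. y powi (- int (max (d i) (d z))) * Nx (1/y) z j (v - s - 1))"]) simp
 qed
 have "ev 1 gL = ev 1 gR"
  unfolding L[OF zero_less_one] R[OF zero_less_one] by(simp add: add.commute add.left_commute)
 moreover have "finite {u. gL u \<noteq> 0}" unfolding gL_def by(intro fin_supp_add fS fin_N)
 moreover have "finite {u. gR u \<noteq> 0}" unfolding gR_def by(intro fin_supp_add fS fN)
 ultimately have "gL = gR" by(intro ev_le_imp_eq le)
 thus ?thesis using L[OF x] R[OF x] by simp
qed

end

section \<open>Orthogonality of kernels and dimensions\<close>

context gpa_data
begin

text \<open>The recursion in all t-degrees; the initial value 1 in t-degree 0 appears as a source at
  w = -1.\<close>

lemma Nx_rec_all:
 assumes x: "x > 0"
 shows "x powi int (d i) * Nx x i j (w + 1) + x powi (- int (d i)) * Nx x i j (w - 1) =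
  (\<Sum>y | adj C i y. br x i y * Nx x y j w) + (if w = -1 \<and> i = j then x powi int (d i) else 0)
   + x powi (- int (d i)) * Kx x i j (w - 1)"
proof -
 consider "w \<ge> 0" | "w = -1" | "w < -1" by linarith
 thus ?thesis
 proof cases
  case 1
  thus ?thesis using Nx_rec[OF x, of "w + 1" i j] by simp
 qed (auto simp: Nx_neg Kx_neg Nx_0)
qed

lemma inv_powi: "x > 0 ==> (1 / x) powi k = x powi (- k)" for x :: real
 by(simp add: power_int_minus power_int_divide_distrib field_simps)

lemma Nx_rec_inv:
 assumes x: "x > 0"
 shows "x powi (- int (d i)) * Nx (1/x) i j (w + 1) + x powi int (d i) * Nx (1/x) i j (w - 1) =
  (\<Sum>y | adj C i y. br x i y * Nx (1/x) y j w) + (if w = -1 \<and> i = j then x powi (- int (d i)) else 0)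
   + x powi int (d i) * Kx (1/x) i j (w - 1)"
proof -
 have "(\<Sum>y | adj C i y. br (1/x) i y * Nx (1/x) y j w) = (\<Sum>y | adj C i y. br x i y * Nx (1/x) y j w)"
  by(intro sum.cong refl) (simp add: br_inv[OF x])
 moreover have "(1/x) powi int (d i) = x powi (- int (d i))" "(1/x) powi (- int (d i)) = x powi int (d i)"
  using inv_powi[OF x, of "int (d i)"] inv_powi[OF x, of "- int (d i)"] by simp_all
 moreover have "1/x > 0" using x by simp
 ultimately show ?thesis using Nx_rec_all[of "1/x" i j w] by(simp only:)
qed

lemma factor_out:
 fixes e e' :: real
 assumes "e * e' = 1"
 shows "S2 - S1 = (e - e') * S ==>
   (P + e * e * Q + S1) - (e' * e' * P + Q + S2) = (e - e') * (e' * P + e * Q - S)"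
  and "(e - e') * ((if c then e' else 0) + e * k) = (if c then 1 - e' * e' else 0) + (e * e - 1) * k"
  and "(e - e') * (e * Q + e' * P - e' * k) = (1 - e' * e') * P + (e * e - 1) * Q - (1 - e' * e') * k"
proof -
 have "(e - e') * (e' * P + e * Q - S) = (e * e') * P - e' * e' * P + e * e * Q - (e * e') * Q - (e - e') * S"
  by(simp add: algebra_simps)
 thus "S2 - S1 = (e - e') * S ==>
   (P + e * e * Q + S1) - (e' * e' * P + Q + S2) = (e - e') * (e' * P + e * Q - S)"
  using assms by simp
 have "(e - e') * (e' + e * k) = e * e' - e' * e' + e * e * k - (e * e') * k"
  "(e - e') * (e * k) = e * e * k - (e * e') * k" by(simp_all add: algebra_simps)
 thus "(e - e') * ((if c then e' else 0) + e * k) = (if c then 1 - e' * e' else 0) + (e * e - 1) * k"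
  using assms by(simp add: algebra_simps)
 have "(e - e') * (e * Q + e' * P - e' * k) =
   e * e * Q + (e * e') * P - (e * e') * k - (e * e') * Q - e' * e' * P + e' * e' * k"
  by(simp add: algebra_simps)
 thus "(e - e') * (e * Q + e' * P - e' * k) = (1 - e' * e') * P + (e * e - 1) * Q - (1 - e' * e') * k"
  using assms by(simp add: algebra_simps)
qed

text \<open>Inserting the recursion on the side of \<open>j\<close> into the Euler characteristic leaves a sum of
 terms of the same sign.\<close>

lemma euler_right:
 assumes x: "x > 0" and s: "s \<ge> -1" "s \<le> int m"
 shows "(\<Sum>i\<in>UNIV. \<Sum>v\<le>m. (x powi (2 * int (d i)) - 1) * Nx x i l (int v) * Kx (1/x) i j (int v - s - 2)) = 0"
proof -
 define J where "J = Nx (1/x)"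
 \<comment> \<open>The difference of the coefficients of \<open>Nx x i l v\<close> on the two sides
   of \<open>euler_char\<close>. It is divisible by x^(d_i) - x^(-d_i), and the cofactor is the
   defect of the recursion for column \<open>j\<close>, that is the source plus the kernel.\<close>
 define Q where "Q i v = (J i j (v - s) + x powi (2 * int (d i)) * J i j (v - s - 2)
     + (\<Sum>y | adj C i y. x powi (- int (max (d i) (d y))) * J y j (v - s - 1)))
   - (x powi (- 2 * int (d i)) * J i j (v - s) + J i j (v - s - 2)
     + (\<Sum>y | adj C i y. x powi int (max (d i) (d y)) * J y j (v - s - 1)))" for i v
 have Q: "Q i v = (if v = s \<and> i = j then 1 - x powi (- 2 * int (d j)) else 0)
   + (x powi (2 * int (d i)) - 1) * Kx (1/x) i j (v - s - 2)" for i v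
 proof -
  let ?d = "int (d i)"
  have "(\<Sum>y | adj C i y. x powi int (max (d i) (d y)) * J y j (v - s - 1))
    - (\<Sum>y | adj C i y. x powi (- int (max (d i) (d y))) * J y j (v - s - 1))
   = (\<Sum>y | adj C i y. (x powi ?d - x powi (- ?d)) * br x i y * J y j (v - s - 1))"
   unfolding sum_subtractf[symmetric]
  proof (rule sum.cong[OF refl])
   fix y assume "y \<in> Collect (adj C i)"
   thus "x powi int (max (d i) (d y)) * J y j (v - s - 1) - x powi (- int (max (d i) (d y))) * J y j (v - s - 1)
    = (x powi ?d - x powi (- ?d)) * br x i y * J y j (v - s - 1)"
    using br_geometric[OF x, of i y] by(simp only: left_diff_distrib[symmetric] mem_Collect_eq)
  qed
  also have "\<dots> = (x powi ?d - x powi (- ?d)) * (\<Sum>y | adj C i y. br x i y * J y j (v - s - 1))"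
   by(simp add: sum_distrib_left mult.assoc)
  finally have S: "(\<Sum>y | adj C i y. x powi int (max (d i) (d y)) * J y j (v - s - 1))
    - (\<Sum>y | adj C i y. x powi (- int (max (d i) (d y))) * J y j (v - s - 1))
   = (x powi ?d - x powi (- ?d)) * (\<Sum>y | adj C i y. br x i y * J y j (v - s - 1))" .
  have "Q i v = (x powi ?d - x powi (- ?d)) * (x powi (- ?d) * J i j (v - s) + x powi ?d * J i j (v - s - 2)
    - (\<Sum>y | adj C i y. br x i y * J y j (v - s - 1)))"
   unfolding Q_def powi_double(1,2)[OF x] by(rule factor_out(1)[OF powi_double(3)[OF x] S])
  also have "x powi (- ?d) * J i j (v - s) + x powi ?d * J i j (v - s - 2)
    - (\<Sum>y | adj C i y. br x i y * J y j (v - s - 1)) =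
    (if v = s \<and> i = j then x powi (- ?d) else 0) + x powi ?d * Kx (1/x) i j (v - s - 2)"
   using Nx_rec_inv[OF x, of i j "v - s - 1"] by(auto simp: J_def)
  also have "(x powi ?d - x powi (- ?d)) * ((if v = s \<and> i = j then x powi (- ?d) else 0) + x powi ?d * Kx (1/x) i j (v - s - 2))
   = (if v = s \<and> i = j then 1 - x powi (- 2 * ?d) else 0) + (x powi (2 * ?d) - 1) * Kx (1/x) i j (v - s - 2)"
   unfolding powi_double(1,2)[OF x] by(rule factor_out(2)[OF powi_double(3)[OF x]])
  also have "(if v = s \<and> i = j then 1 - x powi (- 2 * ?d) else 0) = (if v = s \<and> i = j then 1 - x powi (- 2 * int (d j)) else 0)"
   by simp
  finally show ?thesis .
 qed
 have "(\<Sum>i\<in>UNIV. \<Sum>v\<le>m. Nx x i l (int v) * Q i (int v)) = (1 - x powi (- 2 * int (d j))) * Nx x j l s"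
  using euler_char[OF x s, of l j] unfolding Q_def J_def right_diff_distrib sum_subtractf left_diff_distrib
  by simp
 moreover have "(\<Sum>i\<in>UNIV. \<Sum>v\<le>m. Nx x i l (int v) * Q i (int v)) =
   (\<Sum>i\<in>UNIV. \<Sum>v\<le>m. Nx x i l (int v) * (if int v = s \<and> i = j then 1 - x powi (- 2 * int (d j)) else 0)) +
   (\<Sum>i\<in>UNIV. \<Sum>v\<le>m. (x powi (2 * int (d i)) - 1) * Nx x i l (int v) * Kx (1/x) i j (int v - s - 2))"
  unfolding Q by(simp add: distrib_left sum.distrib mult_ac)
 moreover have "(\<Sum>i\<in>UNIV. \<Sum>v\<le>m. Nx x i l (int v) * (if int v = s \<and> i = j then 1 - x powi (- 2 * int (d j)) else 0))
   = (1 - x powi (- 2 * int (d j))) * Nx x j l s"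
 proof (cases "s \<ge> 0")
  case True
  define s' where "s' = nat s"
  have s': "s = int s'" "s' \<le> m" using True s(2) by(auto simp: s'_def)
  have "(\<Sum>v\<le>m. Nx x i l (int v) * (if int v = s \<and> i = j then 1 - x powi (- 2 * int (d j)) else 0)) =
    (if i = j then (1 - x powi (- 2 * int (d j))) * Nx x j l s else 0)" for i
  proof -
   have "(\<Sum>v\<le>m. Nx x i l (int v) * (if int v = s \<and> i = j then 1 - x powi (- 2 * int (d j)) else 0)) =
    (\<Sum>v\<le>m. if v = s' then (if i = j then (1 - x powi (- 2 * int (d j))) * Nx x j l s else 0) else 0)"
    by(intro sum.cong refl) (simp add: s')
   thus ?thesis using s' by simp
  qed
  thus ?thesis by simp
 next
  case False
  hence "int v = s \<longleftrightarrow> False" for v by auto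
  thus ?thesis using False by(simp add: Nx_neg)
 qed
 ultimately show ?thesis by simp
qed

lemma powi_ge_1: "x > 1 ==> k > 0 ==> x powi int k > 1" for x :: real
 using one_less_power[of x k] by simp

text \<open>For s = v - u - 2 the vanishing sum in \<open>euler_right\<close> contains the product
  of \<open>Nx\<close> in degree \<open>v\<close> and \<open>Kx\<close> in degree \<open>u\<close>.
  At x = 2 all its terms are nonnegative, so this product is 0. The condition v > u is the condition
  s \<ge> -1.\<close>

lemma orthogonality:
 assumes K: "K i j (a, u) \<noteq> 0" and v: "v > u"
 shows "N i l (b, v) = 0"
proof (rule ccontr)
 assume N: "N i l (b, v) \<noteq> 0"
 have u0: "u \<ge> 0" using K K_le_N[of i j "(a, u)"] N_neg[of "(a, u)" i j] by(cases "u \<ge> 0") auto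
 define s where "s = v - u - 2"
 define m where "m = nat v"
 let ?x = "2 :: real"
 have s: "s \<ge> -1" "s \<le> int m" using v u0 by(auto simp: s_def m_def)
 let ?t = "\<lambda>i v. (?x powi (2 * int (d i)) - 1) * Nx ?x i l (int v) * Kx (1/?x) i j (int v - s - 2)"
 have d1: "?x powi (2 * int (d i)) - 1 > 0" for i
  using powi_ge_1[of ?x "2 * d i"] d_pos[of i] by simp
 have t: "?t i v \<ge> 0" for i v
  using d1[of i] Nx_nonneg[of ?x] Kx_nonneg[of "1/?x"] by(intro mult_nonneg_nonneg) auto
 have "(\<Sum>i\<in>UNIV. \<Sum>v\<le>m. ?t i v) = 0" using euler_right[OF _ s, of ?x l j] by simp
 hence "\<forall>i\<in>UNIV. (\<Sum>v\<le>m. ?t i v) = 0"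
  by(subst (asm) sum_nonneg_eq_0_iff) (auto intro: sum_nonneg t)
 hence "(\<Sum>v\<le>m. ?t i v) = 0" by blast
 hence "\<forall>v\<in>{..m}. ?t i v = 0" using t sum_nonneg_eq_0_iff[of "{..m}" "?t i"] by blast
 hence "?t i m = 0" by blast
 moreover have "int m = v" using v u0 by(simp add: m_def)
 moreover have "v - s - 2 = u" by(simp add: s_def)
 ultimately have "Nx ?x i l v = 0 \<or> Kx (1/?x) i j u = 0" using d1[of i] by simp
 thus False using N K Nx_eq_0_iff[of ?x i l v] Kx_eq_0_iff[of "1/?x" i j u] by auto
qed

lemma conv_shift:
 fixes A J :: "int => real"
 assumes "\<And>v. v < 0 \<or> v > int m ==> A v = 0" "\<And>v. v < 0 \<or> v > int m ==> J v = 0"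
 shows "(\<Sum>v\<le>m. A (int v) * J (int v - c)) = (\<Sum>w\<le>m. J (int w) * A (int w + c))"
proof -
 have r: "(\<Sum>v\<le>m. h (int v)) = (\<Sum>v\<in>{0..int m}. h v)" for h :: "int => real"
  by(rule sum.reindex_bij_witness[of _ nat int]) auto
 have "(\<Sum>v\<in>{0..int m}. A v * J (v - c)) = (\<Sum>w\<in>{0..int m}. J w * A (w + c))"
 proof (rule sum.reindex_bij_witness_not_neutral[of "{v\<in>{0..int m}. A v * J (v - c) = 0}"
    "{w\<in>{0..int m}. J w * A (w + c) = 0}" _ "\<lambda>w. w + c" "\<lambda>v. v - c"])
  fix v assume "v \<in> {0..int m} - {v\<in>{0..int m}. A v * J (v - c) = 0}"
  thus "v - c \<in> {0..int m} - {w\<in>{0..int m}. J w * A (w + c) = 0}"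
   using assms(2)[of "v - c"] by(cases "v - c < 0 \<or> v - c > int m") auto
 next
  fix w assume "w \<in> {0..int m} - {w\<in>{0..int m}. J w * A (w + c) = 0}"
  thus "w + c \<in> {0..int m} - {v\<in>{0..int m}. A v * J (v - c) = 0}"
   using assms(1)[of "w + c"] by(cases "w + c < 0 \<or> w + c > int m") auto
 next
  show "finite {v\<in>{0..int m}. A v * J (v - c) = 0}" "finite {w\<in>{0..int m}. J w * A (w + c) = 0}"
   by(rule finite_subset[of _ "{0..int m}"]; auto)+
 qed auto
 thus ?thesis using r[of "\<lambda>v. A v * J (v - c)"] r[of "\<lambda>w. J w * A (w + c)"] by simp
qed

text \<open>The counterpart of \<open>euler_right\<close>: the shift in t-degree is moved from the
  factor for \<open>j\<close> to the factor for \<open>l\<close> by \<open>conv_shift\<close>, and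
  the recursion is inserted there. For this the truncation at \<open>m\<close> must cut nothing off,
  hence the assumptions \<open>fin\<close>.\<close>

lemma euler_left:
 assumes x: "x > 0" and s: "s \<ge> 0" "s \<le> int m"
  and fin: "\<And>i v. v > int m ==> Nx x i l v = 0" "\<And>i v. v > int m ==> Nx (1/x) i j v = 0"
 shows "(\<Sum>i\<in>UNIV. \<Sum>w\<le>m. (1 - x powi (- 2 * int (d i))) * Nx (1/x) i j (int w) * Kx x i l (int w + s))
  = (1 - x powi (- 2 * int (d j))) * Nx x j l s"
proof -
 define J where "J i = Nx (1/x) i j" for i
 define A where "A i = Nx x i l" for i
 define M where "M i y = x powi int (max (d i) (d y)) - x powi (- int (max (d i) (d y)))" for i y
 have c: "(\<Sum>v\<le>m. A i (int v) * J k (int v - c)) = (\<Sum>w\<le>m. J k (int w) * A i (int w + c))" for i k c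
  by(rule conv_shift) (auto simp: A_def J_def Nx_neg fin)
 have "(\<Sum>i\<in>UNIV. \<Sum>v\<le>m. A i (int v) * ((1 - x powi (- 2 * int (d i))) * J i (int v - s)
    + (x powi (2 * int (d i)) - 1) * J i (int v - s - 2) - (\<Sum>y | adj C i y. M i y * J y (int v - s - 1))))
   = (1 - x powi (- 2 * int (d j))) * Nx x j l s"
 proof -
  have "(\<Sum>y | adj C i y. M i y * J y w) = (\<Sum>y | adj C i y. x powi int (max (d i) (d y)) * J y w)
   - (\<Sum>y | adj C i y. x powi (- int (max (d i) (d y))) * J y w)" for i w
   by(simp add: M_def sum_subtractf left_diff_distrib)
  thus ?thesis
   using euler_char[OF x _ s(2), of l j] s(1)
   unfolding A_def J_def
   by(simp add: right_diff_distrib left_diff_distrib distrib_left sum_subtractf sum.distrib)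
 qed
 moreover have "(\<Sum>i\<in>UNIV. \<Sum>v\<le>m. A i (int v) * ((1 - x powi (- 2 * int (d i))) * J i (int v - s)
    + (x powi (2 * int (d i)) - 1) * J i (int v - s - 2) - (\<Sum>y | adj C i y. M i y * J y (int v - s - 1))))
  = (\<Sum>i\<in>UNIV. \<Sum>w\<le>m. J i (int w) * ((1 - x powi (- 2 * int (d i))) * A i (int w + s)
    + (x powi (2 * int (d i)) - 1) * A i (int w + s + 2) - (\<Sum>y | adj C i y. M i y * A y (int w + s + 1))))"
 proof -
  have c1: "(\<Sum>v\<le>m. A i (int v) * J k (int v - s)) = (\<Sum>w\<le>m. J k (int w) * A i (int w + s))"
   "(\<Sum>v\<le>m. A i (int v) * J k (int v - s - 2)) = (\<Sum>w\<le>m. J k (int w) * A i (int w + s + 2))"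
   "(\<Sum>v\<le>m. A i (int v) * J k (int v - s - 1)) = (\<Sum>w\<le>m. J k (int w) * A i (int w + s + 1))" for i k
   using c[of i k s] c[of i k "s + 2"] c[of i k "s + 1"] by(simp_all add: diff_diff_eq add.assoc)
  have L: "(\<Sum>i\<in>UNIV. \<Sum>v\<le>m. A i (int v) * ((1 - x powi (- 2 * int (d i))) * J i (int v - s)
    + (x powi (2 * int (d i)) - 1) * J i (int v - s - 2) - (\<Sum>y | adj C i y. M i y * J y (int v - s - 1))))
   = (\<Sum>i\<in>UNIV. (1 - x powi (- 2 * int (d i))) * (\<Sum>v\<le>m. A i (int v) * J i (int v - s)))
    + (\<Sum>i\<in>UNIV. (x powi (2 * int (d i)) - 1) * (\<Sum>v\<le>m. A i (int v) * J i (int v - s - 2)))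
    - (\<Sum>i\<in>UNIV. \<Sum>y | adj C i y. M i y * (\<Sum>v\<le>m. A i (int v) * J y (int v - s - 1)))"
  proof -
   have "(\<Sum>v\<le>m. A i (int v) * (\<Sum>y | adj C i y. M i y * J y (int v - s - 1))) =
     (\<Sum>y | adj C i y. M i y * (\<Sum>v\<le>m. A i (int v) * J y (int v - s - 1)))" for i
    unfolding sum_distrib_left by(subst sum.swap) (simp add: mult.left_commute)
   thus ?thesis
    by(simp only: right_diff_distrib distrib_left sum_subtractf sum.distrib sum_distrib_left mult.left_commute)
  qed
  have R: "(\<Sum>i\<in>UNIV. \<Sum>w\<le>m. J i (int w) * ((1 - x powi (- 2 * int (d i))) * A i (int w + s)
    + (x powi (2 * int (d i)) - 1) * A i (int w + s + 2) - (\<Sum>y | adj C i y. M i y * A y (int w + s + 1))))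
   = (\<Sum>i\<in>UNIV. (1 - x powi (- 2 * int (d i))) * (\<Sum>w\<le>m. J i (int w) * A i (int w + s)))
    + (\<Sum>i\<in>UNIV. (x powi (2 * int (d i)) - 1) * (\<Sum>w\<le>m. J i (int w) * A i (int w + s + 2)))
    - (\<Sum>i\<in>UNIV. \<Sum>y | adj C i y. M i y * (\<Sum>w\<le>m. J i (int w) * A y (int w + s + 1)))"
  proof -
   have "(\<Sum>w\<le>m. J i (int w) * (\<Sum>y | adj C i y. M i y * A y (int w + s + 1))) =
     (\<Sum>y | adj C i y. M i y * (\<Sum>w\<le>m. J i (int w) * A y (int w + s + 1)))" for i
    unfolding sum_distrib_left by(subst sum.swap) (simp add: mult.left_commute)
   thus ?thesis
    by(simp only: right_diff_distrib distrib_left sum_subtractf sum.distrib sum_distrib_left mult.left_commute)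
  qed
  have "(\<Sum>i\<in>UNIV. \<Sum>y | adj C i y. M i y * (\<Sum>w\<le>m. J y (int w) * A i (int w + s + 1)))
   = (\<Sum>i\<in>UNIV. \<Sum>y | adj C i y. M i y * (\<Sum>w\<le>m. J i (int w) * A y (int w + s + 1)))"
  proof -
   have e: "(\<Sum>i\<in>UNIV. \<Sum>y | adj C i y. h i y) = (\<Sum>i\<in>UNIV. \<Sum>y\<in>UNIV. if adj C i y then h i y else 0)" for h :: "'i => 'i => real"
    using sum.inter_filter[of UNIV "h _" "adj C _"] by simp
   have "M i y = M y i" for i y by(simp add: M_def max.commute)
   thus ?thesis unfolding e by(subst sum.swap) (simp add: adj_iff cong: if_cong)
  qed
  thus ?thesis unfolding L R c1 by simp
 qed
 moreover have "(1 - x powi (- 2 * int (d i))) * A i (int w + s) + (x powi (2 * int (d i)) - 1) * A i (int w + s + 2)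
   - (\<Sum>y | adj C i y. M i y * A y (int w + s + 1)) = (1 - x powi (- 2 * int (d i))) * Kx x i l (int w + s)" for i w
 proof -
  let ?d = "int (d i)"
  have "(\<Sum>y | adj C i y. M i y * A y (int w + s + 1)) =
    (x powi ?d - x powi (- ?d)) * (\<Sum>y | adj C i y. br x i y * A y (int w + s + 1))"
   unfolding sum_distrib_left
  proof (rule sum.cong[OF refl])
   fix y assume "y \<in> Collect (adj C i)"
   thus "M i y * A y (int w + s + 1) = (x powi ?d - x powi (- ?d)) * (br x i y * A y (int w + s + 1))"
    using br_geometric[OF x, of i y] by(simp only: M_def mult.assoc[symmetric] mem_Collect_eq)
  qed
  moreover have "x powi ?d * A i (int w + s + 2) + x powi (- ?d) * A i (int w + s) =
    (\<Sum>y | adj C i y. br x i y * A y (int w + s + 1)) + x powi (- ?d) * Kx x i l (int w + s)"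
   using Nx_rec_all[OF x, of i l "int w + s + 1"] s(1) by(simp add: A_def add.assoc)
  ultimately have "(\<Sum>y | adj C i y. M i y * A y (int w + s + 1)) = (x powi ?d - x powi (- ?d)) *
   (x powi ?d * A i (int w + s + 2) + x powi (- ?d) * A i (int w + s) - x powi (- ?d) * Kx x i l (int w + s))"
   by simp
  also have "\<dots> = (1 - x powi (- 2 * ?d)) * A i (int w + s) + (x powi (2 * ?d) - 1) * A i (int w + s + 2)
    - (1 - x powi (- 2 * ?d)) * Kx x i l (int w + s)"
   unfolding powi_double(1,2)[OF x] by(rule factor_out(3)[OF powi_double(3)[OF x]])
  finally show ?thesis by simp
 qed
 ultimately show ?thesis by(simp add: J_def mult_ac)
qed

end

text \<open>The terms with exponent \<open>a\<close> contribute at least x^(-a) x^a = 1 and all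
  others are nonnegative, so equality leaves a single term with coefficient 1 in both
  factors.\<close>

lemma ev_prod_ge_1:
 assumes x: "x > 0" and fin: "finite {u. h u \<noteq> 0}" and le: "\<And>u. g u \<le> h u" and g: "g a \<noteq> 0"
 shows "ev (1/x) h * ev x g \<ge> 1"
  and "ev (1/x) h * ev x g = 1 ==> h u = (if u = a then 1 else 0) \<and> g u = (if u = a then 1 else 0)"
proof -
 have hs: "{u. g u \<noteq> 0} \<subseteq> {u. h u \<noteq> 0}"
 proof
  fix u assume "u \<in> {u. g u \<noteq> 0}" then show "u \<in> {u. h u \<noteq> 0}" using le[of u] by auto
 qed
 have fing: "finite {u. g u \<noteq> 0}" by(rule finite_subset[OF hs fin])
 have ha: "h a \<noteq> 0" using g le[of a] by auto
 have "x \<noteq> 0" using x by simp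
 have inv: "(1/x) powi a * x powi a = 1" using x by(simp add: power_int_divide_distrib)
 have G: "ev x g = real (g a) * x powi a + (\<Sum>u\<in>{u. g u \<noteq> 0} - {a}. real (g u) * x powi u)"
  unfolding ev_def by(rule sum.remove[OF fing]) (use g in simp)
 have H: "ev (1/x) h = real (h a) * (1/x) powi a + (\<Sum>u\<in>{u. h u \<noteq> 0} - {a}. real (h u) * (1/x) powi u)"
  unfolding ev_def by(rule sum.remove[OF fin]) (use ha in simp)
 define r where "r = (\<Sum>u\<in>{u. g u \<noteq> 0} - {a}. real (g u) * x powi u)"
 define r' where "r' = (\<Sum>u\<in>{u. h u \<noteq> 0} - {a}. real (h u) * (1/x) powi u)"
 have r: "r \<ge> 0" "r' \<ge> 0" unfolding r_def r'_def using x by(auto intro!: sum_nonneg)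
 have pa: "x powi a > 0" "(1/x) powi a > 0" using x by(simp_all add: zero_less_power_int)
 have ga: "real (g a) \<ge> 1" "real (h a) \<ge> 1" using g ha by simp_all
 have "1 * x powi a \<le> real (g a) * x powi a" "1 * (1/x) powi a \<le> real (h a) * (1/x) powi a"
  by(rule mult_right_mono; use ga pa in linarith)+
 hence G1: "ev x g \<ge> x powi a" and H1: "ev (1/x) h \<ge> (1/x) powi a"
  unfolding G H r_def[symmetric] r'_def[symmetric] using r by linarith+
 show "ev (1/x) h * ev x g \<ge> 1"
  using mult_mono[OF H1 G1] pa inv G1 H1 by simp
 assume eq: "ev (1/x) h * ev x g = 1"
 have "ev x g = x powi a"
 proof (rule ccontr)
  assume "ev x g \<noteq> x powi a"
  hence "ev x g > x powi a" using G1 by simp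
  hence "(1/x) powi a * ev x g > 1" using pa inv by(metis mult_strict_left_mono)
  moreover have "ev (1/x) h * ev x g \<ge> (1/x) powi a * ev x g"
   using H1 G1 pa by(intro mult_right_mono) auto
  ultimately show False using eq by simp
 qed
 hence H2: "ev (1/x) h = (1/x) powi a" using eq inv pa by(metis mult_cancel_right less_irrefl)
 have "real (h a) * (1/x) powi a + r' = (1/x) powi a" using H H2 r'_def by simp
 moreover have "real (h a) * (1/x) powi a \<ge> (1/x) powi a" using mult_right_mono[OF ga(2), of "(1/x) powi a"] pa by simp
 ultimately have "r' = 0" "real (h a) * (1/x) powi a = 1 * (1/x) powi a" using r by linarith+
 hence h1: "h a = 1" using pa(2) by(metis mult_cancel_right less_irrefl of_nat_eq_1_iff)
 have "h v = 0" if "v \<noteq> a" for v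
 proof (rule ccontr)
  assume "h v \<noteq> 0"
  hence "v \<in> {u. h u \<noteq> 0} - {a}" using that by simp
  moreover have "finite ({u. h u \<noteq> 0} - {a})" using fin by simp
  moreover have "\<forall>u\<in>{u. h u \<noteq> 0} - {a}. real (h u) * (1/x) powi u \<ge> 0" using x by simp
  ultimately have "real (h v) * (1/x) powi v = 0"
   using \<open>r' = 0\<close> sum_nonneg_eq_0_iff[of "{u. h u \<noteq> 0} - {a}" "\<lambda>u. real (h u) * (1/x) powi u"]
   unfolding r'_def by blast
  thus False using \<open>h v \<noteq> 0\<close> x by simp
 qed
 thus "h u = (if u = a then 1 else 0) \<and> g u = (if u = a then 1 else 0)"
  using h1 le[of u] le[of a] g by(cases "u = a") auto
qed

lemma ev_delta: "(\<And>u. g u = (if u = a then 1 else 0)) ==> ev x g = x powi a"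
 using ev_superset[of "{a}" g x] by auto

lemma prod_eq_1_imp:
 fixes h :: "'a => real"
 assumes "finite A" "\<And>a. a \<in> A ==> h a \<ge> 1" "(\<Prod>a\<in>A. h a) = 1" "a \<in> A"
 shows "h a = 1"
proof -
 have "(\<Prod>a\<in>A. h a) = h a * (\<Prod>a\<in>A - {a}. h a)" using assms by(simp add: prod.remove)
 moreover have "(\<Prod>a\<in>A - {a}. h a) \<ge> 1" using assms(2) by(intro prod_ge_1) auto
 moreover have "h a \<ge> 1" using assms by simp
 ultimately show ?thesis using assms(3)
  by(metis mult.right_neutral mult_less_cancel_left_pos mult_mono' not_less order.strict_iff_order
    zero_less_one less_le_trans le_less)
qed

text \<open>Finite type enters through \<open>pvec\<close>: a positive row vector whose product with
  the Cartan matrix is again positive.\<close>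

locale gpa_finite = gpa_data +
 assumes conn: "J \<noteq> {} ==> (\<And>i y. i \<in> J ==> adj C i y ==> y \<in> J) ==> J = UNIV"
  and pvec: "\<exists>p::'a => real. (\<forall>i. p i > 0) \<and>
   (\<forall>y. (\<Sum>i | adj C i y. p i * real (mul C i y)) < 2 * p y)"
begin

definition Nz where "Nz i l v \<longleftrightarrow> (\<exists>u. N i l (u, v) \<noteq> 0)"
definition Kz where "Kz i l v \<longleftrightarrow> (\<exists>u. K i l (u, v) \<noteq> 0)"

lemma Kz_Nz: "Kz i l v ==> Nz i l v"
 using K_le_N by(metis Kz_def Nz_def le_zero_eq)

lemma Nz_nonneg: "Nz i l v ==> v \<ge> 0"
 unfolding Nz_def using N_neg by(metis not_le snd_conv)

lemma Kz_Nz_orth: "Kz i j u ==> v > u ==> \<not> Nz i l v"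
 unfolding Kz_def Nz_def by(metis orthogonality)

lemma Nx_zero_iff: "x > 0 ==> Nx x i l v = 0 \<longleftrightarrow> \<not> Nz i l v"
 by(simp add: Nx_eq_0_iff Nz_def)

lemma Kx_zero_iff: "x > 0 ==> Kx x i l v = 0 \<longleftrightarrow> \<not> Kz i l v"
 by(simp add: Kx_eq_0_iff Kz_def)

lemma br_1: "br 1 i y = real (f i y)"
 by(simp add: br_def)

text \<open>Without kernels the total dimension in \<open>t\<close>-degree \<open>v\<close>, weighted by \<open>p\<close>, would be a positive and
 uniformly concave function of \<open>v\<close>.\<close>

lemma Kz_exists: "\<exists>i v. Kz i l v"
proof (rule ccontr)
 assume "\<nexists>i v. Kz i l v"
 hence K0: "Kx 1 i l v = 0" for i v by(simp add: Kx_zero_iff)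
 obtain p :: "'a => real" where p: "\<And>i. p i > 0" "\<And>y. (\<Sum>i | adj C i y. p i * real (f i y)) < 2 * p y"
  using pvec by blast
 define a where "a i w = Nx 1 i l (int w)" for i and w :: nat
 have rec: "a i (Suc (Suc w)) + a i w = (\<Sum>y | adj C i y. real (f i y) * a y (Suc w))" for i w
  using Nx_rec_all[of 1 i l "int w + 1"] K0 by(simp add: br_1 a_def add.commute)
 have rec0: "a i 1 = (\<Sum>y | adj C i y. real (f i y) * a y 0)" for i
  using Nx_rec_all[of 1 i l 0] K0 by(simp add: br_1 a_def Nx_neg)
 have a0: "a i w \<ge> 0" for i w by(simp add: a_def Nx_nonneg)
 \<comment> \<open>At x = 1 the values are sums of dimensions, hence integers; this gives a gap of 1
   where positivity alone would not be uniform.\<close>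
 have a_int: "a i w \<ge> 1" if "a i w \<noteq> 0" for i w
 proof -
  obtain T :: nat where "a i w = real T"
   using that[of "\<Sum>u\<in>{u. N i l (u, int w) \<noteq> 0}. N i l (u, int w)"]
   by(simp add: a_def Nx_def ev_def flip: of_nat_sum)
  thus ?thesis using that by(cases T) auto
 qed
 define n where "n w = (\<Sum>i\<in>UNIV. p i * a i w)" for w
 define c where "c = Min ((\<lambda>y. 2 * p y - (\<Sum>i | adj C i y. p i * real (f i y))) ` UNIV)"
 have c: "c > 0" unfolding c_def using p(2) by(subst Min_gr_iff) auto
 have cle: "(\<Sum>i | adj C i y. p i * real (f i y)) \<le> 2 * p y - c" for y
 proof -
  have "c \<le> 2 * p y - (\<Sum>i | adj C i y. p i * real (f i y))" unfolding c_def by(rule Min_le) auto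
  thus ?thesis by simp
 qed
 \<comment> \<open>The recursion also runs backwards, so two consecutive zero vectors would force
   the initial vector to vanish.\<close>
 have nz: "\<exists>i. a i w \<noteq> 0 \<or> a i (Suc w) \<noteq> 0" for w
 proof (induction w)
  case 0
  have "a l 0 = 1" by(simp add: a_def Nx_0)
  thus ?case by(intro exI[of _ l]) simp
 next
  case (Suc w)
  show ?case
  proof (rule ccontr)
   assume "\<nexists>i. a i (Suc w) \<noteq> 0 \<or> a i (Suc (Suc w)) \<noteq> 0"
   hence z: "a i (Suc w) = 0" "a i (Suc (Suc w)) = 0" for i by auto
   hence "a i w = 0" for i using rec[of i w] by simp
   thus False using Suc z by blast
  qed
 qed
 have nz1: "\<exists>i. a i (Suc w) \<noteq> 0" for w
 proof (rule ccontr)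
  assume "\<nexists>i. a i (Suc w) \<noteq> 0"
  hence z: "a i (Suc w) = 0" for i by auto
  have "a i (Suc (Suc w)) + a i w = 0" for i using rec[of i w] z by simp
  hence "a i w = 0" for i using a0[of i w] a0[of i "Suc (Suc w)"] by(metis add_nonneg_eq_0_iff)
  thus False using nz[of w] z by blast
 qed
 have sum1: "(\<Sum>y\<in>UNIV. a y (Suc w)) \<ge> 1" for w
 proof -
  obtain i where "a i (Suc w) \<noteq> 0" using nz1 by blast
  hence "1 \<le> a i (Suc w)" by(rule a_int)
  also have "\<dots> \<le> (\<Sum>y\<in>UNIV. a y (Suc w))" by(rule member_le_sum) (auto simp: a0)
  finally show ?thesis .
 qed
 \<comment> \<open>Pairing the recursion with \<open>p\<close> bounds the second difference by -c
   uniformly. The slope then tends to minus infinity, against nonnegativity.\<close>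
 have conc: "n (Suc (Suc w)) + n w \<le> 2 * n (Suc w) - c" for w
 proof -
  have "n (Suc (Suc w)) + n w = (\<Sum>i\<in>UNIV. \<Sum>y | adj C i y. p i * real (f i y) * a y (Suc w))"
   unfolding n_def sum.distrib[symmetric] distrib_left[symmetric] rec sum_distrib_left
   by(simp add: mult.assoc)
  also have "\<dots> = (\<Sum>i\<in>UNIV. \<Sum>y\<in>UNIV. if adj C i y then p i * real (f i y) * a y (Suc w) else 0)"
   by(rule sum.cong[OF refl])
    (use sum.inter_filter[of UNIV "\<lambda>y. p _ * real (f _ y) * a y (Suc w)" "adj C _"] in simp)
  also have "\<dots> = (\<Sum>y\<in>UNIV. \<Sum>i\<in>UNIV. if adj C i y then p i * real (f i y) * a y (Suc w) else 0)"
   by(rule sum.swap)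
  also have "\<dots> = (\<Sum>y\<in>UNIV. (\<Sum>i | adj C i y. p i * real (f i y)) * a y (Suc w))"
  proof (rule sum.cong[OF refl])
   fix y
   have "(\<Sum>i\<in>UNIV. if adj C i y then p i * real (f i y) * a y (Suc w) else 0) =
    (\<Sum>i | adj C i y. p i * real (f i y) * a y (Suc w))" using sum.inter_filter[of UNIV "\<lambda>i. p i * real (f i y) * a y (Suc w)"] by simp
   thus "(\<Sum>i\<in>UNIV. if adj C i y then p i * real (f i y) * a y (Suc w) else 0) =
    (\<Sum>i | adj C i y. p i * real (f i y)) * a y (Suc w)" by(simp add: sum_distrib_right)
  qed
  also have "\<dots> \<le> (\<Sum>y\<in>UNIV. (2 * p y - c) * a y (Suc w))"
   by(intro sum_mono mult_right_mono cle a0)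
  also have "\<dots> = 2 * n (Suc w) - c * (\<Sum>y\<in>UNIV. a y (Suc w))"
   by(simp add: n_def left_diff_distrib sum_subtractf sum_distrib_left mult.assoc)
  also have "\<dots> \<le> 2 * n (Suc w) - c" using sum1[of w] c by simp
  finally show ?thesis .
 qed
 have slope: "n (Suc w) - n w \<le> n 1 - n 0 - c * real w" for w
 proof (induction w)
  case (Suc w)
  thus ?case using conc[of w] by(simp add: algebra_simps)
 qed simp
 obtain W :: nat where W: "real W > (n 1 - n 0 + 1) / c" using reals_Archimedean2 by blast
 have sl1: "n (Suc w) \<le> n w - 1" if "w \<ge> W" for w
 proof -
  have "c * real w \<ge> c * real W" using that c by simp
  moreover have "c * real W > n 1 - n 0 + 1" using W c by(simp add: field_simps)
  ultimately show ?thesis using slope[of w] by linarith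
 qed
 have "n (W + k) \<le> n W - real k" for k
 proof (induction k)
  case (Suc k)
  thus ?case using sl1[of "W + k"] by simp
 qed simp
 moreover obtain k :: nat where "real k > n W" using reals_Archimedean2 by blast
 ultimately have "n (W + k) < 0" by(metis diff_less_0_iff_less le_less_trans)
 moreover have "n w \<ge> 0" for w unfolding n_def using p(1) a0 by(intro sum_nonneg mult_nonneg_nonneg) (auto intro: less_imp_le)
 ultimately show False by(metis not_le)
qed

text \<open>At a vertex that carries a kernel the dimensions stop by orthogonality. If they stop at
  \<open>i\<close>, the left side of the recursion at \<open>i\<close> vanishes in high degrees and
  with it the nonnegative terms of the neighbours; connectedness spreads this to all
  vertices.\<close>

lemma Nz_bounded: "\<exists>V. \<forall>i v. v > V \<longrightarrow> \<not> Nz i l v"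
proof -
 let ?J = "{i. \<exists>V. \<forall>v>V. \<not> Nz i l v}"
 obtain i0 v0 where "Kz i0 l v0" using Kz_exists by blast
 hence "i0 \<in> ?J" using Kz_Nz_orth by blast
 hence ne: "?J \<noteq> {}" by blast
 have closed: "y \<in> ?J" if i: "i \<in> ?J" and y: "adj C i y" for i y
 proof -
  obtain V where V: "\<forall>v>V. \<not> Nz i l v" using i by blast
  have "\<not> Nz y l v" if v: "v > max V 0 + 1" for v
  proof -
   have v0: "v \<noteq> -1" using v by linarith
   have "Nx 1 i l w = 0" if "w > V" for w using V that by(simp add: Nx_zero_iff)
   moreover have "Kx 1 i l (v - 1) \<le> Nx 1 i l (v - 1)" by(rule Kx_le_Nx) simp
   hence "Kx 1 i l (v - 1) = 0" using calculation[of "v - 1"] v Kx_nonneg[of 1 i l "v - 1"] by simp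
   ultimately have "(\<Sum>z | adj C i z. br 1 i z * Nx 1 z l v) = 0"
    using Nx_rec_all[of 1 i l v] v v0 by simp
   moreover have "br 1 i z * Nx 1 z l v \<ge> 0" for z by(simp add: br_1 Nx_nonneg)
   ultimately have "\<forall>z\<in>{z. adj C i z}. br 1 i z * Nx 1 z l v = 0"
    by(subst (asm) sum_nonneg_eq_0_iff) auto
   hence "br 1 i y * Nx 1 y l v = 0" using y by blast
   thus ?thesis using mul_pos[OF y] by(simp add: br_1 Nx_zero_iff)
  qed
  thus ?thesis by blast
 qed
 have "?J = UNIV" by(rule conn[OF ne closed])
 hence "\<forall>i. \<exists>V. \<forall>v>V. \<not> Nz i l v" by blast
 then obtain V where V: "\<forall>i. \<forall>v>V i. \<not> Nz i l v" by metis
 have "\<not> Nz i l v" if "v > Max (range V)" for i v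
 proof -
  have "V i \<le> Max (range V)" by simp
  thus ?thesis using V that by auto
 qed
 thus ?thesis by blast
qed

lemma Nz_bounded_all: "\<exists>m::nat. \<forall>i l v. v > int m \<longrightarrow> \<not> Nz i l v"
proof -
 obtain V where V: "\<And>l i v. v > V l ==> \<not> Nz i l v" using Nz_bounded by metis
 have "\<not> Nz i l v" if "v > int (nat (Max (range V)))" for i l v
 proof -
  have "V l \<le> Max (range V)" by simp
  hence "v > V l" using that by linarith
  thus ?thesis by(rule V)
 qed
 thus ?thesis by blast
qed

end

lemma powi_2_inject: "(2::real) powi a = 2 powi b \<longleftrightarrow> a = b"
 using power_int_strict_increasing[of a b "2::real"] power_int_strict_increasing[of b a "2::real"]
 by(metis less_irrefl linorder_neqE one_less_numeral_iff semiring_norm(76))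

section \<open>The kernels form a permutation\<close>

context gpa_finite
begin

text \<open>A kernel is part of a nonzero dimension, so by orthogonality neither of two kernels at
  the same vertex \<open>i\<close> can lie above the other, even in different columns.\<close>

lemma Kz_unique:
 assumes "Kz i l w" "Kz i l' w'"
 shows "w = w'"
 using assms Kz_Nz_orth Kz_Nz by(metis linorder_neqE)

lemma coeff_pos:
 fixes x :: real
 assumes x: "x > 1"
 shows "1 - x powi (- 2 * int (d i)) > 0"
proof -
 have "x powi (2 * int (d i)) > 1" using powi_ge_1[OF x, of "2 * d i"] d_pos[of i] by simp
 hence "inverse (x powi (2 * int (d i))) < 1" by(simp add: inverse_less_1_iff)
 thus ?thesis by(simp add: power_int_minus)
qed

lemma euler_left':
 assumes "x > 0" "s \<ge> 0"
 shows "\<exists>m::nat. (\<forall>i l v. v > int m \<longrightarrow> \<not> Nz i l v) \<and>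
  (\<Sum>i\<in>UNIV. \<Sum>w\<le>m. (1 - x powi (- 2 * int (d i))) * Nx (1/x) i j (int w) * Kx x i l (int w + s))
  = (1 - x powi (- 2 * int (d j))) * Nx x j l s"
proof -
 obtain m0 :: nat where m0: "\<forall>i l v. v > int m0 \<longrightarrow> \<not> Nz i l v" using Nz_bounded_all by blast
 let ?m = "max m0 (nat s)"
 have z: "\<forall>i l v. v > int ?m \<longrightarrow> \<not> Nz i l v" using m0 by auto
 moreover have "(\<Sum>i\<in>UNIV. \<Sum>w\<le>?m. (1 - x powi (- 2 * int (d i))) * Nx (1/x) i j (int w) * Kx x i l (int w + s))
  = (1 - x powi (- 2 * int (d j))) * Nx x j l s"
  by(rule euler_left[OF assms(1,2)]) (use assms z in \<open>auto simp: Nx_zero_iff\<close>)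
 ultimately show ?thesis by blast
qed

text \<open>At s = 0 \<open>euler_left\<close> says that N(1/x) transposed times K(x), weighted by
  the c_i, is the diagonal matrix of the c_l. Column \<open>l\<close> of \<open>K\<close> has a
  nonzero entry, in row \<sigma>(l) say. Off the diagonal the identity makes \<sigma> injective; on
  the diagonal it reads c(\<sigma> l) P(l) = c(l) with P(l) \<ge> 1, and the product over all
  \<open>l\<close> forces P(l) = 1.\<close>

lemma structure_1:
 "\<exists>\<sigma> g w. bij \<sigma> \<and> (\<forall>i l u v. K i l (u, v) = (if i = \<sigma> l \<and> u = g l \<and> v = w l then 1 else 0)) \<and>
  (\<forall>l u. N (\<sigma> l) l (u, w l) = (if u = g l then 1 else 0)) \<and> (\<forall>l. d (\<sigma> l) = d l)"
proof -
 let ?x = "2 :: real"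
 have x: "?x > 0" "?x > 1" by simp_all
 define c where "c i = 1 - ?x powi (- 2 * int (d i))" for i
 have c: "c i > 0" for i unfolding c_def using coeff_pos[OF x(2)] by simp
 have t: "c i * Nx (1/?x) i j (int v) * Kx ?x i l (int v) \<ge> 0" for i j l v
  using c[of i] Nx_nonneg[of "1/?x"] Kx_nonneg[of ?x] by(intro mult_nonneg_nonneg) auto
 have E: "\<exists>m::nat. (\<forall>i l v. v > int m \<longrightarrow> \<not> Nz i l v) \<and>
   (\<Sum>i\<in>UNIV. \<Sum>w\<le>m. c i * Nx (1/?x) i j (int w) * Kx ?x i l (int w)) = (if j = l then c l else 0)" for j l
 proof -
  obtain m :: nat where "\<forall>i l v. v > int m \<longrightarrow> \<not> Nz i l v"
   "(\<Sum>i\<in>UNIV. \<Sum>w\<le>m. (1 - ?x powi (- 2 * int (d i))) * Nx (1/?x) i j (int w) * Kx ?x i l (int w + 0))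
    = (1 - ?x powi (- 2 * int (d j))) * Nx ?x j l 0"
   using euler_left'[OF x(1), of 0 j l] by blast
  thus ?thesis by(intro exI[of _ m]) (auto simp: Nx_0 c_def)
 qed
 have orth: "\<not> Nz i j w" if K: "Kz i l w" and jl: "j \<noteq> l" for i j l w
 proof -
  obtain m :: nat where m: "\<forall>i l v. v > int m \<longrightarrow> \<not> Nz i l v"
   "(\<Sum>i\<in>UNIV. \<Sum>w\<le>m. c i * Nx (1/?x) i j (int w) * Kx ?x i l (int w)) = 0"
   using E[of j l] jl by auto
  have w: "0 \<le> w" "w \<le> int m" using Kz_Nz[OF K] Nz_nonneg m(1) by(auto simp: not_less[symmetric])
  have "\<forall>i\<in>UNIV. (\<Sum>w\<le>m. c i * Nx (1/?x) i j (int w) * Kx ?x i l (int w)) = 0"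
   using m(2) by(subst (asm) sum_nonneg_eq_0_iff) (auto intro: sum_nonneg t)
  hence "(\<Sum>w\<le>m. c i * Nx (1/?x) i j (int w) * Kx ?x i l (int w)) = 0" by blast
  hence "\<forall>w\<in>{..m}. c i * Nx (1/?x) i j (int w) * Kx ?x i l (int w) = 0"
   using t sum_nonneg_eq_0_iff[of "{..m}" "\<lambda>w. c i * Nx (1/?x) i j (int w) * Kx ?x i l (int w)"] by blast
  moreover have "nat w \<in> {..m}" using w by auto
  ultimately have "c i * Nx (1/?x) i j (int (nat w)) * Kx ?x i l (int (nat w)) = 0" by blast
  hence "Nx (1/?x) i j w = 0 \<or> Kx ?x i l w = 0" using c[of i] w by simp
  thus ?thesis using K Nx_zero_iff[of "1/?x" i j w] Kx_zero_iff[of ?x i l w] by auto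
 qed
 have "\<forall>l. \<exists>i w. Kz i l w" using Kz_exists by blast
 then obtain \<sigma> w where sw: "\<And>l. Kz (\<sigma> l) l (w l)" by metis
 have inj: "inj \<sigma>"
 proof (rule injI, rule ccontr)
  fix l j assume e: "\<sigma> l = \<sigma> j" and n: "l \<noteq> j"
  have "w l = w j" using Kz_unique sw[of l] sw[of j] e by metis
  hence "Nz (\<sigma> l) j (w l)" using Kz_Nz[OF sw[of j]] e by simp
  thus False using orth[OF sw[of l], of j] n by simp
 qed
 hence bij: "bij \<sigma>" using finite_UNIV_inj_surj[of \<sigma>] by(simp add: bij_def)
 have Kz_iff: "i = \<sigma> l \<and> v = w l" if K: "Kz i l v" for i l v
 proof -
  obtain j where j: "i = \<sigma> j" using bij by(metis bij_pointE)
  have v: "v = w j" using Kz_unique K sw[of j] j by metis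
  have "j = l"
  proof (rule ccontr)
   assume "j \<noteq> l"
   hence "\<not> Nz i j v" using orth[OF K] by simp
   thus False using Kz_Nz[OF sw[of j]] j v by simp
  qed
  thus ?thesis using j v by simp
 qed
 have P: "c (\<sigma> l) * (Nx (1/?x) (\<sigma> l) l (w l) * Kx ?x (\<sigma> l) l (w l)) = c l" for l
 proof -
  obtain m :: nat where m: "\<forall>i l v. v > int m \<longrightarrow> \<not> Nz i l v"
   "(\<Sum>i\<in>UNIV. \<Sum>v\<le>m. c i * Nx (1/?x) i l (int v) * Kx ?x i l (int v)) = c l"
   using E[of l l] by auto
  have wl: "0 \<le> w l" "w l \<le> int m" using Kz_Nz[OF sw[of l]] Nz_nonneg m(1) by(auto simp: not_less[symmetric])
  let ?t = "c (\<sigma> l) * Nx (1/?x) (\<sigma> l) l (w l) * Kx ?x (\<sigma> l) l (w l)"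
  have tt: "c i * Nx (1/?x) i l (int v) * Kx ?x i l (int v) = (if v = nat (w l) then (if i = \<sigma> l then ?t else 0) else 0)" for i v
  proof (cases "v = nat (w l) \<and> i = \<sigma> l")
   case True
   thus ?thesis using wl by simp
  next
   case False
   have "\<not> Kz i l (int v)"
   proof
    assume "Kz i l (int v)"
    hence "i = \<sigma> l" "int v = w l" using Kz_iff by blast+
    moreover from this(2) have "v = nat (w l)" by(metis nat_int)
    ultimately show False using False by simp
   qed
   hence "Kx ?x i l (int v) = 0" using Kx_zero_iff[OF x(1)] by simp
   thus ?thesis using False by(simp only: mult_zero_right if_False split: if_split) auto
  qed
  have inner: "(\<Sum>v\<le>m. c i * Nx (1/?x) i l (int v) * Kx ?x i l (int v)) = (if i = \<sigma> l then ?t else 0)" for i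
  proof -
   have "(\<Sum>v\<le>m. c i * Nx (1/?x) i l (int v) * Kx ?x i l (int v)) =
     (\<Sum>v\<le>m. if v = nat (w l) then (if i = \<sigma> l then ?t else 0) else 0)"
    by(rule sum.cong[OF refl]) (rule tt)
   also have "\<dots> = (if i = \<sigma> l then ?t else 0)" using wl by(subst sum.delta) auto
   finally show ?thesis .
  qed
  have "(\<Sum>i\<in>UNIV. \<Sum>v\<le>m. c i * Nx (1/?x) i l (int v) * Kx ?x i l (int v)) = (\<Sum>i\<in>UNIV. if i = \<sigma> l then ?t else 0)"
   by(rule sum.cong[OF refl]) (rule inner)
  also have "\<dots> = ?t" by(subst sum.delta) auto
  finally have "?t = c l" using m(2) by(simp only:)
  thus ?thesis by(simp only: mult.assoc)
 qed
 define P' where "P' l = Nx (1/?x) (\<sigma> l) l (w l) * Kx ?x (\<sigma> l) l (w l)" for l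
 obtain g where g: "\<And>l. K (\<sigma> l) l (g l, w l) \<noteq> 0" using sw unfolding Kz_def by metis
 note one = ev_prod_ge_1[OF x(1) fin_N K_le_N, folded Nx_def Kx_def]
 have P1: "P' l \<ge> 1" for l unfolding P'_def by(rule one(1)[OF g])
 \<comment> \<open>The permutation does not change the product of the positive numbers
   \<open>c l\<close>, so it cancels and only the product of the factors \<open>P' l\<close> is
   left.\<close>
 have "(\<Prod>l\<in>UNIV. c (\<sigma> l) * P' l) = (\<Prod>l\<in>UNIV. c l)" using P by(simp add: P'_def)
 moreover have "(\<Prod>l\<in>UNIV. c (\<sigma> l)) = (\<Prod>l\<in>UNIV. c l)"
  using prod.reindex_bij_betw[of \<sigma> UNIV UNIV c] bij by simp
 ultimately have "(\<Prod>l\<in>UNIV. c l) * (\<Prod>l\<in>UNIV. P' l) = (\<Prod>l\<in>UNIV. c l)" by(simp add: prod.distrib)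
 moreover have "(\<Prod>l\<in>UNIV. c l) \<noteq> 0" using c by(simp add: less_imp_neq[symmetric])
 ultimately have "(\<Prod>l\<in>UNIV. P' l) = 1" by simp
 hence P'1: "P' l = 1" for l using prod_eq_1_imp[of UNIV P' l] P1 by simp
 have Ng: "N (\<sigma> l) l (u, w l) = (if u = g l then 1 else 0) \<and> K (\<sigma> l) l (u, w l) = (if u = g l then 1 else 0)" for l u
  by(rule one(2)[OF g]) (use P'1[of l] in \<open>simp add: P'_def\<close>)
 have "K i l (u, v) = (if i = \<sigma> l \<and> u = g l \<and> v = w l then 1 else 0)" for i l u v
 proof (cases "i = \<sigma> l \<and> v = w l")
  case True
  thus ?thesis using Ng by simp
 next
  case False
  hence "\<not> Kz i l v" using Kz_iff by blast
  hence "K i l (u, v) = 0" unfolding Kz_def by blast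
  thus ?thesis using False by simp
 qed
 moreover have "d (\<sigma> l) = d l" for l
 proof -
  have "c (\<sigma> l) = c l" using P[of l] P'1[of l] by(simp add: P'_def)
  hence "?x powi (- 2 * int (d (\<sigma> l))) = ?x powi (- 2 * int (d l))" by(simp add: c_def)
  thus ?thesis unfolding powi_2_inject by simp
 qed
 ultimately show ?thesis using bij Ng by blast
qed

context
 fixes \<sigma> :: "'a => 'a" and g w :: "'a => int"
 assumes bij: "bij \<sigma>"
  and K_eq: "\<And>i l u v. K i l (u, v) = (if i = \<sigma> l \<and> u = g l \<and> v = w l then 1 else 0)"
  and d_\<sigma>: "\<And>l. d (\<sigma> l) = d l"
begin

lemma Kz_iff: "Kz i l v \<longleftrightarrow> i = \<sigma> l \<and> v = w l"
 by(auto simp: Kz_def K_eq)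

text \<open>In the highest nonzero t-degree M the recursion at M + 1 reduces to the equality of
  dimension and kernel, and the only kernel of column \<open>l\<close> sits in degree
  \<open>w l\<close>.\<close>

lemma top_degree: "v > w l ==> \<not> Nz i l v"
proof -
 let ?S = "{v. \<exists>i. Nz i l v}"
 obtain V where V: "\<forall>i v. v > V \<longrightarrow> \<not> Nz i l v" using Nz_bounded by blast
 have "?S \<subseteq> {0..V}" using V Nz_nonneg by(auto simp: not_less[symmetric])
 hence fin: "finite ?S" by(rule finite_subset) simp
 have ne: "?S \<noteq> {}" using Kz_Nz Kz_iff by blast
 define M where "M = Max ?S"
 have "M \<in> ?S" unfolding M_def by(rule Max_in[OF fin ne])
 then obtain i0 where i0: "Nz i0 l M" by blast
 have big: "\<not> Nz i l v" if "v > M" for i v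
 proof
  assume "Nz i l v"
  hence "v \<le> M" unfolding M_def by(intro Max_ge[OF fin]) blast
  thus False using that by simp
 qed
 have M0: "M \<ge> 0" using Nz_nonneg[OF i0] .
 have "Nx 1 i0 l (M + 1 + 1) = 0" "Nx 1 y l (M + 1) = 0" for y using big by(simp_all add: Nx_zero_iff)
 hence "Nx 1 i0 l M = Kx 1 i0 l M" using Nx_rec_all[of 1 i0 l "M + 1"] M0 by simp
 hence "Kz i0 l M" using i0 Nx_zero_iff[of 1 i0 l M] Kx_zero_iff[of 1 i0 l M] by simp
 hence "M = w l" using Kz_iff by simp
 thus "v > w l ==> \<not> Nz i l v" using big by simp
qed

lemma w_nonneg: "w l \<ge> 0"
 using Kz_Nz[of "\<sigma> l" l "w l"] Nz_nonneg by(auto simp: Kz_iff)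

lemma N_top: "N i l (u, w l) = (if i = \<sigma> l \<and> u = g l then 1 else 0)"
proof -
 have z: "N i l (u, v) = 0" if "v > w l" for i u v using top_degree[OF that] by(simp add: Nz_def)
 let ?n = "(u - 2 * int (d i), w l + 2)"
 have "N i l ?n + N i l (?n + (2 * int (d i), -2)) =
  (\<Sum>s\<in>nb i. N (fst s) l (?n - shift_deg i s)) + K i l (?n + (2 * int (d i), -2))"
  by(rule N_rec) (use w_nonneg[of l] in simp)
 moreover have "N (fst s) l (?n - shift_deg i s) = 0" for s
  by(cases s) (simp add: shift_deg_def z)
 ultimately show ?thesis by(simp add: z K_eq)
qed

text \<open>By \<open>N_le\<close> an empty t-degree makes the next one empty, and so on up to the
  top degree, which is not empty.\<close>

lemma Nz_chain: "0 \<le> v ==> v \<le> w l ==> \<exists>i. Nz i l v"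
proof (rule ccontr)
 assume v: "0 \<le> v" "v \<le> w l" and n: "\<nexists>i. Nz i l v"
 have "\<nexists>i. Nz i l (v + int k)" for k
 proof (induction k)
  case 0
  thus ?case using n by simp
 next
  case (Suc k)
  have "N i l (u, v + int (Suc k)) = 0" for i u
  proof -
   have "N (fst s) l ((u, v + int (Suc k)) - shift_deg i s) = 0" for s
    using Suc by(cases s) (simp add: shift_deg_def Nz_def)
   thus ?thesis using N_le[of "(u, v + int (Suc k))" i l] v by simp
  qed
  thus ?case by(simp add: Nz_def)
 qed
 from this[of "nat (w l - v)"] have "\<nexists>i. Nz i l (w l)" using v by simp
 thus False using Kz_Nz Kz_iff by blast
qed

lemma Nx_top: "Nx x i l (w l) = (if i = \<sigma> l then x powi g l else 0)"
proof (cases "i = \<sigma> l")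
 case True
 thus ?thesis unfolding Nx_def using ev_delta[of "\<lambda>u. N i l (u, w l)" "g l" x] by(simp add: N_top)
qed (simp add: Nx_def N_top)

text \<open>Read from the top, the column of \<open>l\<close> at 1/x satisfies the same recursion of
  order two as the column of \<sigma>(l) at x, with the same initial values after scaling by x^(g
  l). So they coincide as long as both last. Since no degree in between is empty they have equal
  length, and comparing the last vectors gives \<sigma>(\<sigma> l) = l.\<close>

lemma duality_involution: "\<sigma> (\<sigma> l) = l \<and> w (\<sigma> l) = w l \<and> g (\<sigma> l) = g l"
proof -
 let ?x = "2 :: real"
 have x: "?x > 0" by simp
 define a where "a v i = ?x powi g l * Nx (1/?x) i l (w l - v)" for v i
 define b where "b v i = Nx ?x i (\<sigma> l) v" for v i
 have ra: "?x powi int (d i) * a (v + 1) i = (\<Sum>y | adj C i y. br ?x i y * a v y) - ?x powi (- int (d i)) * a (v - 1) i"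
  if v: "0 \<le> v" "v \<le> w l" for v i
 proof -
  have "Kx (1/?x) i l (w l - v - 1) = 0" using v by(simp add: Kx_zero_iff Kz_iff)
  hence "?x powi (- int (d i)) * Nx (1/?x) i l (w l - v + 1) + ?x powi int (d i) * Nx (1/?x) i l (w l - v - 1) =
   (\<Sum>y | adj C i y. br ?x i y * Nx (1/?x) y l (w l - v))"
   using Nx_rec_inv[OF x, of i l "w l - v"] v by simp
  hence "?x powi int (d i) * Nx (1/?x) i l (w l - (v + 1)) =
   (\<Sum>y | adj C i y. br ?x i y * Nx (1/?x) y l (w l - v)) - ?x powi (- int (d i)) * Nx (1/?x) i l (w l - (v - 1))"
   by(simp add: algebra_simps)
  hence "?x powi g l * (?x powi int (d i) * Nx (1/?x) i l (w l - (v + 1))) =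
   ?x powi g l * ((\<Sum>y | adj C i y. br ?x i y * Nx (1/?x) y l (w l - v)) - ?x powi (- int (d i)) * Nx (1/?x) i l (w l - (v - 1)))"
   by(rule arg_cong)
  thus ?thesis
   unfolding a_def by(simp only: right_diff_distrib sum_distrib_left mult.left_commute)
 qed
 have rb: "?x powi int (d i) * b (v + 1) i = (\<Sum>y | adj C i y. br ?x i y * b v y) - ?x powi (- int (d i)) * b (v - 1) i"
  if v: "0 \<le> v" "v \<le> w (\<sigma> l)" for v i
 proof -
  have "Kx ?x i (\<sigma> l) (v - 1) = 0" using v by(simp add: Kx_zero_iff Kz_iff)
  thus ?thesis using Nx_rec_all[OF x, of i "\<sigma> l" v] v by(simp add: b_def)
 qed
 have a0: "a 0 i = b 0 i" for i by(simp add: a_def b_def Nx_top Nx_0 power_int_divide_distrib)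
 have am: "a (-1) i = 0" "b (-1) i = 0" for i
  by(simp_all add: a_def b_def Nx_neg Nx_zero_iff top_degree)
 have ab: "int k \<le> min (w l) (w (\<sigma> l)) + 1 ==> a (int k) = b (int k)" for k
 proof (induction k rule: less_induct)
  case (less k)
  show ?case
  proof (cases k)
   case 0
   thus ?thesis using a0 by(simp add: fun_eq_iff)
  next
   case (Suc k')
   have e1: "a (int k') = b (int k')" using less Suc by simp
   have e2: "a (int k' - 1) = b (int k' - 1)"
   proof (cases k')
    case 0
    thus ?thesis using am by(simp add: fun_eq_iff)
   next
    case (Suc k'')
    thus ?thesis using less.IH[of k''] less.prems \<open>k = Suc k'\<close> by simp
   qed
   have k': "0 \<le> int k'" "int k' \<le> w l" "int k' \<le> w (\<sigma> l)" using less.prems Suc by auto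
   have "?x powi int (d i) * a (int k' + 1) i = ?x powi int (d i) * b (int k' + 1) i" for i
    unfolding ra[OF k'(1,2)] rb[OF k'(1,3)] e1 e2 by simp
   hence "a (int k' + 1) i = b (int k' + 1) i" for i by simp
   thus ?thesis using Suc by(simp add: fun_eq_iff add.commute)
  qed
 qed
 have weq: "w (\<sigma> l) = w l"
 proof (rule ccontr)
  assume "w (\<sigma> l) \<noteq> w l"
  then consider "w l < w (\<sigma> l)" | "w (\<sigma> l) < w l" by linarith
  thus False
  proof cases
   case 1
   have "a (w l + 1) = b (w l + 1)" using ab[of "nat (w l + 1)"] 1 w_nonneg[of l] by simp
   moreover have "a (w l + 1) i = 0" for i by(simp add: a_def Nx_neg)
   moreover obtain i where "Nz i (\<sigma> l) (w l + 1)" using Nz_chain[of "w l + 1" "\<sigma> l"] 1 w_nonneg[of l] by auto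
   ultimately show False using Nx_zero_iff[OF x, of i "\<sigma> l" "w l + 1"] by(simp add: b_def)
  next
   case 2
   let ?v = "w (\<sigma> l) + 1"
   have "a ?v = b ?v" using ab[of "nat ?v"] 2 w_nonneg[of "\<sigma> l"] by simp
   moreover have "b ?v i = 0" for i by(simp add: b_def Nx_zero_iff top_degree)
   moreover obtain i where "Nz i l (w l - ?v)"
    using Nz_chain[of "w l - ?v" l] 2 w_nonneg[of "\<sigma> l"] by auto
   ultimately show False using Nx_zero_iff[of "1/?x" i l "w l - ?v"] by(simp add: a_def fun_eq_iff)
  qed
 qed
 have "a (w l) = b (w l)" using ab[of "nat (w l)"] weq w_nonneg[of l] by simp
 hence "a (w l) l = b (w l) l" by simp
 hence "?x powi g l = (if l = \<sigma> (\<sigma> l) then ?x powi g (\<sigma> l) else 0)"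
  using Nx_top[of ?x l "\<sigma> l"] weq by(simp add: a_def b_def Nx_0)
 thus ?thesis using weq by(auto simp: powi_2_inject split: if_splits)
qed

text \<open>\<open>euler_left\<close> with the known kernels has a single term left. It relates
  column \<open>l\<close> in degree \<open>s\<close> to row \<sigma>(l) in the complementary degree
  w l - s.\<close>

lemma dual_identity:
 assumes x: "x > 0" and s: "s \<ge> 0"
 shows "(1 - x powi (- 2 * int (d l))) * (Nx (1/x) (\<sigma> l) j (w l - s) * x powi g l)
  = (1 - x powi (- 2 * int (d j))) * Nx x j l s"
proof -
 obtain m :: nat where m: "\<forall>i l v. v > int m \<longrightarrow> \<not> Nz i l v"
  "(\<Sum>i\<in>UNIV. \<Sum>v\<le>m. (1 - x powi (- 2 * int (d i))) * Nx (1/x) i j (int v) * Kx x i l (int v + s))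
  = (1 - x powi (- 2 * int (d j))) * Nx x j l s"
  using euler_left'[OF x s] by blast
 have wm: "w l \<le> int m" using m(1) Kz_Nz[of "\<sigma> l" l "w l"] by(auto simp: Kz_iff not_less[symmetric])
 have Kx: "Kx x i l v = (if i = \<sigma> l \<and> v = w l then x powi g l else 0)" for i v
 proof (cases "i = \<sigma> l \<and> v = w l")
  case True
  thus ?thesis unfolding Kx_def using ev_delta[of "\<lambda>u. K i l (u, v)" "g l" x] by(simp add: K_eq)
 qed (auto simp: Kx_def K_eq)
 let ?t = "(1 - x powi (- 2 * int (d l))) * (Nx (1/x) (\<sigma> l) j (w l - s) * x powi g l)"
 have "(\<Sum>v\<le>m. (1 - x powi (- 2 * int (d i))) * Nx (1/x) i j (int v) * Kx x i l (int v + s)) = (if i = \<sigma> l then ?t else 0)" for i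
 proof (cases "s \<le> w l")
  case True
  have "(\<Sum>v\<le>m. (1 - x powi (- 2 * int (d i))) * Nx (1/x) i j (int v) * Kx x i l (int v + s)) =
    (\<Sum>v\<le>m. if v = nat (w l - s) then (if i = \<sigma> l then ?t else 0) else 0)"
  proof (rule sum.cong[OF refl])
   fix v
   have "int v + s = w l \<longleftrightarrow> v = nat (w l - s)" using True by auto
   thus "(1 - x powi (- 2 * int (d i))) * Nx (1/x) i j (int v) * Kx x i l (int v + s) =
     (if v = nat (w l - s) then (if i = \<sigma> l then ?t else 0) else 0)"
    using True by(simp add: Kx d_\<sigma> mult.assoc)
  qed
  moreover have "nat (w l - s) \<le> m" using wm s True by simp
  ultimately show ?thesis by simp
 next
  case False
  hence "int v + s \<noteq> w l" for v by auto
  thus ?thesis using False by(simp add: Kx Nx_neg)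
 qed
 thus ?thesis using m(2) by simp
qed

lemma Nx_1: "x > 0 ==> Nx x j l 1 = (if adj C j l then x powi (- int (d j)) * br x j l else 0)"
proof -
 assume x: "x > 0"
 have "x powi int (d j) * Nx x j l 1 = (\<Sum>y | adj C j y. br x j y * (if y = l then 1 else 0))"
  using Nx_rec_all[OF x, of j l 0] by(simp add: Nx_neg Kx_neg Nx_0)
 also have "\<dots> = (\<Sum>y | adj C j y. if y = l then br x j l else 0)" by(rule sum.cong) auto
 also have "\<dots> = (if adj C j l then br x j l else 0)" by(simp add: sum.delta)
 finally have "x powi (- int (d j)) * (x powi int (d j) * Nx x j l 1) = x powi (- int (d j)) * (if adj C j l then br x j l else 0)"
  by simp
 moreover have "x powi (- int (d j)) * (x powi int (d j) * z) = z" for z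
 proof -
  have "x powi (- int (d j)) * (x powi int (d j) * z) = (x powi int (d j) * x powi (- int (d j))) * z"
   by(simp only: mult_ac)
  thus ?thesis by(simp only: powi_double(3)[OF x] mult_1)
 qed
 ultimately show ?thesis by(simp only: if_distrib[of "(*) _"] mult_zero_right)
qed

text \<open>In t-degree 1 the dimension at an edge is nonzero, so by duality the entry of column
  \<open>j\<close> at \<sigma>(l) is nonzero in degree w l - 1. This is not the top degree of column
  \<open>j\<close>, where only \<sigma>(j) occurs.\<close>

lemma w_le:
 assumes "adj C j l"
 shows "w l \<ge> 1 \<and> w l \<le> w j"
proof -
 let ?x = "2 :: real"
 have x: "?x > 0" "?x > 1" by simp_all
 have "Nx ?x j l 1 \<noteq> 0" using Nx_1[OF x(1), of j l] assms br_pos[OF x(1) assms] by simp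
 hence "Nx (1/?x) (\<sigma> l) j (w l - 1) \<noteq> 0"
  using dual_identity[OF x(1), of 1 l j] coeff_pos[OF x(2), of j] by auto
 hence nz: "Nz (\<sigma> l) j (w l - 1)" using Nx_zero_iff[of "1/?x"] by simp
 hence 1: "w l - 1 \<le> w j" using top_degree[of j "w l - 1" "\<sigma> l"] by linarith
 have "w l - 1 \<noteq> w j"
 proof
  assume e: "w l - 1 = w j"
  hence "\<sigma> l = \<sigma> j" using nz unfolding Nz_def e by(auto simp: N_top split: if_splits)
  hence "l = j" using bij by(metis bij_pointE)
  thus False using assms by(simp add: adj_def)
 qed
 thus ?thesis using 1 Nz_nonneg[OF nz] by simp
qed

text \<open>\<open>dual_identity\<close> is used at x with s = 1 and at 1/x with s = w l - 1.
  Eliminating the common dimension relates the part of t-degree 1 at the edge to that at the image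
  edge by a power x^e. Both are given by the same positive number \<open>br\<close>, as \<sigma>
  preserves \<open>d\<close>, so e = 0.\<close>

lemma adjacent_compare:
 assumes "adj C j l"
 shows "w j = w l \<and> g j - 2 * int (d j) = g l - 2 * int (d l) \<and> adj C (\<sigma> j) (\<sigma> l)"
proof -
 let ?x = "2 :: real"
 have x: "?x > 0" "?x > 1" by simp_all
 have w: "w j = w l" "w l \<ge> 1" using w_le[OF assms] w_le[OF adj_sym[OF assms]] by auto
 define c where "c i = 1 - ?x powi (- 2 * int (d i))" for i
 define c' where "c' i = 1 - ?x powi (2 * int (d i))" for i
 have c: "c i > 0" for i unfolding c_def by(rule coeff_pos[OF x(2)])
 have c': "c' i = - (?x powi (2 * int (d i))) * c i" for i
  using powi_double(3)[OF x(1), of "2 * int (d i)"] by(simp add: c_def c'_def right_diff_distrib)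
 let ?M = "Nx (1/?x) (\<sigma> l) j (w l - 1)"
 have 1: "c l * (?M * ?x powi g l) = c j * Nx ?x j l 1"
  using dual_identity[OF x(1), of 1 l j] by(simp add: c_def)
 have inv: "(1/?x) powi k = ?x powi (- k)" for k by(rule inv_powi[OF x(1)])
 have 2: "c' j * (Nx ?x (\<sigma> j) (\<sigma> l) 1 * ?x powi (- g j)) = c' l * ?M"
  using dual_identity[of "1/?x" "w l - 1" j "\<sigma> l"] w by(simp add: c'_def d_\<sigma> inv)
 define e where "e = (g l - 2 * int (d l)) - (g j - 2 * int (d j))"
 have 3: "Nx ?x j l 1 = ?x powi e * Nx ?x (\<sigma> j) (\<sigma> l) 1"
 proof -
  let ?p = "\<lambda>k. ?x powi k"
  have pw: "?p a * ?p b = ?p (a + b)" for a b by(simp add: power_int_add)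
  have "?p (2 * int (d l)) * (c j * Nx ?x j l 1) * c l = ?p (2 * int (d l)) * c l * ?M * ?p (g l) * c l"
   using 1 by simp
  also have "\<dots> = - (c' l * ?M) * ?p (g l) * c l" by(simp add: c')
  also have "\<dots> = ?p (2 * int (d j)) * c j * (Nx ?x (\<sigma> j) (\<sigma> l) 1 * ?p (- g j)) * ?p (g l) * c l"
   unfolding 2[symmetric] by(simp add: c')
  finally have "c l * c j * (?p (2 * int (d l)) * Nx ?x j l 1) =
    c l * c j * (?p (2 * int (d j)) * ?p (- g j) * ?p (g l) * Nx ?x (\<sigma> j) (\<sigma> l) 1)"
   by(simp add: mult_ac)
  hence "?p (2 * int (d l)) * Nx ?x j l 1 = ?p (2 * int (d j)) * ?p (- g j) * ?p (g l) * Nx ?x (\<sigma> j) (\<sigma> l) 1"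
   using c[of l] c[of j] by simp
  hence "?p (- (2 * int (d l))) * (?p (2 * int (d l)) * Nx ?x j l 1) =
    ?p (- (2 * int (d l))) * (?p (2 * int (d j)) * ?p (- g j) * ?p (g l) * Nx ?x (\<sigma> j) (\<sigma> l) 1)" by simp
  thus ?thesis unfolding mult.assoc[symmetric] pw by(simp add: e_def algebra_simps)
 qed
 have "Nx ?x j l 1 \<noteq> 0" using Nx_1[OF x(1), of j l] assms br_pos[OF x(1) assms] by simp
 hence adj: "adj C (\<sigma> j) (\<sigma> l)" using 3 Nx_1[OF x(1), of "\<sigma> j" "\<sigma> l"] by(auto split: if_splits)
 have "br ?x (\<sigma> j) (\<sigma> l) = br ?x j l"
 proof -
  have "?x powi int (d j) - ?x powi (- int (d j)) \<noteq> 0"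
   using power_int_strict_increasing[of "- int (d j)" "int (d j)" ?x] d_pos[of j] by simp
  moreover have "(?x powi int (d j) - ?x powi (- int (d j))) * br ?x (\<sigma> j) (\<sigma> l) =
    (?x powi int (d j) - ?x powi (- int (d j))) * br ?x j l"
   using br_geometric[OF x(1) adj] br_geometric[OF x(1) assms] by(simp only: d_\<sigma>)
  ultimately show ?thesis by simp
 qed
 hence "?x powi e = 1"
  using 3 Nx_1[OF x(1), of j l] Nx_1[OF x(1), of "\<sigma> j" "\<sigma> l"] assms adj br_pos[OF x(1) assms]
  by(simp add: d_\<sigma>)
 hence "e = 0" using powi_2_inject[of e 0] by simp
 thus ?thesis using w adj by(simp add: e_def)
qed

end

text \<open>The kernels form a permutation: \<open>\<sigma>\<close> plays the role of \<open>*\<close>, \<open>B\<close> that of \<open>h\<close> and \<open>-G\<close> that of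
 \<open>r h\<^sup>\<or>\<close>.\<close>

theorem finite_structure:
 "\<exists>\<sigma> (B::nat) G. B \<ge> 2 \<and> (\<forall>l. \<sigma> (\<sigma> l) = l) \<and> (\<forall>l. d (\<sigma> l) = d l) \<and>
   (\<forall>j l. adj C j l \<longrightarrow> adj C (\<sigma> j) (\<sigma> l)) \<and>
   (\<forall>i l u v. K i l (u, v) = (if i = \<sigma> l \<and> u = G + 2 * int (d l) \<and> v = int B - 2 then 1 else 0)) \<and>
   (\<forall>i l u v. v > int B - 2 \<longrightarrow> N i l (u, v) = 0) \<and>
   (\<forall>i l u. N i l (u, int B - 2) = (if i = \<sigma> l \<and> u = G + 2 * int (d l) then 1 else 0)) \<and>
   (\<forall>l v. 0 \<le> v \<longrightarrow> v \<le> int B - 2 \<longrightarrow> (\<exists>i u. N i l (u, v) \<noteq> 0))"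
proof -
 obtain \<sigma> g w where s: "bij \<sigma>"
  "\<And>i l u v. K i l (u, v) = (if i = \<sigma> l \<and> u = g l \<and> v = w l then 1 else 0)"
  "\<And>l. d (\<sigma> l) = d l" using structure_1 by metis
 note adjc = adjacent_compare[OF s] and inv = duality_involution[OF s]
 fix l0 :: 'a
 have "{l. w l = w l0 \<and> g l - 2 * int (d l) = g l0 - 2 * int (d l0)} = UNIV"
 proof (rule conn)
  fix i y assume i: "i \<in> {l. w l = w l0 \<and> g l - 2 * int (d l) = g l0 - 2 * int (d l0)}" and y: "adj C i y"
  show "y \<in> {l. w l = w l0 \<and> g l - 2 * int (d l) = g l0 - 2 * int (d l0)}"
   using i adjc[OF y] by simp
 qed auto
 hence c: "w l = w l0" "g l - 2 * int (d l) = g l0 - 2 * int (d l0)" for l by auto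
 \<comment> \<open>The shifts by 2 and by 2 d_l turn the position of the kernel into the degree (G,
   B) at which it enters \<open>N_rec\<close>; this degree is the same for all columns.\<close>
 define B where "B = nat (w l0 + 2)"
 define G where "G = g l0 - 2 * int (d l0)"
 have w: "w l = int B - 2" for l using c(1)[of l] w_nonneg[OF s, of l0] by(simp add: B_def)
 have g: "g l = G + 2 * int (d l)" for l using c(2)[of l] by(simp add: G_def)
 have "B \<ge> 2" using w_nonneg[OF s, of l0] by(simp add: B_def)
 moreover have "N i l (u, v) = 0" if "v > int B - 2" for i l u v
  using top_degree[OF s, of l v i] that by(simp add: w Nz_def)
 moreover have "\<exists>i u. N i l (u, v) \<noteq> 0" if "0 \<le> v" "v \<le> int B - 2" for l v
  using Nz_chain[OF s, of v l] that by(simp add: w Nz_def)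
 ultimately show ?thesis
  using inv s(3) adjc s(2) N_top[OF s] unfolding w g
  by(intro exI[of _ \<sigma>] exI[of _ B] exI[of _ G]) auto
qed

end

section \<open>Cartan matrices of finite type\<close>

lemma cross_ratio:
 fixes a :: "'a::idom"
 assumes "a * x = b * y" "c * x = e * y" "x \<noteq> 0" "y \<noteq> 0"
 shows "a * e = b * c"
proof -
 have "(a * e) * (x * y) = (a * x) * (e * y)" by(simp add: mult_ac)
 also have "\<dots> = (b * y) * (c * x)" by(simp only: assms(1,2))
 also have "\<dots> = (b * c) * (x * y)" by(simp add: mult_ac)
 finally show ?thesis using assms(3,4) by simp
qed

locale cartan =
 fixes C :: "int ^ 'i ^ 'i"
 assumes scm: "simple_cartan_matrix C"
begin

abbreviation d where "d \<equiv> sym_d C"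
abbreviation f where "f \<equiv> mul C"

lemmas scm' = scm[unfolded simple_cartan_matrix_def]

lemma diag: "C $ i $ i = 2" using scm'[THEN conjunct1] by(rule spec)

lemma C_nonpos: "i \<noteq> j ==> C $ i $ j \<le> 0" using scm'[THEN conjunct2, THEN conjunct1] by blast

lemma C_zero: "C $ i $ j = 0 ==> C $ j $ i = 0" using scm'[THEN conjunct2, THEN conjunct2, THEN conjunct1] by blast

lemma C_adj: "adj C i j \<longleftrightarrow> i \<noteq> j \<and> C $ i $ j \<noteq> 0"
 using C_nonpos[of i j] unfolding adj_def by auto

lemma adj_sym: "adj C i j ==> adj C j i"
 using C_zero unfolding C_adj by blast

lemma C_mul: "i \<noteq> j ==> C $ i $ j = - int (f i j)"
 using C_nonpos[of i j] by(simp add: mul_def)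

lemma mul_pos: "adj C i j ==> f i j > 0"
 by(simp add: adj_def mul_def)

lemma conn: "J \<noteq> {} ==> (\<And>i y. i \<in> J ==> adj C i y ==> y \<in> J) ==> J = UNIV"
proof (rule ccontr)
 assume J: "J \<noteq> {}" "\<And>i y. i \<in> J ==> adj C i y ==> y \<in> J" "J \<noteq> UNIV"
 then obtain i j where "i \<in> J" "j \<notin> J" "C $ i $ j \<noteq> 0"
  using scm'[THEN conjunct2, THEN conjunct2, THEN conjunct2, THEN conjunct2] by blast
 thus False using J(2)[of i j] C_adj by blast
qed

text \<open>Justifies the definite description in \<open>sym_d\<close>. A symmetriser divided by the
  gcd of its entries qualifies, and two candidates are proportional because their ratio is constant
  along edges of a connected diagram. As a multiple of \<open>sym_d\<close> the given symmetriser
  also hands over its positive definiteness.\<close>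

lemma sym_d_witness:
 obtains D :: "'i => int" where "\<And>i. D i > 0" "\<And>i j. D i * C $ i $ j = D j * C $ j $ i"
  "\<And>x :: real ^ 'i. x \<noteq> 0 ==> (\<Sum>i\<in>UNIV. \<Sum>j\<in>UNIV. x $ i * of_int (D i * C $ i $ j) * x $ j) > 0"
  "\<exists>k>0. \<forall>i. D i = k * int (d i)"
  "\<And>i. d i > 0" "\<And>i j. int (d i) * C $ i $ j = int (d j) * C $ j $ i" "Gcd (range d) = 1"
proof -
 obtain D :: "'i => int" where D: "\<And>i. D i > 0" "\<And>i j. D i * C $ i $ j = D j * C $ j $ i"
  "\<And>x :: real ^ 'i. x \<noteq> 0 ==> (\<Sum>i\<in>UNIV. \<Sum>j\<in>UNIV. x $ i * of_int (D i * C $ i $ j) * x $ j) > 0"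
  using scm'[THEN conjunct2, THEN conjunct2, THEN conjunct2, THEN conjunct1] by blast
 let ?P = "\<lambda>d. (\<forall>i. d i > 0) \<and> (\<forall>i j. int (d i) * C $ i $ j = int (d j) * C $ j $ i) \<and> Gcd (range d) = (1::nat)"
 define g where "g = Gcd (range (\<lambda>i. nat (D i)))"
 have g0: "g \<noteq> 0" unfolding g_def using D(1)
  by(metis Gcd_0_iff nat_eq_iff not_less_iff_gr_or_eq range_eqI singletonD subsetD zero_less_nat_eq)
 define e where "e i = nat (D i) div g" for i
 have ge: "g * e i = nat (D i)" for i unfolding e_def g_def by(simp add: Gcd_dvd)
 hence Dg: "D i = int g * int (e i)" for i using D(1)[of i] by(metis int_nat_eq less_imp_le of_nat_mult)
 have e0: "e i > 0" for i using ge[of i] D(1)[of i] by(metis gr0I mult_0_right nat_0_iff not_le)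
 have "int g * (int (e i) * C $ i $ j) = int g * (int (e j) * C $ j $ i)" for i j
  using D(2)[of i j] unfolding Dg by(simp add: mult.assoc)
 hence es: "int (e i) * C $ i $ j = int (e j) * C $ j $ i" for i j using g0 by simp
 have "(\<lambda>x. g * x) ` range e = range (\<lambda>i. nat (D i))" by(auto simp: ge image_image)
 hence "g * Gcd (range e) = g" using Gcd_mult[of g "range e"] g_def by auto
 hence "Gcd (range e) = 1" using g0 by simp
 hence Pe: "?P e" using e0 es by blast
 have uniq: "d' = e" if P: "?P d'" for d'
 proof
  fix i0
  have "{i. d' i * e i0 = e i * d' i0} = UNIV"
  proof (rule conn)
   fix i j assume i: "i \<in> {i. d' i * e i0 = e i * d' i0}" and a: "adj C i j"
   have "int (d' i) * C $ i $ j = int (d' j) * C $ j $ i" using P by blast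
   hence "int (d' i) * int (e j) = int (d' j) * int (e i)"
    using a adj_sym[OF a] by(intro cross_ratio[OF _ es[of i j]]) (auto simp: C_adj)
   hence ij: "d' i * e j = d' j * e i" by(metis of_nat_eq_iff of_nat_mult)
   have "e i * (d' j * e i0) = (d' j * e i) * e i0" by(simp only: mult_ac)
   also have "\<dots> = (d' i * e i0) * e j" unfolding ij[symmetric] by(simp only: mult_ac)
   also have "\<dots> = (e i * d' i0) * e j" using i by simp
   finally have "e i * (d' j * e i0) = e i * (e j * d' i0)" by(simp only: mult_ac)
   thus "j \<in> {i. d' i * e i0 = e i * d' i0}" using e0[of i] by simp
  qed (use mult.commute[of "d' i0" "e i0"] in blast)
  hence "d' i * e i0 = e i * d' i0" for i by blast
  hence "(\<lambda>x. e i0 * x) ` range d' = (\<lambda>x. d' i0 * x) ` range e"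
   by(simp add: image_image mult.commute)
  thus "d' i0 = e i0" using Gcd_mult[of "e i0" "range d'"] Gcd_mult[of "d' i0" "range e"] P Pe by simp
 qed
 have "d = e" unfolding sym_d_def by(rule the_equality) (use Pe uniq in blast)+
 thus thesis using that[OF D] Pe exI[of "\<lambda>k. k > 0 \<and> (\<forall>i. D i = k * int (e i))" "int g"] Dg g0 by simp
qed

lemma d_pos: "d i > 0" and d_sym: "int (d i) * C $ i $ j = int (d j) * C $ j $ i"
 and d_gcd: "Gcd (range d) = 1"
 by(rule sym_d_witness, blast)+

lemma d_mul_sym: "i \<noteq> j ==> d i * f i j = d j * f j i"
 using d_sym[of i j] by(simp add: C_mul flip: of_nat_mult)

section \<open>Positive definiteness and forbidden subdiagrams\<close>

definition form :: "real ^ 'i => real ^ 'i => real" where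
 "form x y = (\<Sum>i\<in>UNIV. \<Sum>j\<in>UNIV. x $ i * of_int (int (d i) * C $ i $ j) * y $ j)"

lemma form_pos: "x \<noteq> 0 ==> form x x > 0"
proof -
 assume x: "x \<noteq> 0"
 show ?thesis
 proof (rule sym_d_witness)
  fix D :: "'i => int"
  assume D: "\<And>x :: real ^ 'i. x \<noteq> 0 ==> (\<Sum>i\<in>UNIV. \<Sum>j\<in>UNIV. x $ i * of_int (D i * C $ i $ j) * x $ j) > 0"
   and k: "\<exists>k>0. \<forall>i. D i = k * int (d i)"
  from k obtain k where k: "k > 0" "\<And>i. D i = k * int (d i)" by blast
  have "(\<Sum>i\<in>UNIV. \<Sum>j\<in>UNIV. x $ i * of_int (D i * C $ i $ j) * x $ j) = of_int k * form x x"
   unfolding form_def sum_distrib_left k(2) by(intro sum.cong refl) simp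
  thus ?thesis using D[OF x] k(1) by(simp add: zero_less_mult_iff)
 qed
qed

text \<open>Up to sign, the off-diagonal entries of the symmetrised Cartan matrix.\<close>

definition s :: "'i => 'i => real" where "s u v = sqrt (real (f u v * f v u))"

lemma s_ge: "adj C u v ==> n \<le> f u v * f v u ==> s u v \<ge> sqrt (real n)"
 unfolding s_def by(simp only: real_sqrt_le_iff of_nat_le_iff)

lemma s_ge_1: "adj C u v ==> s u v \<ge> 1"
 using s_ge[of u v 1] mul_pos[of u v] mul_pos[OF adj_sym, of u v] by(simp add: Suc_leI)

lemma s_sym: "s u v = s v u" by(simp add: s_def mult.commute)

text \<open>A nonnegative subharmonic vector would make the symmetrised form nonpositive.\<close>

lemma no_subharmonic:
 assumes y: "\<And>u. y u \<ge> 0" "y u0 > 0"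
  and sub: "\<And>u. y u > 0 ==> (\<Sum>v | adj C u v. s u v * y v) \<ge> 2 * y u"
 shows False
proof -
 \<comment> \<open>Dividing by sqrt(d_i) passes to the symmetrised matrix, for which the form is the
   sum of y_i times the defect 2 y_i - (sum of s_iv y_v).\<close>
 define x :: "real ^ 'i" where "x = (\<chi> i. y i / sqrt (real (d i)))"
 have dp: "real (d i) > 0" for i using d_pos by simp
 have "x $ u0 \<noteq> 0" using y(2) dp[of u0] by(simp add: x_def)
 hence x0: "x \<noteq> 0" by auto
 have "x $ i * of_int (int (d i) * C $ i $ j) * x $ j = (if i = j then 2 * y i * y i else if adj C i j then - (y i * (s i j * y j)) else 0)" for i j
 proof (cases "i = j")
  case True
  have "sqrt (real (d j)) * sqrt (real (d j)) = real (d j)" using dp by simp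
  thus ?thesis using True dp[of j] by(simp add: x_def diag field_simps)
 next
  case False
  have e: "real (d i) * real (f i j) = real (d j) * real (f j i)" using d_mul_sym[OF False] by(simp flip: of_nat_mult)
  have "real (d i) * real (f i j) / (sqrt (real (d i)) * sqrt (real (d j))) = s i j"
  proof -
   have "(real (d i) * real (f i j))\<^sup>2 = (real (d i) * real (f i j)) * (real (d j) * real (f j i))" by(simp add: e power2_eq_square)
   also have "\<dots> = (real (d i) * real (d j)) * real (f i j * f j i)" by simp
   finally have "real (d i) * real (f i j) = sqrt ((real (d i) * real (d j)) * real (f i j * f j i))"
    by(metis abs_of_nonneg of_nat_0_le_iff of_nat_mult real_sqrt_abs)
   thus ?thesis using dp[of i] dp[of j] by(simp add: s_def real_sqrt_mult)
  qed
  moreover have "x $ i * of_int (int (d i) * C $ i $ j) * x $ j =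
    - (y i * (real (d i) * real (f i j) / (sqrt (real (d i)) * sqrt (real (d j))) * y j))"
   by(simp add: x_def C_mul[OF False] mult_ac)
  moreover have "\<not> adj C i j ==> s i j = 0" using False C_mul[OF False] by(simp add: C_adj s_def)
  ultimately show ?thesis using False by simp
 qed
 hence "form x x = (\<Sum>i\<in>UNIV. \<Sum>j\<in>UNIV. if i = j then 2 * y i * y i else if adj C i j then - (y i * (s i j * y j)) else 0)"
  by(simp add: form_def)
 also have "\<dots> = (\<Sum>i\<in>UNIV. y i * (2 * y i - (\<Sum>v | adj C i v. s i v * y v)))"
 proof (rule sum.cong[OF refl])
  fix i
  have "(\<Sum>j\<in>UNIV. if i = j then 2 * y i * y i else if adj C i j then - (y i * (s i j * y j)) else 0) =
    (\<Sum>j\<in>UNIV. (if j = i then 2 * y i * y i else 0) + (if adj C i j then - (y i * (s i j * y j)) else 0))"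
   by(rule sum.cong) (auto simp: adj_def)
  also have "\<dots> = 2 * y i * y i + (\<Sum>j\<in>UNIV. if adj C i j then - (y i * (s i j * y j)) else 0)"
   by(simp add: sum.distrib)
  also have "(\<Sum>j\<in>UNIV. if adj C i j then - (y i * (s i j * y j)) else 0) = (\<Sum>j | adj C i j. - (y i * (s i j * y j)))"
   using sum.inter_filter[of UNIV "\<lambda>j. - (y i * (s i j * y j))" "adj C i"] by simp
  finally show "(\<Sum>j\<in>UNIV. if i = j then 2 * y i * y i else if adj C i j then - (y i * (s i j * y j)) else 0) =
    y i * (2 * y i - (\<Sum>v | adj C i v. s i v * y v))"
   by(simp add: right_diff_distrib sum_distrib_left sum_negf)
 qed
 also have "\<dots> \<le> 0"
 proof (rule sum_nonpos)
  fix i show "y i * (2 * y i - (\<Sum>v | adj C i v. s i v * y v)) \<le> 0"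
   using y(1)[of i] sub[of i] by(cases "y i > 0") (auto simp: mult_le_0_iff)
 qed
 finally show False using form_pos[OF x0] by simp
qed

lemma sum_ge_member: "finite A ==> B \<subseteq> A ==> (\<And>x. x \<in> A ==> h x \<ge> (0::real)) ==> sum h B \<le> sum h A"
 by(rule sum_mono2) auto

lemma s_nonneg: "s u v \<ge> 0" by(simp add: s_def)

text \<open>A product of at least 4 gives s \<ge> 2, and then the vector with value 1 at the two
  ends of the edge is subharmonic.\<close>

lemma mul_prod_le_3: "adj C i j ==> f i j * f j i \<le> 3"
proof (rule ccontr)
 assume a: "adj C i j" and n: "\<not> f i j * f j i \<le> 3"
 let ?y = "\<lambda>u. if u = i \<or> u = j then 1 else 0 :: real"
 have s2: "s i j \<ge> 2" using s_ge[OF a, of 4] n by simp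
 have ge: "(\<Sum>v | adj C u v. s u v * ?y v) \<ge> s u v" if "adj C u v" "v = i \<or> v = j" for u v
  using sum_ge_member[of "{v. adj C u v}" "{v}" "\<lambda>v. s u v * ?y v"] that s_nonneg by auto
 show False
 proof (rule no_subharmonic[of ?y i])
  fix u assume "?y u > 0"
  then consider "u = i" | "u = j" by(auto split: if_splits)
  thus "2 * ?y u \<le> (\<Sum>v | adj C u v. s u v * ?y v)"
   using ge[of i j] ge[of j i] a adj_sym[OF a] s2 s_sym[of i j] by cases auto
 qed auto
qed

text \<open>If every vertex of \<open>J\<close> had two neighbours in \<open>J\<close>, the
  indicator vector of \<open>J\<close> would be subharmonic. In particular there are no
  cycles.\<close>

lemma leaf:
 assumes "J \<noteq> {}"
 shows "\<exists>i\<in>J. card {j \<in> J. adj C i j} \<le> 1"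
proof (rule ccontr)
 assume n: "\<not> (\<exists>i\<in>J. card {j \<in> J. adj C i j} \<le> 1)"
 obtain i0 where i0: "i0 \<in> J" using assms by blast
 show False
 proof (rule no_subharmonic[of "\<lambda>u. if u \<in> J then 1 else 0" i0])
  fix u assume "(if u \<in> J then 1 else 0 :: real) > 0"
  hence u: "u \<in> J" by(auto split: if_splits)
  have "2 \<le> real (card {j \<in> J. adj C u j})" using n u by force
  also have "\<dots> = (\<Sum>j\<in>{j \<in> J. adj C u j}. 1)" by simp
  also have "\<dots> \<le> (\<Sum>j\<in>{j \<in> J. adj C u j}. s u j)" by(rule sum_mono) (simp add: s_ge_1)
  also have "\<dots> = (\<Sum>j\<in>{j \<in> J. adj C u j}. s u j * (if j \<in> J then 1 else 0))" by(rule sum.cong) auto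
  also have "\<dots> \<le> (\<Sum>v | adj C u v. s u v * (if v \<in> J then 1 else 0))"
   by(rule sum_ge_member) (auto simp: s_nonneg)
  finally show "2 * (if u \<in> J then 1 else 0) \<le> (\<Sum>v | adj C u v. s u v * (if v \<in> J then 1 else 0))"
   using u by simp
 qed (use i0 in auto)
qed

text \<open>The Dynkin diagram is a forest, so every orientation comes from a height function.\<close>

lemma height_function:
 fixes h :: "'i => 'i => int"
 assumes "\<And>i j. h i j = - h j i"
 shows "\<exists>\<xi>. \<forall>i j. adj C i j \<longrightarrow> \<xi> j = \<xi> i + h i j"
proof -
 have "\<exists>\<xi>. \<forall>i\<in>J. \<forall>j\<in>J. adj C i j \<longrightarrow> \<xi> j = \<xi> i + h i j" for J
 proof (induction "card J" arbitrary: J)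
  case 0
  thus ?case by simp
 next
  case (Suc n)
  hence "J \<noteq> {}" by auto
  then obtain i where i: "i \<in> J" "card {j \<in> J. adj C i j} \<le> 1" using leaf by blast
  have "n = card (J - {i})" using Suc(2) i(1) by simp
  from Suc(1)[OF this] obtain \<xi> where \<xi>: "\<forall>a\<in>J - {i}. \<forall>b\<in>J - {i}. adj C a b \<longrightarrow> \<xi> b = \<xi> a + h a b" by blast
  obtain k where k: "\<forall>j\<in>J. adj C i j \<longrightarrow> j = k"
  proof (cases "{j \<in> J. adj C i j} = {}")
   case False
   hence "card {j \<in> J. adj C i j} = 1" using i(2) by(metis card_0_eq finite le_neq_implies_less less_one)
   then obtain k where "{j \<in> J. adj C i j} = {k}" using card_1_singletonE by blast
   thus ?thesis using that by blast
  qed (use that in blast)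
  define \<xi>' where "\<xi>' = \<xi>(i := \<xi> k + h k i)"
  have "\<xi>' b = \<xi>' a + h a b" if ab: "a \<in> J" "b \<in> J" "adj C a b" for a b
  proof -
   have "a \<noteq> b" using ab(3) by(simp add: adj_def)
   consider "a = i" "b \<noteq> i" | "b = i" "a \<noteq> i" | "a \<noteq> i" "b \<noteq> i" using \<open>a \<noteq> b\<close> by blast
   thus ?thesis
   proof cases
    case 1
    hence "b = k" using k ab by blast
    thus ?thesis using 1 assms[of k i] by(simp add: \<xi>'_def)
   next
    case 2
    hence "a = k" using k ab adj_sym by blast
    thus ?thesis using 2 by(simp add: \<xi>'_def)
   next
    case 3
    thus ?thesis using \<xi> ab by(simp add: \<xi>'_def)
   qed
  qed
  thus ?case by blast
 qed
 from this[of UNIV] show ?thesis by simp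
qed

text \<open>The vector is modelled on the null vector of an affine diagram: 2 along a path and,
  beyond each end, either sqrt 2 across a multiple edge or 1 at each of two branches. The functions
  \<open>e\<close> and \<open>e'\<close> treat both kinds of ends alike; each has to contribute at
  least 2 at its end of the path.\<close>

lemma no_two_ends:
 assumes p: "inj_on p {..m::nat}" "\<And>k. k < m ==> adj C (p k) (p (Suc k))"
  and e: "\<And>u. e u \<ge> 0" "\<And>u. e u > 0 ==> u \<notin> p ` {..m} \<and> e' u = 0 \<and> adj C u (p 0) \<and> s u (p 0) \<ge> e u"
   "(\<Sum>v | adj C (p 0) v. s (p 0) v * e v) \<ge> 2"
  and e': "\<And>u. e' u \<ge> 0" "\<And>u. e' u > 0 ==> u \<notin> p ` {..m} \<and> adj C u (p m) \<and> s u (p m) \<ge> e' u"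
   "(\<Sum>v | adj C (p m) v. s (p m) v * e' v) \<ge> 2"
 shows False
proof -
 define y where "y u = (if u \<in> p ` {..m} then 2 else 0) + e u + e' u" for u
 let ?P = "\<lambda>u. if u \<in> p ` {..m} then 2 else 0 :: real"
 have split: "(\<Sum>v | adj C u v. s u v * y v) = (\<Sum>v | adj C u v. s u v * ?P v)
   + (\<Sum>v | adj C u v. s u v * e v) + (\<Sum>v | adj C u v. s u v * e' v)" for u
  by(simp add: y_def distrib_left sum.distrib)
 have pos: "(\<Sum>v | adj C u v. s u v * ?P v) \<ge> 0" "(\<Sum>v | adj C u v. s u v * e v) \<ge> 0"
  "(\<Sum>v | adj C u v. s u v * e' v) \<ge> 0" for u
  using s_nonneg e(1) e'(1) by(auto intro!: sum_nonneg mult_nonneg_nonneg)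
 have ge: "(\<Sum>v | adj C u v. s u v * ?P v) \<ge> (\<Sum>v\<in>A. s u v * 2)"
  if "A \<subseteq> {v. adj C u v}" "A \<subseteq> p ` {..m}" for u A
 proof -
  have "(\<Sum>v\<in>A. s u v * 2) = (\<Sum>v\<in>A. s u v * ?P v)" using that by(intro sum.cong) auto
  also have "\<dots> \<le> (\<Sum>v | adj C u v. s u v * ?P v)"
   using that s_nonneg by(intro sum_ge_member) auto
  finally show ?thesis .
 qed
 show False
 proof (rule no_subharmonic[of y "p 0"])
  show "y u \<ge> 0" for u using e(1) e'(1) by(simp add: y_def)
  show "y (p 0) > 0" using e(1)[of "p 0"] e'(1)[of "p 0"] by(simp add: y_def add_pos_nonneg)
  fix u assume u: "y u > 0"
  show "2 * y u \<le> (\<Sum>v | adj C u v. s u v * y v)"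
  proof (cases "u \<in> p ` {..m}")
   case True
   then obtain k where k: "u = p k" "k \<le> m" by blast
   have "e u = 0" "e' u = 0" using e(1)[of u] e'(1)[of u] e(2)[of u] e'(2)[of u] True by force+
   hence yu: "y u = 2" using True by(simp add: y_def)
   have L: "k > 0 ==> adj C (p k) (p (k - 1))" using p(2)[of "k - 1"] k adj_sym by simp
   have R: "k < m ==> adj C (p k) (p (Suc k))" using p(2) by simp
   have s2: "adj C u v ==> s u v * 2 \<ge> 2" for v using s_ge_1[of u v] by simp
   consider "k = 0" "k = m" | "k = 0" "k < m" | "k > 0" "k = m" | "k > 0" "k < m" using k by linarith
   hence "(\<Sum>v | adj C u v. s u v * y v) \<ge> 4"
   proof cases
    case 1
    thus ?thesis using split[of u] pos(1)[of u] e(3) e'(3) k by simp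
   next
    case 2
    hence "(\<Sum>v | adj C u v. s u v * ?P v) \<ge> 2"
     using ge[of "{p (Suc k)}" u] R s2[of "p (Suc k)"] k by auto
    thus ?thesis using split[of u] pos(3)[of u] e(3) k 2 by simp
   next
    case 3
    hence "(\<Sum>v | adj C u v. s u v * ?P v) \<ge> 2"
     using ge[of "{p (k - 1)}" u] L s2[of "p (k - 1)"] k by auto
    thus ?thesis using split[of u] pos(2)[of u] e'(3) k 3 by simp
   next
    case 4
    have "p (k - 1) \<noteq> p (Suc k)" using inj_onD[OF p(1), of "k - 1" "Suc k"] 4 by force
    hence "(\<Sum>v\<in>{p (k - 1), p (Suc k)}. s u v * 2) \<ge> 4"
     using s2[of "p (k - 1)"] s2[of "p (Suc k)"] L R 4 k by simp
    moreover have "(\<Sum>v | adj C u v. s u v * ?P v) \<ge> (\<Sum>v\<in>{p (k - 1), p (Suc k)}. s u v * 2)"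
     using L R 4 k by(intro ge) auto
    ultimately show ?thesis using split[of u] pos(2,3)[of u] by simp
   qed
   thus ?thesis using yu by simp
  next
   case False
   have "e u > 0 \<or> e' u > 0" using u False e(1)[of u] e'(1)[of u] by(auto simp: y_def less_le)
   thus ?thesis
   proof
    assume a: "e u > 0"
    hence "s u (p 0) * 2 \<ge> 2 * y u" "adj C u (p 0)" using e(2)[OF a] False by(auto simp: y_def)
    thus ?thesis using ge[of "{p 0}" u] split[of u] pos(2,3)[of u] by auto
   next
    assume a: "e' u > 0"
    have "e u = 0" using e(1)[of u] e(2)[of u] a by force
    hence "s u (p m) * 2 \<ge> 2 * y u" "adj C u (p m)" using e'(2)[OF a] False by(auto simp: y_def)
    thus ?thesis using ge[of "{p m}" u] split[of u] pos(2,3)[of u] by auto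
   qed
  qed
 qed
qed

end

section \<open>The multiple edge, the lacing number and diagram automorphisms\<close>

context cartan
begin

text \<open>In a walk of minimal length a repeated vertex could be cut out, and a second visit to
  one of the two sets would allow a shorter walk.\<close>

lemma minimal_walk:
 assumes "X \<noteq> {}" "Y \<noteq> {}"
 obtains p and m :: nat where "p 0 \<in> X" "p m \<in> Y" "inj_on p {..m}" "\<And>k. k < m ==> adj C (p k) (p (Suc k))"
  "\<And>k. 0 < k ==> k \<le> m ==> p k \<notin> X" "\<And>k. k < m ==> p k \<notin> Y"
proof -
 define W where "W m p \<longleftrightarrow> p 0 \<in> X \<and> p m \<in> Y \<and> (\<forall>k<m. adj C (p k) (p (Suc k)))" for m and p :: "nat => 'i"
 let ?J = "{y. \<exists>(m::nat) p. p 0 \<in> X \<and> p m = y \<and> (\<forall>k<m. adj C (p k) (p (Suc k)))}"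
 have "?J = UNIV"
 proof (rule conn)
  obtain x where "x \<in> X" using assms(1) by blast
  hence "x \<in> ?J" by(intro CollectI exI[of _ 0] exI[of _ "\<lambda>_. x"]) simp
  thus "?J \<noteq> {}" by blast
  fix i y assume "i \<in> ?J" and a: "adj C i y"
  then obtain m p where p: "p 0 \<in> X" "p m = i" "\<forall>k<m. adj C (p k) (p (Suc k))" by blast
  show "y \<in> ?J"
   by(intro CollectI exI[of _ "Suc m"] exI[of _ "p(Suc m := y)"]) (use p a in \<open>auto simp: less_Suc_eq\<close>)
 qed
 moreover obtain y where "y \<in> Y" using assms(2) by blast
 ultimately have "y \<in> ?J" by blast
 hence "\<exists>m p. W m p" using \<open>y \<in> Y\<close> unfolding W_def by blast
 define m where "m = (LEAST m. \<exists>p. W m p)"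
 have "\<exists>p. W m p" unfolding m_def by(rule LeastI_ex) fact
 then obtain p where p: "W m p" by blast
 have least: "m \<le> m'" if "W m' p'" for m' p' unfolding m_def by(rule Least_le) (use that in blast)
 have notX: "p k \<notin> X" if "0 < k" "k \<le> m" for k
 proof
  assume "p k \<in> X"
  hence "W (m - k) (\<lambda>l. p (l + k))" using p that by(simp add: W_def)
  from least[OF this] that show False by simp
 qed
 have notY: "p k \<notin> Y" if "k < m" for k
 proof
  assume "p k \<in> Y"
  hence "W k p" using p that by(simp add: W_def)
  from least[OF this] that show False by simp
 qed
 have "p k \<noteq> p l" if "k < l" "l \<le> m" for k l
 proof
  assume e: "p k = p l"
  define p' where "p' a = (if a \<le> k then p a else p (a + (l - k)))" for a
  have "p' (m - (l - k)) = p m" using that e by(cases "l = m") (auto simp: p'_def)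
  moreover have "adj C (p' a) (p' (Suc a))" if "a < m - (l - k)" for a
  proof -
   have "p' a = p a \<and> p' (Suc a) = p (Suc a) \<and> a < m \<or> p' a = p (a + (l - k)) \<and> p' (Suc a) = p (Suc (a + (l - k))) \<and> a + (l - k) < m"
    using that \<open>k < l\<close> \<open>l \<le> m\<close> e by(cases a k rule: linorder_cases) (auto simp: p'_def)
   thus ?thesis using p by(auto simp: W_def)
  qed
  ultimately have "W (m - (l - k)) p'" using p by(simp add: W_def p'_def)
  from least[OF this] that show False by simp
 qed
 hence "inj_on p {..m}" by(intro linorder_inj_onI') auto
 thus thesis using that[of p m] p notX notY by(simp add: W_def)
qed

lemma end_sum:
 assumes "adj C x b" "f x b * f b x \<ge> 2" "\<And>u. e u \<ge> 0" "e b = sqrt 2"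
 shows "(\<Sum>v | adj C x v. s x v * e v) \<ge> 2"
proof -
 have "s x b \<ge> sqrt 2" using s_ge[OF assms(1,2)] by simp
 hence "2 \<le> s x b * e b" using mult_right_mono[of "sqrt 2" "s x b" "sqrt 2"] assms(4) by simp
 also have "\<dots> \<le> (\<Sum>v | adj C x v. s x v * e v)"
  using sum_ge_member[of "{v. adj C x v}" "{b}" "\<lambda>v. s x v * e v"] assms s_nonneg by auto
 finally show ?thesis .
qed

lemma multi_edge_end:
 assumes "adj C a b" "f a b * f b a \<ge> 2" "x \<in> {a, b}"
 obtains y where "{a, b} = {x, y}" "adj C x y" "f x y * f y x \<ge> 2" "s y x \<ge> sqrt 2" "x \<noteq> y"
proof -
 obtain y where y: "{a, b} = {x, y}" "adj C x y" "f x y * f y x \<ge> 2"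
  using assms adj_sym[OF assms(1)] by(auto simp: mult.commute insert_commute)
 thus thesis using that s_ge[OF adj_sym[OF y(2)], of 2] by(simp add: mult.commute adj_def)
qed

text \<open>A shortest walk joins two different multiple edges, and their outer ends carry the value
  sqrt 2 in \<open>no_two_ends\<close>. The outer ends are distinct, since otherwise the walk would
  close up to a cycle, against \<open>leaf\<close>.\<close>

lemma multi_edge_unique:
 assumes e1: "adj C a b" "f a b * f b a \<ge> 2" and e2: "adj C a' b'" "f a' b' * f b' a' \<ge> 2"
 shows "{a, b} = {a', b'}"
proof (rule ccontr)
 assume ne: "{a, b} \<noteq> {a', b'}"
 obtain p and m :: nat where p: "p 0 \<in> {a, b}" "p m \<in> {a', b'}" "inj_on p {..m}" "\<And>k. k < m ==> adj C (p k) (p (Suc k))"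
  "\<And>k. 0 < k ==> k \<le> m ==> p k \<notin> {a, b}" "\<And>k. k < m ==> p k \<notin> {a', b'}"
  using minimal_walk[of "{a, b}" "{a', b'}"] by blast
 obtain y where y: "{a, b} = {p 0, y}" "adj C (p 0) y" "f (p 0) y * f y (p 0) \<ge> 2" "s y (p 0) \<ge> sqrt 2" "p 0 \<noteq> y"
  by(rule multi_edge_end[OF e1 p(1)])
 obtain z where z: "{a', b'} = {p m, z}" "adj C (p m) z" "f (p m) z * f z (p m) \<ge> 2" "s z (p m) \<ge> sqrt 2" "p m \<noteq> z"
  by(rule multi_edge_end[OF e2 p(2)])
 have yp: "y \<notin> p ` {..m}"
 proof
  assume "y \<in> p ` {..m}"
  then obtain k where k: "k \<le> m" "y = p k" by blast
  thus False using p(5)[of k] y(1,5) by(cases "k = 0") auto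
 qed
 have zp: "z \<notin> p ` {..m}"
 proof
  assume "z \<in> p ` {..m}"
  then obtain k where k: "k \<le> m" "z = p k" by blast
  thus False using p(6)[of k] z(1,5) by(cases "k = m") auto
 qed
 have yz: "y \<noteq> z"
 proof
  assume "y = z"
  show False
  proof (cases "m = 0")
   case True then show False using y(1) z(1) ne \<open>y = z\<close> by simp
  next
   case False
   let ?J = "insert y (p ` {..m})"
   have two: "\<exists>v w. v \<noteq> w \<and> {v, w} \<subseteq> {j \<in> ?J. adj C u j}" if u: "u \<in> ?J" for u
   proof -
    consider "u = y" | k where "u = p k" "k \<le> m" using u by blast
    thus ?thesis
    proof cases
     case 1
     thus ?thesis using p(1) p(5)[of m] False adj_sym[OF y(2)] adj_sym[OF z(2)] \<open>y = z\<close>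
      by(intro exI[of _ "p 0"] exI[of _ "p m"]) auto
    next
     case (2 k)
     define v w where "v = (if k = 0 then y else p (k - 1))" and "w = (if k = m then y else p (Suc k))"
     have "adj C u v" "adj C u w"
      using 2 y(2) z(2) \<open>y = z\<close> p(4)[of k] adj_sym[OF p(4)[of "k - 1"]] by(auto simp: v_def w_def)
     moreover have "v \<in> ?J" "w \<in> ?J" using 2 by(auto simp: v_def w_def)
     moreover have "k = 0 \<or> k = m \<or> p (k - 1) \<noteq> p (Suc k)" using inj_onD[OF p(3), of "k - 1" "Suc k"] 2 by force
     hence "v \<noteq> w" using 2 yp False by(auto simp: v_def w_def)
     ultimately show ?thesis by blast
    qed
   qed
   obtain u where "u \<in> ?J" "card {j \<in> ?J. adj C u j} \<le> 1" using leaf[of ?J] by blast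
   moreover from two[OF this(1)] obtain v w where "v \<noteq> w" "{v, w} \<subseteq> {j \<in> ?J. adj C u j}" by blast
   hence "card {v, w} \<le> card {j \<in> ?J. adj C u j}" by(intro card_mono) auto
   ultimately show False using \<open>v \<noteq> w\<close> by simp
  qed
 qed
 define e where "e u = (if u = y then sqrt 2 else 0)" for u
 define e' where "e' u = (if u = z then sqrt 2 else 0)" for u
 show False
 proof (rule no_two_ends[of p m e e'])
  show "(\<Sum>v | adj C (p 0) v. s (p 0) v * e v) \<ge> 2" by(rule end_sum[OF y(2,3)]) (auto simp: e_def)
  show "(\<Sum>v | adj C (p m) v. s (p m) v * e' v) \<ge> 2" by(rule end_sum[OF z(2,3)]) (auto simp: e'_def)
  show "u \<notin> p ` {..m} \<and> e' u = 0 \<and> adj C u (p 0) \<and> s u (p 0) \<ge> e u" if "e u > 0" for u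
   using that yp yz y(4) adj_sym[OF y(2)] by(auto simp: e_def e'_def split: if_splits)
  show "u \<notin> p ` {..m} \<and> adj C u (p m) \<and> s u (p m) \<ge> e' u" if "e' u > 0" for u
   using that zp z(4) adj_sym[OF z(2)] by(auto simp: e'_def split: if_splits)
 qed (use p(3,4) in \<open>auto simp: e_def e'_def\<close>)
qed

lemma simple_edge: "adj C i j ==> \<not> f i j * f j i \<ge> 2 ==> f i j = 1 \<and> f j i = 1 \<and> d i = d j"
proof -
 assume a: "adj C i j" and n: "\<not> f i j * f j i \<ge> 2"
 have "f i j \<ge> 1" "f j i \<ge> 1" using mul_pos[OF a] mul_pos[OF adj_sym[OF a]] by auto
 hence "f i j = 1" "f j i = 1" using n by(auto simp: not_le less_2_cases_iff)
 thus ?thesis using d_mul_sym[of i j] a by(simp add: adj_def)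
qed

lemma one_simple: "adj C i j ==> f i j = 1 \<or> f j i = 1"
proof (rule ccontr)
 assume a: "adj C i j" and n: "\<not> (f i j = 1 \<or> f j i = 1)"
 hence "f i j \<ge> 2" "f j i \<ge> 2" using mul_pos[OF a] mul_pos[OF adj_sym[OF a]] by auto
 hence "f i j * f j i \<ge> 2 * 2" by(rule mult_le_mono)
 thus False using mul_prod_le_3[OF a] by simp
qed

lemma d_mul: "adj C i j ==> d i * f i j = max (d i) (d j)"
proof -
 assume a: "adj C i j"
 have e: "d i * f i j = d j * f j i" using d_mul_sym[of i j] a by(simp add: adj_def)
 have ge: "d i * f i j \<ge> d i" "d j * f j i \<ge> d j" using mul_pos[OF a] mul_pos[OF adj_sym[OF a]] by auto
 from one_simple[OF a] show ?thesis
  using e ge by(auto simp: max_def)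
qed

abbreviation r where "r \<equiv> lacing_number C"

lemma mul_prod: "i \<noteq> j ==> C $ i $ j * C $ j $ i = int (f i j * f j i)"
 by(simp add: C_mul)

text \<open>Across simple edges \<open>d\<close> is constant, so with the unique multiple edge
  between \<open>a\<close> and \<open>b\<close> it takes only the values d_a and d_b = d_a f_ab. As
  the gcd is 1, these are 1 and the multiplicity, which is the lacing number.\<close>

lemma lacing_cases:
 shows "(r = 1 \<and> (\<forall>i. d i = 1) \<and> (\<forall>i j. adj C i j \<longrightarrow> f i j = 1)) \<or>
  (\<exists>a b. adj C a b \<and> f b a = 1 \<and> int (f a b) = r \<and> r > 1 \<and> d a = 1 \<and> int (d b) = r \<and>
   (\<forall>i. d i = 1 \<or> int (d i) = r) \<and> (\<forall>i j. adj C i j \<longrightarrow> f i j > 1 \<longrightarrow> i = a \<and> j = b))"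
proof -
 have fin: "finite (insert 1 {C $ i $ j * C $ j $ i | i j. i \<noteq> j})"
  by(rule finite.insertI, rule finite_subset[of _ "(\<lambda>(i, j). C $ i $ j * C $ j $ i) ` UNIV"]) auto
 show ?thesis
 proof (cases "\<exists>i j. adj C i j \<and> f i j * f j i \<ge> 2")
  case False
  hence simple: "adj C i j ==> f i j = 1 \<and> f j i = 1 \<and> d i = d j" for i j using simple_edge by blast
  obtain i0 :: 'i where True by blast
  have "{i. d i = d i0} = UNIV" by(rule conn) (use simple in auto)
  hence "d i = d i0" for i by blast
  hence "range d = {d i0}" by auto
  hence "d i0 = 1" using d_gcd by simp
  have "C $ i $ j * C $ j $ i \<le> 1" if "i \<noteq> j" for i j
   using simple[of i j] C_adj[of i j] that mul_prod[OF that] by(cases "adj C i j") auto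
  hence "r = 1" unfolding lacing_number_def using fin by(intro Max_eqI) auto
  thus ?thesis using simple \<open>d i0 = 1\<close> \<open>\<And>i. d i = d i0\<close> by simp
 next
  case True
  then obtain a' b' where ab': "adj C a' b'" "f a' b' * f b' a' \<ge> 2" by blast
  obtain a b where ab: "adj C a b" "f a b * f b a \<ge> 2" "f b a = 1"
   using one_simple[OF ab'(1)] ab' adj_sym[OF ab'(1)] by(metis mult.commute)
  have simple: "{i, j} = {a, b} \<or> f i j = 1 \<and> f j i = 1 \<and> d i = d j" if "adj C i j" for i j
   using simple_edge[OF that] multi_edge_unique[OF that _ ab(1,2)] by blast
  have db: "d b = d a * f a b" using d_mul_sym[of a b] ab by(simp add: adj_def)
  have "{i. d i = d a \<or> d i = d b} = UNIV"
  proof (rule conn)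
   fix i y assume "i \<in> {i. d i = d a \<or> d i = d b}" "adj C i y"
   thus "y \<in> {i. d i = d a \<or> d i = d b}" using simple[of i y] by(auto simp: doubleton_eq_iff)
  qed auto
  hence dd: "d i = d a \<or> d i = d b" for i by blast
  hence "range d = {d a, d b}" by auto
  hence "d a = 1" using d_gcd db by simp
  have one: "f i j > 1 ==> i = a \<and> j = b" if "adj C i j" for i j
   using simple[OF that] ab(3) by(auto simp: doubleton_eq_iff)
  have "C $ i $ j * C $ j $ i \<le> int (f a b)" if "i \<noteq> j" for i j
  proof (cases "adj C i j")
   case True
   thus ?thesis using simple[OF True] ab mul_prod[OF that] by(auto simp: doubleton_eq_iff mult.commute)
  qed (use C_adj[of i j] that in simp)
  moreover have "a \<noteq> b" using ab(1) by(simp add: adj_def)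
  hence "int (f a b) \<in> {C $ i $ j * C $ j $ i | i j. i \<noteq> j}" using mul_prod[of a b] ab(3)
   by(intro CollectI exI[of _ a] exI[of _ b]) simp
  moreover have "int (f a b) \<ge> 1" using ab by simp
  ultimately have r: "r = int (f a b)" unfolding lacing_number_def using fin by(intro Max_eqI) blast+
  have "r > 1" "int (d b) = r" using r ab(2,3) db \<open>d a = 1\<close> by simp_all
  moreover have "d i = 1 \<or> int (d i) = r" for i using dd[of i] \<open>int (d b) = r\<close> \<open>d a = 1\<close> by metis
  ultimately show ?thesis using ab(1,3) r[symmetric] \<open>d a = 1\<close> one by blast
 qed
qed

text \<open>The reason why the entry [c_ij]_q of the deformed matrix, formed with q and not with
  q^(d_i), agrees with the sum of powers in the recursion.\<close>

lemma mul_gt_1: "adj C i j ==> f i j > 1 ==> d i = 1"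
 using lacing_cases by(metis less_irrefl)

lemma d_cases: "d i = 1 \<or> int (d i) = r" and ex_long: "\<exists>k. int (d k) = r" and r_pos: "r \<ge> 1"
proof -
 from lacing_cases have "(d i = 1 \<or> int (d i) = r) \<and> (\<exists>k. int (d k) = r) \<and> r \<ge> 1"
 proof
  assume "r = 1 \<and> (\<forall>i. d i = 1) \<and> (\<forall>i j. adj C i j \<longrightarrow> f i j = 1)"
  thus ?thesis by simp
 next
  assume "\<exists>a b. adj C a b \<and> f b a = 1 \<and> int (f a b) = r \<and> r > 1 \<and> d a = 1 \<and> int (d b) = r \<and>
   (\<forall>i. d i = 1 \<or> int (d i) = r) \<and> (\<forall>i j. adj C i j \<longrightarrow> f i j > 1 \<longrightarrow> i = a \<and> j = b)"
  then obtain b where "r > 1" "int (d b) = r" "\<forall>i. d i = 1 \<or> int (d i) = r" by blast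
  thus ?thesis by auto
 qed
 thus "d i = 1 \<or> int (d i) = r" "\<exists>k. int (d k) = r" "r \<ge> 1" by auto
qed

text \<open>The unique multiple edge is fixed pointwise because its ends differ in \<open>d\<close>.
  On a shortest walk from it to a fixed vertex with a moved neighbour \<open>j\<close>, the branches
  \<open>j\<close> and \<open>\<sigma> j\<close> form one end for \<open>no_two_ends\<close> and the
  multiple edge forms the other.\<close>

lemma automorphism_trivial:
 assumes r: "r \<noteq> 1" and \<sigma>: "\<And>i. d (\<sigma> i) = d i" "\<And>i j. adj C i j ==> adj C (\<sigma> i) (\<sigma> j)" "\<And>i. \<sigma> (\<sigma> i) = i"
 shows "\<sigma> i = i"
proof (rule ccontr)
 assume n: "\<sigma> i \<noteq> i"
 obtain a b where ab: "adj C a b" "f b a = 1" "f a b > 1" and u: "\<And>i j. adj C i j ==> f i j > 1 ==> i = a \<and> j = b"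
 proof -
  from lacing_cases r obtain a b where "adj C a b \<and> f b a = 1 \<and> int (f a b) = r \<and> r > 1 \<and>
   (\<forall>i j. adj C i j \<longrightarrow> f i j > 1 \<longrightarrow> i = a \<and> j = b)" by blast
  thus thesis using that[of a b] by simp
 qed
 have f2: "f a b * f b a \<ge> 2" using ab by simp
 have "d a * f a b = d b * f b a" using d_mul_sym[of a b] ab by(simp add: adj_def)
 hence lt: "d a < d b" using ab d_pos[of a] n_less_m_mult_n[of "d a" "f a b"] by(simp add: mult.commute)
 have s1: "adj C (\<sigma> a) (\<sigma> b)" using \<sigma>(2)[OF ab(1)] .
 have "d a * f (\<sigma> a) (\<sigma> b) = d b" using d_mul[OF s1] lt by(simp add: \<sigma>(1))
 hence "f (\<sigma> a) (\<sigma> b) > 1" using lt by(metis mult_0_right mult.right_neutral nat_neq_iff less_one not_less_zero)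
 hence fix_ab: "\<sigma> a = a" "\<sigma> b = b" using u[OF s1] by auto
 let ?Y = "{x. \<sigma> x = x \<and> (\<exists>j. adj C x j \<and> \<sigma> j \<noteq> j)}"
 have "?Y \<noteq> {}"
 proof
  assume "?Y = {}"
  hence "{x. \<sigma> x = x} = UNIV" by(intro conn) (use fix_ab in auto)
  thus False using n by blast
 qed
 then obtain p and m :: nat where p: "p 0 \<in> {a, b}" "p m \<in> ?Y" "inj_on p {..m}" "\<And>k. k < m ==> adj C (p k) (p (Suc k))"
  "\<And>k. 0 < k ==> k \<le> m ==> p k \<notin> {a, b}" "\<And>k. k < m ==> p k \<notin> ?Y"
  using minimal_walk[of "{a, b}" ?Y] by blast
 obtain y where y: "{a, b} = {p 0, y}" "adj C (p 0) y" "f (p 0) y * f y (p 0) \<ge> 2" "s y (p 0) \<ge> sqrt 2" "p 0 \<noteq> y"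
  by(rule multi_edge_end[OF ab(1) f2 p(1)])
 have yp: "y \<notin> p ` {..m}"
 proof
  assume "y \<in> p ` {..m}"
  then obtain k where k: "k \<le> m" "y = p k" by blast
  thus False using p(5)[of k] y(1,5) by(cases "k = 0") auto
 qed
 have pf: "k \<le> m ==> \<sigma> (p k) = p k" for k
 proof (induction k)
  case 0 then show ?case using p(1) fix_ab by auto
 next
  case (Suc k)
  thus ?case using p(6)[of k] p(4)[of k] by auto
 qed
 obtain j where j: "adj C (p m) j" "\<sigma> j \<noteq> j" using p(2) by blast
 have sj: "adj C (p m) (\<sigma> j)" using \<sigma>(2)[OF j(1)] pf[of m] by simp
 have sj2: "\<sigma> (\<sigma> j) \<noteq> \<sigma> j" using j(2) \<sigma>(3) by simp
 define e where "e u = (if u = y then sqrt 2 else 0)" for u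
 define e' where "e' u = (if u = j \<or> u = \<sigma> j then 1 else 0 :: real)" for u
 have jp: "u \<notin> p ` {..m} \<and> u \<noteq> y" if "u = j \<or> u = \<sigma> j" for u
 proof -
  have "\<sigma> u \<noteq> u" using that j(2) sj2 by blast
  moreover have "\<sigma> y = y" using fix_ab y(1) by(metis insertI2 insert_iff singletonD singletonI)
  ultimately show ?thesis using pf by auto
 qed
 show False
 proof (rule no_two_ends[of p m e e'])
  show "(\<Sum>v | adj C (p 0) v. s (p 0) v * e v) \<ge> 2" by(rule end_sum[OF y(2,3)]) (auto simp: e_def)
  have "2 \<le> (\<Sum>v\<in>{j, \<sigma> j}. s (p m) v * e' v)" using s_ge_1[OF j(1)] s_ge_1[OF sj] j(2) by(auto simp: e'_def)
  also have "\<dots> \<le> (\<Sum>v | adj C (p m) v. s (p m) v * e' v)"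
   by(rule sum_ge_member) (use j sj s_nonneg in \<open>auto simp: e'_def\<close>)
  finally show "(\<Sum>v | adj C (p m) v. s (p m) v * e' v) \<ge> 2" .
  show "u \<notin> p ` {..m} \<and> e' u = 0 \<and> adj C u (p 0) \<and> s u (p 0) \<ge> e u" if "e u > 0" for u
   using that yp jp y(4) adj_sym[OF y(2)] by(auto simp: e_def e'_def split: if_splits)
  show "u \<notin> p ` {..m} \<and> adj C u (p m) \<and> s u (p m) \<ge> e' u" if "e' u > 0" for u
   using that jp[of u] adj_sym[OF j(1)] adj_sym[OF sj] s_ge_1 by(auto simp: e'_def split: if_splits)
 qed (use p(3,4) in \<open>auto simp: e_def e'_def\<close>)
qed

lemma form_linear: "form x (a *\<^sub>R y + b *\<^sub>R z) = a * form x y + b * form x z"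
 by(simp add: form_def sum_distrib_left algebra_simps flip: sum.distrib)

definition gram :: "real ^ 'i ^ 'i" where "gram = (\<chi> i j. of_int (int (d i) * C $ i $ j))"

lemma form_gram: "form x y = (\<Sum>i\<in>UNIV. x $ i * (gram *v y) $ i)"
 by(simp add: form_def gram_def matrix_vector_mult_def sum_distrib_left mult.assoc)

text \<open>Solve gram q = (1, ..., 1). As the off-diagonal entries are nonpositive, the negative
  part n of q has form n n \<le> 0 and is 0; a zero entry of q would make a row sum nonpositive
  instead of 1. By symmetry of the form the vector p_i = d_i q_i has the required property.\<close>

lemma positive_vector:
 "\<exists>p. (\<forall>i. p i > 0) \<and> (\<forall>y. (\<Sum>i | adj C i y. p i * real (f i y)) < 2 * p y)"
proof -
 have "inj ((*v) gram)"
 proof (subst linear_injective_0)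
  show "linear ((*v) gram)" by simp
  show "\<forall>x. gram *v x = 0 \<longrightarrow> x = 0" using form_pos by(force simp: form_gram)
 qed
 hence "surj ((*v) gram)" using linear_injective_imp_surjective[of "(*v) gram"] by simp
 then obtain q where q: "gram *v q = (\<chi> i. 1)" by(metis surjD)
 define n where "n = (\<chi> i. max 0 (- q $ i))"
 define m where "m = (\<chi> i. max 0 (q $ i))"
 have qmn: "q = 1 *\<^sub>R m + (-1) *\<^sub>R n" by(simp add: vec_eq_iff m_def n_def max_def)
 have off: "i \<noteq> j ==> gram $ i $ j \<le> 0" for i j
  using C_nonpos[of i j] d_pos[of i] by(simp add: gram_def mult_le_0_iff)
 have "form n m \<le> 0" unfolding form_def
 proof (intro sum_nonpos)
  fix i j
  show "n $ i * of_int (int (d i) * C $ i $ j) * m $ j \<le> 0"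
  proof (cases "i = j")
   case False
   have "0 \<le> n $ i" "0 \<le> m $ j" by(simp_all add: n_def m_def)
   thus ?thesis using off[OF False] by(simp add: gram_def mult_nonneg_nonpos mult_nonpos_nonneg)
  qed (simp add: n_def m_def max_def)
 qed
 moreover have "form n q \<ge> 0" unfolding form_gram q by(simp add: n_def sum_nonneg)
 moreover have "form n q = form n m - form n n" unfolding qmn form_linear by simp
 ultimately have "form n n \<le> 0" by simp
 hence n0: "n = 0" using form_pos[of n] by force
 have q0: "q $ i \<ge> 0" for i using arg_cong[OF n0, of "\<lambda>v. v $ i"] by(simp add: n_def max_def split: if_splits)
 have gq: "(\<Sum>j\<in>UNIV. gram $ i $ j * q $ j) = 1" for i
  using arg_cong[OF q, of "\<lambda>v. v $ i"] by(simp add: matrix_vector_mult_def)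
 have qp: "q $ i > 0" for i
 proof (rule ccontr)
  assume "\<not> q $ i > 0"
  hence "q $ i = 0" using q0[of i] by simp
  hence "(\<Sum>j\<in>UNIV. gram $ i $ j * q $ j) \<le> 0"
   using off[of i] q0 by(intro sum_nonpos) (metis mult_nonneg_nonpos2 mult_zero_right order_refl)
  thus False using gq[of i] by simp
 qed
 define p where "p i = real (d i) * q $ i" for i
 have "(\<Sum>i | adj C i y. p i * real (f i y)) < 2 * p y" for y
 proof -
  have "1 = (\<Sum>j\<in>UNIV. (if j = y then 2 * p y else 0) + (if adj C j y then - (p j * real (f j y)) else 0))"
  proof (subst gq[of y, symmetric], rule sum.cong[OF refl])
   fix j
   show "gram $ y $ j * q $ j = (if j = y then 2 * p y else 0) + (if adj C j y then - (p j * real (f j y)) else 0)"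
   proof (cases "j = y")
    case True
    thus ?thesis by(simp add: gram_def diag p_def adj_def)
   next
    case False
    have "C $ j $ y = (if adj C j y then - int (f j y) else 0)" using C_adj[of j y] C_mul[of j y] False by auto
    thus ?thesis using False d_sym[of y j] by(simp add: gram_def p_def flip: of_int_mult of_nat_mult)
   qed
  qed
  also have "\<dots> = 2 * p y - (\<Sum>i | adj C i y. p i * real (f i y))"
   using sum.inter_filter[of UNIV "\<lambda>j. - (p j * real (f j y))" "\<lambda>j. adj C j y"]
   by(simp add: sum.distrib sum_negf)
  finally show ?thesis by simp
 qed
 thus ?thesis using qp d_pos by(intro exI[of _ p]) (simp add: p_def)
qed

lemma gpa_finite: "sign_choice C \<omega> ==> gpa_finite C \<omega>"
proof -
 assume s: "sign_choice C \<omega>"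
 show ?thesis
 proof
  show "adj C x y ==> \<omega> x y \<in> {1, - 1} \<and> \<omega> x y = - \<omega> y x" for x y
   using s unfolding sign_choice_def by blast
  show "\<exists>p::'i => real. (\<forall>i. p i > 0) \<and> (\<forall>y. (\<Sum>i | adj C i y. p i * real (f i y)) < 2 * p y)"
   by(rule positive_vector)
 qed (rule adj_sym d_pos d_mul conn; assumption?)+
qed

end

section \<open>The Coxeter element\<close>

text \<open>Keeps only the numerical data of the algebra: the deformed multiplicities
  \<open>b\<close>, the dimensions \<open>P\<close>, and the position (\<sigma>, B, G) of the
  kernels. The degrees in \<open>P_rec\<close> are those in which neither the source nor a kernel
  contributes.\<close>

locale mesh = cartan C for C :: "int ^ 'i ^ 'i" +
 fixes b :: "real => 'i => 'i => real" and P :: "real => 'i => 'i => int => real"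
  and \<sigma> :: "'i => 'i" and B :: nat and G :: int
 assumes B2: "B \<ge> 2" and \<sigma>_\<sigma>: "\<sigma> (\<sigma> i) = i" and d_\<sigma>: "d (\<sigma> i) = d i"
  and adj_\<sigma>: "adj C i j ==> adj C (\<sigma> i) (\<sigma> j)"
  and b_1: "adj C i j ==> b 1 i j = real (f i j)"
  and P_neg: "v < 0 ==> P x i j v = 0"
  and P_0: "P x i j 0 = (if i = j then 1 else 0)"
  and P_nonneg: "x > 0 ==> P x i j v \<ge> 0"
  and P_ex: "x > 0 ==> 0 \<le> v ==> v \<le> int B - 2 ==> \<exists>i. P x i j v \<noteq> 0"
  and P_rec: "x > 0 ==> 0 \<le> v ==> v \<le> int B - 2 ==> x powi int (d i) * P x i j (v + 1) + x powi (- int (d i)) * P x i j (v - 1)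
   = (\<Sum>y | adj C i y. b x i y * P x y j v)"
  and P_top: "P x i j (int B - 2) = (if i = \<sigma> j then x powi (G + 2 * int (d j)) else 0)"
  and P_high: "v > int B - 2 ==> P x i j v = 0"
begin

definition mesh_at :: "real => (int => 'i => real) => int => bool" where
 "mesh_at x a w \<longleftrightarrow> (\<forall>i. x powi int (d i) * a (w + 1) i + x powi (- int (d i)) * a (w - 1) i
   = (\<Sum>y | adj C i y. b x i y * a w y))"

text \<open>\<open>P\<close> is the fundamental solution of the recursion. A solution is determined
  by two consecutive values: the one at v0 + 1 is propagated by \<open>P\<close>, the one at v0 by
  \<open>P\<close> delayed by one step, with the factor -x^(-2 d_j) that arises from solving for the
  next value.\<close>

lemma mesh_expansion:
 assumes x: "x > 0" and m: "\<And>w. w > v0 ==> mesh_at x a w" and t: "t < B"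
 shows "a (v0 + 1 + int t) i = (\<Sum>j\<in>UNIV. a (v0 + 1) j * P x i j (int t) - x powi (- 2 * int (d j)) * a v0 j * P x i j (int t - 1))"
 using t
proof (induction t arbitrary: i rule: less_induct)
 case (less t)
 let ?E = "\<lambda>t i. \<Sum>j\<in>UNIV. a (v0 + 1) j * P x i j t - x powi (- 2 * int (d j)) * a v0 j * P x i j (t - 1)"
 show ?case
 proof (cases "t = 0")
  case True
  thus ?thesis by(simp add: P_0 P_neg if_distrib[of "\<lambda>t. _ * t"] cong: if_cong)
 next
  case False
  define w where "w = v0 + int t"
  define e e' where "e = x powi int (d i)" and "e' = x powi (- int (d i))"
  have ee: "e * e' = 1" and e0: "e > 0" and e2: "x powi (- 2 * int (d i)) = e' * e'" unfolding e_def e'_def by(rule powi_double(3)[OF x], simp add: x, rule powi_double(2)[OF x])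
  have "mesh_at x a w" by(rule m) (use False w_def in simp)
  hence "e * a (w + 1) i + e' * a (w - 1) i = (\<Sum>y | adj C i y. b x i y * a w y)" unfolding mesh_at_def e_def e'_def by blast
  also have "\<dots> = (\<Sum>y | adj C i y. b x i y * ?E (int t - 1) y)"
  proof (intro sum.cong refl)
   fix y
   have "a w y = ?E (int (t - 1)) y" using less.IH[of "t - 1" y] False less.prems by(simp add: w_def)
   thus "b x i y * a w y = b x i y * ?E (int t - 1) y" using False by(simp add: of_nat_diff)
  qed
  also have "\<dots> = (\<Sum>j\<in>UNIV. a (v0 + 1) j * (\<Sum>y | adj C i y. b x i y * P x y j (int t - 1))
    - x powi (- 2 * int (d j)) * a v0 j * (\<Sum>y | adj C i y. b x i y * P x y j (int t - 1 - 1)))"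
   unfolding sum_distrib_left sum_subtractf[symmetric] right_diff_distrib
   by(subst sum.swap) (simp add: mult_ac)
  \<comment> \<open>For t = 1 the second sum is taken at time -1, outside the range of
    \<open>P_rec\<close>, and is 0; the initial value at v0 then comes from the term a(w -
    1).\<close>
  also have "\<dots> = (\<Sum>j\<in>UNIV. a (v0 + 1) j * (e * P x i j (int t) + e' * P x i j (int t - 2))
    - x powi (- 2 * int (d j)) * a v0 j * (if t = 1 then 0 else e * P x i j (int t - 1) + e' * P x i j (int t - 3)))"
  proof (intro sum.cong refl)
   fix j
   have 1: "(\<Sum>y | adj C i y. b x i y * P x y j (int t - 1)) = e * P x i j (int t) + e' * P x i j (int t - 2)"
    using P_rec[OF x, of "int t - 1" i j] False less.prems by(simp add: e_def e'_def)
   have 2: "(\<Sum>y | adj C i y. b x i y * P x y j (int t - 1 - 1)) = (if t = 1 then 0 else e * P x i j (int t - 1) + e' * P x i j (int t - 3))"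
    using P_rec[OF x, of "int t - 2" i j] False less.prems by(simp add: e_def e'_def P_neg)
   show "a (v0 + 1) j * (\<Sum>y | adj C i y. b x i y * P x y j (int t - 1)) - x powi (- 2 * int (d j)) * a v0 j * (\<Sum>y | adj C i y. b x i y * P x y j (int t - 1 - 1))
    = a (v0 + 1) j * (e * P x i j (int t) + e' * P x i j (int t - 2))
    - x powi (- 2 * int (d j)) * a v0 j * (if t = 1 then 0 else e * P x i j (int t - 1) + e' * P x i j (int t - 3))"
    unfolding 1 2 ..
  qed
  finally have main: "e * a (w + 1) i + e' * a (w - 1) i = \<dots>" .
  have "e * a (w + 1) i = e * ?E (int t) i"
  proof (cases "t = 1")
   case True
   have H1: "(\<Sum>j\<in>UNIV. a (v0 + 1) j * (e * P x i j (int t) + e' * P x i j (int t - 2))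
    - x powi (- 2 * int (d j)) * a v0 j * (if t = 1 then 0 else e * P x i j (int t - 1) + e' * P x i j (int t - 3)))
    = e * (\<Sum>j\<in>UNIV. a (v0 + 1) j * P x i j 1)"
    using True by(simp add: P_neg sum_distrib_left mult_ac)
   moreover have E: "?E (int t) i = (\<Sum>j\<in>UNIV. a (v0 + 1) j * P x i j 1) - e' * e' * a v0 i"
    using True by(simp add: P_0 sum_subtractf if_distrib[of "\<lambda>t. _ * t"] flip: e2 cong: if_cong)
   moreover have H3: "a (w - 1) i = a v0 i" using True by(simp add: w_def)
   moreover have ee2: "e * (e' * e' * a v0 i) = e' * a v0 i" using ee by(simp flip: mult.assoc)
   ultimately show ?thesis using main[unfolded H1 H3] unfolding E right_diff_distrib ee2 by linarith
  next
   case ne: False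
   have "a (w - 1) i = ?E (int (t - 2)) i" using less.IH[of "t - 2" i] False ne less.prems by(simp add: w_def)
   moreover have "int (t - 2) = int t - 2" using False ne by simp
   ultimately have "e' * a (w - 1) i = (\<Sum>j\<in>UNIV. a (v0 + 1) j * (e' * P x i j (int t - 2)) - x powi (- 2 * int (d j)) * a v0 j * (e' * P x i j (int t - 3)))"
    by(simp add: sum_distrib_left right_diff_distrib mult_ac)
   with main show ?thesis using ne
    by(simp add: sum_distrib_left right_diff_distrib distrib_left sum.distrib sum_subtractf mult_ac)
  qed
  thus ?thesis using e0 by(simp add: w_def add_ac)
 qed
qed

text \<open>At t = B - 1 the coefficients of the value at v + 1 vanish by \<open>P_high\<close>.
  Those of the value at v are the permutation \<sigma> by \<open>P_top\<close>, where x^(-2 d_j)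
  cancels the 2 d_j in the exponent.\<close>

lemma half_period:
 assumes x: "x > 0" and m: "\<And>w. w > v ==> mesh_at x a w"
 shows "a (v + int B) i = - (x powi G) * a v (\<sigma> i)"
proof -
 have t: "B - 1 < B" "int (B - 1) = int B - 1" using B2 by auto
 have "a (v + int B) i = (\<Sum>j\<in>UNIV. a (v + 1) j * P x i j (int B - 1) - x powi (- 2 * int (d j)) * a v j * P x i j (int B - 1 - 1))"
  unfolding t(2)[symmetric] using mesh_expansion[of x v a "B - 1" i, OF x m t(1)] t(2) by simp
 also have "\<dots> = (\<Sum>j\<in>UNIV. if j = \<sigma> i then - (x powi G) * a v (\<sigma> i) else 0)"
 proof (intro sum.cong refl)
  fix j
  have "i = \<sigma> j \<longleftrightarrow> j = \<sigma> i" using \<sigma>_\<sigma> by metis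
  moreover have "x powi (- 2 * int (d j)) * x powi (G + 2 * int (d j)) = x powi G" using x by(simp flip: power_int_add)
  moreover have "x powi (- 2 * int (d j)) * a v j * x powi (G + 2 * int (d j)) = x powi G * a v j"
   using calculation(2) by(simp only: mult_ac)
  ultimately show "a (v + 1) j * P x i j (int B - 1) - x powi (- 2 * int (d j)) * a v j * P x i j (int B - 1 - 1)
   = (if j = \<sigma> i then - (x powi G) * a v (\<sigma> i) else 0)"
   by(auto simp: P_high P_top \<sigma>_\<sigma>)
 qed
 finally show ?thesis by simp
qed

section \<open>Deformed simple reflections, which solve the mesh relation for one coordinate, and
  their products\<close>

definition sx :: "real => 'i => real ^ 'i => real ^ 'i" where
 "sx x i z = (\<chi> k. if k = i then x powi (- int (d i)) * (\<Sum>y | adj C i y. b x i y * z $ y) - x powi (- 2 * int (d i)) * z $ i else z $ k)"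

definition cx :: "real => 'i list => real ^ 'i => real ^ 'i" where
 "cx x xs z = foldr (sx x) xs z"

lemma cx_other: "i \<notin> set xs ==> cx x xs z $ i = z $ i"
 by(induction xs) (auto simp: cx_def sx_def)

lemma cx_append: "cx x (xs @ ys) z = cx x xs (cx x ys z)"
 by(simp add: cx_def)

text \<open>A word acts from its right end: when \<open>k\<close> is reflected, the vertices of
  \<open>zs\<close> already have their new values and those of \<open>ys\<close> still have the old
  ones.\<close>

lemma cx_relation:
 assumes x: "x > 0" and dist: "distinct (ys @ k # zs)" and all: "set (ys @ k # zs) = UNIV"
 shows "x powi int (d k) * cx x (ys @ k # zs) z $ k + x powi (- int (d k)) * z $ k =
  (\<Sum>y | adj C k y. b x k y * (if y \<in> set zs then cx x (ys @ k # zs) z $ y else z $ y))"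
proof -
 let ?c = "cx x (ys @ k # zs) z" and ?u = "cx x zs z"
 have c: "?c = cx x ys (sx x k ?u)" by(simp add: cx_append) (simp add: cx_def)
 have ck: "?c $ k = x powi (- int (d k)) * (\<Sum>y | adj C k y. b x k y * ?u $ y) - x powi (- 2 * int (d k)) * ?u $ k"
  using dist cx_other[of k ys] unfolding c by(simp add: sx_def)
 have uk: "?u $ k = z $ k" using dist by(simp add: cx_other)
 have "?u $ y = (if y \<in> set zs then ?c $ y else z $ y)" if "adj C k y" for y
 proof (cases "y \<in> set zs")
  case True
  hence "y \<notin> set ys" using dist by auto
  thus ?thesis using True that cx_other[of y ys x "sx x k ?u"] unfolding c by(auto simp: sx_def adj_def)
 qed (simp add: cx_other)
 hence "(\<Sum>y | adj C k y. b x k y * ?u $ y) = (\<Sum>y | adj C k y. b x k y * (if y \<in> set zs then ?c $ y else z $ y))"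
  by(intro sum.cong) auto
 moreover define e e' where "e = x powi int (d k)" and "e' = x powi (- int (d k))"
 moreover have "e * e' = 1" "x powi (- 2 * int (d k)) = e' * e'" unfolding e_def e'_def by(rule powi_double(3)[OF x], rule powi_double(2)[OF x])
 ultimately show ?thesis unfolding e_def[symmetric] e'_def[symmetric] ck uk
  by(simp add: right_diff_distrib flip: mult.assoc)
qed

lemma cx_inj:
 assumes "x > 0"
 shows "cx x xs z = cx x xs z' ==> z = z'"
proof (induction xs)
 case (Cons i xs)
 have "sx x i u = sx x i u' ==> u = u'" for u u'
 proof -
  assume e: "sx x i u = sx x i u'"
  have k: "u $ k = u' $ k" if "k \<noteq> i" for k using arg_cong[OF e, of "\<lambda>v. v $ k"] that by(simp add: sx_def)
  have "(\<Sum>y | adj C i y. b x i y * u $ y) = (\<Sum>y | adj C i y. b x i y * u' $ y)"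
   by(intro sum.cong refl) (use k in \<open>auto simp: adj_def\<close>)
  hence "u $ i = u' $ i" using arg_cong[OF e, of "\<lambda>v. v $ i"] assms by(simp add: sx_def)
  thus "u = u'" using k unfolding vec_eq_iff by metis
 qed
 thus ?case using Cons by(simp add: cx_def)
qed (simp add: cx_def)

text \<open>The order of the letters orients the edges. As the diagram is a forest, the orientation
  comes from a height function, normalised here to minimum 0.\<close>

lemma ordering_height:
 assumes "distinct xs" "set xs = UNIV"
 obtains \<xi> :: "'i => int" where "\<And>i. \<xi> i \<ge> 0" "\<exists>j. \<xi> j = 0"
  "\<And>ys k zs i. xs = ys @ k # zs ==> adj C k i ==> \<xi> i = \<xi> k + (if i \<in> set zs then 1 else -1)"
proof -
 define pos where "pos i = (THE p. p < length xs \<and> xs ! p = i)" for i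
 have pos: "pos (xs ! p) = p" if "p < length xs" for p
  unfolding pos_def by(rule the_equality) (use that assms(1) nth_eq_iff_index_eq in auto)
 define h where "h k i = (if pos i = pos k then 0 else if pos i > pos k then 1 else -1 :: int)" for k i
 obtain \<xi> where \<xi>: "\<And>i j. adj C i j ==> \<xi> j = \<xi> i + h i j"
 proof -
  have "h i j = - h j i" for i j by(simp add: h_def)
  thus thesis using height_function[of h] that by blast
 qed
 define m where "m = Min (range \<xi>)"
 have m: "m \<le> \<xi> i" "m \<in> range \<xi>" for i unfolding m_def by(auto intro: Min_in)
 show thesis
 proof (rule that[of "\<lambda>i. \<xi> i - m"])
  fix ys k zs i
  assume xs: "xs = ys @ k # zs" and a: "adj C k i"
  have pk: "pos k = length ys" using pos[of "length ys"] xs by simp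
  obtain p where p: "p < length xs" "xs ! p = i" using assms(2) in_set_conv_nth[of i xs] by auto
  have pi: "pos i = p" using pos[OF p(1)] p(2) by simp
  have "i \<noteq> k" using a by(auto simp: adj_def)
  have "i \<in> set zs \<longleftrightarrow> p > length ys"
  proof
   assume "p > length ys"
   hence "zs ! (p - Suc (length ys)) = i" "p - Suc (length ys) < length zs"
    using p xs by(auto simp: nth_append nth_Cons')
   thus "i \<in> set zs" by(metis nth_mem)
  next
   assume i: "i \<in> set zs"
   show "p > length ys"
   proof (rule ccontr)
    assume "\<not> p > length ys"
    hence "i \<in> set (ys @ [k])" using p xs by(cases "p = length ys") (auto simp: nth_append)
    thus False using i xs assms(1) by auto
   qed
  qed
  moreover have "p \<noteq> length ys" using p(2) xs \<open>i \<noteq> k\<close> by auto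
  ultimately show "\<xi> i - m = \<xi> k - m + (if i \<in> set zs then 1 else -1)"
   using \<xi>[OF a] by(simp add: h_def pk pi)
 qed (use m in auto)
qed

end

locale coxeter_word = mesh C b P \<sigma> B G for C :: "int ^ 'i ^ 'i" and b P \<sigma> B G +
 fixes xs :: "'i list" and \<xi> :: "'i => int"
 assumes dist: "distinct xs" and all: "set xs = UNIV"
  and \<xi>_nonneg: "\<xi> i \<ge> 0" and \<xi>_0: "\<exists>j. \<xi> j = 0"
  and \<xi>_step: "xs = ys @ k # zs ==> adj C k i ==> \<xi> i = \<xi> k + (if i \<in> set zs then 1 else -1)"
begin

definition zm :: "real => real ^ 'i => nat => real ^ 'i" where
 "zm x z m = (cx x xs ^^ m) z"

text \<open>The value at vertex \<open>i\<close> after m applications of the word is placed at time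
  2 m - \<xi>_i. In this slanted time \<open>cx_relation\<close> becomes the mesh relation; times of
  the wrong parity are filled with 0.\<close>

definition aseq :: "real => real ^ 'i => int => 'i => real" where
 "aseq x z v i = (if even (v + \<xi> i) \<and> v + \<xi> i \<ge> 0 then zm x z (nat ((v + \<xi> i) div 2)) $ i else 0)"

lemma aseq_zm: "aseq x z (2 * int m - \<xi> i) i = zm x z m $ i"
 by(simp add: aseq_def)

lemma aseq_mesh:
 assumes x: "x > 0" and w: "w - 1 \<ge> - \<xi> i"
 shows "x powi int (d i) * aseq x z (w + 1) i + x powi (- int (d i)) * aseq x z (w - 1) i
   = (\<Sum>y | adj C i y. b x i y * aseq x z w y)"
proof -
 obtain ys zs where xs: "xs = ys @ i # zs" using all split_list[of i xs] by auto
 have step: "adj C i y ==> \<xi> y = \<xi> i + (if y \<in> set zs then 1 else -1)" for y using \<xi>_step[OF xs] .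
 show ?thesis
 proof (cases "even (w - 1 + \<xi> i)")
  case False
  have "aseq x z w y = 0" if "adj C i y" for y using False step[OF that] by(auto simp: aseq_def)
  moreover have "aseq x z (w + 1) i = 0" "aseq x z (w - 1) i = 0" using False by(auto simp: aseq_def)
  ultimately show ?thesis by simp
 next
  case True
  then obtain m where m: "w - 1 = 2 * int m - \<xi> i"
   using w by(metis (no_types, opaque_lifting) add.commute add_diff_cancel_left' evenE diff_ge_0_iff_ge diff_minus_eq_add nonneg_int_cases zero_le_mult_iff zero_less_numeral less_le_not_le)
  have "w + 1 = 2 * int (Suc m) - \<xi> i" using m by simp
  have "aseq x z w y = (if y \<in> set zs then zm x z (Suc m) $ y else zm x z m $ y)" if "adj C i y" for y
  proof -
   have "w = 2 * int (if y \<in> set zs then Suc m else m) - \<xi> y" using m step[OF that] by auto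
   thus ?thesis using aseq_zm[of x z "if y \<in> set zs then Suc m else m" y] by simp
  qed
  hence "(\<Sum>y | adj C i y. b x i y * aseq x z w y) = (\<Sum>y | adj C i y. b x i y * (if y \<in> set zs then zm x z (Suc m) $ y else zm x z m $ y))"
   by(intro sum.cong) auto
  moreover have "zm x z (Suc m) = cx x xs (zm x z m)" by(simp add: zm_def)
  moreover note cx_relation[OF x, of ys i zs "zm x z m", folded xs, OF dist all]
  ultimately show ?thesis
   unfolding m \<open>w + 1 = _\<close> aseq_zm by metis
 qed
qed

lemma aseq_mesh_at: "x > 0 ==> w > 0 ==> mesh_at x (aseq x z) w"
 unfolding mesh_at_def
proof
 fix i assume "x > 0" "w > 0"
 thus "x powi int (d i) * aseq x z (w + 1) i + x powi (- int (d i)) * aseq x z (w - 1) i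
   = (\<Sum>y | adj C i y. b x i y * aseq x z w y)"
  using \<xi>_nonneg[of i] by(intro aseq_mesh) auto
qed

lemma cx_funpow_inj: "x > 0 ==> (cx x xs ^^ m) z = (cx x xs ^^ m) z' ==> z = z'"
 by(induction m) (auto dest: cx_inj)

lemma cx_scale: "cx x ys (c *\<^sub>R z) = c *\<^sub>R cx x ys z"
proof (induction ys)
 case (Cons i ys)
 have "sx x i (c *\<^sub>R u) = c *\<^sub>R sx x i u" for u
  by(simp add: vec_eq_iff sx_def sum_distrib_left right_diff_distrib mult_ac)
 thus ?case using Cons by(simp add: cx_def)
qed (simp add: cx_def)

text \<open>Two half periods give the factor x^(2 G), as \<sigma> is an involution. The argument
  begins after \<open>M\<close> applications, when the mesh relation is available at all vertices
  and later times; injectivity of the reflections removes \<open>M\<close> again.\<close>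

lemma coxeter_period:
 assumes x: "x > 0"
 shows "(cx x xs ^^ B) z = (x powi (2 * G)) *\<^sub>R z"
proof -
 obtain M :: nat where M: "\<And>i. 2 * int M \<ge> \<xi> i"
 proof
  fix i
  have "\<xi> i \<le> Max (range \<xi>)" by simp
  thus "2 * int (nat (Max (range \<xi>))) \<ge> \<xi> i" using \<xi>_nonneg[of i] by linarith
 qed
 have "zm x z (M + B) $ i = (x powi (2 * G)) * zm x z M $ i" for i
 proof -
  let ?v = "2 * int M - \<xi> i"
  have "aseq x z (?v + int B + int B) i = - (x powi G) * aseq x z (?v + int B) (\<sigma> i)"
   by(rule half_period[OF x], rule aseq_mesh_at[OF x]) (use M[of i] in simp)
  also have "aseq x z (?v + int B) (\<sigma> i) = - (x powi G) * aseq x z ?v i"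
   by(subst half_period[OF x], rule aseq_mesh_at[OF x]) (use M[of i] in \<open>simp_all add: \<sigma>_\<sigma>\<close>)
  finally have "aseq x z (2 * int (M + B) - \<xi> i) i = x powi (2 * G) * aseq x z ?v i"
   using powi_double(1)[OF x, of G] by(simp add: algebra_simps)
  thus ?thesis unfolding aseq_zm .
 qed
 hence "(cx x xs ^^ M) ((cx x xs ^^ B) z) = (x powi (2 * G)) *\<^sub>R (cx x xs ^^ M) z"
  by(simp add: zm_def funpow_add vec_eq_iff)
 also have "\<dots> = (cx x xs ^^ M) ((x powi (2 * G)) *\<^sub>R z)"
  by(induction M) (simp_all add: cx_scale[symmetric])
 finally show ?thesis by(rule cx_funpow_inj[OF x])
qed

text \<open>Started at a simple root of height 0, the sequence is column \<open>j\<close> of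
  \<open>P\<close> from time 0 on: nonzero at the times 0, ..., B - 2, zero at B - 1, and then
  repeated, up to \<sigma>, with the opposite sign. A period 2 n makes it vanish at 2 n - 1, which
  for n < B leaves 2 n = B, and this contradicts the sign.\<close>

lemma coxeter_order:
 assumes n: "0 < n" "\<And>j. (cx 1 xs ^^ n) (axis j 1) = axis j 1"
 shows "n \<ge> B"
proof (rule ccontr)
 assume nB: "\<not> n \<ge> B"
 obtain j where j: "\<xi> j = 0" using \<xi>_0 by blast
 define a where "a = aseq 1 (axis j 1)"
 \<comment> \<open>Vertex \<open>i\<close> starts at time -\<xi>_i with value 0 unless i = j. As
   \<xi>_j = 0, only zeros are fed into the recursion before time 0.\<close>
 have neg: "a v i = 0" if "v < 0" for v i
  using that
 proof (induction "nat (v + Max (range \<xi>))" arbitrary: v i rule: less_induct)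
  case less
  show ?case
  proof (cases "v + \<xi> i > 0")
   case True
   hence mx: "\<xi> i \<le> Max (range \<xi>)" by simp
   show ?thesis
   proof (cases "even (v + \<xi> i)")
    case False then show ?thesis by(simp add: a_def aseq_def)
   next
    case ev: True
    hence g: "v + \<xi> i \<ge> 2" using True by presburger
    have "a (v - 1) y = 0" for y using less.hyps[of "v - 1" y] less.prems g mx by auto
    moreover have "a (v - 2) i = 0" using less.hyps[of "v - 2" i] less.prems g mx by auto
    ultimately show ?thesis using aseq_mesh[of 1 i "v - 1" "axis j 1"] g by(simp add: a_def)
   qed
  next
   case False
   show ?thesis
   proof (cases "v + \<xi> i = 0")
    case True
    hence "i \<noteq> j" using j less.prems by auto
    thus ?thesis using True by(simp add: a_def aseq_def zm_def axis_def)
   qed (use False in \<open>simp add: a_def aseq_def\<close>)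
  qed
 qed
 have a0: "a 0 i = (if i = j then 1 else 0)" for i
 proof (cases "\<xi> i = 0")
  case True then show ?thesis by(simp add: a_def aseq_def zm_def axis_def)
 next
  case False
  hence "i \<noteq> j" using j by auto
  show ?thesis
  proof (cases "\<xi> i \<ge> 2")
   case True
   have "a (- 1) y = 0" "a (- 2) i = 0" for y using neg by auto
   thus ?thesis using aseq_mesh[of 1 i "- 1" "axis j 1"] True \<open>i \<noteq> j\<close> by(simp add: a_def)
  next
   case F: False
   hence "\<xi> i = 1" using False \<xi>_nonneg[of i] by simp
   thus ?thesis using \<open>i \<noteq> j\<close> by(simp add: a_def aseq_def)
  qed
 qed
 have m: "mesh_at 1 a w" if "w > - 1" for w
 proof (cases "w = 0")
  case True
  show ?thesis unfolding mesh_at_def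
  proof
   fix i
   show "1 powi int (d i) * a (w + 1) i + 1 powi (- int (d i)) * a (w - 1) i = (\<Sum>y | adj C i y. b 1 i y * a w y)"
   proof (cases "\<xi> i \<ge> 1")
    case T: True
    thus ?thesis using aseq_mesh[of 1 i w "axis j 1"] True by(simp add: a_def)
   next
    case F: False
    hence xi: "\<xi> i = 0" using \<xi>_nonneg[of i] by simp
    obtain ys zs where xs: "xs = ys @ i # zs" using all split_list[of i xs] by auto
    have "a 0 y = 0" if "adj C i y" for y
    proof -
     have "odd (\<xi> y)" using \<xi>_step[OF xs that] xi by auto
     thus ?thesis by(simp add: a_def aseq_def)
    qed
    thus ?thesis using True xi by(simp add: a_def aseq_def)
   qed
  qed
 next
  case False
  thus ?thesis using that unfolding a_def by(intro aseq_mesh_at) auto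
 qed
 have aP: "a (int t) i = P 1 i j (int t)" if "t < B" for t i
 proof -
  have "a (int t) i = (\<Sum>l\<in>UNIV. a 0 l * P 1 i l (int t))"
   using mesh_expansion[of 1 "-1" a t i, OF _ m that] neg by simp
  thus ?thesis by(simp add: a0 if_distrib[of "\<lambda>t. t * _"] cong: if_cong)
 qed
 have hp: "a (v + int B) i = - a v (\<sigma> i)" if "v \<ge> 0" for v i
  using half_period[of 1 v a i, OF _ m] that by simp
 have per: "a (v + 2 * int n) i = a v i" if "v \<ge> - \<xi> i" for v i
 proof (cases "even (v + \<xi> i)")
  case True
  have "zm 1 (axis j 1) (nat ((v + 2 * int n + \<xi> i) div 2)) = zm 1 (axis j 1) (nat ((v + \<xi> i) div 2))"
  proof -
   have "nat ((v + 2 * int n + \<xi> i) div 2) = nat ((v + \<xi> i) div 2) + n" using that by linarith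
   thus ?thesis by(simp add: zm_def funpow_add n(2))
  qed
  thus ?thesis using True that by(simp add: a_def aseq_def)
 qed (simp add: a_def aseq_def)
 have zero: "a (2 * int n - 1) i = 0" for i
 proof (cases "\<xi> i \<ge> 1")
  case True
  thus ?thesis using per[where v="-1" and i=i] neg by(simp add: algebra_simps)
 next
  case False
  hence "\<xi> i = 0" using \<xi>_nonneg[of i] by simp
  thus ?thesis by(simp add: a_def aseq_def)
 qed
 consider "2 * n \<le> B - 1" | "2 * n = B" | "2 * n > B" by linarith
 thus False
 proof cases
  case 1
  hence t: "2 * n - 1 < B" "int (2 * n - 1) = 2 * int n - 1" "int (2 * n - 1) \<le> int B - 2" using n B2 by auto
  obtain i where "P 1 i j (int (2 * n - 1)) \<noteq> 0" using P_ex[of 1 "int (2 * n - 1)" j] t by auto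
  thus False using aP[OF t(1), of i] zero[of i] t(2) by simp
 next
  case 2
  have "a (0 + int B) j = a 0 j" using per[where v=0 and i=j] j 2 by(simp flip: 2)
  thus False using hp[of 0 j] a0 by(simp split: if_splits)
 next
  case 3
  define t where "t = 2 * n - 1 - B"
  have t: "t < B" "int t \<le> int B - 2" "2 * int n - 1 = int t + int B" using 3 nB by(auto simp: t_def)
  obtain i where i: "P 1 i j (int t) \<noteq> 0" using P_ex[of 1 "int t" j] t by auto
  have "a (int t + int B) (\<sigma> i) = - a (int t) i" using hp[of "int t" "\<sigma> i"] by(simp add: \<sigma>_\<sigma>)
  thus False using aP[OF t(1), of i] i zero[of "\<sigma> i"] t(3) by simp
 qed
qed

section \<open>Determinants of the deformed reflections\<close>

definition smat :: "real => 'i => real ^ 'i ^ 'i" where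
 "smat x i = (\<chi> k. if k = i then (\<chi> y. (if adj C i y then x powi (- int (d i)) * b x i y else 0) - (if y = i then x powi (- 2 * int (d i)) else 0))
   else axis k 1)"

lemma smat_sx: "smat x i *v z = sx x i z"
proof -
 have "(smat x i *v z) $ k = sx x i z $ k" for k
 proof (cases "k = i")
  case True
  have "(smat x i *v z) $ k = (\<Sum>y\<in>UNIV. (if adj C i y then x powi (- int (d i)) * b x i y * z $ y else 0) - (if y = i then x powi (- 2 * int (d i)) * z $ i else 0))"
   unfolding matrix_vector_mult_def smat_def by(simp add: True) (intro sum.cong refl, simp add: left_diff_distrib)
  also have "\<dots> = (\<Sum>y | adj C i y. x powi (- int (d i)) * b x i y * z $ y) - x powi (- 2 * int (d i)) * z $ i"
   using sum.inter_filter[of UNIV "\<lambda>y. x powi (- int (d i)) * b x i y * z $ y" "adj C i"] by(simp add: sum_subtractf)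
  finally show ?thesis by(simp add: sx_def True sum_distrib_left mult.assoc)
 next
  case False
  hence "(smat x i *v z) $ k = z $ k"
   unfolding matrix_vector_mult_def smat_def by(simp add: axis_def if_distrib[of "\<lambda>t. t * _"] cong: if_cong)
  thus ?thesis using False by(simp add: sx_def)
 qed
 thus ?thesis by(simp add: vec_eq_iff)
qed

text \<open>The matrix is the identity with row \<open>i\<close> replaced, so its determinant is the
  diagonal entry of that row.\<close>

lemma det_smat: "det (smat x i) = - (x powi (- 2 * int (d i)))"
proof -
 let ?v = "smat x i $ i"
 have "smat x i = (\<chi> k. if k = i then (\<Sum>l\<in>UNIV. ?v $ l *s row l (mat 1 :: real ^ 'i ^ 'i)) else row k (mat 1))"
 proof -
  have r: "row l (mat 1 :: real ^ 'i ^ 'i) = axis l 1" for l by(simp add: row_def mat_def axis_def vec_eq_iff)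
  have "(\<Sum>l\<in>UNIV. ?v $ l *s axis l 1) = ?v"
   by(simp add: vec_eq_iff axis_def if_distrib[of "\<lambda>t. _ * t"] cong: if_cong)
  thus ?thesis unfolding r by(simp add: vec_eq_iff smat_def)
 qed
 hence "det (smat x i) = ?v $ i * det (mat 1 :: real ^ 'i ^ 'i)" using cramer_lemma_transpose[of i ?v "mat 1"] by simp
 also have "\<dots> = - (x powi (- 2 * int (d i)))" by(simp add: smat_def adj_def)
 finally show ?thesis .
qed

text \<open>Determinants of both sides of \<open>coxeter_period\<close> at x = 2: each reflection
  contributes -2^(-2 d_i), and the scalar 2^(2 G) contributes its power with the rank as exponent.
  Absolute values dispose of the signs, and exponents of 2 can be compared.\<close>

lemma degree_formula: "- G * int CARD('i) = int B * (\<Sum>i\<in>UNIV. int (d i))"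
proof -
 define M where "M = foldr (\<lambda>i A. smat 2 i ** A) xs (mat 1)"
 have "foldr (\<lambda>i A. smat 2 i ** A) ys (mat 1) *v z = cx 2 ys z" for ys z
  by(induction ys) (simp_all add: cx_def flip: smat_sx matrix_vector_mul_assoc)
 hence M: "M *v z = cx 2 xs z" for z by(simp add: M_def)
 have "det (foldr (\<lambda>i A. smat 2 i ** A) ys (mat 1)) = (\<Prod>i\<leftarrow>ys. - (2 powi (- 2 * int (d i))))" for ys
  by(induction ys) (simp_all add: det_mul det_smat)
 hence "det M = (\<Prod>i\<leftarrow>xs. - (2 powi (- 2 * int (d i))))" by(simp add: M_def)
 also have "\<dots> = (\<Prod>i\<in>UNIV. - (2 powi (- 2 * int (d i))))"
  using prod.distinct_set_conv_list[OF dist, of "\<lambda>i. - (2 powi (- 2 * int (d i)) :: real)"] all by simp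
 finally have "\<bar>det M\<bar> = (\<Prod>i\<in>UNIV. 2 powi (- 2 * int (d i)))" by(simp add: abs_prod)
 moreover have "(\<Prod>i\<in>A. 2 powi g i) = (2::real) powi (\<Sum>i\<in>A. g i)" if "finite A" for A and g :: "'i => int"
  using that by(induction A) (simp_all add: power_int_add)
 ultimately have dM: "\<bar>det M\<bar> = 2 powi (- 2 * (\<Sum>i\<in>UNIV. int (d i)))" by(simp only: finite sum_distrib_left)
 have "((**) M ^^ n) (mat 1) *v z = (cx 2 xs ^^ n) z" for n z
  by(induction n) (simp_all add: M flip: matrix_vector_mul_assoc)
 hence "((**) M ^^ B) (mat 1) *v z = ((2 powi (2 * G)) *\<^sub>R mat 1) *v z" for z
  using coxeter_period[of 2 z] by(simp add: scaleR_matrix_vector_assoc[symmetric])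
 hence "((**) M ^^ B) (mat 1) = (2 powi (2 * G)) *\<^sub>R mat 1" by(simp add: matrix_eq)
 moreover have "det (((**) M ^^ n) (mat 1)) = det M ^ n" for n by(induction n) (simp_all add: det_mul)
 moreover have "det ((2 powi (2 * G)) *\<^sub>R mat 1 :: real ^ 'i ^ 'i) = (2 powi (2 * G)) ^ CARD('i)"
  by(subst det_diagonal) (auto simp: mat_def)
 ultimately have "\<bar>det M\<bar> ^ B = (2 powi (2 * G)) ^ CARD('i)" by(metis abs_of_pos power_abs zero_less_numeral zero_less_power zero_less_power_int)
 moreover have "((2::real) powi a) ^ n = 2 powi (a * int n)" for a n by(simp add: power_int_mult)
 ultimately have "2 powi (- 2 * (\<Sum>i\<in>UNIV. int (d i)) * int B) = (2::real) powi (2 * G * int CARD('i))"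
  by(simp only: dM)
 hence e: "- 2 * (\<Sum>i\<in>UNIV. int (d i)) * int B = 2 * G * int CARD('i)" by(simp only: powi_2_inject)
 have "- g * n = b * S" if "- 2 * S * b = 2 * g * n" for S b g n :: int
  using that by(simp add: mult.commute[of b S])
 from this[OF e] show ?thesis .
qed

end

section \<open>Roots and the Weyl group\<close>

lemma even_double_sum:
 fixes g :: "'a => 'a => int"
 assumes "finite A" "\<And>i j. g i j = g j i" "\<And>i j. m dvd g i j" "\<And>i. 2 * m dvd g i i"
 shows "2 * m dvd (\<Sum>i\<in>A. \<Sum>j\<in>A. g i j)"
 using assms(1)
proof (induction A)
 case (insert a A)
 have "(\<Sum>j\<in>A. g j a) = (\<Sum>j\<in>A. g a j)" by(intro sum.cong refl assms(2))
 hence "(\<Sum>i\<in>insert a A. \<Sum>j\<in>insert a A. g i j) = g a a + 2 * (\<Sum>j\<in>A. g a j) + (\<Sum>i\<in>A. \<Sum>j\<in>A. g i j)"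
  using insert.hyps by(simp add: sum.distrib)
 moreover have "2 * m dvd 2 * (\<Sum>j\<in>A. g a j)" using assms(3) by(intro mult_dvd_mono dvd_sum) auto
 ultimately show ?case using assms(4)[of a] insert by simp
qed simp

context cartan
begin

abbreviation sr where "sr \<equiv> simple_reflection C"
abbreviation wa where "wa \<equiv> word_action C"
abbreviation rf where "rf \<equiv> root_form C"
abbreviation \<alpha> :: "'i => int ^ 'i" where "\<alpha> i \<equiv> axis i 1"

lemma rf_add: "rf (x + y) z = rf x z + rf y z" "rf z (x + y) = rf z x + rf z y"
 and rf_diff: "rf (x - y) z = rf x z - rf y z" "rf z (x - y) = rf z x - rf z y"
 and rf_scale: "rf (c *s x) z = c * rf x z" "rf z (c *s x) = c * rf z x"
 and rf_minus: "rf (- x) z = - rf x z" "rf z (- x) = - rf z x"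
 and rf_zero: "rf 0 z = 0" "rf z 0 = 0"
 by(simp_all add: root_form_def algebra_simps sum.distrib sum_subtractf sum_distrib_left sum_negf)

lemma rf_sum: "finite A ==> rf (\<Sum>a\<in>A. g a) z = (\<Sum>a\<in>A. rf (g a) z)"
 by(induction A rule: finite_induct) (simp_all add: rf_zero rf_add)

lemma rf_sym: "rf x y = rf y x"
proof -
 have "rf x y = (\<Sum>j\<in>UNIV. \<Sum>i\<in>UNIV. x $ i * (int (d i) * C $ i $ j) * y $ j)"
  unfolding root_form_def by(rule sum.swap)
 also have "\<dots> = rf y x" unfolding root_form_def d_sym by(intro sum.cong refl) (simp add: mult_ac)
 finally show ?thesis .
qed

lemma rf_pos: "x \<noteq> 0 ==> rf x x > 0"
proof -
 assume "x \<noteq> 0"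
 hence "(\<chi> i. real_of_int (x $ i)) \<noteq> 0" by(auto simp: vec_eq_iff)
 hence "form (\<chi> i. real_of_int (x $ i)) (\<chi> i. real_of_int (x $ i)) > 0" by(rule form_pos)
 also have "form (\<chi> i. real_of_int (x $ i)) (\<chi> i. real_of_int (x $ i)) = of_int (rf x x)"
  by(simp add: form_def root_form_def)
 finally show ?thesis by simp
qed

lemma rf_alpha: "rf (\<alpha> i) x = int (d i) * (\<Sum>j\<in>UNIV. C $ i $ j * x $ j)"
proof -
 have "rf (\<alpha> i) x = (\<Sum>k\<in>UNIV. if k = i then (\<Sum>j\<in>UNIV. int (d i) * C $ i $ j * x $ j) else 0)"
  unfolding root_form_def by(intro sum.cong refl) (simp add: axis_def)
 thus ?thesis by(simp add: sum_distrib_left mult.assoc)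
qed

lemma rf_alpha_alpha: "rf (\<alpha> i) (\<alpha> j) = int (d i) * C $ i $ j"
 unfolding rf_alpha by(simp add: axis_def if_distrib[of "\<lambda>t. _ * t"] cong: if_cong)

lemma rf_expand: "rf x y = (\<Sum>i\<in>UNIV. x $ i * rf (\<alpha> i) y)"
 unfolding rf_alpha by(simp add: root_form_def sum_distrib_left mult.assoc)

definition cpair :: "'i => int ^ 'i => int" where "cpair i x = (\<Sum>j\<in>UNIV. C $ i $ j * x $ j)"

lemma cpair_rf: "int (d i) * cpair i x = rf (\<alpha> i) x"
 by(simp add: rf_alpha cpair_def)

lemma sr_eq: "sr i x = x - cpair i x *s \<alpha> i"
 by(simp add: simple_reflection_def cpair_def)

lemma sr_nth: "sr i x $ k = (if k = i then x $ i - cpair i x else x $ k)"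
 by(simp add: sr_eq axis_def)

lemma cpair_alpha: "cpair i (\<alpha> j) = C $ i $ j"
 by(simp add: cpair_def axis_def if_distrib[of "\<lambda>t. _ * t"] cong: if_cong)

lemma cpair_linear: "cpair i (x + y) = cpair i x + cpair i y" "cpair i (c *s x) = c * cpair i x" "cpair i (- x) = - cpair i x"
 by(simp_all add: cpair_def algebra_simps sum.distrib sum_distrib_left sum_negf)

lemma sr_linear: "sr i (x + y) = sr i x + sr i y" "sr i (c *s x) = c *s sr i x" "sr i (- x) = - sr i x"
 by(simp_all add: vec_eq_iff sr_nth cpair_linear right_diff_distrib)

lemma sr_alpha: "sr i (\<alpha> i) = - \<alpha> i"
 unfolding sr_eq cpair_alpha diag by(simp add: vec_eq_iff axis_def)

lemma cpair_expand: "cpair i x = 2 * x $ i - (\<Sum>y | adj C i y. int (f i y) * x $ y)"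
proof -
 have "cpair i x = (\<Sum>j\<in>UNIV. (if j = i then 2 * x $ i else 0) - (if adj C i j then int (f i j) * x $ j else 0))"
  unfolding cpair_def
 proof (rule sum.cong[OF refl])
  fix j
  show "C $ i $ j * x $ j = (if j = i then 2 * x $ i else 0) - (if adj C i j then int (f i j) * x $ j else 0)"
   using C_adj[of i j] C_mul[of i j] by(cases "j = i") (auto simp: diag adj_def)
 qed
 also have "\<dots> = 2 * x $ i - (\<Sum>y | adj C i y. int (f i y) * x $ y)"
  using sum.inter_filter[of UNIV "\<lambda>y. int (f i y) * x $ y" "adj C i"] by(simp add: sum_subtractf)
 finally show ?thesis .
qed

lemma sr_sr: "sr i (sr i x) = x"
proof -
 have "cpair i (sr i x) = - cpair i x"
  by(simp add: sr_eq diff_conv_add_uminus cpair_linear cpair_alpha diag del: add_uminus_conv_diff)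
 thus ?thesis by(simp add: vec_eq_iff sr_nth)
qed

lemma rf_sr: "rf (sr i x) (sr i y) = rf x y"
proof -
 have h: "rf x (\<alpha> i) = int (d i) * cpair i x" "rf (\<alpha> i) y = int (d i) * cpair i y" for x y
  using cpair_rf rf_sym by metis+
 show ?thesis
  by(simp only: sr_eq rf_diff rf_scale rf_alpha_alpha diag h(1)[of x] h(2)[of y]) (simp add: algebra_simps)
qed

lemma wa_Nil: "wa [] x = x" and wa_Cons: "wa (i # xs) x = sr i (wa xs x)"
 by(simp_all add: word_action_def)

lemma wa_append: "wa (xs @ ys) x = wa xs (wa ys x)"
 by(induction xs) (simp_all add: wa_Nil wa_Cons)

lemma wa_linear: "wa xs (x + y) = wa xs x + wa xs y" "wa xs (c *s x) = c *s wa xs x" "wa xs (- x) = - wa xs x"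
 by(induction xs) (simp_all add: wa_Nil wa_Cons sr_linear)

lemma wa_diff: "wa xs (x - y) = wa xs x - wa xs y"
 using wa_linear(1)[of xs x "- y"] by(simp add: wa_linear)

lemma wa_rev: "wa (rev xs) (wa xs x) = x" "wa xs (wa (rev xs) x) = x"
 by(induction xs arbitrary: x) (simp_all add: wa_Nil wa_Cons wa_append sr_sr)

lemma rf_wa: "rf (wa xs x) (wa xs y) = rf x y"
 by(induction xs) (simp_all add: wa_Nil wa_Cons rf_sr)

abbreviation R where "R \<equiv> roots C"

lemma root_iff: "\<beta> \<in> R \<longleftrightarrow> (\<exists>xs i. \<beta> = wa xs (\<alpha> i))"
 by(auto simp: roots_def weyl_group_def)

lemma root_alpha: "\<alpha> i \<in> R"
 unfolding root_iff by(intro exI[of _ "[]"] exI[of _ i]) (simp add: wa_Nil)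

lemma root_wa: "\<beta> \<in> R ==> wa xs \<beta> \<in> R"
 unfolding root_iff by(metis wa_append)

lemma root_sr: "\<beta> \<in> R ==> sr i \<beta> \<in> R"
 using root_wa[of \<beta> "[i]"] by(simp add: wa_Cons wa_Nil)

lemma root_uminus: "\<beta> \<in> R ==> - \<beta> \<in> R"
proof -
 assume "\<beta> \<in> R"
 then obtain xs i where "\<beta> = wa xs (\<alpha> i)" unfolding root_iff by blast
 hence "- \<beta> = wa (xs @ [i]) (\<alpha> i)" by(simp add: wa_append wa_Cons wa_Nil sr_alpha wa_linear)
 thus ?thesis unfolding root_iff by blast
qed

lemma root_nonzero: "\<beta> \<in> R ==> \<beta> \<noteq> 0"
proof
 assume "\<beta> \<in> R" "\<beta> = 0"
 then obtain xs i where "wa xs (\<alpha> i) = 0" unfolding root_iff by metis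
 hence "rf (\<alpha> i) (\<alpha> i) = 0" using rf_wa[of xs "\<alpha> i" "\<alpha> i"] by(simp add: rf_zero)
 thus False using d_pos[of i] by(simp add: rf_alpha_alpha diag)
qed

text \<open>A sublattice that the Weyl group preserves because d_i c_ij is symmetric. For m = d_l it
  contains \<alpha>_l and so its whole orbit. Lower bounds for norms in it replace a case
  distinction by root lengths.\<close>

definition inL :: "nat => int ^ 'i => bool" where "inL m x \<longleftrightarrow> (\<forall>k. int m dvd int (d k) * x $ k)"

lemma inL_wa: "inL m x ==> inL m (wa xs x)"
proof (induction xs)
 case (Cons i xs)
 let ?y = "wa xs x"
 have y: "inL m ?y" using Cons by simp
 have "int (d i) * cpair i ?y = (\<Sum>j\<in>UNIV. C $ j $ i * (int (d j) * ?y $ j))"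
  unfolding cpair_def sum_distrib_left
 proof (rule sum.cong[OF refl])
  fix j
  show "int (d i) * (C $ i $ j * ?y $ j) = C $ j $ i * (int (d j) * ?y $ j)"
   using arg_cong[OF d_sym[of i j], of "\<lambda>t. t * ?y $ j"] by(simp add: mult_ac)
 qed
 hence "int m dvd int (d i) * cpair i ?y" using y by(simp add: inL_def dvd_sum)
 hence "inL m (sr i ?y)" using y by(auto simp: inL_def sr_nth right_diff_distrib)
 thus ?case by(simp add: wa_Cons)
qed (simp add: wa_Nil)

text \<open>Every term of the double sum is divisible by m, the sum is symmetric, and the diagonal
  terms gain a factor 2 from c_ii = 2.\<close>

lemma inL_norm: "inL m x ==> 2 * int m dvd rf x x"
 unfolding root_form_def
proof (rule even_double_sum)
 assume L: "inL m x"
 show "x $ i * (int (d i) * C $ i $ j) * x $ j = x $ j * (int (d j) * C $ j $ i) * x $ i" for i j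
  by(simp add: d_sym[of i j] mult_ac)
 have "int m dvd (int (d i) * x $ i) * (C $ i $ j * x $ j)" for i j
  using L by(intro dvd_mult2[of "int m" "int (d i) * x $ i"]) (simp add: inL_def)
 thus "int m dvd x $ i * (int (d i) * C $ i $ j) * x $ j" for i j by(simp add: mult_ac)
 have "2 * int m dvd 2 * ((int (d i) * x $ i) * x $ i)" for i
  using L by(intro mult_dvd_mono dvd_mult2[of "int m" "int (d i) * x $ i"]) (simp_all add: inL_def)
 thus "2 * int m dvd x $ i * (int (d i) * C $ i $ i) * x $ i" for i by(simp add: mult_ac diag)
qed simp

definition pos :: "int ^ 'i => bool" where "pos x \<longleftrightarrow> (\<forall>k. x $ k \<ge> 0)"

text \<open>Write a root in the orbit of \<alpha>_l as x - y with its positive and negative parts.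
  Both lie in the sublattice for d_l, so if both are nonzero their norms are at least 2 d_l. As (x,
  y) \<le> 0, the norm would be at least 4 d_l, but it is 2 d_l.\<close>

lemma root_sign:
 assumes "\<beta> \<in> R"
 shows "pos \<beta> \<or> pos (- \<beta>)"
proof (rule ccontr)
 assume n: "\<not> (pos \<beta> \<or> pos (- \<beta>))"
 obtain xs l where b: "\<beta> = wa xs (\<alpha> l)" using assms unfolding root_iff by blast
 let ?m = "d l"
 have "inL ?m (\<alpha> l)" by(simp add: inL_def axis_def)
 hence L: "inL ?m \<beta>" unfolding b by(rule inL_wa)
 define x where "x = (\<chi> k. max 0 (\<beta> $ k))"
 define y where "y = (\<chi> k. max 0 (- \<beta> $ k))"
 have "int ?m dvd int (d k) * x $ k \<and> int ?m dvd int (d k) * y $ k" for k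
  using L[unfolded inL_def, rule_format, of k] by(cases "\<beta> $ k \<ge> 0") (simp_all add: x_def y_def)
 hence Lxy: "inL ?m x" "inL ?m y" by(simp_all add: inL_def)
 obtain a b where "\<beta> $ a > 0" "\<beta> $ b < 0" using n by(auto simp: pos_def not_le)
 hence "x $ a \<noteq> 0" "y $ b \<noteq> 0" by(simp_all add: x_def y_def)
 hence "x \<noteq> 0" "y \<noteq> 0" by auto
 hence "rf x x \<ge> 2 * int ?m" "rf y y \<ge> 2 * int ?m"
  using inL_norm[OF Lxy(1)] inL_norm[OF Lxy(2)] rf_pos[of x] rf_pos[of y] zdvd_imp_le by blast+
 moreover have "rf x y \<le> 0" unfolding root_form_def
 proof (intro sum_nonpos)
  fix i j
  show "x $ i * (int (d i) * C $ i $ j) * y $ j \<le> 0"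
  proof (cases "i = j")
   case False
   have "int (d i) * C $ i $ j \<le> 0" using C_nonpos[OF False] by(simp add: mult_le_0_iff)
   moreover have "0 \<le> x $ i" "0 \<le> y $ j" by(simp_all add: x_def y_def)
   ultimately show ?thesis by(metis mult_nonneg_nonpos mult_nonpos_nonneg)
  qed (simp add: x_def y_def max_def)
 qed
 moreover have "\<beta> = x - y" by(simp add: vec_eq_iff x_def y_def max_def)
 hence "rf \<beta> \<beta> = rf x x + rf y y - 2 * rf x y" by(simp add: rf_diff rf_sym[of y x])
 moreover have "rf \<beta> \<beta> = 2 * int ?m" by(simp add: b rf_wa rf_alpha_alpha diag)
 ultimately show False using d_pos[of l] by linarith
qed

lemma pos_not_neg: "\<beta> \<in> R ==> pos \<beta> ==> \<not> pos (- \<beta>)"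
proof
 assume "\<beta> \<in> R" "pos \<beta>" "pos (- \<beta>)"
 hence "\<beta> $ k = 0" for k by(simp add: pos_def order_antisym)
 hence "\<beta> = 0" by(simp add: vec_eq_iff)
 thus False using root_nonzero \<open>\<beta> \<in> R\<close> by blast
qed

section \<open>Positive roots, inversions and length\<close>

definition Rp where "Rp = {\<beta> \<in> R. pos \<beta>}"

lemma alpha_Rp: "\<alpha> i \<in> Rp" using root_alpha by(simp add: Rp_def pos_def axis_def)

text \<open>The inverse word writes a simple root as c times an integral vector, so c divides
  1.\<close>

lemma root_multiple: "c *s \<alpha> i \<in> R ==> \<bar>c\<bar> = 1"
proof -
 assume "c *s \<alpha> i \<in> R"
 then obtain xs l where "c *s \<alpha> i = wa xs (\<alpha> l)" unfolding root_iff by blast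
 hence "\<alpha> l = c *s wa (rev xs) (\<alpha> i)" using wa_rev(1)[of xs "\<alpha> l"] by(metis wa_linear(2))
 hence "c * wa (rev xs) (\<alpha> i) $ l = 1" by(metis axis_nth vector_smult_component)
 thus ?thesis by(metis zmult_eq_1_iff abs_1 abs_minus_cancel)
qed

text \<open>A positive root other than \<alpha>_i is not a multiple of it and has a positive
  coordinate away from \<open>i\<close>. The reflection does not touch that coordinate, which
  decides the sign of the result.\<close>

lemma Rp_sr: "\<beta> \<in> Rp ==> \<beta> \<noteq> \<alpha> i ==> sr i \<beta> \<in> Rp"
proof -
 assume b: "\<beta> \<in> Rp" and ne: "\<beta> \<noteq> \<alpha> i"
 have "\<exists>k. k \<noteq> i \<and> \<beta> $ k \<noteq> 0"
 proof (rule ccontr)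
  assume "\<not> (\<exists>k. k \<noteq> i \<and> \<beta> $ k \<noteq> 0)"
  hence e: "\<beta> = (\<beta> $ i) *s \<alpha> i" by(auto simp: vec_eq_iff axis_def)
  hence "\<bar>\<beta> $ i\<bar> = 1" using root_multiple[of "\<beta> $ i" i] b by(simp add: Rp_def)
  hence "\<beta> $ i = 1" using b by(simp add: Rp_def pos_def)
  thus False using e ne by simp
 qed
 then obtain k where k: "k \<noteq> i" "\<beta> $ k \<noteq> 0" by blast
 hence "\<beta> $ k > 0" using b by(simp add: Rp_def pos_def less_le)
 hence "\<not> pos (- sr i \<beta>)" using k by(auto simp: pos_def sr_nth not_le intro!: exI[of _ k])
 thus ?thesis using root_sign[of "sr i \<beta>"] root_sr[of \<beta> i] b by(simp add: Rp_def)
qed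

lemma root_cases: "\<beta> \<in> R ==> \<beta> \<in> Rp \<or> - \<beta> \<in> Rp"
 using root_sign root_uminus by(auto simp: Rp_def)

lemma Rp_uminus: "\<beta> \<in> Rp ==> - \<beta> \<notin> Rp"
 using pos_not_neg by(simp add: Rp_def)

lemma reflection_conjugate:
 assumes "wa xs (\<alpha> i) = \<alpha> j"
 shows "wa (xs @ [i]) x = wa (j # xs) x"
proof -
 have "rf (\<alpha> j) (wa xs x) = rf (\<alpha> i) x" using rf_wa[of xs "\<alpha> i" x] assms by simp
 moreover have "rf (\<alpha> j) (\<alpha> j) = rf (\<alpha> i) (\<alpha> i)" using rf_wa[of xs "\<alpha> i" "\<alpha> i"] assms by simp
 hence "d i = d j" by(simp add: rf_alpha_alpha diag)
 ultimately have "cpair j (wa xs x) = cpair i x" using d_pos[of j] by(simp flip: cpair_rf)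
 thus ?thesis
  by(simp add: wa_append wa_Cons wa_Nil sr_eq wa_diff wa_linear assms)
qed

text \<open>The letter, counted from the right, at which \<alpha>_i first turns negative reflects
  precisely the simple root reached so far; by conjugation it cancels against the appended
  letter.\<close>

lemma exchange:
 "wa xs (\<alpha> i) \<notin> Rp ==> \<exists>ys. length ys + 1 = length xs \<and> (\<forall>x. wa (xs @ [i]) x = wa ys x)"
proof (induction xs)
 case Nil
 thus ?case using alpha_Rp by(simp add: wa_Nil)
next
 case (Cons k xs)
 show ?case
 proof (cases "wa xs (\<alpha> i) \<in> Rp")
  case False
  then obtain ys where "length ys + 1 = length xs" "\<forall>x. wa (xs @ [i]) x = wa ys x" using Cons.IH by blast
  thus ?thesis by(intro exI[of _ "k # ys"]) (simp add: wa_Cons)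
 next
  case True
  hence "wa xs (\<alpha> i) = \<alpha> k" using Rp_sr[of "wa xs (\<alpha> i)" k] Cons.prems by(auto simp: wa_Cons)
  hence "wa ((k # xs) @ [i]) x = wa xs x" for x
   using reflection_conjugate[of xs i k x] by(simp add: wa_Cons sr_sr)
  thus ?thesis by(intro exI[of _ xs]) simp
 qed
qed

lemma wa_sum: "finite A ==> wa xs (\<Sum>a\<in>A. g a) = (\<Sum>a\<in>A. wa xs (g a))"
proof (induction A rule: finite_induct)
 case empty
 show ?case using wa_linear(2)[of xs 0 0] by simp
qed (simp add: wa_linear)

lemma vec_expand: "x = (\<Sum>i\<in>UNIV. x $ i *s \<alpha> i)"
 by(simp add: vec_eq_iff axis_def if_distrib[of "\<lambda>t. _ * t"] cong: if_cong)

lemma wa_determined: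
 assumes "\<And>i. wa xs (\<alpha> i) = g i"
 shows "wa xs x = (\<Sum>i\<in>UNIV. x $ i *s g i)"
 by(subst vec_expand[of x]) (simp add: wa_sum wa_linear assms)

lemma weyl_length_word: "\<exists>ys. length ys = weyl_length C (wa xs) \<and> wa ys = wa xs"
 unfolding weyl_length_def by(rule LeastI_ex) blast

lemma weyl_length_le: "weyl_length C (wa xs) \<le> length xs"
 unfolding weyl_length_def by(rule Least_le) blast

lemma positive_preserving:
 assumes "\<And>i. wa xs (\<alpha> i) \<in> Rp"
 shows "wa xs = id"
proof -
 obtain ys where ys: "length ys = weyl_length C (wa xs)" "wa ys = wa xs" using weyl_length_word by blast
 have "ys = []"
 proof (rule ccontr)
  assume "ys \<noteq> []"
  then obtain zs i where z: "ys = zs @ [i]" by(metis rev_exhaust)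
  have "wa ys (\<alpha> i) = - wa zs (\<alpha> i)" by(simp add: z wa_append wa_Cons wa_Nil sr_alpha wa_linear)
  hence "- wa zs (\<alpha> i) \<in> Rp" using assms[of i] ys(2) by simp
  hence "wa zs (\<alpha> i) \<notin> Rp" using Rp_uminus[of "- wa zs (\<alpha> i)"] by simp
  then obtain us where us: "length us + 1 = length zs" "\<forall>x. wa (zs @ [i]) x = wa us x" using exchange by blast
  hence "wa us = wa xs" using ys(2) z by auto
  hence "weyl_length C (wa xs) \<le> length us" using weyl_length_le[of us] by simp
  thus False using us(1) ys(1) z by simp
 qed
 moreover have "wa [] = id" by(simp add: fun_eq_iff wa_Nil)
 ultimately show ?thesis using ys(2) by metis
qed

text \<open>The number of inversions, which \<open>length_eq_nneg\<close> identifies with the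
  length.\<close>

definition nneg :: "'i list => nat" where "nneg xs = card {\<beta> \<in> Rp. wa xs \<beta> \<notin> Rp}"

lemma nneg_step:
 assumes fin: "finite Rp"
 shows "card ({\<beta> \<in> Rp. wa (xs @ [i]) \<beta> \<notin> Rp} - {\<alpha> i}) \<le> card ({\<beta> \<in> Rp. wa xs \<beta> \<notin> Rp} - {\<alpha> i})"
proof (rule card_inj_on_le[of "sr i"])
 show "inj_on (sr i) ({\<beta> \<in> Rp. wa (xs @ [i]) \<beta> \<notin> Rp} - {\<alpha> i})" by(rule inj_on_inverseI[of _ "sr i"]) (simp add: sr_sr)
 have "sr i \<beta> \<noteq> \<alpha> i" if "\<beta> \<in> Rp" for \<beta>
 proof
  assume "sr i \<beta> = \<alpha> i"
  hence "\<beta> = - \<alpha> i" using sr_sr[of i \<beta>] by(simp add: sr_alpha)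
  thus False using that Rp_uminus[OF alpha_Rp] by simp
 qed
 thus "sr i ` ({\<beta> \<in> Rp. wa (xs @ [i]) \<beta> \<notin> Rp} - {\<alpha> i}) \<subseteq> {\<beta> \<in> Rp. wa xs \<beta> \<notin> Rp} - {\<alpha> i}"
  using Rp_sr by(auto simp: wa_append wa_Cons wa_Nil)
qed (use fin in auto)

lemma nneg_le_length: "finite Rp ==> nneg xs \<le> length xs"
proof (induction xs rule: rev_induct)
 case Nil
 thus ?case by(simp add: nneg_def wa_Nil)
next
 case (snoc i xs)
 have "nneg (xs @ [i]) \<le> card ({\<beta> \<in> Rp. wa (xs @ [i]) \<beta> \<notin> Rp} - {\<alpha> i}) + 1"
 proof -
  let ?S = "{\<beta> \<in> Rp. wa (xs @ [i]) \<beta> \<notin> Rp}"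
  have c1: "card ?S \<le> card (insert (\<alpha> i) (?S - {\<alpha> i}))" using snoc.prems by(intro card_mono) auto
  have c2: "card (insert a T) \<le> card T + 1" if "finite T" for a and T :: "(int ^ 'i) set"
   using that by(simp add: card_insert_if)
  have c3: "finite (?S - {\<alpha> i})" using snoc.prems by simp
  show ?thesis unfolding nneg_def by(rule le_trans[OF c1 c2[OF c3]])
 qed
 also have "\<dots> \<le> nneg xs + 1"
  using nneg_step[OF snoc.prems, of xs i] card_mono[of "{\<beta> \<in> Rp. wa xs \<beta> \<notin> Rp}" "{\<beta> \<in> Rp. wa xs \<beta> \<notin> Rp} - {\<alpha> i}"] snoc.prems
  unfolding nneg_def by simp
 finally show ?case using snoc by simp
qed

lemma length_le_nneg: "finite Rp ==> weyl_length C (wa xs) \<le> nneg xs"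
proof (induction "nneg xs" arbitrary: xs rule: less_induct)
 case less
 show ?case
 proof (cases "\<forall>i. wa xs (\<alpha> i) \<in> Rp")
  case True
  hence "wa xs = wa []" using positive_preserving[of xs] by(auto simp: wa_Nil)
  thus ?thesis using weyl_length_le[of "[]"] by simp
 next
  case False
  then obtain i where i: "wa xs (\<alpha> i) \<notin> Rp" by blast
  have "- wa xs (\<alpha> i) \<in> Rp" using root_cases[OF root_wa[OF root_alpha], of xs i] i by blast
  hence "\<alpha> i \<notin> {\<beta> \<in> Rp. wa (xs @ [i]) \<beta> \<notin> Rp}"
   by(simp add: wa_append wa_Cons wa_Nil sr_alpha wa_linear)
  hence "nneg (xs @ [i]) \<le> card ({\<beta> \<in> Rp. wa xs \<beta> \<notin> Rp} - {\<alpha> i})"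
   using nneg_step[OF less.prems, of xs i] by(simp add: nneg_def)
  also have "\<dots> + 1 \<le> nneg xs"
   unfolding nneg_def using i alpha_Rp[of i] less.prems
   by(subst card_Suc_Diff1[symmetric, of _ "\<alpha> i"]) auto
  finally have lt: "nneg (xs @ [i]) + 1 \<le> nneg xs" by simp
  obtain ys where ys: "length ys = weyl_length C (wa (xs @ [i]))" "wa ys = wa (xs @ [i])" using weyl_length_word by blast
  have "wa (ys @ [i]) = wa xs" by(rule ext) (simp add: wa_append ys(2) wa_Cons wa_Nil sr_sr)
  hence "weyl_length C (wa xs) \<le> length ys + 1" using weyl_length_le[of "ys @ [i]"] by simp
  also have "\<dots> \<le> nneg (xs @ [i]) + 1" using less.hyps[of "xs @ [i]"] lt less.prems ys(1) by simp
  finally show ?thesis using lt by simp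
 qed
qed

lemma length_eq_nneg: "finite Rp ==> weyl_length C (wa xs) = nneg xs"
proof -
 assume fin: "finite Rp"
 obtain ys where ys: "length ys = weyl_length C (wa xs)" "wa ys = wa xs" using weyl_length_word by blast
 have "nneg xs = nneg ys" by(simp add: nneg_def ys(2))
 thus ?thesis using nneg_le_length[OF fin, of ys] length_le_nneg[OF fin, of xs] ys(1) by simp
qed

text \<open>Such an element makes all positive roots negative and so has the maximal number of
  inversions. Any element of maximal length does the same; its product with this one preserves
  positivity and is the identity by \<open>positive_preserving\<close>.\<close>

theorem longest_element_eq:
 assumes fin: "finite Rp" and w: "\<And>i. wa xs (\<alpha> i) = - \<alpha> (\<sigma> i)"
 shows "longest_element C = wa xs"
proof -
 have neg: "wa xs \<beta> \<notin> Rp" if "\<beta> \<in> Rp" for \<beta>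
 proof -
  have "pos (- wa xs \<beta>)"
   unfolding wa_determined[OF w] pos_def using that by(simp add: Rp_def pos_def axis_def sum_nonpos)
  hence "- wa xs \<beta> \<in> Rp" using that root_uminus[OF root_wa[of \<beta> xs]] by(simp add: Rp_def)
  thus ?thesis using Rp_uminus[of "- wa xs \<beta>"] by auto
 qed
 hence "{\<beta> \<in> Rp. wa xs \<beta> \<notin> Rp} = Rp" by blast
 hence inv: "nneg xs = card Rp" by(simp add: nneg_def)
 have le: "nneg ys \<le> card Rp" for ys unfolding nneg_def by(rule card_mono[OF fin]) auto
 show ?thesis unfolding longest_element_def
 proof (rule the_equality)
  show "wa xs \<in> weyl_group C \<and> (\<forall>w'\<in>weyl_group C. weyl_length C w' \<le> weyl_length C (wa xs))"
   using le inv by(auto simp: weyl_group_def length_eq_nneg[OF fin])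
  fix w assume a: "w \<in> weyl_group C \<and> (\<forall>w'\<in>weyl_group C. weyl_length C w' \<le> weyl_length C w)"
  then obtain ys where ys: "w = wa ys" by(auto simp: weyl_group_def)
  have "nneg xs \<le> nneg ys" using a unfolding ys by(auto simp: weyl_group_def length_eq_nneg[OF fin])
  hence "{\<beta> \<in> Rp. wa ys \<beta> \<notin> Rp} = Rp" using inv fin by(intro card_seteq) (auto simp: nneg_def)
  hence yneg: "wa ys \<beta> \<notin> Rp" if "\<beta> \<in> Rp" for \<beta> using that by blast
  have "wa (zs @ xs) = id" if z: "\<And>\<beta>. \<beta> \<in> Rp ==> wa zs \<beta> \<notin> Rp" for zs
  proof (rule positive_preserving)
   fix i
   have "wa zs (\<alpha> (\<sigma> i)) \<notin> Rp" by(rule z[OF alpha_Rp])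
   thus "wa (zs @ xs) (\<alpha> i) \<in> Rp"
    using root_cases[OF root_wa[OF root_alpha], of zs "\<sigma> i"] by(simp add: wa_append w wa_linear)
  qed
  from this[OF yneg] this[OF neg] have 1: "wa ys (wa xs x) = x" "wa xs (wa xs x) = x" for x
   by(metis wa_append id_apply)+
  show "w = wa xs" unfolding ys by(rule ext) (metis 1)
 qed
qed

lemma star_eq:
 assumes "finite Rp" "\<And>i. wa xs (\<alpha> i) = - \<alpha> (\<sigma> i)"
 shows "star C i = \<sigma> i"
 unfolding star_def longest_element_eq[OF assms] assms(2)
 by(rule the_equality) (auto simp: axis_eq_axis)

end

section \<open>Alternating reflections in the two colour classes\<close>

context mesh
begin

definition col :: "'i => bool" where
 "col = (SOME c. \<forall>i j. adj C i j \<longrightarrow> c j = (\<not> c i))"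

text \<open>The parity of a height function changes along every edge, so a colouring as in the
  choice exists.\<close>

lemma col_adj: "adj C i j ==> col j = (\<not> col i)"
proof -
 obtain xs :: "'i list" where xs: "distinct xs" "set xs = UNIV" using finite_distinct_list[of "UNIV :: 'i set"] by auto
 obtain \<xi> :: "'i => int" where \<xi>: "\<And>ys k zs i. xs = ys @ k # zs ==> adj C k i ==> \<xi> i = \<xi> k + (if i \<in> set zs then 1 else -1)"
  by(rule ordering_height[OF xs]) blast
 have "even (\<xi> j) = (\<not> even (\<xi> i))" if "adj C i j" for i j
 proof -
  obtain ys zs where "xs = ys @ i # zs" using split_list[of i xs] xs(2) by auto
  from \<xi>[OF this that] show ?thesis by auto
 qed
 hence "\<exists>c. \<forall>i j. adj C i j \<longrightarrow> c j = (\<not> c i)" by(intro exI[of _ "\<lambda>i. even (\<xi> i)"]) blast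
 from someI_ex[OF this] show "adj C i j ==> col j = (\<not> col i)" unfolding col_def by blast
qed

text \<open>The product of all reflections of one colour. Vertices of the same colour are not
  adjacent, so these commute and each uses the old values of its neighbours.\<close>

definition kc :: "bool => int ^ 'i => int ^ 'i" where
 "kc a y = (\<chi> i. if col i = a then sr i y $ i else y $ i)"

lemma sr_diag: "sr i y $ i = (\<Sum>k | adj C i k. int (f i k) * y $ k) - y $ i"
 by(simp add: sr_nth cpair_expand)

lemma sr_diag_cong: "y $ i = z $ i ==> (\<And>k. adj C i k ==> y $ k = z $ k) ==> sr i y $ i = sr i z $ i"
 unfolding sr_diag by(auto intro!: arg_cong2[of _ _ _ _ "(-)"] sum.cong)

lemma kc_word: "\<exists>ws. wa ws = kc a"
proof -
 have w: "wa xs y $ i = (if i \<in> set xs then sr i y $ i else y $ i)"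
  if "distinct xs" "set xs \<subseteq> {i. col i = a}" for xs y i
  using that
 proof (induction xs arbitrary: i)
  case (Cons k xs)
  have IH: "wa xs y $ l = (if l \<in> set xs then sr l y $ l else y $ l)" for l using Cons by simp
  have "sr k (wa xs y) $ k = sr k y $ k"
  proof (rule sr_diag_cong)
   show "wa xs y $ k = y $ k" using Cons.prems IH by simp
   fix l assume "adj C k l"
   hence "l \<notin> set xs" using Cons.prems col_adj[of k l] by auto
   thus "wa xs y $ l = y $ l" using IH by simp
  qed
  moreover have "sr k (wa xs y) $ i = wa xs y $ i" if "i \<noteq> k" using that by(simp add: sr_nth)
  ultimately show ?case using IH[of i] Cons.prems(1) by(cases "i = k") (auto simp: wa_Cons)
 qed (simp add: wa_Nil)
 obtain xs where "distinct xs" "set xs = {i. col i = a}" using finite_distinct_list[of "{i. col i = a}"] by auto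
 hence "wa xs = kc a" using w[of xs] by(auto simp: fun_eq_iff vec_eq_iff kc_def)
 thus ?thesis by blast
qed

lemma kc_kc: "kc a (kc a y) = y"
proof -
 have "kc a (kc a y) $ i = y $ i" for i
 proof (cases "col i = a")
  case True
  have "(\<Sum>k | adj C i k. int (f i k) * kc a y $ k) = (\<Sum>k | adj C i k. int (f i k) * y $ k)"
   by(intro sum.cong refl) (use True col_adj in \<open>auto simp: kc_def\<close>)
  moreover have "kc a (kc a y) $ i = (\<Sum>k | adj C i k. int (f i k) * kc a y $ k) - kc a y $ i"
   unfolding sr_diag[symmetric] by(subst kc_def) (simp add: True)
  moreover have "kc a y $ i = (\<Sum>k | adj C i k. int (f i k) * y $ k) - y $ i"
   by(simp add: kc_def True sr_diag)
  ultimately show ?thesis by simp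
 qed (simp add: kc_def)
 thus ?thesis by(simp add: vec_eq_iff)
qed

primrec walk :: "int ^ 'i => bool => nat => int ^ 'i" where
 "walk y a 0 = y"
| "walk y a (Suc n) = kc (a = even n) (walk y a n)"

lemma walk_word: "\<exists>ws. \<forall>y. walk y a n = wa ws y"
proof (induction n)
 case 0
 show ?case by(intro exI[of _ "[]"]) (simp add: wa_Nil)
next
 case (Suc n)
 then obtain ws where "\<forall>y. walk y a n = wa ws y" by blast
 moreover obtain us where "wa us = kc (a = even n)" using kc_word by blast
 ultimately show ?case by(intro exI[of _ "us @ ws"]) (simp add: wa_append)
qed

text \<open>At a positive time only the colour class just reflected is shown. As \<open>nat\<close>
  sends -1 to 0, the times -1 and 0 show the two colour classes of the start vector, which are the
  initial values for the mesh relation.\<close>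

definition slice :: "int ^ 'i => bool => int => 'i => real" where
 "slice y a v i = (if col i = (a = odd v) then real_of_int (walk y a (nat v) $ i) else 0)"

lemma walk_other: "col i \<noteq> (a = even n) ==> walk y a (Suc n) $ i = walk y a n $ i"
 by(auto simp: kc_def)

lemma slice_mesh:
 assumes "w > - 1"
 shows "mesh_at 1 (slice y a) w"
 unfolding mesh_at_def
proof
 fix i
 define n where "n = nat w"
 have w: "w = int n" using assms by(simp add: n_def)
 have n1: "nat (w + 1) = Suc n" by(simp add: w)
 have sum: "(\<Sum>k | adj C i k. b 1 i k * slice y a w k) = (\<Sum>k | adj C i k. real (f i k) * slice y a w k)"
  by(intro sum.cong refl) (simp add: b_1)
 have "slice y a (w + 1) i + slice y a (w - 1) i = (\<Sum>k | adj C i k. real (f i k) * slice y a w k)"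
 proof (cases "col i = (a = even n)")
  case False
  hence "slice y a w k = 0" if "adj C i k" for k using col_adj[OF that] by(auto simp: slice_def w)
  hence "(\<Sum>k | adj C i k. real (f i k) * slice y a w k) = 0" by(intro sum.neutral) simp
  moreover have "slice y a (w + 1) i = 0" "slice y a (w - 1) i = 0" using False by(auto simp: slice_def w)
  ultimately show ?thesis by simp
 next
  case True
  have "slice y a (w + 1) i = real_of_int (walk y a (Suc n) $ i)" using True n1 by(simp add: slice_def w)
  moreover have "slice y a (w - 1) i = real_of_int (walk y a n $ i)"
  proof (cases n)
   case 0
   thus ?thesis using True by(simp add: slice_def w)
  next
   case (Suc m)
   hence "col i \<noteq> (a = even m)" using True by auto
   thus ?thesis using True walk_other[of i a m y] Suc by(simp add: slice_def w del: walk.simps)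
  qed
  moreover have "slice y a w k = real_of_int (walk y a n $ k)" if "adj C i k" for k
   using True col_adj[OF that] by(auto simp: slice_def w)
  hence "(\<Sum>k | adj C i k. real (f i k) * slice y a w k) = real_of_int (\<Sum>k | adj C i k. int (f i k) * walk y a n $ k)"
   by(simp add: of_int_sum)
  moreover have "walk y a (Suc n) $ i = (\<Sum>k | adj C i k. int (f i k) * walk y a n $ k) - walk y a n $ i"
   using True by(simp add: kc_def sr_diag)
  ultimately show ?thesis by simp
 qed
 thus "1 powi int (d i) * slice y a (w + 1) i + 1 powi - int (d i) * slice y a (w - 1) i = (\<Sum>y' | adj C i y'. b 1 i y' * slice y a w y')"
  unfolding sum by simp
qed

lemma P_parity: "t < B ==> P 1 i j (int t) \<noteq> 0 ==> (col i = col j) = even t"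
proof (induction t arbitrary: i rule: less_induct)
 case (less t)
 show ?case
 proof (cases "t = 0")
  case True
  thus ?thesis using less.prems by(simp add: P_0 split: if_splits)
 next
  case False
  show ?thesis
  proof (rule ccontr)
   assume n: "\<not> ?thesis"
   have "P 1 y j (int (t - 1)) = 0" if "adj C i y" for y
    proof -
    have "t - 1 < B" "t - 1 < t" "even (t - 1) = odd t" using less.prems(1) False by auto
    thus ?thesis using less.IH[of "t - 1" y] n col_adj[OF that] by blast
   qed
   moreover have "P 1 i j (int t - 2) = 0"
   proof (cases "t = 1")
    case F: False
    hence "P 1 i j (int (t - 2)) = 0" proof -
     have "t - 2 < B" "t - 2 < t" "even (t - 2) = even t" using less.prems(1) False F by auto
     thus ?thesis using less.IH[of "t - 2" i] n by blast
    qed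
    moreover have "int (t - 2) = int t - 2" using False F by simp
    ultimately show ?thesis by simp
   qed (simp add: P_neg)
   moreover have "int (t - 1) = int t - 1" using False by simp
   ultimately show False using P_rec[of 1 "int t - 1" i j] False less.prems by simp
  qed
 qed
qed

lemma col_\<sigma>: "col (\<sigma> j) = (col j = even B)"
proof -
 have "P 1 (\<sigma> j) j (int (B - 2)) \<noteq> 0" using P_top[of 1 "\<sigma> j" j] B2 by(simp add: of_nat_diff)
 from P_parity[OF _ this] B2 show ?thesis by auto
qed

text \<open>\<open>half_period\<close> at x = 1, started at time 0 or -1 according to the colour of
  \<open>i\<close>; in the second case the last step does not change the coordinate.\<close>

lemma half_turn: "walk y a B $ i = - y $ \<sigma> i"
proof (cases "col i = (a = odd B)")
 case True
 have "slice y a (0 + int B) i = - slice y a 0 (\<sigma> i)"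
  using half_period[of 1 0 "slice y a" i] slice_mesh by simp
 moreover have "col (\<sigma> i) = (\<not> a)" using True col_\<sigma>[of i] by auto
 ultimately have "real_of_int (walk y a B $ i) = real_of_int (- y $ \<sigma> i)" using True by(simp add: slice_def)
 thus ?thesis unfolding of_int_eq_iff .
next
 case False
 have "slice y a (- 1 + int B) i = - slice y a (- 1) (\<sigma> i)"
  using half_period[of 1 "-1" "slice y a" i] slice_mesh by simp
 moreover have "nat (- 1 + int B) = B - 1" by simp
 moreover have "col (\<sigma> i) = a" using False col_\<sigma>[of i] by auto
 ultimately have "real_of_int (walk y a (B - 1) $ i) = real_of_int (- y $ \<sigma> i)" using False by(auto simp: slice_def)
 moreover have "walk y a B $ i = walk y a (B - 1) $ i" using walk_other[of i a "B - 1" y] False B2 by(cases B) auto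
 ultimately show ?thesis by(simp only: of_int_eq_iff)
qed

lemma half_turn_alpha: "walk (\<alpha> i) a B = - \<alpha> (\<sigma> i)"
proof -
 have "\<sigma> k = i \<longleftrightarrow> k = \<sigma> i" for k using \<sigma>_\<sigma> by metis
 thus ?thesis by(simp add: vec_eq_iff half_turn) (simp add: axis_def)
qed

text \<open>With start \<alpha>_j and the first step in the opposite colour, the value at time -1 is
  0 and at time 0 it is the unit vector, so the sequence is the fundamental solution.\<close>

lemma string_slice: "t < B ==> slice (\<alpha> j) (\<not> col j) (int t) i = P 1 i j (int t)"
proof -
 assume t: "t < B"
 let ?s = "slice (\<alpha> j) (\<not> col j)"
 have "?s (- 1) i = 0" for i by(auto simp: slice_def axis_def)
 moreover have "?s 0 i = (if i = j then 1 else 0)" for i by(auto simp: slice_def axis_def)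
 moreover have "?s (- 1 + 1 + int t) i = (\<Sum>l\<in>UNIV. ?s (- 1 + 1) l * P 1 i l (int t) - 1 powi (- 2 * int (d l)) * ?s (- 1) l * P 1 i l (int t - 1))"
  by(rule mesh_expansion[OF _ _ t]) (use slice_mesh in simp_all)
 ultimately show ?thesis by(simp add: if_distrib[of "\<lambda>t. t * _"] cong: if_cong)
qed

abbreviation string where "string j n \<equiv> walk (\<alpha> j) (\<not> col j) n"

lemma string_coord:
 assumes "n < B" "n \<ge> 1"
 shows "real_of_int (string j n $ i) = (if col i = ((\<not> col j) = odd n) then P 1 i j (int n) else P 1 i j (int n - 1))"
proof (cases "col i = ((\<not> col j) = odd n)")
 case True
 thus ?thesis using string_slice[OF assms(1), of j i] by(simp add: slice_def)
next
 case False
 have "string j n $ i = string j (n - 1) $ i" using walk_other[of i "\<not> col j" "n - 1" "\<alpha> j"] False assms(2) by(cases n) auto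
 moreover have "slice (\<alpha> j) (\<not> col j) (int (n - 1)) i = real_of_int (string j (n - 1) $ i)"
  using False assms(2) by(cases n) (auto simp: slice_def)
 moreover have "int (n - 1) = int n - 1" using assms(2) by simp
 ultimately have "real_of_int (string j n $ i) = P 1 i j (int n - 1)"
  using string_slice[of "n - 1" j i] assms by simp
 thus ?thesis using False by(simp only: if_False)
qed

lemma walk_root: "\<beta> \<in> R ==> walk \<beta> a n \<in> R"
 using walk_word[of a n] root_wa by metis

lemma string_Rp: "n < B ==> string j n \<in> Rp"
proof (cases "n = 0")
 case True
 thus ?thesis using alpha_Rp by simp
next
 case False
 assume "n < B"
 hence "real_of_int (string j n $ i) \<ge> 0" for i
  using string_coord[of n j i] False P_nonneg[of 1] by simp
 thus ?thesis using walk_root[OF root_alpha] by(simp add: Rp_def pos_def)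
qed

lemma string_end: "string j (B - 1) = \<alpha> (\<sigma> j)"
proof -
 have "real_of_int (string j (B - 1) $ i) = real_of_int (\<alpha> (\<sigma> j) $ i)" for i
 proof -
  have B: "B - 1 < B" "B - 1 \<ge> 1" "int (B - 1) = int B - 1" "odd (B - 1) = even B" using B2 by auto
  have P: "P 1 i j (int B - 1) = 0" "P 1 i j (int B - 1 - 1) = (if i = \<sigma> j then 1 else 0)"
   using P_high[of "int B - 1" 1 i j] P_top[of 1 i j] by simp_all
  have "col i \<noteq> ((\<not> col j) = even B)" if "i = \<sigma> j" using that col_\<sigma>[of j] by auto
  thus ?thesis using string_coord[OF B(1,2), of j i] P unfolding B(3,4) by(auto simp: axis_def)
 qed
 thus ?thesis by(simp add: vec_eq_iff)
qed

text \<open>A root made negative is supported on colour \<open>a\<close>, as the other coordinates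
  stay. If it were not simple, the single reflection at a vertex \<open>i\<close> of its support
  would keep it positive; but without neighbours in the support this reflection negates the
  coordinate at \<open>i\<close>.\<close>

lemma flip_alpha:
 assumes "\<beta> \<in> Rp" "kc a \<beta> \<notin> Rp"
 shows "\<exists>i. col i = a \<and> \<beta> = \<alpha> i"
proof -
 have bR: "\<beta> \<in> R" using assms(1) by(simp add: Rp_def)
 obtain ws where "wa ws = kc a" using kc_word by blast
 hence "kc a \<beta> \<in> R" using root_wa[OF bR, of ws] by simp
 hence neg: "kc a \<beta> $ k \<le> 0" for k using root_cases[of "kc a \<beta>"] assms(2) by(auto simp: Rp_def pos_def)
 have p: "\<beta> $ k \<ge> 0" for k using assms(1) by(simp add: Rp_def pos_def)
 have z: "\<beta> $ k = 0" if "col k \<noteq> a" for k using neg[of k] p[of k] that by(simp add: kc_def)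
 obtain i where i: "\<beta> $ i \<noteq> 0" using root_nonzero[OF bR] by(auto simp: vec_eq_iff)
 hence ca: "col i = a" using z by blast
 have "\<beta> = \<alpha> i"
 proof (rule ccontr)
  assume "\<beta> \<noteq> \<alpha> i"
  hence "sr i \<beta> $ i \<ge> 0" using Rp_sr[OF assms(1)] by(simp add: Rp_def pos_def)
  moreover have "(\<Sum>k | adj C i k. int (f i k) * \<beta> $ k) = 0"
   by(rule sum.neutral) (use z col_adj ca in auto)
  ultimately show False using sr_diag[of i \<beta>] p[of i] i by simp
 qed
 thus ?thesis using ca by blast
qed

section \<open>Enumeration of the positive roots by strings\<close>

definition st :: "(int ^ 'i) \<times> bool => (int ^ 'i) \<times> bool" where
 "st p = (kc (snd p) (fst p), \<not> snd p)"

lemma st_walk: "(st ^^ n) (y, a) = (walk y a n, a = even n)"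
 by(induction n) (auto simp: st_def)

lemma inj_st: "inj st"
proof (rule injI)
 fix p p' assume e: "st p = st p'"
 hence s: "snd p = snd p'" by(simp add: st_def)
 have "kc (snd p) (fst p) = kc (snd p') (fst p')" using arg_cong[OF e, of fst] by(simp add: st_def)
 hence "kc (snd p') (kc (snd p') (fst p)) = kc (snd p') (kc (snd p') (fst p'))" unfolding s by(rule arg_cong)
 hence "fst p = fst p'" unfolding kc_kc .
 with s show "p = p'" by(simp add: prod_eq_iff)
qed

lemma st_cancel: "(st ^^ n) p = (st ^^ n') p' ==> n \<le> n' ==> p = (st ^^ (n' - n)) p'"
proof -
 assume e: "(st ^^ n) p = (st ^^ n') p'" and le: "n \<le> n'"
 have "(st ^^ n') p' = (st ^^ n) ((st ^^ (n' - n)) p')" using le by(metis comp_apply funpow_add le_add_diff_inverse)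
 thus ?thesis using e inj_fn[OF inj_st, of n] by(simp add: inj_eq)
qed

definition start :: "'i => (int ^ 'i) \<times> bool" where "start j = (\<alpha> j, \<not> col j)"

text \<open>The predecessor of a start would be \<alpha>_j reflected in its own colour; this has the
  coordinate -1 at \<open>j\<close> and is not positive.\<close>

lemma string_first: "k < B ==> start j \<noteq> (st ^^ Suc k) (start j')"
proof
 assume k: "k < B" and e: "start j = (st ^^ Suc k) (start j')"
 obtain y a where ya: "(st ^^ k) (start j') = (y, a)" by fastforce
 have "y \<in> Rp" using ya string_Rp[OF k, of j'] by(simp add: start_def st_walk)
 have "kc a y = \<alpha> j" "a = col j" using e ya by(auto simp: start_def st_def)
 hence y: "y = kc (col j) (\<alpha> j)" using kc_kc[of a y] by simp
 have "(\<Sum>k | adj C j k. int (f j k) * \<alpha> j $ k) = 0" by(intro sum.neutral) (auto simp: axis_def adj_def)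
 hence "y $ j = - 1" by(simp add: y kc_def sr_diag)
 thus False using \<open>y \<in> Rp\<close> by(auto simp: Rp_def pos_def dest: spec[of _ j])
qed

text \<open>\<open>st\<close> is injective and no start has a predecessor on a string, so the
  strings are disjoint. Conversely, follow a positive root until just before it turns negative:
  there it is a simple root \<alpha>_i about to be reflected, which is the end of the string of
  \<sigma>(i), and going back finds the root on that string. The boolean is the colour of the next
  step.\<close>

lemma strings_bij: "bij_betw (\<lambda>(n, j). (st ^^ n) (start j)) ({..<B} \<times> UNIV) (Rp \<times> UNIV)"
proof (rule bij_betwI')
 have key: "n = n' \<and> j = j'" if "n \<le> n'" "n' < B" "(st ^^ n) (start j) = (st ^^ n') (start j')" for n n' j j'
 proof (cases "n' - n")
  case 0
  hence "start j = start j'" using st_cancel[OF that(3,1)] by simp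
  hence "\<alpha> j = \<alpha> j'" by(simp add: start_def)
  thus ?thesis using 0 that(1) by(simp add: axis_eq_axis)
 next
  case (Suc k)
  hence "k < B" using that(2) by linarith
  thus ?thesis using st_cancel[OF that(3,1)] string_first[of k j j'] Suc by simp
 qed
 fix p p' assume pp: "p \<in> {..<B} \<times> (UNIV :: 'i set)" "p' \<in> {..<B} \<times> (UNIV :: 'i set)"
 obtain n j n' j' where p: "p = (n, j)" "p' = (n', j')" by fastforce
 show "((case p of (n, j) => (st ^^ n) (start j)) = (case p' of (n, j) => (st ^^ n) (start j))) = (p = p')"
  using key[of n n' j j'] key[of n' n j' j] pp p by(cases "n \<le> n'") auto
next
 fix p assume "p \<in> {..<B} \<times> (UNIV :: 'i set)"
 thus "(case p of (n, j) => (st ^^ n) (start j)) \<in> Rp \<times> UNIV"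
  using string_Rp by(auto simp: start_def st_walk)
next
 fix q assume "q \<in> Rp \<times> (UNIV :: bool set)"
 then obtain \<beta> a where q: "q = (\<beta>, a)" "\<beta> \<in> Rp" by blast
 define n where "n = (LEAST n. walk \<beta> a (Suc n) \<notin> Rp)"
 have "walk \<beta> a (Suc (B - 1)) \<notin> Rp"
 proof
  assume "walk \<beta> a (Suc (B - 1)) \<in> Rp"
  hence "walk \<beta> a B \<in> Rp" using B2 by simp
  hence "\<beta> $ \<sigma> i \<le> 0" for i using half_turn[of \<beta> a i] by(auto simp: Rp_def pos_def dest: spec[of _ i])
  from this[of "\<sigma> _"] have "pos (- \<beta>)" by(simp add: \<sigma>_\<sigma> pos_def)
  thus False using pos_not_neg q(2) by(simp add: Rp_def)
 qed
 hence n: "walk \<beta> a (Suc n) \<notin> Rp" "n \<le> B - 1" unfolding n_def by(rule LeastI, rule Least_le)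
 have "walk \<beta> a n \<in> Rp"
 proof (cases n)
  case 0 then show ?thesis using q by simp
 next
  case (Suc m)
  thus ?thesis using not_less_Least[of m "\<lambda>n. walk \<beta> a (Suc n) \<notin> Rp"] by(auto simp: n_def)
 qed
 then obtain i where i: "col i = (a = even n)" "walk \<beta> a n = \<alpha> i" using flip_alpha[of "walk \<beta> a n" "a = even n"] n(1) by auto
 have "(st ^^ n) q = (\<alpha> i, col i)" by(simp add: q st_walk i)
 moreover have "(st ^^ (B - 1)) (start (\<sigma> i)) = (\<alpha> i, col i)"
 proof -
  have "(\<not> col (\<sigma> i)) = even (B - 1) \<longleftrightarrow> col i" using col_\<sigma>[of i] B2 by auto
  thus ?thesis unfolding start_def st_walk string_end \<sigma>_\<sigma> by simp
 qed
 ultimately have "q = (st ^^ (B - 1 - n)) (start (\<sigma> i))" using st_cancel[of n q "B - 1"] n(2) by simp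
 thus "\<exists>p\<in>{..<B} \<times> UNIV. q = (case p of (n, j) => (st ^^ n) (start j))"
  using B2 by(intro bexI[of _ "(B - 1 - n, \<sigma> i)"]) auto
qed

lemma finite_Rp: "finite Rp"
proof -
 have "finite (Rp \<times> (UNIV :: bool set))" using bij_betw_finite[OF strings_bij] by simp
 thus ?thesis by(rule finite_cartesian_productD1) auto
qed

lemma star_\<sigma>: "star C i = \<sigma> i"
proof -
 obtain ws where "\<forall>y. walk y True B = wa ws y" using walk_word by blast
 hence "wa ws (\<alpha> i) = - \<alpha> (\<sigma> i)" for i using half_turn_alpha by metis
 thus ?thesis by(rule star_eq[OF finite_Rp])
qed

text \<open>All roots on the string of \<open>j\<close> have norm 2 d_j, and every positive root
  occurs once for each colour; the two factors 2 cancel.\<close>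

lemma sum_norms: "(\<Sum>\<beta>\<in>Rp. rf \<beta> \<beta>) = int B * (\<Sum>j\<in>UNIV. int (d j))"
proof -
 have "(\<Sum>q\<in>Rp \<times> (UNIV :: bool set). rf (fst q) (fst q)) = (\<Sum>(n, j)\<in>{..<B} \<times> UNIV. 2 * int (d j))"
 proof (subst sum.reindex_bij_betw[OF strings_bij, symmetric], rule sum.cong[OF refl])
  fix p assume "p \<in> {..<B} \<times> (UNIV :: 'i set)"
  obtain n j where p: "p = (n, j)" by fastforce
  obtain ws where "\<forall>y. walk y (\<not> col j) n = wa ws y" using walk_word by blast
  thus "rf (fst (case p of (n, j) => (st ^^ n) (start j))) (fst (case p of (n, j) => (st ^^ n) (start j))) = (case p of (n, j) => 2 * int (d j))"
   by(simp add: p start_def st_walk rf_wa rf_alpha_alpha diag)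
 qed
 also have "\<dots> = int B * (2 * (\<Sum>j\<in>UNIV. int (d j)))"
  by(simp add: sum.cartesian_product[symmetric] sum_distrib_left)
 also have "(\<Sum>q\<in>Rp \<times> (UNIV :: bool set). rf (fst q) (fst q)) = (\<Sum>\<beta>\<in>Rp. \<Sum>a\<in>(UNIV :: bool set). rf \<beta> \<beta>)"
  by(subst sum.cartesian_product) (simp add: case_prod_beta)
 finally show ?thesis by(simp add: card_UNIV_bool flip: sum_distrib_left)
qed

end

section \<open>The highest root and the dual Coxeter number\<close>

context cartan
begin

lemma root_norm: "\<beta> \<in> R ==> \<exists>l. rf \<beta> \<beta> = 2 * int (d l) \<and> inL (d l) \<beta>"
proof -
 assume "\<beta> \<in> R"
 then obtain xs l where b: "\<beta> = wa xs (\<alpha> l)" unfolding root_iff by blast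
 have "inL (d l) (\<alpha> l)" by(simp add: inL_def axis_def)
 thus ?thesis unfolding b using inL_wa by(intro exI[of _ l]) (simp add: rf_wa rf_alpha_alpha diag)
qed

text \<open>The reflection in an arbitrary root is conjugate to a simple one, so its coefficient
  \<open>k\<close> is an integer.\<close>

lemma root_reflection:
 assumes "\<beta> \<in> R" "\<gamma> \<in> R"
 shows "\<exists>k. rf \<gamma> \<gamma> * k = 2 * rf \<gamma> \<beta> \<and> \<beta> - k *s \<gamma> \<in> R"
proof -
 obtain xs i where g: "\<gamma> = wa xs (\<alpha> i)" using assms(2) unfolding root_iff by blast
 define k where "k = cpair i (wa (rev xs) \<beta>)"
 have "rf \<gamma> \<beta> = int (d i) * k" using rf_wa[of xs "\<alpha> i" "wa (rev xs) \<beta>"] by(simp add: g wa_rev k_def cpair_rf)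
 moreover have "rf \<gamma> \<gamma> = 2 * int (d i)" by(simp add: g rf_wa rf_alpha_alpha diag)
 ultimately have "rf \<gamma> \<gamma> * k = 2 * rf \<gamma> \<beta>" by simp
 moreover have "wa xs (sr i (wa (rev xs) \<beta>)) = \<beta> - k *s \<gamma>"
  by(simp add: sr_eq wa_diff wa_linear wa_rev k_def g)
 ultimately show ?thesis using root_wa[OF root_sr[OF root_wa[OF assms(1)]]] by metis
qed

lemma proportional_roots:
 assumes "\<beta> \<in> R" "\<gamma> \<in> R" "a *s \<beta> = b *s \<gamma>" "a \<noteq> 0"
 shows "\<beta> = \<gamma> \<or> \<beta> = - \<gamma>"
proof -
 obtain xs i where g: "\<gamma> = wa xs (\<alpha> i)" using assms(2) unfolding root_iff by blast
 let ?b = "wa (rev xs) \<beta>"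
 have "a *s ?b = b *s \<alpha> i" using arg_cong[OF assms(3), of "wa (rev xs)"] by(simp add: wa_linear g wa_rev)
 hence h: "a * ?b $ k = b * \<alpha> i $ k" for k by(metis vector_smult_component)
 have "?b $ k = 0" if "k \<noteq> i" for k using that assms(4) h[of k] by(simp add: axis_def)
 hence e: "?b = (?b $ i) *s \<alpha> i" by(simp add: vec_eq_iff axis_def)
 moreover have "?b \<in> R" using root_wa assms(1) by blast
 ultimately have "\<bar>?b $ i\<bar> = 1" using root_multiple by metis
 moreover have "\<beta> = (?b $ i) *s \<gamma>" using arg_cong[OF e, of "wa xs"] by(simp add: wa_linear g wa_rev)
 ultimately show ?thesis by(cases "?b $ i \<ge> 0") (auto simp: vec_eq_iff)
qed

lemma cauchy_schwarz_roots:
 assumes "\<beta> \<in> R" "\<gamma> \<in> R" "\<beta> \<noteq> \<gamma>" "\<beta> \<noteq> - \<gamma>"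
 shows "rf \<beta> \<gamma> * rf \<beta> \<gamma> < rf \<beta> \<beta> * rf \<gamma> \<gamma>"
proof -
 let ?a = "rf \<gamma> \<gamma>" and ?b = "rf \<beta> \<gamma>" and ?c = "rf \<beta> \<beta>"
 have a: "?a > 0" using rf_pos root_nonzero assms by blast
 hence "?a *s \<beta> - ?b *s \<gamma> \<noteq> 0" using proportional_roots[OF assms(1,2), of ?a ?b] assms(3,4) by auto
 hence "0 < rf (?a *s \<beta> - ?b *s \<gamma>) (?a *s \<beta> - ?b *s \<gamma>)" by(rule rf_pos)
 also have "\<dots> = ?a * (?c * ?a - ?b * ?b)"
  by(simp add: rf_diff rf_scale rf_sym[of \<gamma> \<beta>] algebra_simps)
 finally show ?thesis using a by(simp add: zero_less_mult_iff)
qed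

text \<open>Both Cartan numbers are positive integers, and by the strict Cauchy-Schwarz inequality
  not both are at least 2. A reflection with Cartan number 1 produces the difference up to
  sign.\<close>

lemma root_difference:
 assumes "\<beta> \<in> R" "\<gamma> \<in> R" "\<beta> \<noteq> \<gamma>" "rf \<beta> \<gamma> > 0"
 shows "\<beta> - \<gamma> \<in> R"
proof -
 let ?a = "rf \<gamma> \<gamma>" and ?b = "rf \<beta> \<gamma>" and ?c = "rf \<beta> \<beta>"
 have p: "?a > 0" "?c > 0" using rf_pos root_nonzero assms by blast+
 obtain k where k: "?a * k = 2 * ?b" "\<beta> - k *s \<gamma> \<in> R" using root_reflection[OF assms(1,2)] rf_sym[of \<gamma> \<beta>] by auto
 obtain l where l: "?c * l = 2 * ?b" "\<gamma> - l *s \<beta> \<in> R" using root_reflection[OF assms(2,1)] by auto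
 have kl: "k \<ge> 1" "l \<ge> 1" using k(1) l(1) p assms(4) by(smt (verit) mult_nonneg_nonpos)+
 have "\<beta> \<noteq> - \<gamma>" using assms(4) p by(auto simp: rf_minus)
 hence cs: "?b * ?b < ?c * ?a" using cauchy_schwarz_roots assms by blast
 have "\<not> (k \<ge> 2 \<and> l \<ge> 2)"
 proof
  assume "k \<ge> 2 \<and> l \<ge> 2"
  hence "?a * 2 \<le> ?a * k" "?c * 2 \<le> ?c * l" using p by(auto intro: mult_left_mono)
  hence "?a \<le> ?b" "?c \<le> ?b" using k(1) l(1) by simp_all
  hence "?c * ?a \<le> ?b * ?b" using p by(intro mult_mono) auto
  thus False using cs by simp
 qed
 then consider "k = 1" | "l = 1" using kl by linarith
 thus ?thesis
 proof cases
  case 1 then show ?thesis using k(2) by simp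
 next
  case 2 then show ?thesis using root_uminus[OF l(2)] by simp
 qed
qed

section \<open>The highest root\<close>

definition maximal :: "int ^ 'i => bool" where
 "maximal \<theta> \<longleftrightarrow> \<theta> \<in> Rp \<and> (\<forall>\<beta>\<in>R. (\<forall>k. \<theta> $ k \<le> \<beta> $ k) \<longrightarrow> \<beta> = \<theta>)"

definition dominant :: "int ^ 'i => bool" where "dominant x \<longleftrightarrow> (\<forall>i. rf (\<alpha> i) x \<ge> 0)"

lemma sr_increases: "\<not> rf (\<alpha> i) x \<ge> 0 ==> (\<forall>k. x $ k \<le> sr i x $ k) \<and> x $ i < sr i x $ i"
proof -
 assume "\<not> rf (\<alpha> i) x \<ge> 0"
 hence "cpair i x < 0" using d_pos[of i] by(simp add: mult_less_0_iff not_le flip: cpair_rf)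
 thus ?thesis by(simp add: sr_nth)
qed

lemma maximal_dominant: "maximal \<theta> ==> dominant \<theta>"
 unfolding dominant_def
proof (rule allI, rule ccontr)
 fix i assume m: "maximal \<theta>" and n: "\<not> rf (\<alpha> i) \<theta> \<ge> 0"
 have "sr i \<theta> \<in> R" using m root_sr by(simp add: maximal_def Rp_def)
 hence "sr i \<theta> = \<theta>" using m sr_increases[OF n] by(simp add: maximal_def)
 thus False using sr_increases[OF n] by simp
qed

lemma dominant_nonneg: "dominant y ==> pos x ==> rf x y \<ge> 0"
 by(subst rf_expand) (auto simp: dominant_def pos_def intro!: sum_nonneg)

text \<open>At a vertex outside the support but adjacent to it the pairing would be negative,
  against dominance; connectedness does the rest.\<close>

lemma maximal_support: "maximal \<theta> ==> \<theta> $ k > 0"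
proof -
 assume m: "maximal \<theta>"
 hence nn: "\<theta> $ i \<ge> 0" for i by(simp add: maximal_def Rp_def pos_def)
 have "{i. \<theta> $ i > 0} = UNIV"
 proof (rule conn)
  have "\<theta> \<noteq> 0" using m root_nonzero by(auto simp: maximal_def Rp_def)
  then obtain i where "\<theta> $ i \<noteq> 0" by(auto simp: vec_eq_iff)
  hence "\<theta> $ i > 0" using nn[of i] by simp
  thus "{i. \<theta> $ i > 0} \<noteq> {}" by blast
  fix i y assume i: "i \<in> {i. \<theta> $ i > 0}" and a: "adj C i y"
  show "y \<in> {i. \<theta> $ i > 0}"
  proof (rule ccontr)
   assume "y \<notin> {i. \<theta> $ i > 0}"
   hence y0: "\<theta> $ y = 0" using nn[of y] by simp
   have "0 < int (f y i) * \<theta> $ i" using mul_pos[OF adj_sym[OF a]] i by simp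
   also have "\<dots> \<le> (\<Sum>k | adj C y k. int (f y k) * \<theta> $ k)"
    using adj_sym[OF a] nn by(intro member_le_sum) auto
   finally have "cpair y \<theta> < 0" by(simp add: cpair_expand y0)
   hence "rf (\<alpha> y) \<theta> < 0" using d_pos[of y] by(simp add: mult_less_0_iff flip: cpair_rf)
   thus False using maximal_dominant[OF m] by(simp add: dominant_def not_less[symmetric])
  qed
 qed
 thus ?thesis by blast
qed

text \<open>Full support of one and dominance of the other make the inner product positive, so the
  difference is a root. Having a sign, it makes the two comparable.\<close>

lemma maximal_unique:
 assumes m: "maximal \<theta>" "maximal \<theta>'"
 shows "\<theta> = \<theta>'"
proof (rule ccontr)
 assume ne: "\<theta> \<noteq> \<theta>'"
 have R: "\<theta> \<in> R" "\<theta>' \<in> R" using m by(auto simp: maximal_def Rp_def)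
 have dn: "rf (\<alpha> i) \<theta>' \<ge> 0" for i using maximal_dominant[OF m(2)] by(simp add: dominant_def)
 have "\<exists>i. rf (\<alpha> i) \<theta>' \<noteq> 0"
 proof (rule ccontr)
  assume "\<not> ?thesis"
  hence "rf \<theta>' \<theta>' = 0" by(subst rf_expand) simp
  thus False using rf_pos[OF root_nonzero[OF R(2)]] by simp
 qed
 then obtain i where "rf (\<alpha> i) \<theta>' > 0" using dn by(metis less_le)
 hence "0 < \<theta> $ i * rf (\<alpha> i) \<theta>'" using maximal_support[OF m(1)] by simp
 also have "\<dots> \<le> (\<Sum>i\<in>UNIV. \<theta> $ i * rf (\<alpha> i) \<theta>')"
  using dn maximal_support[OF m(1)] by(intro member_le_sum) (auto intro: mult_nonneg_nonneg less_imp_le)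
 finally have "rf \<theta> \<theta>' > 0" by(subst rf_expand)
 hence "\<theta> - \<theta>' \<in> R" using root_difference[OF R ne] by blast
 hence "pos (\<theta> - \<theta>') \<or> pos (- (\<theta> - \<theta>'))" by(rule root_sign)
 thus False
 proof
  assume "pos (\<theta> - \<theta>')" then show False using m(2) R(1) ne by(auto simp: maximal_def pos_def)
 next
  assume "pos (- (\<theta> - \<theta>'))" then show False using m(1) R(2) ne by(auto simp: maximal_def pos_def)
 qed
qed

lemma highest_in_set:
 assumes "finite A" "A \<subseteq> Rp" "\<beta> \<in> A"
 shows "\<exists>\<theta>\<in>A. (\<forall>k. \<beta> $ k \<le> \<theta> $ k) \<and> (\<forall>\<gamma>\<in>A. (\<forall>k. \<theta> $ k \<le> \<gamma> $ k) \<longrightarrow> \<gamma> = \<theta>)"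
proof -
 let ?A = "{\<gamma> \<in> A. \<forall>k. \<beta> $ k \<le> \<gamma> $ k}"
 let ?h = "\<lambda>\<gamma>. \<Sum>k\<in>UNIV. \<gamma> $ k"
 have fin: "finite (?h ` ?A)" and ne: "?h ` ?A \<noteq> {}" using assms by auto
 obtain \<theta> where t: "\<theta> \<in> ?A" "?h \<theta> = Max (?h ` ?A)" using Max_in[OF fin ne] by auto
 have mx: "?h \<gamma> \<le> ?h \<theta>" if "\<gamma> \<in> ?A" for \<gamma> unfolding t(2) using fin that by(intro Max_ge) auto
 show ?thesis
 proof (intro bexI[of _ \<theta>] conjI ballI impI)
  fix \<gamma> assume g: "\<gamma> \<in> A" "\<forall>k. \<theta> $ k \<le> \<gamma> $ k"
  hence "\<gamma> \<in> ?A" using t(1) by(auto intro: order_trans)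
  from mx[OF this] have "?h \<gamma> \<le> ?h \<theta>" .
  show "\<gamma> = \<theta>"
  proof (rule ccontr)
   assume "\<gamma> \<noteq> \<theta>"
   then obtain k where "\<theta> $ k < \<gamma> $ k" using g(2) by(metis vec_eq_iff order_antisym_conv not_le)
   hence "?h \<theta> < ?h \<gamma>" using g(2) by(intro sum_strict_mono_ex1) auto
   thus False using \<open>?h \<gamma> \<le> ?h \<theta>\<close> by simp
  qed
 qed (use t in auto)
qed

text \<open>The highest root is long: a maximal positive root \<beta> in the orbit of a long simple
  root is dominant and lies below \<theta>, and pairing \<theta> - \<beta> with both gives
  (\<theta>, \<theta>) \<ge> (\<beta>, \<beta>) = 2 r. The divisibility is membership in the
  sublattice \<open>inL\<close> with d_l = r.\<close>

lemma highest_root_props: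
 assumes fin: "finite Rp"
 obtains \<theta> where "highest_root C = \<theta>" "\<theta> \<in> Rp" "dominant \<theta>" "rf \<theta> \<theta> = 2 * r" "\<forall>k. r dvd int (d k) * \<theta> $ k"
proof -
 have above: "\<exists>\<theta>. maximal \<theta> \<and> (\<forall>k. \<beta> $ k \<le> \<theta> $ k)" if b: "\<beta> \<in> Rp" for \<beta>
 proof -
  obtain \<theta> where t: "\<theta> \<in> Rp" "\<forall>k. \<beta> $ k \<le> \<theta> $ k" "\<forall>\<gamma>\<in>Rp. (\<forall>k. \<theta> $ k \<le> \<gamma> $ k) \<longrightarrow> \<gamma> = \<theta>"
   using highest_in_set[OF fin order_refl b] by blast
  have "maximal \<theta>" unfolding maximal_def
  proof (intro conjI ballI impI)
   fix \<gamma> assume g: "\<gamma> \<in> R" "\<forall>k. \<theta> $ k \<le> \<gamma> $ k"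
   hence "\<gamma> \<in> Rp" using t(1) by(auto simp: Rp_def pos_def intro: order_trans)
   thus "\<gamma> = \<theta>" using t(3) g(2) by blast
  qed fact
  thus ?thesis using t(2) by blast
 qed
 obtain k0 where k0: "int (d k0) = r" using ex_long by blast
 obtain \<theta> where m: "maximal \<theta>" using above[OF alpha_Rp[of k0]] by blast
 have tp: "\<theta> \<in> Rp" "\<theta> \<in> R" using m by(auto simp: maximal_def Rp_def)
 have dom: "dominant \<theta>" by(rule maximal_dominant[OF m])
 have le: "\<beta> $ k \<le> \<theta> $ k" if "\<beta> \<in> R" for \<beta> k
 proof (cases "\<beta> \<in> Rp")
  case True
  thus ?thesis using above[OF True] maximal_unique[OF m] by blast
 next
  case False
  hence "- \<beta> \<in> Rp" using root_cases[OF that] by blast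
  hence "\<beta> $ k \<le> 0" "\<theta> $ k \<ge> 0" using tp(1) by(auto simp: Rp_def pos_def)
  thus ?thesis by simp
 qed
 have hr: "highest_root C = \<theta>" unfolding highest_root_def
 proof (rule the_equality)
  fix \<beta> assume b: "\<beta> \<in> R \<and> (\<forall>\<gamma>\<in>R. \<forall>i. \<gamma> $ i \<le> \<beta> $ i)"
  thus "\<beta> = \<theta>" using le[of \<beta>] tp(2) by(simp add: vec_eq_iff order_antisym)
 qed (use le tp in blast)
 obtain l where l: "rf \<theta> \<theta> = 2 * int (d l)" "inL (d l) \<theta>" using root_norm[OF tp(2)] by blast
 let ?O = "{\<beta> \<in> Rp. \<exists>xs. \<beta> = wa xs (\<alpha> k0)}"
 have o1: "\<alpha> k0 \<in> ?O" using alpha_Rp wa_Nil[of "\<alpha> k0", symmetric] by blast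
 have o2: "finite ?O" using fin by simp
 have o3: "?O \<subseteq> Rp" by blast
 obtain \<beta> where b: "\<beta> \<in> ?O" "\<forall>\<gamma>\<in>?O. (\<forall>k. \<beta> $ k \<le> \<gamma> $ k) \<longrightarrow> \<gamma> = \<beta>"
  using highest_in_set[OF o2 o3 o1] by auto
 have bdom: "dominant \<beta>" unfolding dominant_def
 proof (rule allI, rule ccontr)
  fix i assume n: "\<not> rf (\<alpha> i) \<beta> \<ge> 0"
  obtain xs where xs: "\<beta> = wa xs (\<alpha> k0)" using b(1) by blast
  have "sr i \<beta> = wa (i # xs) (\<alpha> k0)" by(simp add: wa_Cons xs)
  moreover have "sr i \<beta> \<in> Rp" using sr_increases[OF n] b(1) root_sr by(auto simp: Rp_def pos_def intro: order_trans)
  ultimately have o: "sr i \<beta> \<in> ?O" by blast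
  have "sr i \<beta> = \<beta>" using b(2)[rule_format, OF o] sr_increases[OF n] by simp
  thus False using sr_increases[OF n] by simp
 qed
 have bn: "rf \<beta> \<beta> = 2 * r" using b(1) k0 by(auto simp: rf_wa rf_alpha_alpha diag)
 have "pos (\<theta> - \<beta>)" using le[of \<beta>] b(1) by(auto simp: pos_def Rp_def)
 hence "rf (\<theta> - \<beta>) \<theta> \<ge> 0" "rf (\<theta> - \<beta>) \<beta> \<ge> 0" using dominant_nonneg dom bdom by blast+
 hence "rf \<theta> \<theta> \<ge> rf \<beta> \<beta>" by(simp add: rf_diff rf_sym[of \<beta> \<theta>])
 hence "int (d l) = r" using d_cases[of l] r_pos bn l(1) by auto
 thus thesis using that[OF hr tp(1) dom] l by(simp add: inL_def)
qed

section \<open>Sums over the positive roots and the Casimir identity\<close>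

lemma Rp_reindex:
 assumes "finite Rp"
 shows "(\<Sum>\<beta>\<in>Rp - {\<alpha> i}. g (sr i \<beta>)) = (\<Sum>\<beta>\<in>Rp - {\<alpha> i}. g \<beta>)"
proof (rule sum.reindex_bij_betw)
 have "sr i \<beta> \<in> Rp - {\<alpha> i}" if "\<beta> \<in> Rp - {\<alpha> i}" for \<beta>
 proof -
  have "sr i \<beta> \<noteq> \<alpha> i"
  proof
   assume "sr i \<beta> = \<alpha> i"
   hence "\<beta> = - \<alpha> i" using sr_sr[of i \<beta>] by(simp add: sr_alpha)
   thus False using that Rp_uminus[OF alpha_Rp] by auto
  qed
  thus ?thesis using Rp_sr that by auto
 qed
 thus "bij_betw (sr i) (Rp - {\<alpha> i}) (Rp - {\<alpha> i})"
  by(intro bij_betw_byWitness[where f' = "sr i"]) (auto simp: sr_sr)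
qed

lemma rf_sr_swap: "rf (sr i \<beta>) x = rf \<beta> (sr i x)"
 using rf_sr[of i \<beta> "sr i x"] by(simp add: sr_sr)

text \<open>The reflection s_i permutes the positive roots other than \<alpha>_i and changes the
  sign of the pairing with \<alpha>_i, so only \<alpha>_i itself contributes, with 2 d_i.\<close>

lemma sum_positive_roots: "finite Rp ==> (\<Sum>\<beta>\<in>Rp. rf \<beta> x) = (\<Sum>i\<in>UNIV. 2 * int (d i) * x $ i)"
proof -
 assume fin: "finite Rp"
 have "(\<Sum>\<beta>\<in>Rp. rf \<beta> (\<alpha> i)) = 2 * int (d i)" for i
 proof -
  have "(\<Sum>\<beta>\<in>Rp - {\<alpha> i}. rf \<beta> (\<alpha> i)) = (\<Sum>\<beta>\<in>Rp - {\<alpha> i}. rf (sr i \<beta>) (\<alpha> i))"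
   using Rp_reindex[OF fin, of "\<lambda>\<beta>. rf \<beta> (\<alpha> i)" i] by simp
  also have "\<dots> = - (\<Sum>\<beta>\<in>Rp - {\<alpha> i}. rf \<beta> (\<alpha> i))" by(simp add: rf_sr_swap sr_alpha rf_minus sum_negf)
  finally have "(\<Sum>\<beta>\<in>Rp - {\<alpha> i}. rf \<beta> (\<alpha> i)) = 0" by simp
  thus ?thesis using sum.remove[OF fin alpha_Rp[of i], of "\<lambda>\<beta>. rf \<beta> (\<alpha> i)"] by(simp add: rf_alpha_alpha diag)
 qed
 note a = this
 have "(\<Sum>\<beta>\<in>Rp. rf \<beta> x) = (\<Sum>\<beta>\<in>Rp. \<Sum>i\<in>UNIV. x $ i * rf \<beta> (\<alpha> i))"
 proof (rule sum.cong[OF refl])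
  fix \<beta>
  have "rf \<beta> x = rf x \<beta>" by(rule rf_sym)
  also have "\<dots> = (\<Sum>i\<in>UNIV. x $ i * rf \<beta> (\<alpha> i))" by(subst rf_expand) (simp add: rf_sym[of \<beta>])
  finally show "rf \<beta> x = (\<Sum>i\<in>UNIV. x $ i * rf \<beta> (\<alpha> i))" .
 qed
 also have "\<dots> = (\<Sum>i\<in>UNIV. x $ i * (\<Sum>\<beta>\<in>Rp. rf \<beta> (\<alpha> i)))" by(subst sum.swap) (simp add: sum_distrib_left)
 finally show ?thesis by(simp add: a mult_ac)
qed

definition S2 :: "int ^ 'i => int ^ 'i => int" where "S2 x y = (\<Sum>\<beta>\<in>Rp. rf \<beta> x * rf \<beta> y)"

lemma S2_linear: "S2 x (y - z) = S2 x y - S2 x z" "S2 (x - z) y = S2 x y - S2 z y" "S2 (c *s x) y = c * S2 x y" "S2 x (- y) = - S2 x y"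
 by(simp_all add: S2_def rf_diff rf_scale rf_minus algebra_simps sum_subtractf sum_distrib_left sum_negf)

lemma S2_sym: "S2 x y = S2 y x" by(simp add: S2_def mult.commute)

lemma S2_sr: "finite Rp ==> S2 (sr i x) (sr i y) = S2 x y"
proof -
 assume fin: "finite Rp"
 note rem = sum.remove[OF fin alpha_Rp[of i]]
 have "rf (\<alpha> i) (sr i z) = - rf (\<alpha> i) z" for z using rf_sr_swap[of i "\<alpha> i" z] by(simp add: sr_alpha rf_minus)
 thus ?thesis unfolding S2_def rem
  using Rp_reindex[OF fin, of "\<lambda>\<beta>. rf \<beta> x * rf \<beta> y" i] by(simp add: rf_sr_swap)
qed

lemma S2_alpha:
 assumes fin: "finite Rp"
 shows "2 * int (d i) * S2 x (\<alpha> i) = rf (\<alpha> i) x * S2 (\<alpha> i) (\<alpha> i)"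
proof -
 have "S2 x (\<alpha> i) = S2 (sr i x) (sr i (\<alpha> i))" by(simp add: S2_sr[OF fin])
 also have "\<dots> = - (S2 x (\<alpha> i) - cpair i x * S2 (\<alpha> i) (\<alpha> i))"
  unfolding sr_alpha sr_eq[of i x] by(simp add: S2_linear)
 finally have "2 * S2 x (\<alpha> i) = cpair i x * S2 (\<alpha> i) (\<alpha> i)" by simp
 hence "int (d i) * (2 * S2 x (\<alpha> i)) = int (d i) * (cpair i x * S2 (\<alpha> i) (\<alpha> i))" by(rule arg_cong)
 thus ?thesis by(simp add: mult_ac flip: cpair_rf)
qed

text \<open>By \<open>S2_alpha\<close> the ratio of the invariant form \<open>S2\<close> to
  \<open>rf\<close> is the same at adjacent simple roots, hence a constant g. The operator sending z
  to the sum of the (\<beta>, z) \<beta> is then multiplication by g; its trace is the sum of the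
  norms on the one hand and rank times g on the other.\<close>

lemma casimir:
 assumes fin: "finite Rp"
 shows "\<exists>g::real. (\<forall>x y. real_of_int (S2 x y) = g * real_of_int (rf x y)) \<and>
  real_of_int (\<Sum>\<beta>\<in>Rp. rf \<beta> \<beta>) = real CARD('i) * g"
proof -
 define e where "e i = S2 (\<alpha> i) (\<alpha> i)" for i
 obtain i0 :: 'i where True by blast
 define g where "g = real_of_int (e i0) / (2 * real (d i0))"
 have "{i. e i * int (d i0) = e i0 * int (d i)} = UNIV"
 proof (rule conn)
  fix i y assume i: "i \<in> {i. e i * int (d i0) = e i0 * int (d i)}" and a: "adj C i y"
  have s1: "2 * int (d i) * S2 (\<alpha> y) (\<alpha> i) = rf (\<alpha> i) (\<alpha> y) * e i"
   unfolding e_def by(rule S2_alpha[OF fin])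
  have s2: "2 * int (d y) * S2 (\<alpha> y) (\<alpha> i) = rf (\<alpha> i) (\<alpha> y) * e y"
   unfolding e_def S2_sym[of "\<alpha> y" "\<alpha> i"] rf_sym[of "\<alpha> i" "\<alpha> y"] by(rule S2_alpha[OF fin])
  have "rf (\<alpha> i) (\<alpha> y) * (e i * int (d y)) = 2 * int (d i) * S2 (\<alpha> y) (\<alpha> i) * int (d y)"
   unfolding s1 by(simp only: mult.assoc)
  also have "\<dots> = 2 * int (d y) * S2 (\<alpha> y) (\<alpha> i) * int (d i)" by(simp only: mult_ac)
  also have "\<dots> = rf (\<alpha> i) (\<alpha> y) * (e y * int (d i))" unfolding s2 by(simp only: mult.assoc)
  finally have "rf (\<alpha> i) (\<alpha> y) * (e i * int (d y)) = rf (\<alpha> i) (\<alpha> y) * (e y * int (d i))" .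
  moreover have "rf (\<alpha> i) (\<alpha> y) \<noteq> 0" using a d_pos[of i] by(simp add: rf_alpha_alpha C_adj)
  ultimately have ey: "e i * int (d y) = e y * int (d i)" by simp
  have "int (d i) * (e y * int (d i0)) = (e i * int (d i0)) * int (d y)" using ey by(simp add: mult_ac)
  also have "\<dots> = int (d i) * (e i0 * int (d y))" using i by(simp add: mult_ac)
  finally show "y \<in> {i. e i * int (d i0) = e i0 * int (d i)}" using d_pos[of i] by simp
 qed auto
 hence "e i * int (d i0) = e i0 * int (d i)" for i by blast
 hence "real_of_int (e i) * real (d i0) = real_of_int (e i0) * real (d i)" for i by(metis of_int_mult of_int_of_nat_eq)
 hence eg: "real_of_int (e i) = g * (2 * real (d i))" for i
  using d_pos[of i0] by(simp add: g_def field_simps)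
 have Sa: "real_of_int (S2 x (\<alpha> i)) = g * real_of_int (rf (\<alpha> i) x)" for x i
 proof -
  have "2 * real (d i) * real_of_int (S2 x (\<alpha> i)) = real_of_int (rf (\<alpha> i) x) * real_of_int (e i)"
   using arg_cong[OF S2_alpha[OF fin, of i x], of real_of_int] by(simp add: e_def)
  thus ?thesis using d_pos[of i] unfolding eg by simp
 qed
 have S2_expand: "S2 x y = (\<Sum>i\<in>UNIV. y $ i * S2 x (\<alpha> i))" for x y
 proof -
  have "S2 x y = (\<Sum>\<beta>\<in>Rp. \<Sum>i\<in>UNIV. y $ i * (rf \<beta> x * rf \<beta> (\<alpha> i)))" unfolding S2_def
  proof (rule sum.cong[OF refl])
   fix \<beta>
   have "rf \<beta> y = rf y \<beta>" by(rule rf_sym)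
   also have "\<dots> = (\<Sum>i\<in>UNIV. y $ i * rf \<beta> (\<alpha> i))" by(subst rf_expand) (simp add: rf_sym[of \<beta>])
   finally show "rf \<beta> x * rf \<beta> y = (\<Sum>i\<in>UNIV. y $ i * (rf \<beta> x * rf \<beta> (\<alpha> i)))" by(simp add: sum_distrib_left mult_ac)
  qed
  thus ?thesis by(subst (asm) sum.swap) (simp add: S2_def sum_distrib_left)
 qed
 have main: "real_of_int (S2 x y) = g * real_of_int (rf x y)" for x y
 proof -
  have "real_of_int (S2 x y) = (\<Sum>i\<in>UNIV. real_of_int (y $ i) * (g * real_of_int (rf (\<alpha> i) x)))"
   by(subst S2_expand) (simp add: Sa)
  also have "\<dots> = g * real_of_int (\<Sum>i\<in>UNIV. y $ i * rf (\<alpha> i) x)" by(simp add: sum_distrib_left mult_ac)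
  finally show ?thesis unfolding rf_expand[of y x, symmetric] rf_sym[of y x] .
 qed
 \<comment> \<open>The image of \<alpha>_k under that operator; its k-th coordinate is the diagonal
   entry needed for the trace.\<close>
 define v where "v k = (\<Sum>\<beta>\<in>Rp. rf \<beta> (\<alpha> k) *s \<beta>)" for k
 have vk: "2 * int (d k) * v k $ k = e k" for k
 proof -
  have "rf (v k) x = S2 (\<alpha> k) x" for x by(simp add: v_def rf_sum[OF fin] rf_scale S2_def)
  hence "rf ((2 * int (d k)) *s v k - e k *s \<alpha> k) x = 0" for x
   using S2_alpha[OF fin, of k x] S2_sym[of x "\<alpha> k"] by(simp add: rf_diff rf_scale e_def)
  hence "(2 * int (d k)) *s v k - e k *s \<alpha> k = 0" using rf_pos by(metis less_irrefl)
  hence "((2 * int (d k)) *s v k) $ k = (e k *s \<alpha> k) $ k" by simp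
  thus ?thesis by simp
 qed
 have "real_of_int (v k $ k) = g" for k
  using arg_cong[OF vk[of k], of real_of_int] d_pos[of k] by(simp add: eg)
 moreover have "(\<Sum>\<beta>\<in>Rp. rf \<beta> \<beta>) = (\<Sum>k\<in>UNIV. v k $ k)"
 proof -
  have "(\<Sum>k\<in>UNIV. v k $ k) = (\<Sum>k\<in>UNIV. \<Sum>\<beta>\<in>Rp. \<beta> $ k * rf (\<alpha> k) \<beta>)"
   by(simp add: v_def sum_component rf_sym mult.commute)
  also have "\<dots> = (\<Sum>\<beta>\<in>Rp. rf \<beta> \<beta>)" by(subst sum.swap) (simp add: rf_expand[symmetric])
  finally show ?thesis ..
 qed
 ultimately have "real_of_int (\<Sum>\<beta>\<in>Rp. rf \<beta> \<beta>) = real CARD('i) * g" by simp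
 with main show ?thesis by blast
qed

text \<open>For a positive root \<beta> other than \<theta> the number (\<beta>, \<theta>) is a
  multiple of r, nonnegative and below 2 r, so it is 0 or r. Hence its square is r times itself, the
  sum of squares reduces to the linear sum in \<open>sum_positive_roots\<close>, and g = r (1 + m)
  results.\<close>

theorem dual_coxeter_sum:
 assumes fin: "finite Rp"
 shows "(\<Sum>\<beta>\<in>Rp. rf \<beta> \<beta>) = int CARD('i) * (r * dual_coxeter_number C)"
proof -
 obtain g :: real where g: "\<And>x y. real_of_int (S2 x y) = g * real_of_int (rf x y)"
  "real_of_int (\<Sum>\<beta>\<in>Rp. rf \<beta> \<beta>) = real CARD('i) * g" using casimir[OF fin] by blast
 obtain \<theta> where t: "highest_root C = \<theta>" "\<theta> \<in> Rp" "dominant \<theta>" "rf \<theta> \<theta> = 2 * r" "\<forall>k. r dvd int (d k) * \<theta> $ k"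
  by(rule highest_root_props[OF fin])
 have tR: "\<theta> \<in> R" using t(2) by(simp add: Rp_def)
 define s where "s = (\<Sum>i\<in>UNIV. int (d i) * \<theta> $ i)"
 have "r dvd s" unfolding s_def by(intro dvd_sum t(5)[rule_format])
 then obtain m where m: "s = r * m" by(rule dvdE)
 have hv: "dual_coxeter_number C = 1 + m"
  using r_pos by(simp add: dual_coxeter_number_def Let_def t(1,4) s_def[symmetric] m)
 have val: "rf \<beta> \<theta> * rf \<beta> \<theta> = r * rf \<beta> \<theta>" if b: "\<beta> \<in> Rp - {\<theta>}" for \<beta>
 proof -
  have bR: "\<beta> \<in> R" using b by(simp add: Rp_def)
  have "\<beta> \<noteq> - \<theta>" using b Rp_uminus[OF t(2)] by auto
  hence cs: "rf \<beta> \<theta> * rf \<beta> \<theta> < rf \<beta> \<beta> * rf \<theta> \<theta>" using cauchy_schwarz_roots[OF bR tR] b by auto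
  obtain l where "rf \<beta> \<beta> = 2 * int (d l)" using root_norm[OF bR] by blast
  hence "rf \<beta> \<beta> \<le> 2 * r" using d_cases[of l] r_pos by auto
  hence "rf \<beta> \<beta> * rf \<theta> \<theta> \<le> (2 * r) * (2 * r)" unfolding t(4) using r_pos by(intro mult_right_mono) auto
  hence calc: "rf \<beta> \<theta> * rf \<beta> \<theta> < (2 * r) * (2 * r)" using cs by linarith
  have nn: "rf \<beta> \<theta> \<ge> 0" using dominant_nonneg[OF t(3)] b by(simp add: Rp_def)
  have lt: "rf \<beta> \<theta> < 2 * r"
  proof (rule ccontr)
   assume "\<not> rf \<beta> \<theta> < 2 * r"
   hence "(2 * r) * (2 * r) \<le> rf \<beta> \<theta> * rf \<beta> \<theta>" using r_pos by(intro mult_mono) auto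
   thus False using calc by linarith
  qed
  have "rf \<theta> \<beta> = (\<Sum>i\<in>UNIV. (int (d i) * \<theta> $ i) * cpair i \<beta>)"
   by(subst rf_expand) (simp add: mult_ac flip: cpair_rf)
  hence "r dvd rf \<beta> \<theta>" unfolding rf_sym[of \<beta> \<theta>] by(simp add: dvd_sum t(5)[rule_format])
  then obtain k where k: "rf \<beta> \<theta> = r * k" by(rule dvdE)
  have "0 \<le> k" "k < 2" using nn lt r_pos unfolding k by(auto simp: zero_le_mult_iff mult.commute)
  hence "k = 0 \<or> k = 1" by linarith
  thus ?thesis unfolding k by auto
 qed
 have lin: "(\<Sum>\<beta>\<in>Rp - {\<theta>}. rf \<beta> \<theta>) = 2 * s - 2 * r"
 proof -
  have "2 * r + (\<Sum>\<beta>\<in>Rp - {\<theta>}. rf \<beta> \<theta>) = (\<Sum>\<beta>\<in>Rp. rf \<beta> \<theta>)"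
   using sum.remove[OF fin t(2), of "\<lambda>\<beta>. rf \<beta> \<theta>"] by(simp add: t(4))
  also have "\<dots> = 2 * s" unfolding sum_positive_roots[OF fin] s_def by(simp add: sum_distrib_left mult_ac)
  finally show ?thesis by simp
 qed
 have "S2 \<theta> \<theta> = (2 * r) * (2 * r) + (\<Sum>\<beta>\<in>Rp - {\<theta>}. rf \<beta> \<theta> * rf \<beta> \<theta>)"
  unfolding S2_def using sum.remove[OF fin t(2), of "\<lambda>\<beta>. rf \<beta> \<theta> * rf \<beta> \<theta>"] by(simp add: t(4))
 also have "(\<Sum>\<beta>\<in>Rp - {\<theta>}. rf \<beta> \<theta> * rf \<beta> \<theta>) = (\<Sum>\<beta>\<in>Rp - {\<theta>}. r * rf \<beta> \<theta>)"
  by(rule sum.cong[OF refl val])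
 also have "\<dots> = r * (2 * s - 2 * r)" by(simp add: lin flip: sum_distrib_left)
 finally have "S2 \<theta> \<theta> = (r * (1 + m)) * (2 * r)" by(simp add: m algebra_simps)
 hence "g * real_of_int (2 * r) = real_of_int (r * (1 + m)) * real_of_int (2 * r)"
  using g(1)[of \<theta> \<theta>] by(simp only: t(4) of_int_mult)
 hence "g = real_of_int (r * (1 + m))" using r_pos by simp
 hence "real_of_int (\<Sum>\<beta>\<in>Rp. rf \<beta> \<beta>) = real_of_int (int CARD('i) * (r * dual_coxeter_number C))"
  using g(2) by(simp add: hv)
 thus ?thesis by(simp only: of_int_eq_iff)
qed

end

section \<open>The path algebra and its ideals\<close>

text \<open>The pairing of a function on paths with an element of the path algebra. It determines
  the element (\<open>pr_ext\<close>), so identities in the algebra are checked by pairing both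
  sides with an arbitrary function.\<close>

definition pr :: "('i qpath => 'k::field) => ('i qpath \<Rightarrow>\<^sub>0 'k) => 'k" where
 "pr \<phi> x = (\<Sum>p\<in>Poly_Mapping.keys x. Poly_Mapping.lookup x p * \<phi> p)"

lemma pr_superset:
 "finite S ==> Poly_Mapping.keys x \<subseteq> S ==> pr \<phi> x = (\<Sum>p\<in>S. Poly_Mapping.lookup x p * \<phi> p)"
 unfolding pr_def by(rule sum.mono_neutral_left) (auto simp: in_keys_iff)

lemma pr_add: "pr \<phi> (x + y) = pr \<phi> x + pr \<phi> y"
proof -
 let ?S = "Poly_Mapping.keys x \<union> Poly_Mapping.keys y"
 have "Poly_Mapping.keys (x + y) \<subseteq> ?S" by(rule keys_add)
 thus ?thesis
  using pr_superset[of ?S "x + y" \<phi>] pr_superset[of ?S x \<phi>] pr_superset[of ?S y \<phi>]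
  by(simp add: lookup_add distrib_right sum.distrib)
qed

lemma pr_zero [simp]: "pr \<phi> 0 = 0" by(simp add: pr_def)

lemma pr_minus: "pr \<phi> (- x) = - pr \<phi> x"
 using pr_add[of \<phi> x "- x"] by(simp add: eq_neg_iff_add_eq_0 add.commute)

lemma pr_diff: "pr \<phi> (x - y) = pr \<phi> x - pr \<phi> y"
 using pr_add[of \<phi> x "- y"] by(simp add: pr_minus)

lemma pr_sum: "pr \<phi> (\<Sum>a\<in>A. g a) = (\<Sum>a\<in>A. pr \<phi> (g a))"
 by(induction A rule: infinite_finite_induct) (simp_all add: pr_add)

lemma lookup_scale: "Poly_Mapping.lookup (scale c x) p = c * Poly_Mapping.lookup x p"
 by(simp add: scale_def Poly_Mapping.map.rep_eq when_def)

lemma keys_scale: "Poly_Mapping.keys (scale c x) \<subseteq> Poly_Mapping.keys x"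
 by(auto simp: in_keys_iff lookup_scale)

lemma pr_scale: "pr \<phi> (scale c x) = c * pr \<phi> x"
 using pr_superset[of "Poly_Mapping.keys x" "scale c x" \<phi>, OF finite_keys keys_scale]
 by(simp add: pr_def lookup_scale sum_distrib_left mult.assoc)

lemma pr_single [simp]: "pr \<phi> (Poly_Mapping.single p c) = c * \<phi> p"
 by(simp add: pr_def)

lemma pr_cong: "(\<And>p. p \<in> Poly_Mapping.keys x ==> \<phi> p = \<psi> p) ==> pr \<phi> x = pr \<psi> x"
 unfolding pr_def by(intro sum.cong) auto

lemma pr_fun: "pr (\<lambda>p. \<phi> p + \<psi> p) x = pr \<phi> x + pr \<psi> x" "pr (\<lambda>p. c * \<phi> p) x = c * pr \<phi> x" "pr (\<lambda>p. 0) x = 0"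
 by(simp_all add: pr_def distrib_left sum.distrib sum_distrib_left mult.left_commute)

lemma pr_lookup: "pr (\<lambda>q. if q = p then 1 else 0) x = Poly_Mapping.lookup x p"
 by(simp add: pr_def if_distrib[of "\<lambda>t. _ * t"] in_keys_iff cong: if_cong)

lemma pr_ext: "(\<And>\<phi>. pr \<phi> x = pr \<phi> y) ==> x = y"
 by(rule poly_mapping_eqI) (metis pr_lookup)

text \<open>The transpose of \<open>basis_mult\<close>: the value of \<open>\<phi>\<close> at the
  product of two paths.\<close>

fun cm :: "('i qpath => 'k::field) => 'i qpath => 'i qpath => 'k" where
 "cm \<phi> (i, as, j) (k, bs, l) = (if j = k then \<phi> (i, as @ bs, l) else 0)"

lemma pr_basis: "pr \<phi> (basis_mult a b) = cm \<phi> a b"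
 by(cases a; cases b) auto

lemma pr_mult: "pr \<phi> (path_mult x y) = pr (\<lambda>a. pr (cm \<phi> a) y) x"
 by(simp add: path_mult_def pr_sum pr_scale pr_basis) (simp add: pr_def sum_distrib_left mult.assoc)

lemma pm_assoc: "path_mult (path_mult x y) z = path_mult x (path_mult y z)"
proof (rule pr_ext)
 fix \<phi> :: "'a qpath => 'b"
 have "cm (\<lambda>p. pr (cm \<phi> p) z) a b = pr (cm (cm \<phi> a) b) z" for a b
 proof -
  have "cm (cm \<phi> a) b = (case a of (i, as, j) => case b of (k, bs, l) => if j = k then cm \<phi> (i, as @ bs, l) else (\<lambda>_. 0))"
   by(rule ext, rename_tac c, case_tac c, cases a; cases b) simp
  thus ?thesis by(cases a; cases b) (simp add: pr_fun)
 qed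
 hence "cm (\<lambda>p. pr (cm \<phi> p) z) a = (\<lambda>b. pr (cm (cm \<phi> a) b) z)" for a by blast
 thus "pr \<phi> (path_mult (path_mult x y) z) = pr \<phi> (path_mult x (path_mult y z))"
  unfolding pr_mult by simp
qed

lemma pm_distrib: "path_mult (x + y) z = path_mult x z + path_mult y z" "path_mult z (x + y) = path_mult z x + path_mult z y"
 by(rule pr_ext, simp add: pr_mult pr_add pr_fun)+

lemma pm_zero: "path_mult 0 z = 0" "path_mult z 0 = 0"
 using pm_distrib(1)[of 0 0 z] pm_distrib(2)[of z 0 0] by simp_all

lemma pm_scale: "path_mult (scale c x) y = scale c (path_mult x y)"
 by(rule pr_ext) (simp add: pr_mult pr_scale)

lemma pm_single: "path_mult (Poly_Mapping.single (i, as, j) 1) (Poly_Mapping.single (j, bs, l) 1) = Poly_Mapping.single (i, as @ bs, l) (1::'k::field)"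
 by(rule pr_ext) (simp add: pr_mult)

lemma pm_one:
 fixes x :: "'i::finite qpath \<Rightarrow>\<^sub>0 'k::field"
 shows "path_mult (\<Sum>i\<in>UNIV. idem i) x = x" "path_mult x (\<Sum>i\<in>UNIV. idem i) = x"
proof -
 have c: "(\<Sum>i\<in>UNIV. cm \<phi> (i, [], i) p) = \<phi> p" "(\<Sum>i\<in>UNIV. cm \<phi> p (i, [], i)) = \<phi> p" for \<phi> :: "'i qpath => 'k" and p :: "'i qpath"
  by(cases p, simp)+
 have s: "(\<Sum>i\<in>UNIV. pr (g i) x) = pr (\<lambda>p. \<Sum>i\<in>UNIV. g i p) x" for g :: "'i => 'i qpath => 'k"
  unfolding pr_def sum_distrib_left by(rule sum.swap)
 show "path_mult (\<Sum>i\<in>UNIV. idem i) x = x" "path_mult x (\<Sum>i\<in>UNIV. idem i) = x"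
  by(rule pr_ext, simp add: pr_mult pr_sum idem_def s c)+
qed

lemma idem_left: "pr \<phi> (path_mult (idem i) x) = pr (\<lambda>(k, as, l). if k = i then \<phi> (k, as, l) else 0) x"
 unfolding pr_mult idem_def by(auto intro!: pr_cong)

lemma idem_right: "pr \<phi> (path_mult x (idem j)) = pr (\<lambda>(k, as, l). if l = j then \<phi> (k, as, l) else 0) x"
 unfolding pr_mult idem_def by(auto intro!: pr_cong)

abbreviation PA where "PA C \<equiv> carrier (path_algebra C)"

lemma PA_iff: "x \<in> PA C \<longleftrightarrow> Poly_Mapping.keys x \<subseteq> paths C"
 and PA_mult: "(\<otimes>\<^bsub>path_algebra C\<^esub>) = path_mult" and PA_add: "(\<oplus>\<^bsub>path_algebra C\<^esub>) = (+)"
 and PA_zero: "\<zero>\<^bsub>path_algebra C\<^esub> = 0" and PA_one: "\<one>\<^bsub>path_algebra C\<^esub> = (\<Sum>i\<in>UNIV. idem i)"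
 by(simp_all add: path_algebra_def)

lemma PA_pr: "x \<in> PA C \<longleftrightarrow> (\<forall>\<phi>. (\<forall>p\<in>paths C. \<phi> p = 0) \<longrightarrow> pr \<phi> x = 0)"
proof
 show "x \<in> PA C ==> \<forall>\<phi>. (\<forall>p\<in>paths C. \<phi> p = 0) \<longrightarrow> pr \<phi> x = 0"
  unfolding PA_iff pr_def by(auto intro!: sum.neutral)
 assume h: "\<forall>\<phi>. (\<forall>p\<in>paths C. \<phi> p = 0) \<longrightarrow> pr \<phi> x = 0"
 show "x \<in> PA C" unfolding PA_iff
 proof
  fix p assume p: "p \<in> Poly_Mapping.keys x"
  show "p \<in> paths C"
  proof (rule ccontr)
   assume "p \<notin> paths C"
   hence "pr (\<lambda>q. if q = p then 1 else 0) x = 0" by(intro h[rule_format]) auto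
   thus False using p unfolding pr_lookup by(simp add: in_keys_iff)
  qed
 qed
qed

lemma PA_closed:
 "x \<in> PA C ==> y \<in> PA C ==> x + y \<in> PA C" "x \<in> PA C ==> y \<in> PA C ==> x - y \<in> PA C"
 "x \<in> PA C ==> - x \<in> PA C" "0 \<in> PA C" "x \<in> PA C ==> scale c x \<in> PA C"
 "x \<in> PA C ==> y \<in> PA C ==> path_mult x y \<in> PA C"
proof -
 show "x \<in> PA C ==> y \<in> PA C ==> path_mult x y \<in> PA C"
  unfolding PA_pr[of "path_mult x y"] pr_mult
 proof (intro allI impI)
  fix \<phi> :: "'a qpath => 'b" assume xy: "x \<in> PA C" "y \<in> PA C" and \<phi>: "\<forall>p\<in>paths C. \<phi> p = 0"
  have c: "cm \<phi> a b = 0" if "a \<in> paths C" "b \<in> paths C" for a b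
   using that \<phi>[rule_format, of "(fst a, fst (snd a) @ fst (snd b), snd (snd b))"]
   by(cases a; cases b) (auto simp: paths_def is_walk_append)
  have "pr (cm \<phi> a) y = 0" if "a \<in> paths C" for a
   by(rule xy(2)[unfolded PA_pr, rule_format]) (rule c[OF that])
  thus "pr (\<lambda>a. pr (cm \<phi> a) y) x = 0" by(rule xy(1)[unfolded PA_pr, rule_format])
 qed
qed (auto simp: PA_pr pr_add pr_diff pr_minus pr_scale)

lemma single_PA: "is_walk C i w j ==> Poly_Mapping.single (i, w, j) c \<in> PA C"
 by(auto simp: PA_iff paths_def)

lemma idem_PA: "idem i \<in> PA C" unfolding idem_def by(rule single_PA) simp

lemma eps_PA: "arr (Eps i) \<in> PA C" unfolding arr_def by(rule single_PA) simp

lemma ring_PA: "ring (path_algebra C)"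
proof (rule ringI)
 show "abelian_group (path_algebra C)"
 proof (rule abelian_groupI)
  show "x \<in> PA C ==> \<exists>y\<in>PA C. y \<oplus>\<^bsub>path_algebra C\<^esub> x = \<zero>\<^bsub>path_algebra C\<^esub>" for x
   by(rule bexI[of _ "- x"]) (simp_all add: PA_add PA_zero PA_closed)
 qed (simp_all add: PA_add PA_zero PA_closed add.commute add.left_commute)
 show "Group.monoid (path_algebra C)"
 proof (rule monoidI)
  show "\<one>\<^bsub>path_algebra C\<^esub> \<in> PA C" unfolding PA_one PA_pr pr_sum
   using idem_PA unfolding PA_pr by(auto intro!: sum.neutral)
 qed (simp_all add: PA_mult PA_one PA_closed pm_assoc pm_one)
qed (simp_all add: PA_mult PA_add pm_distrib)

lemma PA_uminus: "x \<in> PA C ==> \<ominus>\<^bsub>path_algebra C\<^esub> x = - x"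
 using abelian_group.minus_equality[OF ring.is_abelian_group[OF ring_PA], of C "- x" x]
 by(simp add: PA_add PA_zero PA_closed)

lemma PA_minus: "x \<in> PA C ==> y \<in> PA C ==> x \<ominus>\<^bsub>path_algebra C\<^esub> y = x - y"
 by(simp add: a_minus_def PA_uminus PA_add)

lemma PA_ideal:
 assumes "J \<subseteq> PA C" "0 \<in> J" "\<And>x y. x \<in> J ==> y \<in> J ==> x + y \<in> J" "\<And>x. x \<in> J ==> - x \<in> J"
  "\<And>x y. x \<in> J ==> y \<in> PA C ==> path_mult y x \<in> J" "\<And>x y. x \<in> J ==> y \<in> PA C ==> path_mult x y \<in> J"
 shows "ideal J (path_algebra C)"
proof (rule idealI[OF ring_PA])
 show "subgroup J (add_monoid (path_algebra C))"
 proof (rule group.subgroupI[OF abelian_group.a_group[OF ring.is_abelian_group[OF ring_PA]]])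
  fix a assume "a \<in> J"
  thus "inv\<^bsub>add_monoid (path_algebra C)\<^esub> a \<in> J"
   using PA_uminus[of a C] assms(1,4) unfolding a_inv_def by auto
 qed (use assms in \<open>auto simp: PA_add\<close>)
qed (use assms in \<open>auto simp: PA_mult\<close>)

lemma eps_pow:
 "arr (Eps i) [^]\<^bsub>path_algebra C\<^esub> n \<in> PA C"
 "path_mult (arr (Eps i) [^]\<^bsub>path_algebra C\<^esub> n) (Poly_Mapping.single (i, w, j) 1) = Poly_Mapping.single (i, eps n i @ w, j) (1::'k::field)"
 "path_mult (Poly_Mapping.single (j, w, i) 1) (arr (Eps i) [^]\<^bsub>path_algebra C\<^esub> n) = Poly_Mapping.single (j, w @ eps n i, i) (1::'k)"
proof -
 interpret ring "path_algebra C" by(rule ring_PA)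
 show "arr (Eps i) [^]\<^bsub>path_algebra C\<^esub> n \<in> PA C" by(rule nat_pow_closed[OF eps_PA])
 show "path_mult (arr (Eps i) [^]\<^bsub>path_algebra C\<^esub> n) (Poly_Mapping.single (i, w, j) 1) = Poly_Mapping.single (i, eps n i @ w, j) (1::'k)"
 proof (induction n arbitrary: w)
  case (Suc n)
  have "path_mult (arr (Eps i)) (Poly_Mapping.single (i, w, j) 1) = Poly_Mapping.single (i, Eps i # w, j) (1::'k)"
   unfolding arr_def using pm_single[of i "[Eps i]" i w j] by simp
  thus ?case using Suc[of "Eps i # w"] by(simp add: PA_mult pm_assoc replicate_app_Cons_same)
 qed (simp add: PA_one pm_one)
 show "path_mult (Poly_Mapping.single (j, w, i) 1) (arr (Eps i) [^]\<^bsub>path_algebra C\<^esub> n) = Poly_Mapping.single (j, w @ eps n i, i) (1::'k)"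
 proof (induction n arbitrary: w)
  case (Suc n)
  have "path_mult (Poly_Mapping.single (j, w @ eps n i, i) 1) (arr (Eps i)) = Poly_Mapping.single (j, w @ eps (Suc n) i, i) (1::'k)"
   unfolding arr_def using pm_single[of j "w @ eps n i" i "[Eps i]" i] by(simp add: replicate_append_same)
  thus ?case using Suc[of w] by(simp add: PA_mult flip: pm_assoc)
 qed (simp add: PA_one pm_one)
qed

lemma arr_Alpha: "arr (Alpha i j) = Poly_Mapping.single (i, [Alpha i j], j) 1"
 by(simp add: arr_def)

lemma relation1_eq: "relation1 C i j = Poly_Mapping.single (i, eps (mul C i j) i @ [Alpha i j], j) 1 - Poly_Mapping.single (i, Alpha i j # eps (mul C j i) j, j) (1::'k::field)"
 by(simp add: relation1_def Let_def PA_mult arr_Alpha eps_pow mul_def[symmetric])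

lemma relation2_eq: "relation2 C \<omega> i = (\<Sum>j | adj C j i. \<Sum>k<mul C i j.
  scale (\<omega> i j) (Poly_Mapping.single (i, eps k i @ [Alpha i j, Alpha j i] @ eps (mul C i j - 1 - k) i, i) (1::'k::field)))"
proof -
 have "path_mult (Poly_Mapping.single (i, eps k i @ [Alpha i j], j) 1) (Poly_Mapping.single (j, [Alpha j i], i) 1)
  = Poly_Mapping.single (i, eps k i @ [Alpha i j, Alpha j i], i) (1::'k)" for j k
  using pm_single[of i "eps k i @ [Alpha i j]" j "[Alpha j i]" i] by simp
 thus ?thesis by(simp add: relation2_def Let_def PA_mult arr_Alpha eps_pow mul_def[symmetric])
qed

lemma pr_relation1: "pr \<phi> (relation1 C i j) = \<phi> (i, eps (mul C i j) i @ [Alpha i j], j) - \<phi> (i, Alpha i j # eps (mul C j i) j, j)"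
 by(simp add: relation1_eq pr_diff)

lemma pr_relation2: "pr \<phi> (relation2 C \<omega> i) = (\<Sum>j | adj C j i. \<Sum>k<mul C i j.
  \<omega> i j * \<phi> (i, eps k i @ [Alpha i j, Alpha j i] @ eps (mul C i j - 1 - k) i, i))"
 by(simp add: relation2_eq pr_sum pr_scale)

section \<open>The defining ideal and the anti-involution\<close>

locale gpa_algebra =
 fixes C :: "int ^ 'i ^ 'i" and \<omega> :: "'i => 'i => 'k::field"
 assumes adj_sym: "adj C x y ==> adj C y x"
begin

abbreviation A :: "('i qpath \<Rightarrow>\<^sub>0 'k) ring" where "A \<equiv> path_algebra C"
abbreviation I where "I \<equiv> rel_ideal C \<omega>"
abbreviation cl where "cl \<equiv> gpa_class C \<omega>"

lemma relations_PA: "relations C \<omega> \<subseteq> PA C"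
proof -
 have "relation1 C x y \<in> PA C" if "adj C x y" for x y
  unfolding relation1_eq by(intro PA_closed single_PA) (use that in \<open>auto simp: is_walk_append\<close>)
 moreover have "relation2 C \<omega> x \<in> PA C" for x unfolding PA_pr pr_relation2
  by(auto intro!: sum.neutral simp: paths_def is_walk_append adj_sym)
 ultimately show ?thesis by(auto simp: relations_def)
qed

lemma ideal_I: "ideal I A" unfolding rel_ideal_def by(rule ring.genideal_ideal[OF ring_PA relations_PA])

lemma relations_I: "relations C \<omega> \<subseteq> I" unfolding rel_ideal_def by(rule ring.genideal_self[OF ring_PA relations_PA])

lemma I_minimal: "ideal J A ==> relations C \<omega> \<subseteq> J ==> I \<subseteq> J"
 unfolding rel_ideal_def by(rule ring.genideal_minimal[OF ring_PA])

lemma I_closed: "x \<in> I ==> x \<in> PA C" "0 \<in> I" "x \<in> I ==> y \<in> I ==> x + y \<in> I" "x \<in> I ==> - x \<in> I"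
 "x \<in> I ==> y \<in> PA C ==> path_mult y x \<in> I" "x \<in> I ==> y \<in> PA C ==> path_mult x y \<in> I"
proof -
 interpret ideal I A by(rule ideal_I)
 show sub: "x \<in> I ==> x \<in> PA C" for x using a_subset by blast
 show "0 \<in> I" using additive_subgroup.zero_closed[OF ideal.axioms(1)[OF ideal_I]] by(simp add: PA_zero)
 show "x \<in> I ==> y \<in> I ==> x + y \<in> I" using additive_subgroup.a_closed[OF ideal.axioms(1)[OF ideal_I]] by(simp add: PA_add)
 show "x \<in> I ==> - x \<in> I"
  using additive_subgroup.a_inv_closed[OF ideal.axioms(1)[OF ideal_I], of x] PA_uminus[OF sub, of x] by simp
 show "x \<in> I ==> y \<in> PA C ==> path_mult y x \<in> I" "x \<in> I ==> y \<in> PA C ==> path_mult x y \<in> I"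
  using ideal.I_l_closed[OF ideal_I] ideal.I_r_closed[OF ideal_I] by(simp_all add: PA_mult)
qed

lemma cl_eq_iff: "x \<in> PA C ==> y \<in> PA C ==> cl x = cl y \<longleftrightarrow> x - y \<in> I"
 unfolding gpa_class_def using ring.quotient_eq_iff_same_a_r_cos[OF ring_PA ideal_I] PA_minus by metis

lemma cl_hom: "x \<in> PA C ==> y \<in> PA C ==> cl x \<otimes>\<^bsub>gpa C \<omega>\<^esub> cl y = cl (path_mult x y)"
 "x \<in> PA C ==> y \<in> PA C ==> cl x \<oplus>\<^bsub>gpa C \<omega>\<^esub> cl y = cl (x + y)"
 using ring_hom_mult[OF ideal.rcos_ring_hom[OF ideal_I]] ring_hom_add[OF ideal.rcos_ring_hom[OF ideal_I]]
 unfolding gpa_def gpa_class_def PA_mult PA_add by blast+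

lemma carrier_gpa: "carrier (gpa C \<omega>) = cl ` PA C"
 unfolding gpa_def gpa_class_def FactRing_def A_RCOSETS_def' by auto

lemma path_rev_path_rev: "path_rev (path_rev p) = p" for p :: "'i qpath"
proof -
 have "arrow_flip (arrow_flip a) = a" for a :: "'i arrow" by(cases a) auto
 hence "arrow_flip \<circ> arrow_flip = (id :: 'i arrow => _)" by(simp add: fun_eq_iff)
 thus ?thesis by(cases p) (simp add: rev_map)
qed

lemma inj_path_rev: "inj (path_rev :: 'i qpath => _)" by(rule inj_on_inverseI) (rule path_rev_path_rev)

lemma pr_anti: "pr \<phi> (path_anti x) = pr (\<lambda>p. \<phi> (path_rev p)) x" for x :: "'i qpath \<Rightarrow>\<^sub>0 'k"
proof -
 have k: "Poly_Mapping.keys (path_anti x) = path_rev ` Poly_Mapping.keys x"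
  unfolding path_anti_def keys_map_key[OF inj_path_rev]
 proof (intro equalityI subsetI)
  fix p assume "p \<in> path_rev -` Poly_Mapping.keys x"
  thus "p \<in> path_rev ` Poly_Mapping.keys x"
   by(intro image_eqI[of p path_rev "path_rev p"]) (simp_all only: path_rev_path_rev vimage_eq)
 next
  fix p assume "p \<in> path_rev ` Poly_Mapping.keys x"
  then obtain q where "q \<in> Poly_Mapping.keys x" "p = path_rev q" by(rule imageE)
  thus "p \<in> path_rev -` Poly_Mapping.keys x" by(simp only: path_rev_path_rev vimage_eq)
 qed
 show ?thesis unfolding pr_def k sum.reindex[OF inj_on_subset[OF inj_path_rev subset_UNIV]]
  by(simp only: path_anti_def Poly_Mapping.map_key.rep_eq[OF inj_path_rev] path_rev_path_rev o_def)
qed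

lemma anti_anti: "path_anti (path_anti x) = x" for x :: "'i qpath \<Rightarrow>\<^sub>0 'k"
 by(rule pr_ext) (simp add: pr_anti path_rev_path_rev)

lemma anti_add: "path_anti (x + y) = path_anti x + path_anti y" for x :: "'i qpath \<Rightarrow>\<^sub>0 'k"
 by(rule pr_ext) (simp add: pr_anti pr_add)

lemma anti_minus: "path_anti (- x) = - path_anti x" for x :: "'i qpath \<Rightarrow>\<^sub>0 'k"
 by(rule pr_ext) (simp add: pr_anti pr_minus)

lemma anti_zero: "path_anti 0 = (0 :: 'i qpath \<Rightarrow>\<^sub>0 'k)" by(rule pr_ext) (simp add: pr_anti)

lemma anti_mult: "path_anti (path_mult x y) = path_mult (path_anti y) (path_anti x)" for x :: "'i qpath \<Rightarrow>\<^sub>0 'k"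
proof (rule pr_ext)
 fix \<phi> :: "'i qpath => 'k"
 have "cm (\<lambda>p. \<phi> (path_rev p)) a b = cm \<phi> (path_rev b) (path_rev a)" for a b by(cases a; cases b) auto
 hence "pr \<phi> (path_anti (path_mult x y)) = (\<Sum>a\<in>Poly_Mapping.keys x. \<Sum>b\<in>Poly_Mapping.keys y.
   Poly_Mapping.lookup x a * (Poly_Mapping.lookup y b * cm \<phi> (path_rev b) (path_rev a)))"
  unfolding pr_anti pr_mult by(simp add: pr_def sum_distrib_left)
 also have "\<dots> = pr \<phi> (path_mult (path_anti y) (path_anti x))"
  unfolding pr_mult pr_anti by(subst sum.swap) (simp add: pr_def sum_distrib_left mult.left_commute)
 finally show "pr \<phi> (path_anti (path_mult x y)) = \<dots>" .
qed

lemma anti_PA: "x \<in> PA C ==> path_anti x \<in> PA C" for x :: "'i qpath \<Rightarrow>\<^sub>0 'k"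
proof -
 have w: "is_walk C j (map arrow_flip (rev as)) i" if "is_walk C i as j" for i as j
  using that
 proof (induction as arbitrary: i)
  case (Cons a as)
  hence "arrow_flip a \<in> arrows C \<and> arrow_tgt (arrow_flip a) = arrow_src a \<and> arrow_src (arrow_flip a) = i"
   using adj_sym by(cases a) auto
  thus ?case using Cons by(auto simp: is_walk_append)
 qed simp
 have r: "path_rev p \<in> paths C" if "p \<in> paths C" for p using that w by(cases p) (auto simp: paths_def)
 assume x: "x \<in> PA C"
 show "path_anti x \<in> PA C" unfolding PA_pr pr_anti
 proof (intro allI impI)
  fix \<phi> :: "'i qpath => 'k" assume "\<forall>p\<in>paths C. \<phi> p = 0"
  thus "pr (\<lambda>p. \<phi> (path_rev p)) x = 0" using r by(intro x[unfolded PA_pr, rule_format]) blast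
 qed
qed

text \<open>The anti-involution sends \<open>relation1 C x y\<close> to minus
  \<open>relation1 C y x\<close> and, after reversal of the sum over k, fixes
  \<open>relation2\<close>. So the elements with image in the ideal form an ideal containing the
  relations.\<close>

lemma anti_I: "x \<in> I ==> path_anti x \<in> I"
proof -
 have "I \<subseteq> {x \<in> PA C. path_anti x \<in> I}"
 proof (rule I_minimal)
  show "ideal {x \<in> PA C. path_anti x \<in> I} A"
   by(rule PA_ideal) (auto simp: PA_closed I_closed anti_zero anti_add anti_minus anti_mult anti_PA)
  have "path_anti (relation1 C x y) = - (relation1 C y x :: 'i qpath \<Rightarrow>\<^sub>0 'k)" for x y
   by(rule pr_ext) (simp add: pr_anti pr_minus pr_relation1)
  moreover have "path_anti (relation2 C \<omega> x) = relation2 C \<omega> x" for x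
  proof (rule pr_ext)
   fix \<phi> :: "'i qpath => 'k"
   have s: "(\<Sum>k<m. \<phi> (x, eps (m - 1 - k) x @ [Alpha x y, Alpha y x] @ eps k x, x)) = (\<Sum>k<m. \<phi> (x, eps k x @ [Alpha x y, Alpha y x] @ eps (m - 1 - k) x, x))" for y m
    by(subst sum.nat_diff_reindex[symmetric]) (auto intro!: sum.cong)
   have "path_rev (x, eps k x @ [Alpha x y, Alpha y x] @ eps n x, x) = (x, eps n x @ [Alpha x y, Alpha y x] @ eps k x, x)" for y k n
    by simp
   thus "pr \<phi> (path_anti (relation2 C \<omega> x)) = pr \<phi> (relation2 C \<omega> x)"
    unfolding pr_anti pr_relation2 sum_distrib_left[symmetric] by(simp only: s)
  qed
  moreover have "adj C x y ==> - relation1 C y x \<in> I" "relation2 C \<omega> x \<in> I" for x y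
   using relations_I by(auto simp: relations_def intro!: I_closed(4) dest: adj_sym)
  ultimately have "path_anti z \<in> I" if "z \<in> relations C \<omega>" for z
   using that unfolding relations_def by auto
  thus "relations C \<omega> \<subseteq> {x \<in> PA C. path_anti x \<in> I}" using relations_PA by blast
 qed
 thus "x \<in> I ==> path_anti x \<in> I" by blast
qed

lemma cl_set: "cl x = {z + x | z. z \<in> I}"
 unfolding gpa_class_def a_r_coset_def' PA_add by auto

text \<open>Consequently e_i acts on a functional by composition with the action of e_i on the
  module.\<close>

lemma anti_cl_idem: "path_anti ` cl (idem i) = cl (idem i)"
proof -
 have e: "path_anti (idem i) = (idem i :: 'i qpath \<Rightarrow>\<^sub>0 'k)" by(rule pr_ext) (simp add: pr_anti idem_def)
 have "path_anti ` cl (idem i) \<subseteq> cl (idem i)" using anti_I by(auto simp: cl_set anti_add e)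
 thus ?thesis using image_mono[of "path_anti ` cl (idem i)" "cl (idem i)" path_anti] by(auto simp: image_image anti_anti)
qed

end

section \<open>Functionals on the modules\<close>

context gpa_algebra
begin

text \<open>The class of x e_j. The module and its homogeneous components consist of such classes
  (\<open>pbar_eq\<close>, \<open>pbar_comp_eq\<close>), which removes cosets of cosets from the
  arguments.\<close>

definition kap :: "'i => ('i qpath \<Rightarrow>\<^sub>0 'k) => ('i, 'k) pbar_elem" where
 "kap j x = pbar_class C \<omega> j (cl (path_mult x (idem j)))"

abbreviation et where "et t j x \<equiv> path_mult t (arr (Eps j)) + path_mult x (idem j)"

lemma et_PA: "t \<in> PA C ==> x \<in> PA C ==> et t j x \<in> PA C"
 by(intro PA_closed eps_PA idem_PA)

lemma pbar_class_cl: "X \<in> PA C ==> pbar_class C \<omega> j (cl X) = {cl (path_mult t (arr (Eps j)) + X) | t. t \<in> PA C}"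
proof -
 assume X: "X \<in> PA C"
 have "eps_left_ideal C \<omega> j = {cl (path_mult t (arr (Eps j))) | t. t \<in> PA C}"
  unfolding eps_left_ideal_def carrier_gpa using cl_hom(1)[OF _ eps_PA] by auto
 hence "pbar_class C \<omega> j (cl X) = {cl (path_mult t (arr (Eps j))) \<oplus>\<^bsub>gpa C \<omega>\<^esub> cl X | t. t \<in> PA C}"
  unfolding pbar_class_def a_r_coset_def' by auto
 also have "\<dots> = {cl (path_mult t (arr (Eps j)) + X) | t. t \<in> PA C}"
  using cl_hom(2)[OF PA_closed(6)[OF _ eps_PA] X] by(intro Collect_cong) metis
 finally show ?thesis .
qed

lemma kap_set: "x \<in> PA C ==> kap j x = {cl (et t j x) | t. t \<in> PA C}"
 unfolding kap_def by(rule pbar_class_cl) (intro PA_closed idem_PA)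

lemma kap_eqD: "x \<in> PA C ==> y \<in> PA C ==> kap j x = kap j y ==> \<exists>t\<in>PA C. path_mult x (idem j) - et t j y \<in> I"
proof -
 assume xy: "x \<in> PA C" "y \<in> PA C" "kap j x = kap j y"
 have "cl (et 0 j x) \<in> kap j y" unfolding xy(3)[symmetric] kap_set[OF xy(1)] using PA_closed(4) by blast
 then obtain t where t: "t \<in> PA C" "cl (et 0 j x) = cl (et t j y)" unfolding kap_set[OF xy(2)] by blast
 hence "et 0 j x - et t j y \<in> I" using cl_eq_iff et_PA PA_closed(4) xy by metis
 thus ?thesis using t(1) by(auto simp: pm_zero)
qed

lemma kap_zero: "x \<in> PA C ==> t \<in> PA C ==> path_mult x (idem j) - path_mult t (arr (Eps j)) \<in> I ==> kap j x = kap j 0"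
proof -
 assume x: "x \<in> PA C" "t \<in> PA C" "path_mult x (idem j) - path_mult t (arr (Eps j)) \<in> I"
 have e: "cl (et s j x) = cl (et (s + t) j 0)" if "s \<in> PA C" for s
  using x that by(subst cl_eq_iff) (auto simp: PA_closed eps_PA idem_PA pm_distrib pm_zero)
 show ?thesis unfolding kap_set[OF x(1)] kap_set[OF PA_closed(4)]
 proof (intro equalityI subsetI)
  fix Y assume "Y \<in> {cl (et s j x) |s. s \<in> PA C}"
  thus "Y \<in> {cl (et s j 0) |s. s \<in> PA C}" using e PA_closed(1) x(2) by blast
 next
  fix Y assume "Y \<in> {cl (et s j 0) |s. s \<in> PA C}"
  then obtain s where s: "s \<in> PA C" "Y = cl (et s j 0)" by blast
  hence "Y = cl (et (s - t) j x)" using e[OF PA_closed(2)[OF s(1) x(2)]] by simp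
  thus "Y \<in> {cl (et s j x) |s. s \<in> PA C}" using PA_closed(2)[OF s(1) x(2)] by blast
 qed
qed

lemma pbar_eq: "pbar C \<omega> j = kap j ` PA C"
 unfolding pbar_def carrier_gpa Setcompr_eq_image image_image kap_def
 by(intro image_cong refl) (simp add: cl_hom idem_PA)

lemma path_comp_PA: "x \<in> path_comp C n ==> x \<in> PA C" by(simp add: path_comp_def)

lemma pbar_comp_eq: "pbar_comp C \<omega> j n = kap j ` path_comp C n"
 unfolding pbar_comp_def Setcompr_eq_image kap_def
 by(intro image_cong refl) (simp add: cl_hom idem_PA path_comp_PA)

lemma kap_add: "x \<in> PA C ==> y \<in> PA C ==> kap j x <+>\<^bsub>gpa C \<omega>\<^esub> kap j y = kap j (x + y)"
proof -
 assume xy: "x \<in> PA C" "y \<in> PA C"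
 have e: "cl (et s j x) \<oplus>\<^bsub>gpa C \<omega>\<^esub> cl (et t j y) = cl (et (s + t) j (x + y))" if "s \<in> PA C" "t \<in> PA C" for s t
  using that xy by(subst cl_hom(2)) (auto simp: PA_closed eps_PA idem_PA pm_distrib add_ac)
 have "kap j x <+>\<^bsub>gpa C \<omega>\<^esub> kap j y = {cl (et s j x) \<oplus>\<^bsub>gpa C \<omega>\<^esub> cl (et t j y) | s t. s \<in> PA C \<and> t \<in> PA C}"
  unfolding kap_set[OF xy(1)] kap_set[OF xy(2)] set_add_def set_mult_def by auto
 also have "\<dots> = {cl (et (s + t) j (x + y)) | s t. s \<in> PA C \<and> t \<in> PA C}" using e by(intro Collect_cong) metis
 also have "\<dots> = {cl (et t j (x + y)) | t. t \<in> PA C}"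
 proof (intro equalityI subsetI)
  fix Y assume "Y \<in> {cl (et t j (x + y)) | t. t \<in> PA C}"
  then obtain t where "t \<in> PA C" "Y = cl (et (t + 0) j (x + y))" by auto
  thus "Y \<in> {cl (et (s + t) j (x + y)) | s t. s \<in> PA C \<and> t \<in> PA C}" using PA_closed(4) by blast
 qed (use PA_closed(1) in blast)
 finally show ?thesis using kap_set[OF PA_closed(1)[OF xy]] by simp
qed

lemma kap_act: "a \<in> PA C ==> x \<in> PA C ==> pbar_act C \<omega> j (cl a) (kap j x) = kap j (path_mult a x)"
proof -
 assume ax: "a \<in> PA C" "x \<in> PA C"
 have "pbar_class C \<omega> j (cl a \<otimes>\<^bsub>gpa C \<omega>\<^esub> cl (et s j x)) = kap j (path_mult a x)" if s: "s \<in> PA C" for s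
 proof -
  have as: "path_mult a s \<in> PA C" by(rule PA_closed(6)[OF ax(1) s])
  have "cl a \<otimes>\<^bsub>gpa C \<omega>\<^esub> cl (et s j x) = cl (et (path_mult a s) j (path_mult a x))"
   using ax s by(subst cl_hom(1)) (auto simp: PA_closed eps_PA idem_PA pm_distrib pm_assoc)
  hence "pbar_class C \<omega> j (cl a \<otimes>\<^bsub>gpa C \<omega>\<^esub> cl (et s j x)) =
    {cl (et (t + path_mult a s) j (path_mult a x)) | t. t \<in> PA C}"
   using pbar_class_cl[OF et_PA[OF as PA_closed(6)[OF ax]], of j] by(simp add: pm_distrib add.assoc)
  also have "\<dots> = {cl (et t j (path_mult a x)) | t. t \<in> PA C}"
  proof (intro equalityI subsetI)
   fix Y assume "Y \<in> {cl (et t j (path_mult a x)) | t. t \<in> PA C}"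
   then obtain t where t: "t \<in> PA C" "Y = cl (et ((t - path_mult a s) + path_mult a s) j (path_mult a x))" by auto
   thus "Y \<in> {cl (et (t + path_mult a s) j (path_mult a x)) | t. t \<in> PA C}" using PA_closed(2)[OF t(1) as] by blast
  qed (use PA_closed(1) as in blast)
  finally show ?thesis using kap_set[OF PA_closed(6)[OF ax]] by simp
 qed
 thus ?thesis unfolding pbar_act_def kap_set[OF ax(2)] using PA_closed(4)[of C] by(intro SUP_eq_const) blast+
qed

lemma one_PA: "(\<Sum>i\<in>UNIV. idem i) \<in> PA C"
 using monoid.one_closed[OF ring.is_monoid[OF ring_PA[of C]]] by(simp add: PA_one)

lemma kap_scale: "x \<in> PA C ==> pbar_scale C \<omega> j c (kap j x) = kap j (scale c x)"
 unfolding pbar_scale_def PA_one by(simp add: kap_act PA_closed one_PA pm_scale pm_one)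

lemma ibar_kap:
 assumes f: "f \<in> ibar C \<omega> j"
 shows "x \<in> PA C ==> y \<in> PA C ==> f (kap j (x + y)) = f (kap j x) + f (kap j y)"
  "x \<in> PA C ==> f (kap j (scale c x)) = c * f (kap j x)" "f (kap j 0) = 0"
  "x \<in> PA C ==> f (kap j x) = pr (\<lambda>p. f (kap j (Poly_Mapping.single p 1))) x"
proof -
 show add: "x \<in> PA C ==> y \<in> PA C ==> f (kap j (x + y)) = f (kap j x) + f (kap j y)" for x y
  using f by(auto simp: ibar_def pbar_eq kap_add)
 show sc: "x \<in> PA C ==> f (kap j (scale c x)) = c * f (kap j x)" for x c
  using f by(auto simp: ibar_def pbar_eq kap_scale)
 show z: "f (kap j 0) = 0" using add[OF PA_closed(4) PA_closed(4)] by(simp only: add_0_left add_cancel_right_right)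
 assume x: "x \<in> PA C"
 let ?s = "\<lambda>p. Poly_Mapping.single p (1::'k)" and ?l = "Poly_Mapping.lookup x"
 have sP: "?s p \<in> PA C" if "p \<in> paths C" for p using that by(simp add: PA_iff)
 have H: "(\<Sum>p\<in>S. scale (?l p) (?s p)) \<in> PA C \<and> f (kap j (\<Sum>p\<in>S. scale (?l p) (?s p))) = (\<Sum>p\<in>S. ?l p * f (kap j (?s p)))"
  if "finite S" "S \<subseteq> paths C" for S
  using that by(induction S) (auto simp: z add sc sP PA_closed)
 have E: "x = (\<Sum>p\<in>Poly_Mapping.keys x. scale (?l p) (?s p))"
  by(rule pr_ext) (simp add: pr_sum pr_scale pr_def[of _ x])
 show "f (kap j x) = pr (\<lambda>p. f (kap j (?s p))) x"
  using H[OF finite_keys x[unfolded PA_iff], THEN conjunct2] unfolding pr_def E[symmetric] .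
qed

text \<open>The functional sending x to \<open>\<phi>\<close> of u x w, on paths from
  \<open>t\<close> to \<open>s\<close>. The front \<open>u\<close> and the back \<open>w\<close>
  make this class of functionals stable under multiplication from both sides
  (\<open>tw_left\<close>, \<open>tw_right\<close>).\<close>

definition tw :: "('i arrow list => 'k) => 'i arrow list => 'i arrow list => 'i => 'i => 'i qpath => 'k" where
 "tw \<phi> u w s t p = (if fst p = s \<and> snd (snd p) = t then \<phi> (u @ fst (snd p) @ w) else 0)"

abbreviation ex where "ex \<phi> \<equiv> tw \<phi> [] []"

lemma pr_swap: "pr (\<lambda>a. pr (\<psi> a) y) x = pr (\<lambda>b. pr (\<lambda>a. \<psi> a b) x) y"
 unfolding pr_def sum_distrib_left by(subst sum.swap) (simp add: mult.left_commute)

lemma tw_left: "cm (tw \<phi> u w s t) (a, q, k) = (if a = s then tw \<phi> (u @ q) w k t else (\<lambda>_. 0))"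
proof
 fix b show "cm (tw \<phi> u w s t) (a, q, k) b = (if a = s then tw \<phi> (u @ q) w k t else (\<lambda>_. 0)) b"
  by(cases b) (auto simp: tw_def)
qed

lemma tw_right: "(\<lambda>b. cm (tw \<phi> u w s t) b (k, q, l)) = (if l = t then tw \<phi> u (q @ w) s k else (\<lambda>_. 0))"
proof
 fix b show "cm (tw \<phi> u w s t) b (k, q, l) = (if l = t then tw \<phi> u (q @ w) s k else (\<lambda>_. 0)) b"
  by(cases b) (auto simp: tw_def)
qed

lemma tw_relation1: "pr (tw \<phi> u w s t) (relation1 C x y) = (if x = s \<and> y = t then
  \<phi> (u @ eps (mul C x y) x @ Alpha x y # w) - \<phi> (u @ Alpha x y # eps (mul C y x) y @ w) else 0)"
 by(simp add: pr_relation1 tw_def)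

lemma tw_relation2: "pr (tw \<phi> u w s t) (relation2 C \<omega> x) = (if x = s \<and> x = t then (\<Sum>y | adj C y x. \<Sum>k<mul C x y.
  \<omega> x y * \<phi> (u @ eps k x @ Alpha x y # Alpha y x # eps (mul C x y - 1 - k) x @ w)) else 0)"
 unfolding pr_relation2 by(cases "x = s \<and> x = t") (auto simp: tw_def intro!: sum.neutral)

text \<open>The elements killed by all translates of \<open>\<phi>\<close> form a two-sided ideal,
  and the conditions in \<open>fspace\<close> say that it contains the relations.\<close>

lemma pr_I: "\<phi> \<in> fspace C \<omega> i j n ==> z \<in> I ==> pr (tw \<phi> u w s t) z = 0"
proof -
 assume \<phi>: "\<phi> \<in> fspace C \<omega> i j n" and z: "z \<in> I"
 let ?J = "{x \<in> PA C. \<forall>u w s t. pr (tw \<phi> u w s t) x = 0}"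
 have "I \<subseteq> ?J"
 proof (rule I_minimal)
  show "ideal ?J A"
  proof (rule PA_ideal)
   fix x y :: "'i qpath \<Rightarrow>\<^sub>0 'k"
   assume x: "x \<in> ?J" and y: "y \<in> PA C"
   have "pr (cm (tw \<phi> u w s t) a) x = 0" for a u w s t using x by(cases a) (auto simp: tw_left pr_fun)
   hence "pr (tw \<phi> u w s t) (path_mult y x) = 0" for u w s t by(simp add: pr_mult pr_fun)
   thus "path_mult y x \<in> ?J" using x y PA_closed(6) by blast
   have "pr (\<lambda>b. cm (tw \<phi> u w s t) b a) x = 0" for a u w s t using x by(cases a) (auto simp: tw_right pr_fun)
   hence "pr (tw \<phi> u w s t) (path_mult x y) = 0" for u w s t unfolding pr_mult by(subst pr_swap) (simp add: pr_fun)
   thus "path_mult x y \<in> ?J" using x y PA_closed(6) by blast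
  qed (auto simp: PA_closed pr_add pr_minus)
  have "pr (tw \<phi> u w s t) x = 0" if "x \<in> relations C \<omega>" for x u w s t
   using that fspace_rel1[OF \<phi>] fspace_rel2[OF \<phi>] by(auto simp: relations_def tw_relation1 tw_relation2)
  thus "relations C \<omega> \<subseteq> ?J" using relations_PA by blast
 qed
 thus ?thesis using z by blast
qed

text \<open>Functions on words seen as functionals on the module. By \<open>Tm_kap\<close> the
  choice of a representative is immaterial; this rests on the relations and on the vanishing at
  words ending in the loop.\<close>

definition Tm :: "'i => 'i => ('i arrow list => 'k) => ('i, 'k) pbar_elem => 'k" where
 "Tm i j \<phi> X = (if X \<in> pbar C \<omega> j then pr (ex \<phi> i j) (SOME x. x \<in> PA C \<and> kap j x = X) else 0)"

lemma pr_ex_idem: "pr (ex \<phi> i j) (path_mult x (idem j)) = pr (ex \<phi> i j) x" "pr (ex \<phi> i j) (path_mult (idem i) x) = pr (ex \<phi> i j) x"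
 by(auto simp: idem_right idem_left tw_def intro!: pr_cong)

lemma Tm_kap:
 assumes \<phi>: "\<phi> \<in> fspace C \<omega> i j n" and x: "x \<in> PA C"
 shows "Tm i j \<phi> (kap j x) = pr (ex \<phi> i j) x"
proof -
 define y where "y = (SOME y. y \<in> PA C \<and> kap j y = kap j x)"
 have y: "y \<in> PA C" "kap j y = kap j x" using someI[of "\<lambda>y. y \<in> PA C \<and> kap j y = kap j x" x] x by(auto simp: y_def)
 obtain t where t: "t \<in> PA C" "path_mult y (idem j) - et t j x \<in> I" using kap_eqD[OF y(1) x y(2)] by blast
 have "cm (ex \<phi> i j) a (j, [Eps j], j) = 0" for a
  using fspace_eps_end[OF \<phi>] by(cases a) (simp add: tw_def)
 hence "pr (ex \<phi> i j) (path_mult t (arr (Eps j))) = 0" by(simp add: pr_mult arr_def pr_fun)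
 hence "pr (ex \<phi> i j) y = pr (ex \<phi> i j) x"
  using pr_I[OF \<phi> t(2), of "[]" "[]" i j] by(simp add: pr_diff pr_add pr_ex_idem)
 thus ?thesis using x by(simp add: Tm_def y_def pbar_eq)
qed

text \<open>The degree changes sign because component \<open>n\<close> of the dual consists of
  functionals on component \<open>-n\<close>. Conversely, the function on words is read off from the
  paths from \<open>j\<close> to \<open>i\<close>; on other paths the functional vanishes, by e_i on
  one side and by x e_j on the other.\<close>

lemma Tm_image: "Tm i j ` fspace C \<omega> i j (- n) = idem_ibar_comp C \<omega> i j n"
proof (intro equalityI subsetI)
 fix f assume "f \<in> Tm i j ` fspace C \<omega> i j (- n)"
 then obtain \<phi> where \<phi>: "\<phi> \<in> fspace C \<omega> i j (- n)" "f = Tm i j \<phi>" by blast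
 note T = Tm_kap[OF \<phi>(1), folded \<phi>(2)]
 have ib: "f \<in> ibar C \<omega> j" unfolding ibar_def
  by(auto simp: pbar_eq kap_add kap_scale T PA_closed pr_add pr_scale) (simp add: \<phi>(2) Tm_def pbar_eq)
 have "f X = 0" if mn: "m \<noteq> - n" and X: "X \<in> pbar_comp C \<omega> j m" for m X
 proof -
  obtain x where x: "x \<in> path_comp C m" "X = kap j x" using X unfolding pbar_comp_eq by blast
  have "ex \<phi> i j p = 0" if "p \<in> Poly_Mapping.keys x" for p
  proof -
   have "path_deg C p = m" using x(1) that by(simp add: path_comp_def)
   thus ?thesis using fspace_support[OF \<phi>(1), of "fst (snd p)"] mn
    by(cases p) (auto simp: tw_def wdeg_def)
  qed
  thus ?thesis using T[OF path_comp_PA[OF x(1)]] x(2) by(simp add: pr_def)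
 qed
 hence ic: "f \<in> ibar_comp C \<omega> j n" using ib unfolding ibar_comp_def by blast
 have "f X = ibar_act C \<omega> j (cl (idem i)) f X" for X
 proof (cases "X \<in> pbar C \<omega> j")
  case True
  then obtain x where x: "x \<in> PA C" "X = kap j x" unfolding pbar_eq by blast
  thus ?thesis using True T PA_closed(6)[OF idem_PA x(1)]
   by(simp add: ibar_act_def anti_cl_idem kap_act idem_PA pr_ex_idem)
 next
  case False then show ?thesis using ib by(simp add: ibar_act_def ibar_def)
 qed
 hence "f = ibar_act C \<omega> j (cl (idem i)) f" by blast
 thus "f \<in> idem_ibar_comp C \<omega> i j n" unfolding idem_ibar_comp_def using ib ic by blast
next
 fix f assume f: "f \<in> idem_ibar_comp C \<omega> i j n"
 then obtain g where g: "g \<in> ibar C \<omega> j" "f = ibar_act C \<omega> j (cl (idem i)) g" unfolding idem_ibar_comp_def by blast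
 have ib: "f \<in> ibar C \<omega> j" and deg: "\<And>m x. m \<noteq> - n ==> x \<in> path_comp C m ==> f (kap j x) = 0"
  using f unfolding idem_ibar_comp_def ibar_comp_def pbar_comp_eq by auto
 note fk = ibar_kap[OF ib]
 let ?s = "\<lambda>a w b. Poly_Mapping.single (a, w, b) (1::'k)"
 have fg: "f (kap j x) = g (kap j (path_mult (idem i) x))" if "x \<in> PA C" for x
  using that by(simp add: g(2) ibar_act_def pbar_eq anti_cl_idem kap_act idem_PA)
 have left: "f (kap j (?s a w b)) = 0" if "a \<noteq> i" "is_walk C a w b" for a w b
 proof -
  have "path_mult (idem i) (?s a w b) = 0" by(rule pr_ext) (use that in \<open>simp add: idem_left\<close>)
  thus ?thesis using fg[OF single_PA[OF that(2)]] ibar_kap(3)[OF g(1)] by simp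
 qed
 have right: "f (kap j (?s a w b)) = 0" if "b \<noteq> j" "is_walk C a w b" for a w b
 proof -
  have "path_mult (?s a w b) (idem j) = 0" by(rule pr_ext) (use that in \<open>simp add: idem_right\<close>)
  thus ?thesis using kap_zero[OF single_PA[OF that(2)] PA_closed(4)] I_closed(2) fk(3) by(simp add: pm_zero)
 qed
 define \<phi> where "\<phi> w = (if is_walk C i w j then f (kap j (?s i w j)) else 0)" for w
 have val: "f (kap j x) = pr (ex \<phi> i j) x" if x: "x \<in> PA C" for x
  unfolding fk(4)[OF x]
 proof (rule pr_cong)
  fix p assume "p \<in> Poly_Mapping.keys x"
  hence "p \<in> paths C" using x unfolding PA_iff by blast
  thus "f (kap j (Poly_Mapping.single p 1)) = ex \<phi> i j p"
   using left right by(cases p) (auto simp: tw_def \<phi>_def paths_def)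
 qed
 have zI: "pr (ex \<phi> i j) z = 0" if z: "z \<in> I" for z
 proof -
  have "path_mult z (idem j) - path_mult 0 (arr (Eps j)) \<in> I" using I_closed(6)[OF z idem_PA] by(simp add: pm_zero)
  thus ?thesis using kap_zero[OF I_closed(1)[OF z] PA_closed(4)] val[OF I_closed(1)[OF z]] fk(3) by simp
 qed
 \<comment> \<open>A relation multiplied by the paths \<open>u\<close> and \<open>w\<close> stays in
   the ideal, which yields the conditions of \<open>fspace\<close> with arbitrary words on both
   sides.\<close>
 have twz: "pr (tw \<phi> u w s t) z = 0" if z: "z \<in> relations C \<omega>" and True: "is_walk C i u s \<and> is_walk C t w j" for u w s t z
 proof -
  have "path_mult (?s i u s) (path_mult z (?s t w j)) \<in> I"
   using True z relations_I by(intro I_closed single_PA) auto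
  hence 0: "pr (ex \<phi> i j) (path_mult (?s i u s) (path_mult z (?s t w j))) = 0" by(rule zI)
  show ?thesis using 0 tw_right[of \<phi> u "[]" s j t w j] by(simp add: pr_mult tw_left)
 qed
 have "\<phi> \<in> fspace C \<omega> i j (- n)" unfolding fspace_def
 proof (intro CollectI conjI allI)
  fix u w x
  show "adj C x y \<longrightarrow> \<phi> (u @ eps (mul C x y) x @ Alpha x y # w) = \<phi> (u @ Alpha x y # eps (mul C y x) y @ w)" for y
  proof (cases "adj C x y \<and> is_walk C i u x \<and> is_walk C y w j")
   case True
   hence "relation1 C x y \<in> relations C \<omega>" by(auto simp: relations_def)
   from twz[OF this, of u x y w] True show ?thesis by(simp add: tw_relation1)
  qed (auto simp: \<phi>_def is_walk_append)
  show "(\<Sum>y | adj C y x. \<Sum>k<mul C x y. \<omega> x y * \<phi> (u @ eps k x @ Alpha x y # Alpha y x # eps (mul C x y - 1 - k) x @ w)) = 0"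
  proof (cases "is_walk C i u x \<and> is_walk C x w j")
   case True
   have "relation2 C \<omega> x \<in> relations C \<omega>" by(auto simp: relations_def)
   from twz[OF this, of u x x w] True show ?thesis by(simp add: tw_relation2)
  qed (auto simp: \<phi>_def is_walk_append intro!: sum.neutral)
 next
  fix w
  show "\<phi> w \<noteq> 0 \<longrightarrow> is_walk C i w j \<and> wdeg C w = - n"
  proof
   assume w: "\<phi> w \<noteq> 0"
   hence wk: "is_walk C i w j" by(simp add: \<phi>_def split: if_splits)
   have "?s i w j \<in> path_comp C (wdeg C w)" using single_PA[OF wk] by(simp add: path_comp_def wdeg_def)
   thus "is_walk C i w j \<and> wdeg C w = - n" using deg[of "wdeg C w" "?s i w j"] w wk by(auto simp: \<phi>_def)
  qed
  show "\<phi> (w @ [Eps j]) = 0"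
  proof (cases "is_walk C i w j")
   case True
   have "path_mult (?s i w j) (arr (Eps j)) = ?s i (w @ [Eps j]) j" unfolding arr_def by(simp add: pm_single)
   moreover have "path_mult (?s i (w @ [Eps j]) j) (idem j) = ?s i (w @ [Eps j]) j" unfolding idem_def using pm_single[of i "w @ [Eps j]" j "[]" j] by simp
   moreover have wk: "is_walk C i (w @ [Eps j]) j" using True by(auto simp: is_walk_append)
   ultimately have "kap j (?s i (w @ [Eps j]) j) = kap j 0"
    using I_closed(2) by(intro kap_zero[OF single_PA[OF wk] single_PA[OF True, where c = 1]]) simp
   thus ?thesis using fk(3) by(simp add: \<phi>_def)
  qed (auto simp: \<phi>_def is_walk_append)
 qed
 moreover have "f = Tm i j \<phi>"
 proof
  fix X show "f X = Tm i j \<phi> X"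
  proof (cases "X \<in> pbar C \<omega> j")
   case True
   thus ?thesis using val Tm_kap[OF calculation] unfolding pbar_eq by auto
  qed (use ib in \<open>simp add: ibar_def Tm_def\<close>)
 qed
 ultimately show "f \<in> Tm i j ` fspace C \<omega> i j (- n)" by blast
qed

theorem fun_dim_idem_ibar_comp:
 assumes d: "\<And>x. sym_d C x > 0"
 shows "fun_dim (idem_ibar_comp C \<omega> i j n) = fun_dim (fspace C \<omega> i j (- n))"
proof -
 have fin: "fin_space (fspace C \<omega> i j (- n))"
  by(rule fin_space_support[OF subspace_fspace finite_walks[OF d, of i j "- n"]]) (use fspace_support in blast)
 have e: "ex (\<lambda>w. \<phi> w + \<psi> w) i j = (\<lambda>p. ex \<phi> i j p + ex \<psi> i j p)" "ex (\<lambda>w. c * \<phi> w) i j = (\<lambda>p. c * ex \<phi> i j p)" for \<phi> \<psi> c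
  by(auto simp: tw_def)
 have lin: "flinear (Tm i j)" unfolding flinear_def plus_fun_def
  by(simp add: fun_eq_iff Tm_def e pr_fun)
 have "\<phi> = 0" if "\<phi> \<in> fspace C \<omega> i j (- n)" "Tm i j \<phi> = 0" for \<phi>
 proof
  fix w show "\<phi> w = 0 w"
  proof (cases "is_walk C i w j")
   case True
   have "Tm i j \<phi> (kap j (Poly_Mapping.single (i, w, j) 1)) = 0" by(simp add: that(2))
   thus ?thesis unfolding Tm_kap[OF that(1) single_PA[OF True]] by(simp add: tw_def)
  qed (use fspace_support[OF that(1), of w] in auto)
 qed
 from fun_dim_bij_eq[OF fin lin Tm_image this] show ?thesis by simp
qed

end

section \<open>The generating functions\<close>

text \<open>The exponents are negated because \<open>N\<close> counts by the degrees of words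
  whereas \<open>dim_qt\<close> counts in the dual module.\<close>

definition qtm :: "int \<times> int => qt_series" where
 "qtm n = qv powi (- fst n) * tv powi (- snd n)"

definition gen :: "(int \<times> int => nat) => qt_series" where
 "gen g = (\<Sum>n\<in>{n. g n \<noteq> 0}. of_nat (g n) * qtm n)"

lemma qv_nonzero: "qv \<noteq> 0" by(simp add: qv_def)

lemma tv_nonzero: "tv \<noteq> 0"
proof -
 have "(fls_X_inv :: rat fls) \<noteq> 0" using fls_X_inv_subdegree[where 'a = rat] by force
 thus ?thesis by(simp add: tv_def)
qed

lemma qtm_add: "qtm (m + n) = qtm m * qtm n"
 using power_int_add[of qv "- fst m" "- fst n"] power_int_add[of tv "- snd m" "- snd n"] qv_nonzero tv_nonzero
 by(simp add: qtm_def algebra_simps)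

lemma gen_superset: "finite S ==> {n. g n \<noteq> 0} \<subseteq> S ==> gen g = (\<Sum>n\<in>S. of_nat (g n) * qtm n)"
 unfolding gen_def by(rule sum.mono_neutral_left) auto

lemma gen_zero: "gen (\<lambda>n. 0) = 0" by(simp add: gen_def)

lemma gen_add: "finite {n. g n \<noteq> 0} ==> finite {n. h n \<noteq> 0} ==> gen (\<lambda>n. g n + h n) = gen g + gen h"
 using gen_superset[of "{n. g n \<noteq> 0} \<union> {n. h n \<noteq> 0}" "\<lambda>n. g n + h n"]
  gen_superset[of "{n. g n \<noteq> 0} \<union> {n. h n \<noteq> 0}" g] gen_superset[of "{n. g n \<noteq> 0} \<union> {n. h n \<noteq> 0}" h]
 by(auto simp: distrib_right sum.distrib)

lemma gen_sum: "finite S ==> (\<And>s. s \<in> S ==> finite {n. g s n \<noteq> 0}) ==>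
  finite {n. (\<Sum>s\<in>S. g s n) \<noteq> 0} \<and> gen (\<lambda>n. \<Sum>s\<in>S. g s n) = (\<Sum>s\<in>S. gen (g s))"
proof (induction S rule: finite_induct)
 case (insert s S)
 have "{n. g s n + (\<Sum>s\<in>S. g s n) \<noteq> 0} \<subseteq> {n. g s n \<noteq> 0} \<union> {n. (\<Sum>s\<in>S. g s n) \<noteq> 0}" by auto
 hence "finite {n. g s n + (\<Sum>s\<in>S. g s n) \<noteq> 0}" using insert by(meson finite_UnI finite_subset insertI1 insertI2)
 moreover have "gen (\<lambda>n. g s n + (\<Sum>s\<in>S. g s n)) = gen (g s) + (\<Sum>s\<in>S. gen (g s))"
  using insert by(subst gen_add) auto
 ultimately show ?case using insert.hyps by simp
qed (simp add: gen_zero)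

lemma gen_shift: "finite {n. g n \<noteq> 0} ==> finite {n. g (n - s) \<noteq> 0} \<and> gen (\<lambda>n. g (n - s)) = qtm s * gen g"
proof -
 assume f: "finite {n. g n \<noteq> 0}"
 have i: "{n. g (n - s) \<noteq> 0} = (\<lambda>n. n + s) ` {n. g n \<noteq> 0}"
  by(auto intro!: image_eqI[of _ _ "_ - s"])
 have "gen (\<lambda>n. g (n - s)) = (\<Sum>n\<in>{n. g n \<noteq> 0}. of_nat (g n) * qtm (n + s))"
  unfolding gen_def i by(subst sum.reindex) (auto simp: inj_on_def)
 also have "\<dots> = qtm s * gen g" by(simp add: gen_def qtm_add sum_distrib_left mult_ac)
 finally show ?thesis using f i by simp
qed

lemma gen_delta: "gen (\<lambda>n. if P \<and> n = m then 1 else 0) = (if P then qtm m else 0)"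
 using gen_superset[of "{m}" "\<lambda>n. if P \<and> n = m then 1 else 0"] by auto

lemma q_ne: "qv - inverse qv \<noteq> 0"
proof
 assume "qv - inverse qv = 0"
 hence "qv * qv = 1" using qv_nonzero by(metis eq_iff_diff_eq_0 right_inverse)
 hence "fls_subdegree (qv * qv) = 0" by simp
 thus False using qv_nonzero by(simp add: qv_def)
qed

lemma q_int_sum: "q_int (- int f) = - (\<Sum>k<f. qv powi (int f - 1 - 2 * int k))"
proof -
 have "(qv - inverse qv) * (\<Sum>k<f. qv powi (int f - 1 - 2 * int k)) = qv powi int f - qv powi (- int f)"
 proof (induction f)
  case (Suc f)
  have st: "qv powi (int (Suc f) - 1 - 2 * int k) = qv * qv powi (int f - 1 - 2 * int k)" for k
   using power_int_add[of qv 1 "int f - 1 - 2 * int k"] qv_nonzero by(simp add: algebra_simps)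
  have l: "int (Suc f) - 1 - 2 * int f = - int f" by simp
  have "(\<Sum>k<Suc f. qv powi (int (Suc f) - 1 - 2 * int k)) = qv * (\<Sum>k<f. qv powi (int f - 1 - 2 * int k)) + qv powi (- int f)"
   unfolding sum.lessThan_Suc l unfolding st sum_distrib_left ..
  hence "(qv - inverse qv) * (\<Sum>k<Suc f. qv powi (int (Suc f) - 1 - 2 * int k))
    = qv * (qv powi int f - qv powi (- int f)) + (qv - inverse qv) * qv powi (- int f)"
   unfolding Suc[symmetric] by(simp only: distrib_left mult_ac)
  also have "\<dots> = qv powi int (Suc f) - qv powi (- int (Suc f))"
  proof -
   have "qv powi int (Suc f) = qv * qv powi int f" "qv powi (- int (Suc f)) = inverse qv * qv powi (- int f)"
    using power_int_add[of qv 1 "int f"] power_int_add[of qv "-1" "- int f"] qv_nonzero by(simp_all add: algebra_simps)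
   thus ?thesis by(simp add: left_diff_distrib right_diff_distrib)
  qed
  finally show ?case .
 qed simp
 hence "(\<Sum>k<f. qv powi (int f - 1 - 2 * int k)) = (qv powi int f - qv powi (- int f)) / (qv - inverse qv)"
  using q_ne by(simp add: eq_divide_eq mult.commute)
 thus ?thesis by(simp add: q_int_def minus_divide_left)
qed

lemma dim_qt_gen:
 assumes "\<And>n. fun_dim (V n) = g (- n)"
 shows "dim_qt V = gen g"
proof -
 have "dim_qt V = (\<Sum>n\<in>{n. g (- n) \<noteq> 0}. of_nat (g (- n)) * qtm (- n))"
  unfolding dim_qt_def assms by(intro sum.cong refl) (auto simp: qtm_def mult.assoc)
 also have "\<dots> = gen g" unfolding gen_def
  by(rule sum.reindex_bij_witness[of _ uminus uminus]) auto
 finally show ?thesis .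
qed

lemma matrix_inv_eqI:
 fixes A T :: "'a::field ^ 'n ^ 'n"
 assumes "A ** T = mat 1"
 shows "matrix_inv A = T"
proof -
 have T: "T ** A = mat 1" using assms matrix_left_right_inverse by blast
 show ?thesis unfolding matrix_inv_def
 proof (rule some_equality)
  fix A' assume "A ** A' = mat 1 \<and> A' ** A = mat 1"
  thus "A' = T" using T by(metis matrix_mul_assoc matrix_mul_lid matrix_mul_rid)
 qed (use assms T in simp)
qed

section \<open>Identification of the Coxeter number and the dual Coxeter number\<close>

context mesh
begin

definition rv :: "int ^ 'i => real ^ 'i" where "rv y = (\<chi> i. real_of_int (y $ i))"

lemma rv_inj: "rv y = rv z \<longleftrightarrow> y = z" by(simp add: rv_def vec_eq_iff)

lemma cx_rv: "cx 1 xs (rv y) = rv (wa xs y)"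
proof (induction xs)
 case (Cons i xs)
 have "sx 1 i (rv y) $ k = rv (sr i y) $ k" for y k
 proof (cases "k = i")
  case True
  have "(\<Sum>j | adj C i j. b 1 i j * rv y $ j) = real_of_int (\<Sum>j | adj C i j. int (f i j) * y $ j)"
   unfolding of_int_sum by(intro sum.cong refl) (simp add: b_1 rv_def)
  thus ?thesis using True by(simp add: sx_def rv_def sr_diag)
 qed (simp add: sx_def rv_def sr_nth)
 hence "sx 1 i (rv y) = rv (sr i y)" for y by(simp add: vec_eq_iff)
 thus ?case using Cons by(simp add: cx_def wa_Cons)
qed (simp add: cx_def wa_Nil)

lemma cx_rv_pow: "(cx 1 xs ^^ n) (rv y) = rv ((wa xs ^^ n) y)"
 by(induction n) (simp_all add: cx_rv)

text \<open>At x = 1 the deformed reflections are the simple reflections, so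
  \<open>coxeter_period\<close> and \<open>coxeter_order\<close> give the order. For the second part
  the sum of the norms of the positive roots is known from \<open>sum_norms\<close> with
  \<open>degree_formula\<close> and from \<open>dual_coxeter_sum\<close>, and the rank
  cancels.\<close>

theorem coxeter_data: "coxeter_number C = B" "r * dual_coxeter_number C = - G"
proof -
 let ?xs = "SOME xs. distinct xs \<and> set xs = (UNIV :: 'i set)"
 have "\<exists>xs. distinct xs \<and> set xs = (UNIV :: 'i set)" using finite_distinct_list[of "UNIV :: 'i set"] by auto
 from someI_ex[OF this] have xs: "distinct ?xs" "set ?xs = UNIV" by auto
 have "\<exists>\<xi>. coxeter_word C b P \<sigma> B G ?xs \<xi>"
 proof (rule ordering_height[OF xs])
  fix \<xi> :: "'i => int"
  assume "\<And>i. \<xi> i \<ge> 0" "\<exists>j. \<xi> j = 0"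
   "\<And>ys k zs i. ?xs = ys @ k # zs ==> adj C k i ==> \<xi> i = \<xi> k + (if i \<in> set zs then 1 else -1)"
  thus ?thesis
   by(intro exI[of _ \<xi>] coxeter_word.intro[OF mesh_axioms] coxeter_word_axioms.intro xs) blast+
 qed
 then obtain \<xi> where "coxeter_word C b P \<sigma> B G ?xs \<xi>" by blast
 then interpret w: coxeter_word C b P \<sigma> B G ?xs \<xi> .
 have "(wa ?xs ^^ B) x = x" for x
  unfolding rv_inj[symmetric] cx_rv_pow[symmetric] using w.coxeter_period[of 1 "rv x"] by simp
 hence "wa ?xs ^^ B = id" by(simp add: fun_eq_iff)
 moreover have "B \<le> n" if "n > 0" "wa ?xs ^^ n = id" for n
 proof (rule w.coxeter_order[OF that(1)])
  fix j
  have "axis j 1 = rv (\<alpha> j)" by(simp add: rv_def vec_eq_iff axis_def)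
  thus "(cx 1 ?xs ^^ n) (axis j 1) = axis j 1" by(simp add: cx_rv_pow that(2))
 qed
 ultimately show "coxeter_number C = B"
  unfolding coxeter_number_def coxeter_element_def using B2 by(intro Least_equality) auto
 have "int CARD('i) * (r * dual_coxeter_number C) = - G * int CARD('i)"
  using w.degree_formula dual_coxeter_sum[OF finite_Rp] sum_norms by simp
 hence e: "int CARD('i) * (r * dual_coxeter_number C) = int CARD('i) * (- G)" by(simp only: mult.commute)
 have "int CARD('i) \<noteq> 0" by simp
 from mult_left_cancel[OF this, THEN iffD1, OF e] show "r * dual_coxeter_number C = - G" .
qed

lemma G_neg: "G < 0"
proof -
 have "int CARD('i) * (- G) = (\<Sum>\<beta>\<in>Rp. rf \<beta> \<beta>)" using dual_coxeter_sum[OF finite_Rp] coxeter_data(2) by simp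
 also have "\<dots> > 0" unfolding sum_norms using B2 d_pos by(simp add: sum_pos)
 finally show ?thesis by(simp add: mult_less_0_iff)
qed

end

context cartan
begin

text \<open>\<open>N_rec\<close> completed to all degrees is an identity of Laurent polynomials.
  Multiplied by q^(-d_i) t it becomes row \<open>i\<close> of the deformed Cartan matrix applied to
  column \<open>j\<close>; on the right stand the source in degree 0 and the kernel in degree (G,
  B), whose monomial is \<open>X\<close>.\<close>

theorem generating_function:
 fixes \<omega> :: "'i => 'i => 'k::field"
 assumes sc: "sign_choice C \<omega>"
 defines "M \<equiv> \<lambda>i j. dim_qt (idem_ibar_comp C \<omega> i j)"
  and "X \<equiv> qv powi (r * dual_coxeter_number C) * tv powi (- int (coxeter_number C))"
 shows "(\<Sum>k\<in>UNIV. qt_cartan C $ i $ k * M k j) =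
   qv powi (- int (d i)) * tv * ((if i = j then 1 else 0) + (if i = star C j then X else 0))"
  and "star C (star C j) = j" and "d (star C j) = d j" and "r \<noteq> 1 ==> star C j = j"
  and "r * dual_coxeter_number C > 0"
proof -
 interpret g: gpa_finite C \<omega> by(rule gpa_finite[OF sc])
 interpret a: gpa_algebra C \<omega> by unfold_locales (rule adj_sym)
 obtain \<sigma> and B :: nat and G where s: "B \<ge> 2" "\<forall>l. \<sigma> (\<sigma> l) = l" "\<forall>l. d (\<sigma> l) = d l"
   "\<forall>j l. adj C j l \<longrightarrow> adj C (\<sigma> j) (\<sigma> l)"
   "\<forall>i l u v. g.K i l (u, v) = (if i = \<sigma> l \<and> u = G + 2 * int (d l) \<and> v = int B - 2 then 1 else 0)"
   "\<forall>i l u v. v > int B - 2 \<longrightarrow> g.N i l (u, v) = 0"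
   "\<forall>i l u. g.N i l (u, int B - 2) = (if i = \<sigma> l \<and> u = G + 2 * int (d l) then 1 else 0)"
   "\<forall>l v. 0 \<le> v \<longrightarrow> v \<le> int B - 2 \<longrightarrow> (\<exists>i u. g.N i l (u, v) \<noteq> 0)"
  using g.finite_structure by(elim exE conjE) (rule that; assumption)
 interpret m: mesh C "\<lambda>x. g.br x" "\<lambda>x. g.Nx x" \<sigma> B G
 proof
  show "adj C i j ==> g.br 1 i j = real (f i j)" for i j by(simp add: g.br_def)
  show "x > 0 ==> 0 \<le> v ==> v \<le> int B - 2 ==> \<exists>i. g.Nx x i j v \<noteq> 0" for x j v
   using s(8) by(metis g.Nx_eq_0_iff)
  show "g.Nx x i j (int B - 2) = (if i = \<sigma> j then x powi (G + 2 * int (d j)) else 0)" for x i j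
   unfolding g.Nx_def s(7)[rule_format]
   by(subst ev_superset[of "{G + 2 * int (d j)}"]) auto
  show "v > int B - 2 ==> g.Nx x i j v = 0" for x i j v using s(6) by(simp add: g.Nx_def)
  show "x powi int (d i) * g.Nx x i j (v + 1) + x powi (- int (d i)) * g.Nx x i j (v - 1)
   = (\<Sum>y | adj C i y. g.br x i y * g.Nx x y j v)" if "x > 0" "0 \<le> v" "v \<le> int B - 2" for x i j v
  proof -
   have "g.Kx x i j (v - 1) = 0" using s(5) that by(simp add: g.Kx_def)
   thus ?thesis using g.Nx_rec_all[OF that(1), of i j v] that by simp
  qed
 qed (use s g.Nx_neg g.Nx_0 g.Nx_nonneg in auto)
 have st: "star C l = \<sigma> l" for l by(rule m.star_\<sigma>)
 show "star C (star C j) = j" "d (star C j) = d j" using s by(simp_all add: st)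
 show "r \<noteq> 1 ==> star C j = j" unfolding st using automorphism_trivial[of \<sigma>] s by blast
 show "r * dual_coxeter_number C > 0" using m.coxeter_data m.G_neg by simp
 have X: "X = qtm (G, int B)" by(simp add: X_def qtm_def m.coxeter_data)
 have M: "M i j = gen (g.N i j)" for i j
  unfolding M_def by(rule dim_qt_gen) (simp add: a.fun_dim_idem_ibar_comp d_pos g.N_def)
 have finN: "finite {n. g.N i j n \<noteq> 0}" for i j
 proof (rule finite_subset)
  show "{n. g.N i j n \<noteq> 0} \<subseteq> (\<Union>v\<in>{0..int B - 2}. (\<lambda>u. (u, v)) ` {u. g.N i j (u, v) \<noteq> 0})"
  proof
   fix n assume n: "n \<in> {n. g.N i j n \<noteq> 0}"
   obtain u v where uv: "n = (u, v)" by fastforce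
   have "\<not> v < 0" "\<not> int B - 2 < v" using n uv s(6)[rule_format, of v i j u] g.N_neg[of "(u, v)" i j] by auto
   hence "v \<in> {0..int B - 2}" by simp
   thus "n \<in> (\<Union>v\<in>{0..int B - 2}. (\<lambda>u. (u, v)) ` {u. g.N i j (u, v) \<noteq> 0})" using n uv by auto
  qed
 qed (use g.fin_N in auto)
 define e where "e = (2 * int (d i), - 2 :: int)"
 have Kd: "g.K i j (n + e) = (if i = \<sigma> j \<and> n = (G, int B) then 1 else 0)" for n
  using s(3,5) by(cases n) (auto simp: e_def)
 \<comment> \<open>\<open>N_rec\<close> covers t-degrees from 1 on. In t-degree 0 the term for n = 0
   accounts for the initial value, and below that everything vanishes.\<close>
 have rec: "g.N i j n + g.N i j (n - (- e)) = ((\<Sum>t\<in>g.nb i. g.N (fst t) j (n - g.shift_deg i t))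
   + (if i = \<sigma> j \<and> n = (G, int B) then 1 else 0)) + (if i = j \<and> n = 0 then 1 else 0)" for n
 proof -
  obtain u v where uv: "n = (u, v)" by fastforce
  consider "v \<ge> 1" | "v = 0" | "v < 0" by linarith
  thus ?thesis
  proof cases
   case 1
   thus ?thesis using g.N_rec[of n i j] Kd[of n] uv by(auto simp: e_def zero_prod_def)
  next
   case 2
   have "g.N (fst t) j (n - g.shift_deg i t) = 0" for t
    by(rule g.N_neg) (use 2 uv in \<open>auto simp: g.shift_deg_def split: prod.splits\<close>)
   moreover have "g.N i j (n - (- e)) = 0" by(rule g.N_neg) (simp add: e_def uv 2)
   ultimately show ?thesis using 2 uv s(1) by(auto simp: g.N_deg0 zero_prod_def)
  next
   case 3
   have "g.N (fst t) j (n - g.shift_deg i t) = 0" for t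
    by(rule g.N_neg) (use 3 uv in \<open>auto simp: g.shift_deg_def split: prod.splits\<close>)
   moreover have "g.N i j (n - (- e)) = 0" "g.N i j n = 0" by(rule g.N_neg, use 3 uv in \<open>simp add: e_def\<close>)+
   ultimately show ?thesis using 3 uv s(1) by(auto simp: zero_prod_def)
  qed
 qed
 have fd: "finite {n. (if P \<and> n = c then 1 else 0 :: nat) \<noteq> 0}" for P and c :: "int \<times> int"
  by(rule finite_subset[of _ "{c}"]) auto
 have fS: "finite {n. (\<Sum>t\<in>g.nb i. g.N (fst t) j (n - g.shift_deg i t)) \<noteq> 0}"
  and gS: "gen (\<lambda>n. \<Sum>t\<in>g.nb i. g.N (fst t) j (n - g.shift_deg i t)) = (\<Sum>t\<in>g.nb i. qtm (g.shift_deg i t) * gen (g.N (fst t) j))"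
  using gen_sum[OF g.finite_nb, of i "\<lambda>t n. g.N (fst t) j (n - g.shift_deg i t)"] gen_shift[OF finN] by simp_all
 have fS2: "finite {n. (\<Sum>t\<in>g.nb i. g.N (fst t) j (n - g.shift_deg i t)) + (if i = \<sigma> j \<and> n = (G, int B) then 1 else 0) \<noteq> 0}"
  by(rule finite_subset[OF _ finite_UnI[OF fS fd]]) auto
 have "gen (g.N i j) + qtm (- e) * gen (g.N i j) = gen (\<lambda>n. g.N i j n + g.N i j (n - (- e)))"
  unfolding gen_add[OF finN conjunct1[OF gen_shift[OF finN]]] conjunct2[OF gen_shift[OF finN]] ..
 also have "\<dots> = (\<Sum>t\<in>g.nb i. qtm (g.shift_deg i t) * M (fst t) j) + (if i = \<sigma> j then X else 0) + (if i = j then 1 else 0)"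
  unfolding rec gen_add[OF fS2 fd] gen_add[OF fS fd] gen_delta gS M X by(simp add: qtm_def)
 finally have main: "M i j + qtm (- e) * M i j = \<dots>" unfolding M .
 define c where "c = qtm (int (d i), - 1)"
 have cM: "c * M i j + c * qtm (- e) * M i j = (\<Sum>t\<in>g.nb i. c * qtm (g.shift_deg i t) * M (fst t) j)
   + c * ((if i = j then 1 else 0) + (if i = \<sigma> j then X else 0))"
  using arg_cong[OF main, of "\<lambda>z. c * z"] by(simp add: distrib_left sum_distrib_left mult.assoc add_ac)
 have c1: "c = qv powi (- int (d i)) * tv" by(simp add: c_def qtm_def)
 have c2: "c * qtm (- e) = qv powi int (d i) * tv powi (- 1)"
  unfolding c_def qtm_add[symmetric] by(simp add: qtm_def e_def)
 have "(\<Sum>t\<in>g.nb i. c * qtm (g.shift_deg i t) * M (fst t) j) = (\<Sum>y | adj C i y. - (qt_cartan C $ i $ y * M y j))"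
  unfolding g.sum_nb
 proof (intro sum.cong refl)
  fix y assume "y \<in> {y. adj C i y}"
  hence ad: "adj C i y" by simp
  \<comment> \<open>If f_iy > 1 then d_i = 1 and the maximum is f_iy; otherwise k = 0 and both sides
    are 0.\<close>
  have ek: "int (max (d i) (d y)) - int (d i) - 2 * int (d i) * int k = int (f i y) - 1 - 2 * int k" if k: "k < f i y" for k
  proof (cases "f i y > 1")
   case True
   thus ?thesis using mul_gt_1[OF ad True] d_mul[OF ad] by simp
  next
   case False
   hence "f i y = 1" "k = 0" using k by simp_all
   thus ?thesis using d_mul[OF ad] by simp
  qed
  have "c * qtm (g.shift_deg i (y, k)) = qv powi (int (f i y) - 1 - 2 * int k)" if "k < f i y" for k
   unfolding c_def qtm_add[symmetric] ek[OF that, symmetric] by(simp add: qtm_def g.shift_deg_def algebra_simps)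
  hence "(\<Sum>k<f i y. c * qtm (g.shift_deg i (y, k)) * M (fst (y, k)) j) = (\<Sum>k<f i y. qv powi (int (f i y) - 1 - 2 * int k)) * M y j"
   by(simp add: sum_distrib_right)
  moreover have "qt_cartan C $ i $ y = q_int (- int (f i y))" using ad C_mul[of i y] by(simp add: qt_cartan_def adj_def)
  ultimately show "(\<Sum>k<f i y. c * qtm (g.shift_deg i (y, k)) * M (fst (y, k)) j) = - (qt_cartan C $ i $ y * M y j)"
   by(simp add: q_int_sum)
 qed
 also have "\<dots> = (\<Sum>y\<in>UNIV. if adj C i y then - (qt_cartan C $ i $ y * M y j) else 0)"
  using sum.inter_filter[of UNIV "\<lambda>y. - (qt_cartan C $ i $ y * M y j)" "adj C i"] by simp
 also have "\<dots> = (\<Sum>y\<in>UNIV. (if y = i then qt_cartan C $ i $ i * M i j else 0) - qt_cartan C $ i $ y * M y j)"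
 proof (rule sum.cong[OF refl])
  fix y
  show "(if adj C i y then - (qt_cartan C $ i $ y * M y j) else 0) = (if y = i then qt_cartan C $ i $ i * M i j else 0) - qt_cartan C $ i $ y * M y j"
   using C_adj[of i y] by(auto simp: qt_cartan_def q_int_def adj_def)
 qed
 also have "\<dots> = qt_cartan C $ i $ i * M i j - (\<Sum>y\<in>UNIV. qt_cartan C $ i $ y * M y j)"
  by(simp add: sum_subtractf)
 also have "qt_cartan C $ i $ i = c + c * qtm (- e)" unfolding c2 by(simp add: qt_cartan_def c1)
 finally have nbs: "(\<Sum>t\<in>g.nb i. c * qtm (g.shift_deg i t) * M (fst t) j) = (c + c * qtm (- e)) * M i j - (\<Sum>y\<in>UNIV. qt_cartan C $ i $ y * M y j)" .
 show "(\<Sum>k\<in>UNIV. qt_cartan C $ i $ k * M k j) =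
   qv powi (- int (d i)) * tv * ((if i = j then 1 else 0) + (if i = star C j then X else 0))"
  using cM unfolding nbs c1[symmetric] st distrib_right by simp
qed

end

text \<open>By \<open>generating_function\<close> the deformed matrix sends column \<open>j\<close>
  to a multiple of the unit vector at \<open>j\<close> plus \<open>X\<close> times that at
  \<open>star C j\<close>. Subtracting \<open>X\<close> times the column of \<open>star C j\<close>
  leaves 1 - X^2 at \<open>j\<close>, since \<open>star\<close> is an involution. Over a field a
  right inverse is the inverse.\<close>

theorem theorem3p13:
  fixes C :: "int ^ 'i ^ 'i" and \<omega> :: "'i \<Rightarrow> 'i \<Rightarrow> 'k::field" and i j :: 'i
  assumes "simple_cartan_matrix C"
    and "sign_choice C \<omega>"
  defines "r \<equiv> lacing_number C"
    and "h \<equiv> int (coxeter_number C)"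
    and "hv \<equiv> dual_coxeter_number C"
  shows "(qt_cartan_inv C $ i $ j =
            qv powi (int (sym_d C j)) * tv powi (-1) / (1 - (qv powi (r * hv) * tv powi (- h)) ^ 2)
            * (dim_qt (idem_ibar_comp C \<omega> i j)
               - qv powi (r * hv) * tv powi (- h) * dim_qt (idem_ibar_comp C \<omega> i (star C j)))) \<and>
         ((\<forall>k. star C k = k) \<longrightarrow>
            qt_cartan_inv C $ i $ j =
            qv powi (int (sym_d C j)) * tv powi (-1) / (1 + qv powi (r * hv) * tv powi (- h))
            * dim_qt (idem_ibar_comp C \<omega> i j)) \<and>
         (r \<noteq> 1 \<longrightarrow> (\<forall>k. star C k = k))"
proof -
 interpret c: cartan C by unfold_locales fact
 define X where "X = qv powi (r * hv) * tv powi (- h)"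
 define M where "M i j = dim_qt (idem_ibar_comp C \<omega> i j)" for i j
 note gf = c.generating_function[OF assms(2), folded r_def h_def hv_def, folded X_def M_def]
 \<comment> \<open>The order of \<open>X\<close> in q is positive, so \<open>X\<close> is neither 1
   nor -1 and the denominators are nonzero.\<close>
 have X: "X \<noteq> 0" "fls_subdegree X = r * hv"
  using qv_nonzero tv_nonzero by(simp_all add: X_def) (simp add: qv_def tv_def)
 have "X \<noteq> 1" "X \<noteq> - 1" using X(2) gf(5) fls_uminus_subdegree[of 1] by auto
 hence p: "1 - X \<noteq> 0" "1 + X \<noteq> 0" by(simp_all add: add_eq_0_iff)
 have sq: "1 - X ^ 2 = (1 - X) * (1 + X)" by(simp add: power2_eq_square algebra_simps)
 with p have ne: "1 - X ^ 2 \<noteq> 0" by simp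
 define a where "a i = qv powi int (sym_d C i) * tv powi (-1)" for i
 have a: "qv powi (- int (sym_d C i)) * tv * a i = 1" for i
  using qv_nonzero tv_nonzero by(simp add: a_def power_int_minus mult_ac)
 define T where "T = (\<chi> i j. a j / (1 - X ^ 2) * (M i j - X * M i (star C j)))"
 have "qt_cartan C ** T = mat 1"
 proof -
  have "(\<Sum>k\<in>UNIV. qt_cartan C $ i $ k * T $ k $ j) = (if i = j then 1 else 0)" for i j
  proof -
   let ?b = "qv powi (- int (sym_d C i)) * tv"
   have "(\<Sum>k\<in>UNIV. qt_cartan C $ i $ k * T $ k $ j) = a j / (1 - X ^ 2) *
     ((\<Sum>k\<in>UNIV. qt_cartan C $ i $ k * M k j) - X * (\<Sum>k\<in>UNIV. qt_cartan C $ i $ k * M k (star C j)))"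
    by(simp add: T_def sum_distrib_left right_diff_distrib sum_subtractf mult_ac)
   also have "(\<Sum>k\<in>UNIV. qt_cartan C $ i $ k * M k j) - X * (\<Sum>k\<in>UNIV. qt_cartan C $ i $ k * M k (star C j))
     = ?b * (if i = j then 1 - X ^ 2 else 0)"
    unfolding gf(1) gf(2) by(simp add: algebra_simps power2_eq_square)
   also have "a j / (1 - X ^ 2) * \<dots> = (if i = j then 1 else 0)"
    using ne a[of j] by(simp add: mult_ac)
   finally show ?thesis .
  qed
  thus ?thesis by(simp add: matrix_matrix_mult_def mat_def vec_eq_iff)
 qed
 hence "qt_cartan_inv C = T" unfolding qt_cartan_inv_def by(rule matrix_inv_eqI)
 hence 1: "qt_cartan_inv C $ i $ j = a j / (1 - X ^ 2) * (M i j - X * M i (star C j))"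
  by(simp add: T_def)
 have 2: "qt_cartan_inv C $ i $ j = a j / (1 + X) * M i j" if "star C j = j"
 proof -
  have "M i j - X * M i j = (1 - X) * M i j" by(simp add: left_diff_distrib)
  thus ?thesis using p unfolding 1 that sq by simp
 qed
 show ?thesis unfolding X_def[symmetric] M_def[symmetric] a_def[symmetric] using 1 2 gf(4) by blast
qed

end
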